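(* There exist absolute constants $c>0$ and $C>0$ such that the following holds for every integer $N\ge 2$. Suppose that $A\subset\{1,\dots,N\}$ lacks configurations of the form $$x,\ x+y,\ x+y^2 \qquad (y\neq 0),$$ that is, there are no integers $x,y$ with $y\neq 0$ such that $x$, $x+y$ and $x+y^2$ all lie in $A$. Then $$|A|\le C\,\frac{N}{(\log N)^{c}}.$$ *)

theory Defs
  imports Complex_Main
begin

definition lacks_configurations :: "int set \<Rightarrow> bool" where
  "lacks_configurations A \<longleftrightarrow>
     \<not> (\<exists>x y :: int. y \<noteq> 0 \<and> x \<in> A \<and> x + y \<in> A \<and> x + y ^ 2 \<in> A)"

end

theory Submission imports Defs
begin

text \<open>
  The argument follows Peluse and Prendiville. For functions on \<open>\<int>/qT\<int>\<close> with \<open>T\<close> comparable to \<open>M\<^sup>2\<close> one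
  considers the counting form \<open>E\<^sub>x E\<^sub>y f\<^sub>0(x) f\<^sub>1(x + y) f\<^sub>2(x + q y\<^sup>2)\<close> with \<open>1 \<le> y \<le> M\<close>. If it is large, then so
  is the \<open>L\<^sup>2\<close> norm of the dual function \<open>E\<^sub>y f\<^sub>0(x - q y\<^sup>2) f\<^sub>1(x - q y\<^sup>2 + y)\<close>; PET induction and a
  concatenation argument bound its \<open>U\<^sup>5\<close> norm along residue classes modulo \<open>q\<close> from below, and degree
  lowering, a feature of dual functions, brings this down to \<open>U\<^sup>2\<close>. The resulting linear phases are
  major arc by Weyl's inequality, so \<open>f\<^sub>1\<close> has large averages along progressions of small step \<open>b\<close> and
  length nearly \<open>M\<close>. All losses are polynomial.

  Averaging \<open>f\<^sub>1\<close> along a progression whose step is a multiple of all possible \<open>b\<close>, hence a factorial,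
  therefore hardly changes the count. Once \<open>f\<^sub>1\<close> is smooth, the same holds for \<open>f\<^sub>2\<close> by Weyl's
  inequality on the Fourier side. If a set of density \<open>\<alpha>\<close> has no density increment to \<open>(1 + 1/100) \<alpha>\<close> on
  progressions of that kind, its averages along them never exceed \<open>(1 + 1/100) \<alpha>\<close> and have mean about
  \<open>\<alpha>\<close>, which makes the count positive. As the increment is by a constant factor, a number of iterations
  logarithmic in \<open>1/\<alpha>\<close> suffices, and \<open>log N\<close> is bounded by a power of \<open>1/\<alpha>\<close>.
\<close>

subsection \<open>Averages over finite sets\<close>

text \<open>Passing to a progression of step Q replaces the coefficient q of the square by q Q, so
  every estimate has to be uniform in a coefficient that grows during the iteration. The two shifts
  then behave differently: q y^2 keeps x in its class modulo q, while y moves it across the classes.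
  Gowers norms are therefore taken inside the classes and averaged over them, and Weyl's inequality
  must produce major arc frequencies for many classes at once. The function f2 is arbitrary and
  offers no structure for degree lowering; the dual function contains the configuration itself, so a
  correlation of its derivatives with linear phases can be unfolded once more. As b depends on the
  functions, smoothing has to serve all b up to a power of 1/\<alpha>. A factorial does so, but its
  size is exponential in a power of 1/\<alpha>; hence only powers of log N are saved. Each increment
  reduces N to about its square root, so exponents grow geometrically; this is affordable because
  there are so few increments.\<close>

definition avg :: "'a set \<Rightarrow> ('a \<Rightarrow> 'b::real_normed_field) \<Rightarrow> 'b" where
  "avg A f = sum f A / of_nat (card A)"

lemma avg_cong: "A = B \<Longrightarrow> (\<And>a. a \<in> B \<Longrightarrow> f a = g a) \<Longrightarrow> avg A f = avg B g"
  by (simp add: avg_def)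

text \<open>No finiteness is assumed: sums over infinite sets and divisions by zero are 0 by
  convention, so both sides agree in the degenerate cases too.\<close>

lemma avg_swap: "avg A (\<lambda>a. avg B (f a)) = avg B (\<lambda>b. avg A (\<lambda>a. f a b))"
  unfolding avg_def sum_divide_distrib[symmetric]
  by (subst sum.swap) (simp add: field_simps)

lemma avg_cmult: "avg A (\<lambda>a. c * f a) = c * avg A f"
  by (simp add: avg_def sum_distrib_left)

lemma avg_multc: "avg A (\<lambda>a. f a * c) = avg A f * c"
  by (simp add: avg_def sum_distrib_right)

lemma avg_add: "avg A (\<lambda>a. f a + g a) = avg A f + avg A g"
  by (simp add: avg_def sum.distrib add_divide_distrib)

lemma avg_diff: "avg A (\<lambda>a. f a - g a) = avg A f - avg A g"
  by (simp add: avg_def sum_subtractf diff_divide_distrib)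

lemma avg_sum: "avg A (\<lambda>a. \<Sum>i\<in>I. f i a) = (\<Sum>i\<in>I. avg A (f i))"
  unfolding avg_def by (subst sum.swap) (simp add: sum_divide_distrib)

lemma avg_const: "finite A \<Longrightarrow> A \<noteq> {} \<Longrightarrow> avg A (\<lambda>_. c) = c"
  by (simp add: avg_def)

lemma avg_of_real: "avg A (\<lambda>a. of_real (f a)) = of_real (avg A f)"
  by (simp add: avg_def)

lemma Re_avg: "Re (avg A f) = avg A (\<lambda>a. Re (f a))"
  by (simp add: avg_def)

lemma cnj_avg: "cnj (avg A f) = avg A (\<lambda>a. cnj (f a))"
  by (simp add: avg_def)

lemma avg_mono: "(\<And>a. a \<in> A \<Longrightarrow> f a \<le> g a) \<Longrightarrow> avg A f \<le> (avg A g :: real)"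
  by (simp add: avg_def divide_right_mono sum_mono)

lemma avg_nonneg: "(\<And>a. a \<in> A \<Longrightarrow> 0 \<le> f a) \<Longrightarrow> 0 \<le> (avg A f :: real)"
  by (simp add: avg_def sum_nonneg)

lemma avg_le: "(\<And>a. a \<in> A \<Longrightarrow> f a \<le> c) \<Longrightarrow> 0 \<le> c \<Longrightarrow> avg A f \<le> (c :: real)"
proof -
  assume a: "\<And>a. a \<in> A \<Longrightarrow> f a \<le> c" "0 \<le> c"
  have "avg A f \<le> avg A (\<lambda>_. c)" by (rule avg_mono) (use a in auto)
  also have "\<dots> \<le> c" using a(2) by (cases "finite A \<and> A \<noteq> {}") (auto simp: avg_def)
  finally show ?thesis .
qed

lemma norm_avg_le: "norm (avg A f) \<le> avg A (\<lambda>a. norm (f a))"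
  by (simp add: avg_def norm_divide divide_right_mono norm_sum)

lemma norm_avg_le_bound: "(\<And>a. a \<in> A \<Longrightarrow> norm (f a) \<le> c) \<Longrightarrow> 0 \<le> c \<Longrightarrow> norm (avg A f) \<le> c"
  using norm_avg_le avg_le order_trans by metis

lemma avg_sq_real: "(avg A f)\<^sup>2 \<le> avg A (\<lambda>a. (f a)\<^sup>2 :: real)"
proof (cases "finite A \<and> A \<noteq> {}")
  case True
  then have c: "real (card A) > 0" by (simp add: card_gt_0_iff)
  have m: "avg A (\<lambda>_. 1) = (1::real)" using True by (intro avg_const) auto
  have "0 \<le> avg A (\<lambda>a. (f a - avg A f)\<^sup>2)" by (rule avg_nonneg) simp
  also have "(\<lambda>a. (f a - avg A f)\<^sup>2) = (\<lambda>a. (f a)\<^sup>2 - 2 * avg A f * f a + (avg A f)\<^sup>2 * 1)"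
    by (auto simp: power2_eq_square algebra_simps)
  also have "avg A \<dots> = avg A (\<lambda>a. (f a)\<^sup>2) - (avg A f)\<^sup>2"
    unfolding avg_add avg_diff avg_cmult m by (simp add: power2_eq_square)
  finally show ?thesis by simp
next
  case False
  then show ?thesis by (auto simp: avg_def)
qed

lemma avg_sq: "(norm (avg A f))\<^sup>2 \<le> avg A (\<lambda>a. (norm (f a))\<^sup>2)"
  using power_mono[OF norm_avg_le, of A f 2] avg_sq_real[of A "\<lambda>a. norm (f a)"] by simp

text \<open>Iterated Cauchy-Schwarz only ever produces exponents \<open>2 ^ n\<close>, for which
  Jensen's inequality is repeated squaring.\<close>

lemma avg_pow2: "avg A f ^ (2^n) \<le> avg A (\<lambda>a. (f a) ^ (2^n) :: real)" if "\<And>a. a \<in> A \<Longrightarrow> 0 \<le> f a"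
proof (induction n)
  case (Suc n)
  have "avg A f ^ 2 ^ Suc n = (avg A f ^ 2 ^ n)\<^sup>2" by (simp add: power_mult[symmetric] mult.commute)
  also have "\<dots> \<le> (avg A (\<lambda>a. (f a) ^ (2^n)))\<^sup>2"
    by (rule power_mono[OF Suc]) (simp add: avg_nonneg that)
  also have "\<dots> \<le> avg A (\<lambda>a. ((f a) ^ (2^n))\<^sup>2)" by (rule avg_sq_real)
  finally show ?case by (simp add: power_mult[symmetric] mult.commute)
qed simp

lemma norm_sq_avg: "of_real ((norm (avg B g))\<^sup>2) = avg B (\<lambda>b. avg B (\<lambda>b'. g b * cnj (g b')))"
  by (simp only: avg_cmult avg_multc complex_norm_square cnj_avg[symmetric])

text \<open>Every elimination of a function below is an instance of this: the factor
  \<open>u\<close> is bounded and does not see \<open>b\<close>, so it is discarded while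
  \<open>b\<close> is doubled. The right side is the exact average, without inner absolute values,
  so that it can be rearranged and shifted further.\<close>

lemma avg_CS:
  assumes "\<And>a. a \<in> A \<Longrightarrow> norm (u a) \<le> 1"
  shows "(norm (avg A (\<lambda>a. u a * avg B (g a))))\<^sup>2
     \<le> Re (avg B (\<lambda>b. avg B (\<lambda>b'. avg A (\<lambda>a. g a b * cnj (g a b')))))"
proof -
  have "(norm (avg A (\<lambda>a. u a * avg B (g a))))\<^sup>2 \<le> avg A (\<lambda>a. (norm (u a * avg B (g a)))\<^sup>2)"
    by (rule avg_sq)
  also have "\<dots> \<le> avg A (\<lambda>a. (norm (avg B (g a)))\<^sup>2)"
  proof (rule avg_mono, rule power_mono)
    fix a assume "a \<in> A"
    from mult_right_mono[OF assms[OF this], of "norm (avg B (g a))"]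
    show "norm (u a * avg B (g a)) \<le> norm (avg B (g a))" by (simp add: norm_mult)
  qed simp
  also have "\<dots> = Re (avg A (\<lambda>a. of_real ((norm (avg B (g a)))\<^sup>2)))" by (simp add: Re_avg)
  also have "avg A (\<lambda>a. of_real ((norm (avg B (g a)))\<^sup>2)) =
     avg B (\<lambda>b. avg B (\<lambda>b'. avg A (\<lambda>a. g a b * cnj (g a b'))))"
    unfolding norm_sq_avg by (subst avg_swap, subst (2) avg_swap) (rule refl)
  finally show ?thesis .
qed

lemma avg_reindex: "bij_betw h A B \<Longrightarrow> avg B f = avg A (\<lambda>a. f (h a))"
  unfolding avg_def by (simp add: sum.reindex_bij_betw bij_betw_same_card)

lemma avg_prod: "finite A \<Longrightarrow> finite B \<Longrightarrow> avg (A \<times> B) f = avg A (\<lambda>a. avg B (\<lambda>b. f (a, b)))"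
  using sum.cartesian_product[of "\<lambda>a b. f (a, b)" B A]
  by (simp add: avg_def card_cartesian_product sum_divide_distrib[symmetric] mult.commute)

lemma avg_popular:
  fixes f :: "'a \<Rightarrow> real"
  assumes "finite A" "\<delta> \<le> avg A f" "\<And>a. a \<in> A \<Longrightarrow> f a \<le> 1" "0 \<le> \<delta>"
  shows "\<delta> / 2 * card A \<le> card {a \<in> A. \<delta> / 2 \<le> f a}"
proof (cases "A = {}")
  case False
  then have c: "real (card A) > 0" using assms by (simp add: card_gt_0_iff)
  let ?S = "{a \<in> A. \<delta> / 2 \<le> f a}"
  have "\<delta> * card A \<le> sum f A" using assms(2) c by (simp add: avg_def field_simps)
  also have "\<dots> = sum f ?S + sum f (A - ?S)" using assms(1) by (subst sum.subset_diff[of ?S A]) auto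
  also have "sum f ?S \<le> (\<Sum>a\<in>?S. 1)" by (rule sum_mono) (use assms in auto)
  also have "sum f (A - ?S) \<le> (\<Sum>a\<in>A - ?S. \<delta> / 2)" by (rule sum_mono) auto
  also have "\<dots> = \<delta> / 2 * card (A - ?S)" by simp
  also have "\<dots> \<le> \<delta> / 2 * card A"
    by (rule mult_left_mono) (use assms in \<open>auto intro!: card_mono\<close>)
  finally show ?thesis by simp
qed simp

lemma avg_indicator: "finite A \<Longrightarrow> avg A (\<lambda>a. of_bool (Q a)) = (card {a \<in> A. Q a} / card A :: real)"
  by (simp add: avg_def sum.If_cases of_bool_def Int_def)

section \<open>Periodic functions on the integers as functions on cyclic groups\<close>

definition per :: "int \<Rightarrow> (int \<Rightarrow> 'a) \<Rightarrow> bool" where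
  "per P f \<longleftrightarrow> (\<forall>x. f (x + P) = f x)"

lemma per_mult: "per P f \<Longrightarrow> f (x + k * P) = f x"
proof (induction k rule: int_induct[where k = 0])
  case (step1 i)
  then show ?case unfolding per_def by (metis add.assoc distrib_left mult.commute mult.right_neutral)
next
  case (step2 i)
  have "f (x + (i - 1) * P) = f (x + (i - 1) * P + P)" using step2(3) by (simp add: per_def)
  also have "x + (i - 1) * P + P = x + i * P" by (simp add: algebra_simps)
  finally show ?case using step2 by simp
qed simp

lemma per_mod: "per P f \<Longrightarrow> f (x mod P) = f x"
  using per_mult[of P f "x mod P" "x div P"] by simp

lemma per_shift: "per P f \<Longrightarrow> per P (\<lambda>x. f (x + h))"
  unfolding per_def by (metis add.assoc add.commute)

lemma bij_betw_shift_mod: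
  assumes "P > (0::int)"
  shows "bij_betw (\<lambda>x. (x + h) mod P) {0..<P} {0..<P}"
proof (rule bij_betw_byWitness[where f' = "\<lambda>x. (x - h) mod P"])
  show "\<forall>a\<in>{0..<P}. ((a + h) mod P - h) mod P = a" by (simp add: mod_diff_left_eq)
  show "\<forall>a'\<in>{0..<P}. ((a' - h) mod P + h) mod P = a'" by (simp add: mod_add_left_eq)
qed (use assms in auto)

lemma avg_per_shift: "P > 0 \<Longrightarrow> per P f \<Longrightarrow> avg {0..<P} (\<lambda>x. f (x + h)) = avg {0..<P} f"
  by (subst avg_reindex[OF bij_betw_shift_mod[of P h]]) (auto simp: per_mod)

lemma sum_interval_shift:
  fixes g :: "int \<Rightarrow> 'b::real_normed_vector"
  assumes b: "\<And>y. norm (g y) \<le> 1" and s: "s \<ge> 0"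
  shows "norm ((\<Sum>y\<in>{a..c}. g (y + s)) - sum g {a..c}) \<le> 2 * real_of_int s"
proof -
  have e: "(\<Sum>y\<in>{a..c}. g (y + s)) = sum g {a+s..c+s}"
    by (rule sum.reindex_bij_witness[of _ "\<lambda>y. y - s" "\<lambda>y. y + s"]) auto
  have 1: "sum g {a+s..c+s} = sum g ({a+s..c+s} - {a..c}) + sum g ({a+s..c+s} \<inter> {a..c})"
    by (subst sum.union_disjoint[symmetric]) (auto intro: sum.cong)
  have 2: "sum g {a..c} = sum g ({a..c} - {a+s..c+s}) + sum g ({a+s..c+s} \<inter> {a..c})"
    by (subst sum.union_disjoint[symmetric]) (auto intro: sum.cong)
  have "{a+s..c+s} - {a..c} \<subseteq> {c+1..c+s}" "{a..c} - {a+s..c+s} \<subseteq> {a..a+s-1}" using s by auto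
  then have c: "card ({a+s..c+s} - {a..c}) \<le> nat s" "card ({a..c} - {a+s..c+s}) \<le> nat s"
    by (auto dest!: card_mono[rotated])
  have n: "norm (sum g S) \<le> real_of_int s" if "card S \<le> nat s" for S
  proof -
    have "norm (sum g S) \<le> of_nat (card S) * 1" by (rule sum_norm_bound) (use b in auto)
    also have "\<dots> \<le> real_of_int s" using that s by linarith
    finally show ?thesis .
  qed
  have "norm (sum g {a+s..c+s} - sum g {a..c}) \<le>
     norm (sum g ({a+s..c+s} - {a..c})) + norm (sum g ({a..c} - {a+s..c+s}))"
    unfolding 1 2 by (simp add: norm_triangle_ineq4)
  also have "\<dots> \<le> 2 * real_of_int s" using n[OF c(1)] n[OF c(2)] by linarith
  finally show ?thesis unfolding e .
qed

lemma avg_interval_shift: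
  fixes g :: "int \<Rightarrow> 'b::real_normed_field"
  assumes b: "\<And>y. norm (g y) \<le> 1" and "M > 0" and "s \<ge> 0"
  shows "norm (avg {1..M} (\<lambda>y. g (y + s)) - avg {1..M} g) \<le> 2 * real_of_int s / real_of_int M"
proof -
  have "avg {1..M} (\<lambda>y. g (y + s)) - avg {1..M} g =
     ((\<Sum>y\<in>{1..M}. g (y + s)) - sum g {1..M}) / of_nat (nat M)"
    by (simp add: avg_def diff_divide_distrib)
  then show ?thesis using sum_interval_shift[of g s 1 M, OF b assms(3)] assms(2)
    by (simp add: norm_divide divide_right_mono)
qed

text \<open>For introducing a smoothing variable i into an average over y: \<open>\<psi> i\<close>
  is what \<open>\<phi>\<close> becomes when only the factors that really react to the shift are
  shifted, and \<open>e\<close> bounds the change of the others.\<close>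

lemma avg_shifts:
  fixes \<phi> :: "int \<Rightarrow> 'b::real_normed_field" and s :: "'i \<Rightarrow> int"
  assumes \<phi>: "\<And>y. norm (\<phi> y) \<le> 1" and M: "M > 0" and I: "finite I" "I \<noteq> {}" and s: "\<And>i. i \<in> I \<Longrightarrow> 0 \<le> s i \<and> s i \<le> S"
    and e: "\<And>i y. i \<in> I \<Longrightarrow> y \<in> {1..M} \<Longrightarrow> norm (\<phi> (y + s i) - \<psi> i y) \<le> e" "e \<ge> 0"
  shows "norm (avg {1..M} \<phi> - avg {1..M} (\<lambda>y. avg I (\<lambda>i. \<psi> i y))) \<le> 2 * real_of_int S / M + e"
proof -
  have S0: "S \<ge> 0" using s I by fastforce
  have "avg {1..M} \<phi> - avg {1..M} (\<lambda>y. avg I (\<lambda>i. \<psi> i y)) = avg I (\<lambda>i. avg {1..M} \<phi> - avg {1..M} (\<psi> i))"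
    unfolding avg_diff avg_const[OF I] by (subst avg_swap) (rule refl)
  also have "norm \<dots> \<le> 2 * real_of_int S / M + e"
  proof (rule norm_avg_le_bound)
    fix i assume i: "i \<in> I"
    have "norm (avg {1..M} (\<lambda>y. \<phi> (y + s i)) - avg {1..M} \<phi>) \<le> 2 * real_of_int (s i) / M"
      by (rule avg_interval_shift) (use \<phi> M s[OF i] in auto)
    also have "\<dots> \<le> 2 * real_of_int S / M" using s[OF i] M by (intro divide_right_mono) auto
    finally have 1: "norm (avg {1..M} (\<lambda>y. \<phi> (y + s i)) - avg {1..M} \<phi>) \<le> 2 * real_of_int S / M" .
    have "norm (avg {1..M} (\<lambda>y. \<phi> (y + s i)) - avg {1..M} (\<psi> i)) \<le> e"
      unfolding avg_diff[symmetric] by (rule norm_avg_le_bound) (use e i in auto)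
    moreover have "avg {1..M} \<phi> - avg {1..M} (\<psi> i) = (avg {1..M} (\<lambda>y. \<phi> (y + s i)) - avg {1..M} (\<psi> i)) - (avg {1..M} (\<lambda>y. \<phi> (y + s i)) - avg {1..M} \<phi>)" by simp
    then have "norm (avg {1..M} \<phi> - avg {1..M} (\<psi> i)) \<le> norm (avg {1..M} (\<lambda>y. \<phi> (y + s i)) - avg {1..M} (\<psi> i)) + norm (avg {1..M} (\<lambda>y. \<phi> (y + s i)) - avg {1..M} \<phi>)"
      by (simp only: norm_triangle_ineq4)
    ultimately show "norm (avg {1..M} \<phi> - avg {1..M} (\<psi> i)) \<le> 2 * real_of_int S / M + e" using 1 by linarith
  qed (use S0 M e in auto)
  finally show ?thesis .
qed

text \<open>The change of variables of Weyl differencing. The range of k may exceed the true range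
  of differences because the inner interval is empty for the surplus k.\<close>

lemma sum_pairs_by_difference:
  fixes H :: "int \<Rightarrow> int \<Rightarrow> 'a::comm_monoid_add"
  assumes "hi - lo \<le> M"
  shows "(\<Sum>y\<in>{lo..hi}. \<Sum>y'\<in>{lo..hi}. H y y') =
    (\<Sum>k\<in>{-M..M}. \<Sum>y'\<in>{max lo (lo-k)..min hi (hi-k)}. H (y' + k) y')"
  unfolding sum.cartesian_product sum.Sigma[of "{-M..M}", simplified]
  by (subst sum.Sigma) (use assms in \<open>auto intro!: sum.reindex_bij_witness[of _ "\<lambda>(k, y'). (y' + k, y')" "\<lambda>(y, y'). (y - y', y')"]\<close>)

lemma pigeonhole_fibre:
  assumes "finite S" "finite B" "f ` S \<subseteq> B" "real (card B) \<le> c" "S \<noteq> {}"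
  shows "\<exists>v\<in>B. real (card S) \<le> c * real (card {k\<in>S. f k = v})"
proof (rule ccontr)
  assume "\<not> ?thesis"
  then have *: "c * real (card {k\<in>S. f k = v}) < real (card S)" if "v \<in> B" for v using that by force
  have "B \<noteq> {}" using assms by auto
  have c: "c > 0" using assms(2,4) \<open>B \<noteq> {}\<close> card_gt_0_iff[of B] by linarith
  have "real (card S) = (\<Sum>v\<in>B. real (card {k\<in>S. f k = v}))"
    using sum.group[OF assms(1,2,3), of "\<lambda>_. 1::real"] by simp
  also have "\<dots> < (\<Sum>v\<in>B. real (card S) / c)"
    using * c \<open>B \<noteq> {}\<close> assms(2) by (intro sum_strict_mono) (auto simp: field_simps)
  also have "\<dots> = real (card B) / c * real (card S)" by simp
  also have "\<dots> \<le> 1 * real (card S)" by (rule mult_right_mono) (use assms(4) c in auto)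
  finally show False by simp
qed

text \<open>The bookkeeping device of the whole proof: as D is at least 2, numerical constants are
  absorbed by a few extra powers of D, and all losses remain pure powers.\<close>

lemma pow_absorb:
  fixes D :: real
  assumes "D \<ge> 2" "c \<le> 2 ^ k" "k + m \<le> n"
  shows "c * D ^ m \<le> D ^ n"
proof -
  have "c * D ^ m \<le> 2 ^ k * D ^ m" using assms by (intro mult_right_mono) auto
  also have "\<dots> \<le> D ^ k * D ^ m" using assms by (intro mult_right_mono power_mono) auto
  also have "\<dots> = D ^ (k + m)" by (simp add: power_add)
  also have "\<dots> \<le> D ^ n" using assms by (intro power_increasing) auto
  finally show ?thesis .
qed

subsection \<open>Exponential phases\<close>

definition ee :: "real \<Rightarrow> complex" where "ee x = cis (2 * pi * x)"

lemma ee_0 [simp]: "ee 0 = 1" by (simp add: ee_def)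
lemma ee_add: "ee (x + y) = ee x * ee y" by (simp add: ee_def cis_mult algebra_simps)
lemma ee_of_int [simp]: "ee (of_int m) = 1" by (simp add: ee_def)
lemma ee_add_int [simp]: "ee (x + of_int m) = ee x" by (simp add: ee_add)
lemma norm_ee [simp]: "norm (ee x) = 1" by (simp add: ee_def)
lemma cnj_ee: "cnj (ee x) = ee (- x)" by (simp add: ee_def cis_cnj)
lemma ee_diff: "ee (x - y) = ee x * cnj (ee y)" by (simp add: cnj_ee ee_add[symmetric])

lemma norm_ee_minus_1: "norm (ee x - 1) = 2 * \<bar>sin (pi * x)\<bar>"
proof -
  have "(norm (ee x - 1))\<^sup>2 = (cos (2*(pi*x)) - 1)\<^sup>2 + (sin (2*(pi*x)))\<^sup>2"
    by (simp add: ee_def cmod_power2 algebra_simps)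
  also have "\<dots> = (2 * \<bar>sin (pi * x)\<bar>)\<^sup>2"
    unfolding sin_double cos_double_sin
    using sin_cos_squared_add[of "pi * x"] by (simp add: power2_eq_square) algebra
  finally show ?thesis by (rule power2_eq_imp_eq) auto
qed

lemma norm_ee_minus_1_le: "norm (ee x - 1) \<le> 8 * \<bar>x\<bar>"
proof -
  have "norm (ee x - 1) \<le> 2 * (pi * \<bar>x\<bar>)"
    using abs_sin_x_le_abs_x[of "pi * x"] by (simp add: norm_ee_minus_1 abs_mult)
  also have "\<dots> \<le> 2 * (4 * \<bar>x\<bar>)"
    using pi_less_4 by (intro mult_left_mono mult_right_mono) auto
  finally show ?thesis by simp
qed

text \<open>The derivative of \<open>sin y - y * cos y\<close> is \<open>y * sin y\<close>, so sin y
  is at least y cos y; apply this at x / 2, where cos^2 is at least 1/2, and double the angle. The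
  constant 1/2 is below the optimal 2/pi but suffices.\<close>

lemma sin_ge_half: assumes "0 \<le> x" "x \<le> pi / 2" shows "x / 2 \<le> sin x"
proof -
  have "(\<lambda>y. sin y - y * cos y) 0 \<le> (\<lambda>y. sin y - y * cos y) (x / 2)"
  proof (rule DERIV_nonneg_imp_nondecreasing[of 0 "x / 2" "\<lambda>y. sin y - y * cos y"])
    fix y assume y: "0 \<le> y" "y \<le> x / 2"
    have "((\<lambda>y. sin y - y * cos y) has_real_derivative y * sin y) (at y)"
      by (auto intro!: derivative_eq_intros)
    moreover have "0 \<le> y * sin y" using y assms by (intro mult_nonneg_nonneg sin_ge_zero) auto
    ultimately show "\<exists>z. ((\<lambda>y. sin y - y * cos y) has_real_derivative z) (at y) \<and> 0 \<le> z" by blast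
  qed (use assms in auto)
  then have 1: "x / 2 * cos (x / 2) \<le> sin (x / 2)" by simp
  have c: "0 \<le> cos (x / 2)" using assms by (intro cos_ge_zero) auto
  have c0: "0 \<le> cos x" using assms by (intro cos_ge_zero) auto
  have "x / 2 \<le> x * (cos (x / 2))\<^sup>2"
  proof -
    have "cos x = 2 * (cos (x/2))\<^sup>2 - 1" using cos_double_cos[of "x/2"] by simp
    then have "1 / 2 \<le> (cos (x/2))\<^sup>2" using c0 by simp
    from mult_left_mono[OF this assms(1)] show ?thesis by simp
  qed
  also have "\<dots> = 2 * (x / 2 * cos (x / 2)) * cos (x / 2)" by (simp add: power2_eq_square)
  also have "\<dots> \<le> 2 * sin (x / 2) * cos (x / 2)"
    using 1 c by (intro mult_right_mono mult_left_mono) auto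
  also have "\<dots> = sin x" using sin_double[of "x/2"] by simp
  finally show ?thesis .
qed

lemma norm_ee_minus_1_ge: assumes "\<bar>x\<bar> \<le> 1/2" shows "2 * \<bar>x\<bar> \<le> norm (ee x - 1)"
proof -
  have "pi * \<bar>x\<bar> / 2 \<le> sin (pi * \<bar>x\<bar>)" using assms by (intro sin_ge_half) auto
  also have "\<dots> \<le> \<bar>sin (pi * x)\<bar>" by (cases "x \<ge> 0") auto
  finally have "pi * \<bar>x\<bar> \<le> norm (ee x - 1)" by (simp add: norm_ee_minus_1)
  moreover have "2 * \<bar>x\<bar> \<le> pi * \<bar>x\<bar>" using pi_ge_two by (intro mult_right_mono) auto
  ultimately show ?thesis by linarith
qed

section \<open>Distance to the nearest integer and diophantine approximation\<close>

definition near_int :: "real \<Rightarrow> real \<Rightarrow> bool" where "near_int x \<epsilon> \<longleftrightarrow> (\<exists>m::int. \<bar>x - of_int m\<bar> \<le> \<epsilon>)"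

lemma near_int_mono: "near_int x a \<Longrightarrow> a \<le> b \<Longrightarrow> near_int x b"
  unfolding near_int_def using order_trans by blast

lemma near_int_mult: assumes "near_int x a" shows "near_int (of_int k * x) (\<bar>of_int k\<bar> * a)"
proof -
  from assms obtain m :: int where m: "\<bar>x - of_int m\<bar> \<le> a" by (auto simp: near_int_def)
  have "\<bar>of_int k * x - of_int (k * m)\<bar> = \<bar>of_int k\<bar> * \<bar>x - of_int m\<bar>"
    by (simp add: abs_mult[symmetric] algebra_simps)
  also have "\<dots> \<le> \<bar>of_int k\<bar> * a" using m by (intro mult_left_mono) auto
  finally show ?thesis unfolding near_int_def by blast
qed

lemma ee_near_int: assumes "near_int x a" shows "norm (ee x - 1) \<le> 8 * a"
proof -
  from assms obtain m :: int where m: "\<bar>x - of_int m\<bar> \<le> a" by (auto simp: near_int_def)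
  have "ee x = ee (x - of_int m)" using ee_add_int[of "x - of_int m" m] by simp
  then show ?thesis using norm_ee_minus_1_le[of "x - of_int m"] m by simp
qed

text \<open>Multiplying the sum by \<open>ee \<theta> - 1\<close> telescopes it to two boundary
  terms, so the product has norm at most 2, while \<open>ee \<theta> - 1\<close> has norm at least 2
  |\<theta>| once \<theta> is reduced to [-1/2, 1/2].\<close>

lemma geometric_near_int:
  assumes K: "K > 0" "K \<le> norm (\<Sum>y\<in>{a..c}. ee (\<alpha> * of_int y))"
  shows "near_int \<alpha> (1 / K)"
proof -
  have ac: "a \<le> c" using K by (cases "a \<le> c") auto
  define m where "m = round \<alpha>"
  define \<theta> where "\<theta> = \<alpha> - of_int m"
  have th: "\<bar>\<theta>\<bar> \<le> 1/2" unfolding \<theta>_def m_def using of_int_round_abs_le[of \<alpha>] by linarith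
  have ee: "ee (\<alpha> * of_int y) = ee (\<theta> * of_int y)" for y
  proof -
    have "\<alpha> * of_int y = \<theta> * of_int y + of_int (m * y)" by (simp add: \<theta>_def algebra_simps)
    then show ?thesis by (metis ee_add_int)
  qed
  let ?S = "\<Sum>y\<in>{a..c}. ee (\<theta> * of_int y)"
  have "(ee \<theta> - 1) * ?S = (\<Sum>y\<in>{a..c}. ee (\<theta> * of_int (y + 1)) - ee (\<theta> * of_int y))"
    by (simp add: sum_distrib_left algebra_simps ee_add)
  also have "norm \<dots> \<le> 2 * real_of_int 1"
    unfolding sum_subtractf by (rule sum_interval_shift) auto
  finally have "norm (ee \<theta> - 1) * norm ?S \<le> 2" by (simp add: norm_mult)
  moreover have "2 * \<bar>\<theta>\<bar> * K \<le> norm (ee \<theta> - 1) * norm ?S"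
    using norm_ee_minus_1_ge[OF th] K by (intro mult_mono) (auto simp: ee)
  ultimately have "\<bar>\<theta>\<bar> * K \<le> 1" by simp
  then have "\<bar>\<theta>\<bar> \<le> 1 / K" using K by (simp add: field_simps)
  then show ?thesis unfolding near_int_def \<theta>_def by blast
qed

lemma finite_int_spread:
  fixes S :: "int set"
  assumes "finite S" "S \<noteq> {}"
  shows "\<exists>x\<in>S. \<exists>y\<in>S. int (card S) - 1 \<le> y - x"
proof -
  have "S \<subseteq> {Min S..Max S}" using assms by auto
  then have "card S \<le> card {Min S..Max S}" by (intro card_mono) auto
  then have "int (card S) - 1 \<le> Max S - Min S" using Min_le[OF assms(1) Max_in[OF assms]] by auto
  then show ?thesis using Min_in[OF assms] Max_in[OF assms] by blast
qed

text \<open>Pigeonhole: at most 2 M / w + 2 windows of length w meet the interval.\<close>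

lemma close_pair:
  fixes S :: "int set"
  assumes S: "S \<subseteq> {-M..M}" and "w > 0" and c: "2 * real_of_int M / real_of_int w + 2 < real (card S)" and "M > 0"
  shows "\<exists>x\<in>S. \<exists>y\<in>S. 0 < y - x \<and> y - x < w"
proof -
  have f: "finite S" using S by (rule finite_subset) simp
  have "(\<lambda>k. k div w) ` S \<subseteq> {(-M) div w..M div w}" using S assms(2) by (auto intro!: zdiv_mono1)
  then have "card ((\<lambda>k. k div w) ` S) \<le> card {(-M) div w..M div w}" by (intro card_mono) auto
  also have "real \<dots> \<le> 2 * real_of_int M / real_of_int w + 2"
  proof -
    have "real_of_int (M div w) \<le> real_of_int M / real_of_int w"
      by (rule real_of_int_div4)
    moreover have "real_of_int (-M) / real_of_int w - 1 \<le> real_of_int ((-M) div w)"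
      using floor_divide_of_int_eq[of "-M" w, where 'a=real] by linarith
    moreover have "(-M) div w \<le> M div w" using assms by (intro zdiv_mono1) auto
    ultimately show ?thesis by (simp add: of_nat_nat)
  qed
  finally have "card S > card ((\<lambda>k. k div w) ` S)" using c by linarith
  from pigeonhole[OF this] obtain x y where xy: "x \<in> S" "y \<in> S" "x \<noteq> y" "x div w = y div w"
    by (auto simp: inj_on_def)
  have "\<bar>y - x\<bar> < w"
  proof -
    have "x = w * (x div w) + x mod w" "y = w * (x div w) + y mod w" using xy(4) by (metis mult_div_mod_eq)+
    moreover have "0 \<le> x mod w" "x mod w < w" "0 \<le> y mod w" "y mod w < w" using assms(2) by auto
    ultimately show ?thesis by linarith
  qed
  then show ?thesis using xy by (cases "x < y") (force, metis abs_minus_commute abs_of_pos diff_gt_0_iff_gt linorder_neqE)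
qed

text \<open>If \<open>k\<psi>\<close> is close to an integer for many \<open>k\<close>, two such \<open>k\<close> differ by a small \<open>b\<close>; sorting the
  remaining ones by their residue modulo \<open>b\<close> and by the integer they approximate yields two far apart
  multiples of \<open>b\<close> whose images nearly coincide.\<close>
lemma vinogradov:
  fixes M :: int and D \<psi> :: real
  assumes D: "D \<ge> 2" and M: "D ^ 10 \<le> M" and S: "S \<subseteq> {-M..M}" and card: "M / D \<le> card S"
    and near: "\<And>k. k \<in> S \<Longrightarrow> near_int (of_int k * \<psi>) (D / M)"
  shows "\<exists>b::int. 1 \<le> b \<and> b \<le> D ^ 3 \<and> near_int (of_int b * \<psi>) (D ^ 12 / (real_of_int M)\<^sup>2)"
proof -
  have fS: "finite S" using S by (rule finite_subset) simp
  have D1: "1 \<le> D ^ n" for n using D by (intro one_le_power) auto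
  have M1: "1 \<le> real_of_int M" using M D1[of 10] by linarith
  have M0: "M > 0" using M1 by linarith
  \<comment> \<open>S has at least M / D elements, more than there are windows of length 4
    D.\<close>
  define w where "w = \<lceil>4 * D\<rceil>"
  have w: "real_of_int w \<ge> 4 * D" "real_of_int w < 4 * D + 1" unfolding w_def by linarith+
  have w0: "w > 0" using w D by linarith
  have M88: "88 * D ^ 3 \<le> M" using pow_absorb[OF D, of 88 7 3 10] M by simp
  have "4 * D < 88 * D ^ 3" using D power_increasing[of 1 3 D] by simp
  then have M4: "4 * D < M" using M88 by linarith
  have "2 * real_of_int M / real_of_int w + 2 \<le> 2 * real_of_int M / (4 * D) + 2"
    by (rule add_right_mono, rule divide_left_mono) (use w D M1 in auto)
  also have "\<dots> < M / D" using M4 D by (simp add: field_simps)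
  finally have "2 * real_of_int M / real_of_int w + 2 < real (card S)" using card by linarith
  from close_pair[OF S w0 this M0] obtain x y where xy: "x \<in> S" "y \<in> S" "0 < y - x" "y - x < w" by blast
  define b where "b = y - x"
  have b0: "b > 0" and bw: "b < w" using xy by (auto simp: b_def)
  have b4: "real_of_int b \<le> 4 * D" using bw w by linarith
  from near[OF xy(1)] obtain mx :: int where mx: "\<bar>of_int x * \<psi> - of_int mx\<bar> \<le> D / M" by (auto simp: near_int_def)
  from near[OF xy(2)] obtain my :: int where my: "\<bar>of_int y * \<psi> - of_int my\<bar> \<le> D / M" by (auto simp: near_int_def)
  define m where "m = my - mx"
  define \<theta> where "\<theta> = of_int b * \<psi> - of_int m"
  have "\<theta> = (of_int y * \<psi> - of_int my) - (of_int x * \<psi> - of_int mx)"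
    unfolding \<theta>_def b_def m_def by (simp add: algebra_simps)
  moreover have DM2: "2 * D / M = D / M + D / M" by simp
  ultimately have th: "\<bar>\<theta>\<bar> \<le> 2 * D / M" using mx my by linarith
  have "\<forall>k\<in>S. \<exists>m::int. \<bar>of_int k * \<psi> - of_int m\<bar> \<le> D / M" using near by (auto simp: near_int_def)
  then obtain mm :: "int \<Rightarrow> int" where mm: "\<And>k. k \<in> S \<Longrightarrow> \<bar>of_int k * \<psi> - of_int (mm k)\<bar> \<le> D / M"
    by (metis (no_types))
  \<comment> \<open>In k, each of the k div b steps of length b moves the nearest integer by m up to
    the small drift \<theta>; n k is what remains of it. For two k with equal k mod b and equal n k,
    the multiples of \<theta> differ by at most 2 D / M.\<close>
  define n where "n k = mm k - (k div b) * m" for k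
  have kdec: "real_of_int k = real_of_int (k mod b) + real_of_int (k div b) * real_of_int b" for k
    by (metis add.commute mod_div_mult_eq of_int_add of_int_mult)
  have nk: "\<bar>of_int (k mod b) * \<psi> + of_int (k div b) * \<theta> - of_int (n k)\<bar> \<le> D / M" if "k \<in> S" for k
  proof -
    have "of_int (k mod b) * \<psi> + of_int (k div b) * \<theta> - of_int (n k) = of_int k * \<psi> - of_int (mm k)"
      unfolding \<theta>_def n_def by (subst (3) kdec) (simp add: algebra_simps)
    then show ?thesis using mm[OF that] by simp
  qed
  have jt: "\<bar>of_int (k div b) * \<theta>\<bar> \<le> 4 * D" if "k \<in> S" for k
  proof -
    have "\<bar>k\<bar> \<le> M" using subsetD[OF S that] by (simp add: abs_le_iff)
    then have "\<bar>k div b\<bar> \<le> M + 1"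
    proof -
      have "k div b \<le> M div b" using \<open>\<bar>k\<bar> \<le> M\<close> b0 by (intro zdiv_mono1) auto
      also have "\<dots> \<le> M" using zdiv_mono2[of M 1 b] b0 M0 by simp
      finally have 1: "k div b \<le> M" .
      have "-(M + 1) \<le> k div b"
      proof -
        have "M * 1 \<le> M * b" using b0 M0 by (intro mult_left_mono) auto
        then have "- (M + 1) * b \<le> k - b" using \<open>\<bar>k\<bar> \<le> M\<close> by (simp add: algebra_simps)
        also have "\<dots> < (k div b) * b" using pos_mod_bound[OF b0, of k] by (simp add: minus_mod_eq_div_mult[symmetric])
        finally have "- (M + 1) < k div b" using b0 by (metis mult_less_cancel_right_pos)
        then show ?thesis by simp
      qed
      with 1 show ?thesis by simp
    qed
    then have "\<bar>real_of_int (k div b)\<bar> \<le> M + 1" by linarith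
    then have "\<bar>of_int (k div b) * \<theta>\<bar> \<le> (M + 1) * (2 * D / M)"
      unfolding abs_mult using th M1 by (intro mult_mono) auto
    also have "\<dots> = 2 * D + 2 * D / M" using M1 by (simp add: field_simps)
    also have "\<dots> \<le> 4 * D" using M1 D by (simp add: field_simps)
    finally show ?thesis .
  qed
  have DM: "D / M \<le> D" using M1 D by (simp add: field_simps)
  \<comment> \<open>The drift is at most 4 D and the approximation error at most D, so n k lies
    within 5 D of (k mod b) \<psi>: at most 11 D values for each of at most 4 D residues.\<close>
  define B where "B = (SIGMA c:{0..<b}. {\<lceil>of_int c * \<psi> - 5 * D\<rceil>..\<lfloor>of_int c * \<psi> + 5 * D\<rfloor>})"
  have fB: "finite B" unfolding B_def by auto
  have im: "(\<lambda>k. (k mod b, n k)) ` S \<subseteq> B"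
  proof (rule image_subsetI)
    fix k assume "k \<in> S"
    have "real_of_int (n k) \<le> of_int (k mod b) * \<psi> + 5 * D" "of_int (k mod b) * \<psi> - 5 * D \<le> real_of_int (n k)"
      using nk[OF \<open>k \<in> S\<close>] jt[OF \<open>k \<in> S\<close>] DM by linarith+
    then show "(k mod b, n k) \<in> B" unfolding B_def using b0 by (auto simp: ceiling_le_iff le_floor_iff)
  qed
  have cB: "real (card B) \<le> 44 * D\<^sup>2"
  proof -
    have "card B = (\<Sum>c\<in>{0..<b}. card {\<lceil>of_int c * \<psi> - 5 * D\<rceil>..\<lfloor>of_int c * \<psi> + 5 * D\<rfloor>})"
      unfolding B_def by (rule card_SigmaI) auto
    also have "real \<dots> \<le> (\<Sum>c\<in>{0..<b}. 11 * D)"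
      unfolding of_nat_sum
    proof (rule sum_mono)
      fix c
      have "real_of_int (\<lfloor>of_int c * \<psi> + 5 * D\<rfloor> - \<lceil>of_int c * \<psi> - 5 * D\<rceil> + 1) \<le> 10 * D + 1"
        by linarith
      then show "real (card {\<lceil>of_int c * \<psi> - 5 * D\<rceil>..\<lfloor>of_int c * \<psi> + 5 * D\<rfloor>}) \<le> 11 * D"
        using D by (cases "0 \<le> \<lfloor>of_int c * \<psi> + 5 * D\<rfloor> - \<lceil>of_int c * \<psi> - 5 * D\<rceil> + 1") auto
    qed
    also have "\<dots> = b * (11 * D)" using b0 by simp
    also have "\<dots> \<le> (4 * D) * (11 * D)" using b4 D by (intro mult_right_mono) auto
    finally show ?thesis by (simp add: power2_eq_square)
  qed
  have "S \<noteq> {}" using xy by auto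
  from pigeonhole_fibre[OF fS fB im cB this] obtain v where
    v: "real (card S) \<le> 44 * D\<^sup>2 * real (card {k\<in>S. (k mod b, n k) = v})" by blast
  define F where "F = {k\<in>S. (k mod b, n k) = v}"
  have "M / D \<le> 44 * D\<^sup>2 * real (card F)" using v card unfolding F_def by linarith
  then have F1: "M / (44 * D ^ 3) \<le> card F" using D by (simp add: field_simps power2_eq_square power3_eq_cube)
  have F2: "2 \<le> M / (44 * D ^ 3)" using M88 D by (simp add: field_simps)
  have "finite F" using fS by (simp add: F_def)
  moreover have "F \<noteq> {}" using F1 F2 by (cases "F = {}") auto
  ultimately have fF: "finite F" "F \<noteq> {}" by auto
  define J where "J = (\<lambda>k. k div b) ` F"
  have inj: "inj_on (\<lambda>k. k div b) F"
    unfolding F_def inj_on_def by (metis (mono_tags, lifting) fst_conv mem_Collect_eq mult_div_mod_eq)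
  have cJ: "card J = card F" unfolding J_def by (rule card_image[OF inj])
  from finite_int_spread[of J] fF obtain i j where ij: "i \<in> F" "j \<in> F" "int (card F) - 1 \<le> j div b - i div b"
    unfolding cJ by (auto simp: J_def)
  define l where "l = j div b - i div b"
  have l: "M / (88 * D ^ 3) \<le> real_of_int l"
  proof -
    have half: "x / 2 \<le> c - 1" if "x \<le> c" "2 \<le> x" for x c :: real using that by linarith
    have "M / (88 * D ^ 3) = M / (44 * D ^ 3) / 2" by simp
    also have "\<dots> \<le> real (card F) - 1" by (rule half[OF F1 F2])
    also have "\<dots> \<le> real_of_int l" using ij(3) unfolding l_def by linarith
    finally show ?thesis .
  qed
  have "\<bar>of_int l * \<theta>\<bar> \<le> 2 * D / M"
  proof -
    have e: "i mod b = j mod b" "n i = n j" and ij': "i \<in> S" "j \<in> S" using ij(1,2) by (auto simp: F_def)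
    have gen: "\<bar>r - p\<bar> \<le> e + e" if "\<bar>a + p - n\<bar> \<le> e" "\<bar>a + r - n\<bar> \<le> e" for a p r n e :: real
      using that by linarith
    have "\<bar>of_int (j div b) * \<theta> - of_int (i div b) * \<theta>\<bar> \<le> D / M + D / M"
      by (rule gen[OF nk[OF ij'(1), unfolded e] nk[OF ij'(2)]])
    then show ?thesis unfolding DM2 by (simp add: l_def algebra_simps)
  qed
  moreover have "M / (88 * D ^ 3) * \<bar>\<theta>\<bar> \<le> \<bar>of_int l * \<theta>\<bar>"
    unfolding abs_mult using l by (intro mult_right_mono) auto
  ultimately have "M / (88 * D ^ 3) * \<bar>\<theta>\<bar> \<le> 2 * D / M" by linarith
  then have "\<bar>\<theta>\<bar> \<le> 176 * D ^ 4 / (real_of_int M)\<^sup>2"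
    using D M1 by (simp add: field_simps power2_eq_square power3_eq_cube power4_eq_xxxx)
  also have "\<dots> \<le> D ^ 12 / (real_of_int M)\<^sup>2"
    by (intro divide_right_mono pow_absorb[OF D, of 176 8]) auto
  finally have "near_int (of_int b * \<psi>) (D ^ 12 / (real_of_int M)\<^sup>2)" unfolding near_int_def \<theta>_def by blast
  moreover have "real_of_int b \<le> D ^ 3" using b4 pow_absorb[OF D, of 4 2 1 3] by simp
  ultimately show ?thesis using b0 by (intro exI[of _ b]) auto
qed

subsection \<open>Weyl sums with quadratic phases\<close>

text \<open>Values below the threshold \<theta> contribute at most \<theta> each, so the surplus s
  must come from the popular elements.\<close>

lemma popular_sum:
  fixes G :: "'a \<Rightarrow> real" and c \<theta> s :: real
  assumes "finite A" "\<And>a. a \<in> A \<Longrightarrow> G a \<le> c" "card A * \<theta> + s \<le> sum G A" "0 \<le> \<theta>"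
  shows "s \<le> card {a\<in>A. \<theta> \<le> G a} * c"
proof -
  let ?S = "{a\<in>A. \<theta> \<le> G a}"
  have "sum G A = sum G ?S + sum G (A - ?S)" using assms(1) by (subst sum.subset_diff[of ?S A]) auto
  also have "sum G ?S \<le> (\<Sum>a\<in>?S. c)" by (rule sum_mono) (use assms in auto)
  also have "sum G (A - ?S) \<le> (\<Sum>a\<in>A - ?S. \<theta>)" by (rule sum_mono) auto
  also have "\<dots> \<le> card A * \<theta>"
    using assms by (auto intro!: mult_right_mono card_mono)
  finally show ?thesis using assms(3) by simp
qed

text \<open>Differencing leaves geometric sums in 2 \<alpha> k, large for many k, and
  \<open>vinogradov\<close> turns this into one denominator b for \<alpha>. Along short progressions
  of step b the quadratic part is then nearly constant, so the linear part has to be a long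
  geometric sum with ratio \<open>ee (b * \<beta>)\<close>, which controls \<beta> with the same b.
  A subinterval of {1..M} is allowed because further differencing truncates the range.\<close>

lemma quadratic_weyl:
  fixes M :: int and D \<alpha> \<beta> :: real
  assumes D: "D \<ge> 2" and M: "D ^ 90 \<le> M" and lo: "1 \<le> lo" and hi: "hi \<le> M"
    and big: "M / D \<le> norm (\<Sum>y\<in>{lo..hi}. ee (\<alpha> * (of_int y)\<^sup>2 + \<beta> * of_int y))"
  shows "\<exists>b::int. 1 \<le> b \<and> b \<le> D ^ 16 \<and> near_int (of_int b * \<alpha>) (D ^ 60 / (real_of_int M)\<^sup>2)
     \<and> near_int (of_int b * \<beta>) (D ^ 84 / M)"
proof -
  have D1: "1 \<le> D ^ n" for n using D by (intro one_le_power) auto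
  have M1: "1 \<le> real_of_int M" using M D1[of 90] by linarith
  have M0: "M > 0" using M1 by linarith
  define g where "g y = ee (\<alpha> * (of_int y)\<^sup>2 + \<beta> * of_int y)" for y :: int
  define I where "I k = {max lo (lo - k)..min hi (hi - k)}" for k :: int
  have cI: "card (I k) \<le> nat M" for k using lo hi unfolding I_def by auto
  have g1: "norm (g y) = 1" for y by (simp add: g_def)
  define G where "G k = norm (\<Sum>y\<in>I k. ee (2 * \<alpha> * of_int k * of_int y))" for k :: int
  have GM: "G k \<le> M" for k
  proof -
    have "G k \<le> of_nat (card (I k)) * 1" unfolding G_def by (rule sum_norm_bound) auto
    then show ?thesis using cI[of k] M0 by linarith
  qed
  have "(M / D)\<^sup>2 \<le> (norm (sum g {lo..hi}))\<^sup>2"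
    using big M1 D unfolding g_def by (intro power_mono) auto
  also have "\<dots> = Re (of_real ((norm (sum g {lo..hi}))\<^sup>2))" by simp
  also have "of_real ((norm (sum g {lo..hi}))\<^sup>2) = (\<Sum>y\<in>{lo..hi}. \<Sum>y'\<in>{lo..hi}. g y * cnj (g y'))"
    by (simp only: complex_norm_square cnj_sum sum_product)
  also have "\<dots> = (\<Sum>k\<in>{-M..M}. \<Sum>y'\<in>I k. g (y' + k) * cnj (g y'))"
    unfolding I_def by (rule sum_pairs_by_difference) (use lo hi in auto)
  also have "\<dots> = (\<Sum>k\<in>{-M..M}. ee (\<alpha> * (of_int k)\<^sup>2 + \<beta> * of_int k) * (\<Sum>y'\<in>I k. ee (2 * \<alpha> * of_int k * of_int y')))"
    unfolding sum_distrib_left g_def ee_diff[symmetric] ee_add[symmetric]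
    by (intro sum.cong refl arg_cong[of _ _ ee]) (simp add: power2_eq_square algebra_simps)
  also have "Re \<dots> \<le> norm \<dots>" by (rule complex_Re_le_cmod)
  also have "\<dots> \<le> (\<Sum>k\<in>{-M..M}. G k)"
    unfolding G_def by (rule order_trans[OF norm_sum]) (simp add: norm_mult)
  finally have sG: "(M / D)\<^sup>2 \<le> sum G {-M..M}" .
  define S where "S = {k\<in>{-M..M}. M / (6 * D\<^sup>2) \<le> G k}"
  have "card {-M..M} * (M / (6 * D\<^sup>2)) + (real_of_int M)\<^sup>2 / (2 * D\<^sup>2) \<le> sum G {-M..M}"
  proof -
    have "real (card {-M..M}) \<le> 3 * M" using M0 by auto
    then have "card {-M..M} * (M / (6 * D\<^sup>2)) \<le> (3 * real_of_int M) * (M / (6 * D\<^sup>2))"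
      using M1 D by (intro mult_right_mono) auto
    also have "\<dots> = (real_of_int M)\<^sup>2 / (2 * D\<^sup>2)" by (simp add: power2_eq_square)
    finally have "card {-M..M} * (M / (6 * D\<^sup>2)) + (real_of_int M)\<^sup>2 / (2 * D\<^sup>2) \<le> (M / D)\<^sup>2"
      by (simp add: power_divide)
    then show ?thesis using sG by linarith
  qed
  from popular_sum[OF _ GM this] have "(real_of_int M)\<^sup>2 / (2 * D\<^sup>2) \<le> card S * M"
    unfolding S_def using M1 D by auto
  then have cS: "M / (2 * D\<^sup>2) \<le> card S" using M1 D by (simp add: field_simps power2_eq_square)
  have 5: "6 * D\<^sup>2 \<le> D ^ 5" "2 * D\<^sup>2 \<le> D ^ 5" using pow_absorb[OF D, of 6 3 2 5] pow_absorb[OF D, of 2 1 2 5] by auto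
  have nrS: "near_int (of_int k * (2 * \<alpha>)) (D ^ 5 / M)" if "k \<in> S" for k
  proof -
    have "near_int (2 * \<alpha> * of_int k) (1 / (M / (6 * D\<^sup>2)))"
      by (rule geometric_near_int[where a = "max lo (lo - k)" and c = "min hi (hi - k)"])
        (use that M1 D in \<open>auto simp: S_def G_def I_def algebra_simps\<close>)
    moreover have "1 / (M / (6 * D\<^sup>2)) \<le> D ^ 5 / M" using 5 M1 by (simp add: divide_right_mono)
    ultimately show ?thesis by (auto simp: algebra_simps intro: near_int_mono)
  qed
  have "M / D ^ 5 \<le> M / (2 * D\<^sup>2)" using 5 M1 D by (intro divide_left_mono) auto
  then have cS': "M / D ^ 5 \<le> card S" using cS by linarith
  have "D ^ 50 \<le> D ^ 90" by (rule power_increasing) (use D in auto)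
  then have M50: "(D ^ 5) ^ 10 \<le> M" unfolding power_mult[symmetric] using M by simp
  have D2: "2 \<le> D ^ 5" using D power_increasing[of 1 5 D] by simp
  have "S \<subseteq> {-M..M}" by (auto simp: S_def)
  from vinogradov[OF D2 M50 this cS' nrS] obtain b1 :: int where b1: "1 \<le> b1" "b1 \<le> (D^5)^3"
      "near_int (of_int b1 * (2 * \<alpha>)) ((D^5) ^ 12 / (real_of_int M)\<^sup>2)"
    by blast
  define b where "b = 2 * b1"
  have b: "1 \<le> b" using b1 by (simp add: b_def)
  have bD: "real_of_int b \<le> D ^ 16" using b1(2) pow_absorb[OF D, of 2 1 15 16] by (simp add: b_def power_mult[symmetric])
  have ba: "near_int (of_int b * \<alpha>) (D ^ 60 / (real_of_int M)\<^sup>2)"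
    using b1(3) by (simp add: b_def power_mult[symmetric] algebra_simps)
  \<comment> \<open>Short enough for two errors: the shift b J is at most M / D^64, and the phase
    error M J D^60 / M^2 is of order D^-20.\<close>
  define J where "J = \<lfloor>M / D ^ 80\<rfloor>"
  have JM: "real_of_int J \<le> M / D ^ 80" unfolding J_def by linarith
  have "2 \<le> M / D ^ 80"
  proof -
    have "2 * D ^ 80 \<le> M" using pow_absorb[OF D, of 2 1 80 90] M by simp
    then show ?thesis using D by (simp add: field_simps)
  qed
  then have J2: "M / (2 * D ^ 80) \<le> J" "1 \<le> J" unfolding J_def by (auto simp: field_simps) linarith+
  have bJ: "real_of_int b * J \<le> M / D ^ 64"
  proof -
    have "real_of_int b * J \<le> D ^ 16 * (M / D ^ 80)" using bD JM b J2 by (intro mult_mono) auto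
    also have "\<dots> = M / D ^ 64" using D power_add[of D 16 64] by (simp add: field_simps)
    finally show ?thesis .
  qed
  have JJ: "finite {1..J}" "{1..J} \<noteq> {}" using J2 by auto
  have card1: "real (card {lo..hi}) \<le> M" using lo hi M0 by auto
  have D64: "4 * D \<le> D ^ 64" using pow_absorb[OF D, of 4 2 1 64] by simp
  have shift: "norm (avg {1..J} (\<lambda>j. \<Sum>y\<in>{lo..hi}. g (y + b * j)) - sum g {lo..hi}) \<le> M / (2 * D)"
  proof -
    have "avg {1..J} (\<lambda>j. \<Sum>y\<in>{lo..hi}. g (y + b * j)) - sum g {lo..hi} =
      avg {1..J} (\<lambda>j. (\<Sum>y\<in>{lo..hi}. g (y + b * j)) - sum g {lo..hi})"
      by (simp add: avg_diff avg_const[OF JJ])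
    also have "norm \<dots> \<le> M / (2 * D)"
    proof (rule norm_avg_le_bound)
      fix j assume j: "j \<in> {1..J}"
      have "norm ((\<Sum>y\<in>{lo..hi}. g (y + b * j)) - sum g {lo..hi}) \<le> 2 * real_of_int (b * j)"
        by (rule sum_interval_shift) (use g1 b j in auto)
      also have "\<dots> \<le> 2 * (real_of_int b * J)" using j b by (auto intro!: mult_left_mono)
      also have "\<dots> \<le> 2 * (M / D ^ 64)" using bJ by simp
      also have "\<dots> \<le> 2 * (M / (4 * D))" using D64 M1 D by (intro mult_left_mono divide_left_mono) auto
      finally show "norm ((\<Sum>y\<in>{lo..hi}. g (y + b * j)) - sum g {lo..hi}) \<le> M / (2 * D)" by simp
    qed (use M1 D in auto)
    finally show ?thesis .
  qed
  have "M / D \<le> norm (sum g {lo..hi})" using big by (simp add: g_def)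
  also have "\<dots> \<le> norm (avg {1..J} (\<lambda>j. \<Sum>y\<in>{lo..hi}. g (y + b * j))) + M / (2 * D)"
    using shift norm_triangle_sub[of "sum g {lo..hi}" "avg {1..J} (\<lambda>j. \<Sum>y\<in>{lo..hi}. g (y + b * j))"]
    by (simp add: norm_minus_commute)
  finally have "M / (2 * D) \<le> norm (avg {1..J} (\<lambda>j. \<Sum>y\<in>{lo..hi}. g (y + b * j)))" using D by (simp add: field_simps)
  also have "\<dots> = norm (\<Sum>y\<in>{lo..hi}. avg {1..J} (\<lambda>j. g (y + b * j)))" by (simp add: avg_sum)
  also have "\<dots> \<le> (\<Sum>y\<in>{lo..hi}. norm (avg {1..J} (\<lambda>j. g (y + b * j))))" by (rule norm_sum)
  finally have "M / (2 * D) \<le> (\<Sum>y\<in>{lo..hi}. norm (avg {1..J} (\<lambda>j. g (y + b * j))))" .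
  moreover have "(\<Sum>y\<in>{lo..hi}. norm (avg {1..J} (\<lambda>j. g (y + b * j)))) < M / (2 * D)"
    if "\<And>y. y \<in> {lo..hi} \<Longrightarrow> norm (avg {1..J} (\<lambda>j. g (y + b * j))) < 1 / (2 * D)"
  proof (cases "lo \<le> hi")
    case True
    have "(\<Sum>y\<in>{lo..hi}. norm (avg {1..J} (\<lambda>j. g (y + b * j)))) < (\<Sum>y\<in>{lo..hi}. 1 / (2 * D))"
      by (rule sum_strict_mono) (use that True in auto)
    also have "\<dots> = card {lo..hi} * (1 / (2 * D))" by simp
    also have "\<dots> \<le> M * (1 / (2 * D))" using card1 D by (intro mult_right_mono) auto
    finally show ?thesis by simp
  qed (use M1 D in auto)
  ultimately obtain y where y: "y \<in> {lo..hi}" "1 / (2 * D) \<le> norm (avg {1..J} (\<lambda>j. g (y + b * j)))"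
    by (meson not_le)
  define h where "h j = ee (of_int b * \<beta> * of_int j)" for j :: int
  have close: "norm (g (y + b * j) - g y * h j) \<le> 1 / (4 * D)" if j: "j \<in> {1..J}" for j
  proof -
    \<comment> \<open>Every quadratic or mixed term of the expanded square is the integer k times b
      \<alpha>, hence close to an integer.\<close>
    define k where "k = 2 * y * j + b * j * j"
    have k0: "0 \<le> k" using j y b lo unfolding k_def by auto
    have kle: "real_of_int k \<le> 3 * M * J"
    proof -
      have "b * J \<le> M"
      proof -
        have "M / D ^ 64 \<le> M / 1" using D1[of 64] M1 by (intro divide_left_mono) auto
        then have "real_of_int (b * J) \<le> M" using bJ by simp
        then show ?thesis by linarith
      qed
      moreover have "b * j \<le> b * J" using j b by (intro mult_left_mono) auto
      ultimately have "b * j * j \<le> M * J" using j M0 by (intro mult_mono) auto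
      moreover have "2 * y * j \<le> 2 * M * J" using y(1) hi lo j M0 by (intro mult_mono) auto
      ultimately have "k \<le> 3 * M * J" unfolding k_def by simp
      then show ?thesis by linarith
    qed
    have "g (y + b * j) = g y * h j * ee (of_int k * (of_int b * \<alpha>))"
      unfolding g_def h_def k_def ee_add[symmetric]
      by (intro arg_cong[of _ _ ee]) (simp add: power2_eq_square algebra_simps)
    then have "g (y + b * j) - g y * h j = g y * h j * (ee (of_int k * (of_int b * \<alpha>)) - 1)"
      by (simp add: algebra_simps)
    then have "norm (g (y + b * j) - g y * h j) = norm (ee (of_int k * (of_int b * \<alpha>)) - 1)"
      by (simp add: norm_mult g1 h_def)
    also have "\<dots> \<le> 8 * (\<bar>of_int k\<bar> * (D ^ 60 / (real_of_int M)\<^sup>2))"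
      by (rule ee_near_int, rule near_int_mult[OF ba])
    also have "\<dots> \<le> 8 * ((3 * real_of_int M * (M / D ^ 80)) * (D ^ 60 / (real_of_int M)\<^sup>2))"
    proof (intro mult_left_mono mult_right_mono)
      have "3 * real_of_int M * J \<le> 3 * real_of_int M * (M / D ^ 80)" using JM M1 by (intro mult_left_mono) auto
      then show "\<bar>real_of_int k\<bar> \<le> 3 * real_of_int M * (M / D ^ 80)" using kle k0 by simp
    qed (use D in auto)
    also have "\<dots> = 24 / D ^ 20"
      using M1 D power_add[of D 60 20] by (simp add: field_simps power2_eq_square)
    also have "\<dots> \<le> 1 / (4 * D)"
      using pow_absorb[OF D, of 96 7 1 20] D by (simp add: field_simps)
    finally show ?thesis .
  qed
  have "norm (avg {1..J} (\<lambda>j. g (y + b * j)) - g y * avg {1..J} h) \<le> 1 / (4 * D)"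
    unfolding avg_cmult[symmetric] avg_diff[symmetric]
    by (rule norm_avg_le_bound) (use close D in auto)
  then have "norm (avg {1..J} (\<lambda>j. g (y + b * j))) \<le> norm (avg {1..J} h) + 1 / (4 * D)"
    using norm_triangle_sub[of "avg {1..J} (\<lambda>j. g (y + b * j))" "g y * avg {1..J} h"]
    by (simp add: norm_mult g1)
  moreover have "1 / (2 * D) = 1 / (4 * D) + 1 / (4 * D)" by simp
  ultimately have "1 / (4 * D) \<le> norm (avg {1..J} h)" using y(2) by linarith
  then have "J / (4 * D) \<le> norm (sum h {1..J})" using J2 D by (simp add: avg_def norm_divide field_simps)
  then have "near_int (of_int b * \<beta>) (1 / (J / (4 * D)))"
    by (intro geometric_near_int[where a = 1 and c = J]) (use J2 D in \<open>auto simp: h_def\<close>)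
  moreover have "1 / (J / (4 * D)) \<le> D ^ 84 / M"
  proof -
    have "1 / (J / (4 * D)) = 4 * D / J" by simp
    also have "\<dots> \<le> 4 * D / (M / (2 * D ^ 80))" using J2 M1 D by (intro divide_left_mono) auto
    also have "\<dots> = 8 * D ^ 81 / M" by (simp add: power_Suc[symmetric] del: power_Suc)
    also have "\<dots> \<le> D ^ 84 / M" using M1 by (intro divide_right_mono pow_absorb[OF D, of 8 3]) auto
    finally show ?thesis .
  qed
  ultimately show ?thesis using b bD ba near_int_mono by blast
qed

text \<open>The width D / M^2 is the one adapted to phases \<psi> y^2 with y up to M. The same D
  bounds denominator and width, as only powers of one parameter are tracked.\<close>

definition major :: "real \<Rightarrow> int \<Rightarrow> real \<Rightarrow> bool" where
  "major D M \<psi> \<longleftrightarrow> (\<exists>b::int. 1 \<le> b \<and> real_of_int b \<le> D \<and> near_int (of_int b * \<psi>) (D / (real_of_int M)\<^sup>2))"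

text \<open>Cauchy-Schwarz removes f1. With x and k = y - y' fixed, the remaining values of f0 are
  constants and the sum over y' has leading coefficient \<psi>(x) - \<psi>(x+k) and linear
  coefficient 2 k \<psi>(x). It is the linear coefficient that is exploited: it involves only
  \<psi>(x), and its being near rational for many k makes \<psi>(x) major. The predicate R
  transports information on the support of f0 to the classes found.\<close>

lemma weyl_classes:
  fixes M q T P :: int and D :: real and \<psi> :: "int \<Rightarrow> real" and f0 f1 :: "int \<Rightarrow> complex"
  assumes D: "D \<ge> 2" and M: "D ^ 7000 \<le> M" and q: "q > 0" "T > 0" "P = q * T"
    and f: "per P f0" "per P f1" "\<And>x. norm (f0 x) \<le> 1" "\<And>x. norm (f1 x) \<le> 1" and p: "per q \<psi>"
    and big: "1 / D \<le> norm (avg {0..<P} (\<lambda>x. avg {1..M} (\<lambda>y. f0 x * f1 (x + y) * ee (\<psi> x * (of_int y)\<^sup>2))))"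
    and R: "\<And>x. f0 x \<noteq> 0 \<Longrightarrow> R (x mod q)"
  shows "q / D ^ 7000 \<le> card {r\<in>{0..<q}. R r \<and> major (D ^ 7000) M (\<psi> r)}"
proof -
  have D1: "1 \<le> D ^ n" for n using D by (intro one_le_power) auto
  have M1: "1 \<le> real_of_int M" using M D1[of 7000] by linarith
  have M0: "M > 0" using M1 by linarith
  have P0: "P > 0" using q by simp
  have pP: "\<psi> (x + P) = \<psi> x" for x using per_mult[OF p, of x T] by (simp add: q(3) mult.commute)
  have fP: "f0 (x + P) = f0 x" "f1 (x + P) = f1 x" for x using f by (auto simp: per_def)
  have fP': "f0 (P + x) = f0 x" "f1 (P + x) = f1 x" "\<psi> (P + x) = \<psi> x" for x
    using fP[of x] pP[of x] by (auto simp: add.commute)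
  have fPy: "f1 (x + (P + y)) = f1 (x + y)" for x y using fP(2)[of "x + y"] by (simp add: ac_simps)
  define g where "g x y = f0 (x - y) * ee (\<psi> (x - y) * (of_int y)\<^sup>2)" for x y :: int
  define I where "I k = {max 1 (1 - k)..min M (M - k)}" for k :: int
  have "avg {0..<P} (\<lambda>x. avg {1..M} (\<lambda>y. f0 x * f1 (x + y) * ee (\<psi> x * (of_int y)\<^sup>2))) =
     avg {1..M} (\<lambda>y. avg {0..<P} (\<lambda>x. f0 x * f1 (x + y) * ee (\<psi> x * (of_int y)\<^sup>2)))"
    by (rule avg_swap)
  also have "\<dots> = avg {1..M} (\<lambda>y. avg {0..<P} (\<lambda>x. f1 x * g x y))"
  proof (rule avg_cong[OF refl])
    fix y
    have "avg {0..<P} (\<lambda>x. f0 x * f1 (x + y) * ee (\<psi> x * (of_int y)\<^sup>2)) =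
      avg {0..<P} (\<lambda>x. (\<lambda>x. f0 x * f1 (x + y) * ee (\<psi> x * (of_int y)\<^sup>2)) (x + (- y)))"
      by (rule avg_per_shift[symmetric, OF P0]) (simp add: per_def fP pP fP' fPy add.commute add.left_commute)
    also have "\<dots> = avg {0..<P} (\<lambda>x. f1 x * g x y)" by (simp add: g_def mult_ac)
    finally show "avg {0..<P} (\<lambda>x. f0 x * f1 (x + y) * ee (\<psi> x * (of_int y)\<^sup>2)) = avg {0..<P} (\<lambda>x. f1 x * g x y)" .
  qed
  also have "\<dots> = avg {0..<P} (\<lambda>x. f1 x * avg {1..M} (g x))"
    by (subst avg_swap) (simp add: avg_cmult)
  finally have "1 / D \<le> norm (avg {0..<P} (\<lambda>x. f1 x * avg {1..M} (g x)))" using big by simp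
  then have "(1 / D)\<^sup>2 \<le> (norm (avg {0..<P} (\<lambda>x. f1 x * avg {1..M} (g x))))\<^sup>2"
    using D by (intro power_mono) auto
  also have "\<dots> \<le> Re (avg {1..M} (\<lambda>y. avg {1..M} (\<lambda>y'. avg {0..<P} (\<lambda>x. g x y * cnj (g x y')))))"
    by (rule avg_CS) (rule f)
  also have "avg {1..M} (\<lambda>y. avg {1..M} (\<lambda>y'. avg {0..<P} (\<lambda>x. g x y * cnj (g x y')))) =
     avg {1..M} (\<lambda>y. avg {1..M} (\<lambda>y'. avg {0..<P} (\<lambda>x. f0 x * cnj (f0 (x + (y - y'))) *
        ee ((\<psi> x * (of_int y)\<^sup>2) - \<psi> (x + (y - y')) * (of_int y')\<^sup>2))))"
  proof (rule avg_cong[OF refl], rule avg_cong[OF refl])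
    fix y y'
    have "avg {0..<P} (\<lambda>x. g x y * cnj (g x y')) = avg {0..<P} (\<lambda>x. (\<lambda>x. g x y * cnj (g x y')) (x + y))"
      by (rule avg_per_shift[symmetric, OF P0])
         (simp add: per_def g_def diff_conv_add_uminus add.assoc add.left_commute[of _ P] fP' del: add_uminus_conv_diff)
    also have "\<dots> = avg {0..<P} (\<lambda>x. f0 x * cnj (f0 (x + (y - y'))) *
        ee ((\<psi> x * (of_int y)\<^sup>2) - \<psi> (x + (y - y')) * (of_int y')\<^sup>2))"
      by (simp add: g_def ee_diff add_diff_eq mult_ac)
    finally show "avg {0..<P} (\<lambda>x. g x y * cnj (g x y')) = avg {0..<P} (\<lambda>x. f0 x * cnj (f0 (x + (y - y'))) *
        ee ((\<psi> x * (of_int y)\<^sup>2) - \<psi> (x + (y - y')) * (of_int y')\<^sup>2))" .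
  qed
  also have "\<dots> = avg {0..<P} (\<lambda>x. avg {1..M} (\<lambda>y. avg {1..M} (\<lambda>y'. f0 x * cnj (f0 (x + (y - y'))) *
        ee ((\<psi> x * (of_int y)\<^sup>2) - \<psi> (x + (y - y')) * (of_int y')\<^sup>2))))"
    by (subst (2) avg_swap, subst avg_swap) (rule refl)
  finally have 1: "(1 / D)\<^sup>2 \<le> Re (avg {0..<P} (\<lambda>x. avg {1..M} (\<lambda>y. avg {1..M} (\<lambda>y'. f0 x * cnj (f0 (x + (y - y'))) *
        ee ((\<psi> x * (of_int y)\<^sup>2) - \<psi> (x + (y - y')) * (of_int y')\<^sup>2)))))" .
  define G where "G x k = norm (f0 x) * norm (\<Sum>y'\<in>I k. ee ((\<psi> x - \<psi> (x + k)) * (of_int y')\<^sup>2 + 2 * of_int k * \<psi> x * of_int y'))" for x k :: int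
  have GM: "G x k \<le> M" for x k
  proof -
    have "norm (\<Sum>y'\<in>I k. ee ((\<psi> x - \<psi> (x + k)) * (of_int y')\<^sup>2 + 2 * of_int k * \<psi> x * of_int y')) \<le> of_nat (card (I k)) * 1"
      by (rule sum_norm_bound) auto
    also have "\<dots> \<le> M" using M0 by (auto simp: I_def)
    finally have "G x k \<le> 1 * real_of_int M" unfolding G_def using f(3) by (intro mult_mono) auto
    then show ?thesis by simp
  qed
  have inner: "norm (avg {1..M} (\<lambda>y. avg {1..M} (\<lambda>y'. f0 x * cnj (f0 (x + (y - y'))) *
        ee ((\<psi> x * (of_int y)\<^sup>2) - \<psi> (x + (y - y')) * (of_int y')\<^sup>2)))) \<le> sum (G x) {-M..M} / (real_of_int M)\<^sup>2" for x
  proof -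
    let ?H = "\<lambda>y y'. f0 x * cnj (f0 (x + (y - y'))) * ee ((\<psi> x * (of_int y)\<^sup>2) - \<psi> (x + (y - y')) * (of_int y')\<^sup>2)"
    have "avg {1..M} (\<lambda>y. avg {1..M} (?H y)) = (\<Sum>y\<in>{1..M}. \<Sum>y'\<in>{1..M}. ?H y y') / (of_int M)\<^sup>2"
      using M0 by (simp add: avg_def sum_divide_distrib[symmetric] power2_eq_square)
    also have "(\<Sum>y\<in>{1..M}. \<Sum>y'\<in>{1..M}. ?H y y') = (\<Sum>k\<in>{-M..M}. \<Sum>y'\<in>I k. ?H (y' + k) y')"
      unfolding I_def by (rule sum_pairs_by_difference) simp
    also have "\<dots> = (\<Sum>k\<in>{-M..M}. f0 x * cnj (f0 (x + k)) * ee (\<psi> x * (of_int k)\<^sup>2) *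
        (\<Sum>y'\<in>I k. ee ((\<psi> x - \<psi> (x + k)) * (of_int y')\<^sup>2 + 2 * of_int k * \<psi> x * of_int y')))"
      unfolding sum_distrib_left mult.assoc[of _ "ee _"] ee_add[symmetric]
      by (intro sum.cong refl arg_cong2[of _ _ _ _ "(*)"] arg_cong[of _ _ ee])
        (auto simp: power2_eq_square algebra_simps)
    also have "norm (\<dots> / (of_int M)\<^sup>2) \<le> (\<Sum>k\<in>{-M..M}. G x k) / (real_of_int M)\<^sup>2"
      unfolding norm_divide norm_power norm_of_int power2_abs
    proof (rule divide_right_mono[OF order_trans[OF norm_sum sum_mono]])
      fix k
      show "norm (f0 x * cnj (f0 (x + k)) * ee (\<psi> x * (of_int k)\<^sup>2) *
        (\<Sum>y'\<in>I k. ee ((\<psi> x - \<psi> (x + k)) * (of_int y')\<^sup>2 + 2 * of_int k * \<psi> x * of_int y'))) \<le> G x k"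
        unfolding G_def norm_mult using f(3)[of "x + k"]
        by (intro mult_right_mono) (auto intro: mult_left_le)
    qed simp
    finally show ?thesis .
  qed
  define Gs where "Gs x = sum (G x) {-M..M} / (real_of_int M)\<^sup>2 / 3" for x
  have "(1 / D)\<^sup>2 \<le> avg {0..<P} (\<lambda>x. sum (G x) {-M..M} / (real_of_int M)\<^sup>2)"
    by (rule order_trans[OF 1], rule order_trans[OF complex_Re_le_cmod], rule order_trans[OF norm_avg_le])
      (rule avg_mono, rule inner)
  then have Gs1: "1 / (3 * D\<^sup>2) \<le> avg {0..<P} Gs"
    unfolding Gs_def by (simp add: avg_def sum_divide_distrib[symmetric] power_divide)
  have Gsle: "Gs x \<le> 1" for x
  proof -
    have "sum (G x) {-M..M} \<le> of_nat (card {-M..M}) * real_of_int M" by (rule sum_bounded_above) (rule GM)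
    also have "\<dots> \<le> 3 * real_of_int M * M" using M0 by (intro mult_right_mono) auto
    finally show ?thesis unfolding Gs_def using M1 by (simp add: field_simps power2_eq_square)
  qed
  define X where "X = {x\<in>{0..<P}. 1 / (3 * D\<^sup>2) / 2 \<le> Gs x}"
  have cX: "1 / (3 * D\<^sup>2) / 2 * card {0..<P} \<le> card X"
    unfolding X_def by (rule avg_popular[OF _ Gs1 Gsle]) auto
  have main: "R (x mod q) \<and> major (D ^ 7000) M (\<psi> (x mod q))" if x: "x \<in> X" for x
  proof -
    have "1 / (6 * D\<^sup>2) \<le> Gs x" using x by (simp add: X_def)
    then have s2: "(real_of_int M)\<^sup>2 / (2 * D\<^sup>2) \<le> sum (G x) {-M..M}" unfolding Gs_def using M1 D by (simp add: field_simps)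
    then have "0 < sum (G x) {-M..M}" using M1 D by (smt (verit) divide_pos_pos zero_less_power)
    then have "f0 x \<noteq> 0" by (auto simp: G_def)
    then have Rx: "R (x mod q)" by (rule R)
    define S where "S = {k\<in>{-M..M}. M / (12 * D\<^sup>2) \<le> G x k}"
    have "card {-M..M} * (M / (12 * D\<^sup>2)) + (real_of_int M)\<^sup>2 / (4 * D\<^sup>2) \<le> sum (G x) {-M..M}"
    proof -
      have "real (card {-M..M}) \<le> 3 * M" using M0 by auto
      then have "card {-M..M} * (M / (12 * D\<^sup>2)) \<le> (3 * real_of_int M) * (M / (12 * D\<^sup>2))"
        using M1 D by (intro mult_right_mono) auto
      also have "\<dots> = (real_of_int M)\<^sup>2 / (4 * D\<^sup>2)" by (simp add: power2_eq_square)
      finally have "card {-M..M} * (M / (12 * D\<^sup>2)) + (real_of_int M)\<^sup>2 / (4 * D\<^sup>2) \<le> (real_of_int M)\<^sup>2 / (2 * D\<^sup>2)"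
        by simp
      then show ?thesis using s2 by linarith
    qed
    from popular_sum[OF _ GM this] have "(real_of_int M)\<^sup>2 / (4 * D\<^sup>2) \<le> card S * M"
      unfolding S_def using M1 D by auto
    then have cS: "M / (4 * D\<^sup>2) \<le> card S" using M1 D by (simp add: field_simps power2_eq_square)
    have D6: "12 * D\<^sup>2 \<le> D ^ 6" "4 * D\<^sup>2 \<le> D ^ 6" using pow_absorb[OF D, of 12 4 2 6] pow_absorb[OF D, of 4 2 2 6] by auto
    have "\<exists>b::int. 1 \<le> b \<and> b \<le> D ^ 96 \<and> near_int (of_int b * (2 * of_int k * \<psi> x)) (D ^ 504 / M)" if k: "k \<in> S" for k
    proof -
      have "M / (12 * D\<^sup>2) \<le> G x k" using k by (simp add: S_def)
      also have "\<dots> \<le> norm (\<Sum>y'\<in>I k. ee ((\<psi> x - \<psi> (x + k)) * (of_int y')\<^sup>2 + 2 * of_int k * \<psi> x * of_int y'))"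
        unfolding G_def using f(3) by (intro mult_left_le_one_le) auto
      finally have "M / (12 * D\<^sup>2) \<le> norm (\<Sum>y'\<in>I k. ee ((\<psi> x - \<psi> (x + k)) * (of_int y')\<^sup>2 + 2 * of_int k * \<psi> x * of_int y'))" .
      moreover have "M / D ^ 6 \<le> M / (12 * D\<^sup>2)" using D6 M1 D by (intro divide_left_mono) auto
      ultimately have "M / D ^ 6 \<le> norm (\<Sum>y'\<in>{max 1 (1 - k)..min M (M - k)}. ee ((\<psi> x - \<psi> (x + k)) * (of_int y')\<^sup>2 + 2 * of_int k * \<psi> x * of_int y'))"
        unfolding I_def by linarith
      from quadratic_weyl[OF _ _ _ _ this] show ?thesis
        using M power_increasing[of 540 7000 D] power_increasing[of 1 6 D] D by (fastforce simp: power_mult[symmetric])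
    qed
    then obtain bb :: "int \<Rightarrow> int" where bb: "\<And>k. k \<in> S \<Longrightarrow> 1 \<le> bb k" "\<And>k. k \<in> S \<Longrightarrow> bb k \<le> D ^ 96"
      "\<And>k. k \<in> S \<Longrightarrow> near_int (of_int (bb k) * (2 * of_int k * \<psi> x)) (D ^ 504 / M)" by metis
    have fS: "finite S" "S \<noteq> {}"
    proof -
      show "finite S" by (rule finite_subset[of _ "{-M..M}"]) (auto simp: S_def)
      have "0 < M / (4 * D\<^sup>2)" using M1 D by auto
      then show "S \<noteq> {}" using cS by (cases "S = {}") auto
    qed
    \<comment> \<open>The denominator still depends on k. The most frequent of its at most D^96 =
      (D^6)^16 values leaves a set of k dense enough for \<open>vinogradov\<close>.\<close>
    have "\<exists>v\<in>{1..\<lfloor>D ^ 96\<rfloor>}. real (card S) \<le> D ^ 96 * real (card {k\<in>S. bb k = v})"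
    proof (rule pigeonhole_fibre[OF fS(1) _ _ _ fS(2)])
      show "bb ` S \<subseteq> {1..\<lfloor>D ^ 96\<rfloor>}" using bb(1,2) by (auto simp: le_floor_iff)
      show "real (card {1..\<lfloor>D ^ 96\<rfloor>}) \<le> D ^ 96" using D1[of 96] by (simp add: of_nat_nat)
    qed auto
    then obtain b :: int where b: "1 \<le> b" "b \<le> D ^ 96" "real (card S) \<le> D ^ 96 * real (card {k\<in>S. bb k = b})"
      by (auto simp: le_floor_iff)
    define S' where "S' = {k\<in>S. bb k = b}"
    have "M / D ^ 504 \<le> card S'"
    proof -
      have "M / (4 * D\<^sup>2) \<le> D ^ 96 * card S'" using cS b(3) unfolding S'_def by linarith
      then have "M \<le> 4 * D ^ 98 * card S'" using D by (simp add: field_simps power_add[symmetric] flip: power2_eq_square)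
      also have "\<dots> \<le> D ^ 504 * card S'" using pow_absorb[OF D, of 4 2 98 504] by (intro mult_right_mono) auto
      finally show ?thesis using D by (simp add: field_simps)
    qed
    moreover have "near_int (of_int k * (2 * of_int b * \<psi> x)) (D ^ 504 / M)" if "k \<in> S'" for k
      using bb(3)[of k] that by (simp add: S'_def algebra_simps)
    moreover have "(D ^ 504) ^ 10 \<le> M"
    proof -
      have "D ^ 5040 \<le> D ^ 7000" by (rule power_increasing) (use D in auto)
      then show ?thesis unfolding power_mult[symmetric] using M by simp
    qed
    moreover have "S' \<subseteq> {-M..M}" by (auto simp: S'_def S_def)
    moreover have "2 \<le> D ^ 504" using power_increasing[of 1 504 D] D by simp
    ultimately obtain b' :: int where b': "1 \<le> b'" "b' \<le> (D ^ 504) ^ 3"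
       "near_int (of_int b' * (2 * of_int b * \<psi> x)) ((D ^ 504) ^ 12 / (real_of_int M)\<^sup>2)"
      using vinogradov[of "D ^ 504" M S' "2 * of_int b * \<psi> x"] by blast
    have "near_int (of_int (2 * b * b') * \<psi> x) (D ^ 6048 / (real_of_int M)\<^sup>2)" using b'(3) by (simp add: power_mult[symmetric] algebra_simps)
    then have "near_int (of_int (2 * b * b') * \<psi> x) (D ^ 7000 / (real_of_int M)\<^sup>2)"
      by (rule near_int_mono) (use D in \<open>auto intro!: divide_right_mono power_increasing\<close>)
    moreover have "1 \<le> 2 * b * b'" using b(1) b'(1) mult_mono[of 1 b 1 b'] by simp
    moreover have "real_of_int (2 * b * b') \<le> D ^ 7000"
    proof -
      have "real_of_int b * b' \<le> D ^ 96 * D ^ 1512" using b b' D by (intro mult_mono) (auto simp: power_mult[symmetric])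
      then have "real_of_int (2 * b * b') \<le> 2 * D ^ 1608" by (simp add: power_add[symmetric])
      also have "\<dots> \<le> D ^ 7000" by (rule pow_absorb[OF D, of 2 1]) auto
      finally show ?thesis .
    qed
    ultimately have "major (D ^ 7000) M (\<psi> x)" unfolding major_def by blast
    then show ?thesis using Rx by (simp add: per_mod[OF p])
  qed
  define Y where "Y = {r\<in>{0..<q}. R r \<and> major (D ^ 7000) M (\<psi> r)}"
  \<comment> \<open>Each class modulo q contains T residues modulo P, so a proportion of good x
    gives at least that proportion of good classes.\<close>
  have im: "(\<lambda>x. (x mod q, x div q)) ` X \<subseteq> Y \<times> {0..<T}"
  proof (rule image_subsetI)
    fix x assume x: "x \<in> X"
    then have x0: "0 \<le> x" "x < q * T" by (auto simp: X_def q)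
    have "q * (x div q) \<le> x" using q by (simp add: minus_mod_eq_mult_div[symmetric])
    then have "q * (x div q) < q * T" using x0 by linarith
    then have "x div q < T" using q(1) by (simp add: mult_less_cancel_left_pos)
    moreover have "0 \<le> x div q" using q x0 by (simp add: pos_imp_zdiv_nonneg_iff)
    ultimately show "(x mod q, x div q) \<in> Y \<times> {0..<T}" using main[OF x] q(1) unfolding Y_def by simp
  qed
  have inj: "inj_on (\<lambda>x. (x mod q, x div q)) X"
    by (rule inj_onI) (metis Pair_inject mult_div_mod_eq)
  have "finite Y" by (rule finite_subset[of _ "{0..<q}"]) (auto simp: Y_def)
  then have fin: "finite (Y \<times> {0..<T})" by simp
  have "card X \<le> card (Y \<times> {0..<T})" using card_mono[OF fin im] card_image[OF inj] by simp
  also have "\<dots> = card Y * nat T" by (simp add: card_cartesian_product)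
  finally have "real (card X) \<le> real (card Y * nat T)" by (simp only: of_nat_le_iff)
  also have "\<dots> = real (card Y) * real_of_int T" using q by simp
  finally have "1 / (3 * D\<^sup>2) / 2 * card {0..<P} \<le> real (card Y) * real_of_int T" using cX by linarith
  moreover have "real (card {0..<P}) = real_of_int q * real_of_int T" using q by simp
  ultimately have "real_of_int T * (q / (6 * D\<^sup>2)) \<le> real_of_int T * real (card Y)" by (simp add: mult_ac)
  then have "q / (6 * D\<^sup>2) \<le> card Y" using q(2) by (simp only: mult_le_cancel_left_pos of_int_0_less_iff)
  moreover have "q / D ^ 7000 \<le> q / (6 * D\<^sup>2)"
    using pow_absorb[OF D, of 6 3 2 7000] q D by (intro divide_left_mono) auto
  ultimately show ?thesis unfolding Y_def by linarith
qed

subsection \<open>Gowers norms\<close>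

declare listset.simps [simp del]

lemma finite_listset_Nil [simp]: "finite (listset [])"
  by (simp add: listset.simps)

lemma finite_listset: "(\<And>I. I \<in> set Is \<Longrightarrow> finite I) \<Longrightarrow> finite (listset Is)"
proof (induction Is)
  case (Cons I Is)
  have "listset (I # Is) = (\<lambda>(i, is). i # is) ` (I \<times> listset Is)" by (auto simp: set_Cons_def listset.simps)
  then show ?case using Cons by simp
qed simp

lemma avg_listset_Nil [simp]: "avg (listset []) g = g []"
  by (simp add: avg_def listset.simps)

lemma avg_listset_Cons:
  assumes "finite I" "finite (listset Is)"
  shows "avg (listset (I # Is)) g = avg I (\<lambda>i. avg (listset Is) (\<lambda>is. g (i # is)))"
proof -
  have b: "bij_betw (\<lambda>(i, is). i # is) (I \<times> listset Is) (listset (I # Is))"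
    by (auto simp: bij_betw_def inj_on_def set_Cons_def listset.simps)
  show ?thesis by (simp add: avg_reindex[OF b] avg_prod[OF assms] case_prod_beta)
qed

lemma length_listset: "is \<in> listset Is \<Longrightarrow> length is = length Is"
  by (induction Is arbitrary: "is") (auto simp: set_Cons_def listset.simps)

text \<open>A function on lists of length \<open>k\<close> is \<open>low k\<close> if it is a product of \<open>k\<close> bounded factors, the
  \<open>i\<close>-th of which does not depend on the \<open>i\<close>-th entry; these are the factors that the
  Gowers--Cauchy--Schwarz inequality removes.\<close>
fun low :: "nat \<Rightarrow> ('a list \<Rightarrow> complex) \<Rightarrow> bool" where
  "low 0 b = (b [] = 1)"
| "low (Suc k) b = (\<exists>b0 b'. (\<forall>i is. length is = k \<longrightarrow> b (i # is) = b0 is * b' i is) \<and>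
     (\<forall>is. norm (b0 is :: complex) \<le> 1) \<and> (\<forall>i. low k (b' i)))"

lemma low_mult_cnj: "low k a \<Longrightarrow> low k b \<Longrightarrow> low k (\<lambda>is. a is * cnj (b is))"
proof (induction k arbitrary: a b)
  case (Suc k)
  from Suc.prems obtain a0 a' b0 b' where
    a: "\<And>i is. length is = k \<Longrightarrow> a (i # is) = a0 is * a' i is" "\<And>is. norm (a0 is) \<le> 1" "\<And>i. low k (a' i)" and
    b: "\<And>i is. length is = k \<Longrightarrow> b (i # is) = b0 is * b' i is" "\<And>is. norm (b0 is) \<le> 1" "\<And>i. low k (b' i)"
    by auto
  show ?case unfolding low.simps
  proof (intro exI conjI allI impI)
    fix i and "is" :: "'a list" assume "length is = k"
    then show "a (i # is) * cnj (b (i # is)) = (a0 is * cnj (b0 is)) * (a' i is * cnj (b' i is))"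
      by (simp add: a b)
  next
    fix "is" show "norm (a0 is * cnj (b0 is)) \<le> 1" using a(2) b(2) by (simp add: norm_mult mult_le_one)
  next
    fix i show "low k (\<lambda>is. a' i is * cnj (b' i is))" by (rule Suc.IH[OF a(3) b(3)])
  qed
qed simp

lemma low_one: "low k (\<lambda>_. 1)"
proof (induction k)
  case (Suc k)
  show ?case unfolding low.simps by (intro exI[of _ "\<lambda>_. 1"] exI[of _ "\<lambda>_ _. 1"]) (use Suc in auto)
qed simp

lemma low_mult: assumes "low k a" "low k b" shows "low k (\<lambda>is. a is * b is)"
  using low_mult_cnj[OF assms(1) low_mult_cnj[OF low_one assms(2)]] by simp

text \<open>\<open>Cb\<close> and \<open>Cs\<close> are the alternating product and sum over the vertices of the cube spanned by a
  list of pairs.\<close>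
primrec Cb :: "('a list \<Rightarrow> complex) \<Rightarrow> ('a \<times> 'a) list \<Rightarrow> complex" where
  "Cb g [] = g []"
| "Cb g (p # ps) = Cb (\<lambda>is. g (fst p # is) * cnj (g (snd p # is))) ps"

lemma Cb_cong: "(\<And>is. length is = length ps \<Longrightarrow> g is = h is) \<Longrightarrow> Cb g ps = Cb h ps"
proof (induction ps arbitrary: g h)
  case (Cons p ps)
  show ?case unfolding Cb.simps by (rule Cons.IH) (simp add: Cons.prems)
qed simp

lemma Cb_mult: "Cb (\<lambda>is. g is * h is) ps = Cb g ps * Cb h ps"
proof (induction ps arbitrary: g h)
  case (Cons p ps)
  show ?case unfolding Cb.simps
    by (subst Cons.IH[symmetric]) (rule Cb_cong, simp add: mult_ac)
qed simp

lemma Cb_nonzero: "Cb g ps \<noteq> 0 \<Longrightarrow> g (map fst ps) \<noteq> 0"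
  by (induction ps arbitrary: g) fastforce+

lemma norm_Cb: "(\<And>is. norm (g is) \<le> 1) \<Longrightarrow> norm (Cb g ps) \<le> 1"
proof (induction ps arbitrary: g)
  case (Cons p ps)
  show ?case unfolding Cb.simps
    by (rule Cons.IH) (simp add: norm_mult mult_le_one Cons.prems)
qed simp

primrec Cs :: "('a list \<Rightarrow> real) \<Rightarrow> ('a \<times> 'a) list \<Rightarrow> real" where
  "Cs \<phi> [] = \<phi> []"
| "Cs \<phi> (p # ps) = Cs (\<lambda>is. \<phi> (fst p # is) - \<phi> (snd p # is)) ps"

lemma Cs_diff: "Cs (\<lambda>is. \<phi> is - \<chi> is) ps = Cs \<phi> ps - Cs \<chi> ps"
proof (induction ps arbitrary: \<phi> \<chi>)
  case (Cons p ps)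
  show ?case unfolding Cs.simps Cons.IH by simp
qed simp

lemma Cs_mult: "Cs (\<lambda>is. \<phi> is * c) ps = Cs \<phi> ps * c"
proof (induction ps arbitrary: \<phi>)
  case (Cons p ps)
  show ?case unfolding Cs.simps left_diff_distrib[symmetric] by (rule Cons.IH)
qed simp

lemma Cb_ee: "Cb (\<lambda>is. ee (\<phi> is)) ps = ee (Cs \<phi> ps)"
proof (induction ps arbitrary: \<phi>)
  case (Cons p ps)
  show ?case unfolding Cb.simps Cs.simps ee_diff[symmetric] by (rule Cons.IH)
qed simp

text \<open>In the alternating sum the vertex \<open>as\<close> itself occurs with sign +, so the
  difference runs over the other vertices; each of them has some entry of \<open>as\<close> replaced
  by the fixed entry of \<open>bs\<close> and does not depend on it.\<close>

lemma low_Cs: "length bs = k \<Longrightarrow> low k (\<lambda>as. ee ((\<phi> as - Cs \<phi> (zip as bs)) * s))"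
proof (induction k arbitrary: bs \<phi>)
  case (Suc k)
  then obtain b bs' where bs: "bs = b # bs'" "length bs' = k" by (cases bs) auto
  show ?case unfolding low.simps
  proof (intro exI conjI allI impI)
    fix a and as :: "'a list"
    show "ee ((\<phi> (a # as) - Cs \<phi> (zip (a # as) bs)) * s) =
       ee (Cs (\<lambda>as. \<phi> (b # as)) (zip as bs') * s) * ee ((\<phi> (a # as) - Cs (\<lambda>as. \<phi> (a # as)) (zip as bs')) * s)"
      unfolding ee_add[symmetric] bs by (rule arg_cong[of _ _ ee]) (simp add: Cs_diff algebra_simps)
    show "norm (ee (Cs (\<lambda>as. \<phi> (b # as)) (zip as bs') * s)) \<le> 1" by simp
    show "low k (\<lambda>as. ee ((\<phi> (a # as) - Cs (\<lambda>as. \<phi> (a # as)) (zip as bs')) * s))"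
      by (rule Suc.IH) (rule bs)
  qed
qed simp

text \<open>The factor of b not depending on the first entry is bounded and drops out when that
  entry is doubled; the remaining factors are paired up and again form a low product in one variable
  less.\<close>

lemma gowers_CS_step:
  fixes g :: "'z \<Rightarrow> 'a list \<Rightarrow> complex"
  assumes fin: "finite Z" "finite I" "finite (listset Is)"
    and b: "\<And>z. low (Suc (length Is)) (b z)"
  obtains b' where "\<And>z i. low (length Is) (b' z i)"
    "(norm (avg Z (\<lambda>z. avg (listset (I # Is)) (\<lambda>is. b z is * g z is))))\<^sup>2
      \<le> Re (avg (I \<times> I) (\<lambda>p. avg Z (\<lambda>z. avg (listset Is)
          (\<lambda>is. (b' z (fst p) is * cnj (b' z (snd p) is)) * (g z (fst p # is) * cnj (g z (snd p # is)))))))"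
proof -
  have "\<forall>z. \<exists>b0 b'. (\<forall>i is. length is = length Is \<longrightarrow> b z (i # is) = b0 is * b' i is) \<and>
     (\<forall>is. norm (b0 is :: complex) \<le> 1) \<and> (\<forall>i. low (length Is) (b' i))" using b by simp
  then obtain b0 b' where
    b0: "\<And>z i is. length is = length Is \<Longrightarrow> b z (i # is) = b0 z is * b' z i is"
      "\<And>z is. norm (b0 z is) \<le> 1" and b': "\<And>z i. low (length Is) (b' z i)" by metis
  let ?g = "\<lambda>zi i. b' (fst zi) i (snd zi) * g (fst zi) (i # snd zi)"
  have "avg Z (\<lambda>z. avg (listset (I # Is)) (\<lambda>is. b z is * g z is)) =
    avg Z (\<lambda>z. avg (listset Is) (\<lambda>is. avg I (\<lambda>i. b z (i # is) * g z (i # is))))"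
    unfolding avg_listset_Cons[OF fin(2,3)] by (subst avg_swap) (rule refl)
  also have "\<dots> = avg Z (\<lambda>z. avg (listset Is) (\<lambda>is. b0 z is * avg I (?g (z, is))))"
    unfolding avg_cmult[symmetric] by (intro avg_cong refl) (simp add: b0 length_listset mult_ac)
  also have "\<dots> = avg (Z \<times> listset Is) (\<lambda>zi. b0 (fst zi) (snd zi) * avg I (?g zi))"
    by (simp add: avg_prod[OF fin(1,3)])
  finally have "(norm (avg Z (\<lambda>z. avg (listset (I # Is)) (\<lambda>is. b z is * g z is))))\<^sup>2
    = (norm (avg (Z \<times> listset Is) (\<lambda>zi. b0 (fst zi) (snd zi) * avg I (?g zi))))\<^sup>2" by simp
  also have "\<dots> \<le> Re (avg I (\<lambda>i. avg I (\<lambda>i'. avg (Z \<times> listset Is) (\<lambda>zi. ?g zi i * cnj (?g zi i')))))"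
    by (rule avg_CS) (rule b0(2))
  also have "\<dots> = Re (avg (I \<times> I) (\<lambda>p. avg Z (\<lambda>z. avg (listset Is)
          (\<lambda>is. (b' z (fst p) is * cnj (b' z (snd p) is)) * (g z (fst p # is) * cnj (g z (snd p # is)))))))"
    by (simp add: avg_prod[OF fin(2,2)] avg_prod[OF fin(1,3)] mult_ac)
  finally show ?thesis using that b' by blast
qed

text \<open>The norm stays inside the average over cubes, so that a large average yields many cubes
  with a large inner average, to each of which Weyl's inequality can be applied.\<close>

lemma gowers_CS:
  fixes g :: "'z \<Rightarrow> 'a list \<Rightarrow> complex"
  assumes fin: "finite Z" "\<And>I. I \<in> set Is \<Longrightarrow> finite I" and b: "\<And>z. low (length Is) (b z)"
  shows "norm (avg Z (\<lambda>z. avg (listset Is) (\<lambda>is. b z is * g z is))) ^ (2 ^ length Is)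
    \<le> avg (listset (map (\<lambda>I. I \<times> I) Is)) (\<lambda>ps. norm (avg Z (\<lambda>z. Cb (g z) ps)))"
  using fin(2) b
proof (induction Is arbitrary: b g)
  case Nil
  then show ?case by simp
next
  case (Cons I Is)
  have fI: "finite I" "finite (listset Is)" using Cons.prems by (auto intro: finite_listset)
  have fI2: "finite (I \<times> I)" "finite (listset (map (\<lambda>I. I \<times> I) Is))"
    using Cons.prems by (auto intro!: finite_listset)
  obtain b' where b': "\<And>z i. low (length Is) (b' z i)" and
    s: "(norm (avg Z (\<lambda>z. avg (listset (I # Is)) (\<lambda>is. b z is * g z is))))\<^sup>2
      \<le> Re (avg (I \<times> I) (\<lambda>p. avg Z (\<lambda>z. avg (listset Is)
          (\<lambda>is. (b' z (fst p) is * cnj (b' z (snd p) is)) * (g z (fst p # is) * cnj (g z (snd p # is)))))))"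
    (is "?X\<^sup>2 \<le> Re (avg _ ?Y)")
    by (rule gowers_CS_step[OF fin(1) fI, of b g]) (use Cons.prems(2) in auto)
  have s': "?X\<^sup>2 \<le> avg (I \<times> I) (\<lambda>p. norm (?Y p))"
    by (rule order_trans[OF s order_trans[OF complex_Re_le_cmod norm_avg_le]])
  have "?X ^ (2 ^ length (I # Is)) = (?X\<^sup>2) ^ (2 ^ length Is)" by (simp add: power_mult)
  also have "\<dots> \<le> avg (I \<times> I) (\<lambda>p. norm (?Y p)) ^ (2 ^ length Is)" by (rule power_mono[OF s']) simp
  also have "\<dots> \<le> avg (I \<times> I) (\<lambda>p. norm (?Y p) ^ (2 ^ length Is))" by (rule avg_pow2) simp
  also have "\<dots> \<le> avg (I \<times> I) (\<lambda>p. avg (listset (map (\<lambda>I. I \<times> I) Is)) (\<lambda>ps. norm (avg Z (\<lambda>z. Cb (g z) (p # ps)))))"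
    unfolding Cb.simps
    by (intro avg_mono Cons.IH low_mult_cnj b') (use Cons.prems in auto)
  also have "\<dots> = avg (listset (map (\<lambda>I. I \<times> I) (I # Is))) (\<lambda>ps. norm (avg Z (\<lambda>z. Cb (g z) ps)))"
    by (simp add: avg_listset_Cons[OF fI2] del: Cb.simps)
  finally show ?case .
qed

text \<open>Here the last application of Cauchy-Schwarz is kept as a real part, which makes the
  right side an exact Gowers-type average. This requires at least one doubling, hence a nonempty
  list.\<close>

lemma gowers_CS_pos:
  fixes g :: "'z \<Rightarrow> 'a list \<Rightarrow> complex"
  assumes fin: "finite Z" "\<And>I. I \<in> set Is \<Longrightarrow> finite I" and b: "\<And>z. low (length Is) (b z)" and ne: "Is \<noteq> []"
  shows "norm (avg Z (\<lambda>z. avg (listset Is) (\<lambda>is. b z is * g z is))) ^ (2 ^ length Is)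
    \<le> Re (avg (listset (map (\<lambda>I. I \<times> I) Is)) (\<lambda>ps. avg Z (\<lambda>z. Cb (g z) ps)))"
  using fin(2) b ne
proof (induction Is arbitrary: b g)
  case (Cons I Is)
  have fI: "finite I" "finite (listset Is)" using Cons.prems by (auto intro: finite_listset)
  have fI2: "finite (I \<times> I)" "finite (listset (map (\<lambda>I. I \<times> I) Is))"
    using Cons.prems by (auto intro!: finite_listset)
  obtain b' where b': "\<And>z i. low (length Is) (b' z i)" and
    s: "(norm (avg Z (\<lambda>z. avg (listset (I # Is)) (\<lambda>is. b z is * g z is))))\<^sup>2
      \<le> Re (avg (I \<times> I) (\<lambda>p. avg Z (\<lambda>z. avg (listset Is)
          (\<lambda>is. (b' z (fst p) is * cnj (b' z (snd p) is)) * (g z (fst p # is) * cnj (g z (snd p # is)))))))"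
    (is "?X\<^sup>2 \<le> Re (avg _ ?Y)")
    by (rule gowers_CS_step[OF fin(1) fI, of b g]) (use Cons.prems(2) in auto)
  show ?case
  proof (cases "Is = []")
    case True
    then have "b' z i [] = 1" for z i using b'[of z i] by simp
    then have "?X\<^sup>2 \<le> Re (avg (I \<times> I) (\<lambda>p. avg Z (\<lambda>z. Cb (g z) [p])))" using s True by simp
    also have "\<dots> = Re (avg (listset (map (\<lambda>I. I \<times> I) (I # Is))) (\<lambda>ps. avg Z (\<lambda>z. Cb (g z) ps)))"
      unfolding True list.map by (subst avg_listset_Cons) (use fI in simp_all)
    finally show ?thesis using True by simp
  next
    case False
    have s': "?X\<^sup>2 \<le> avg (I \<times> I) (\<lambda>p. norm (?Y p))"
      by (rule order_trans[OF s order_trans[OF complex_Re_le_cmod norm_avg_le]])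
    have "?X ^ (2 ^ length (I # Is)) = (?X\<^sup>2) ^ (2 ^ length Is)" by (simp add: power_mult)
    also have "\<dots> \<le> avg (I \<times> I) (\<lambda>p. norm (?Y p)) ^ (2 ^ length Is)" by (rule power_mono[OF s']) simp
    also have "\<dots> \<le> avg (I \<times> I) (\<lambda>p. norm (?Y p) ^ (2 ^ length Is))" by (rule avg_pow2) simp
    also have "\<dots> \<le> avg (I \<times> I) (\<lambda>p. Re (avg (listset (map (\<lambda>I. I \<times> I) Is)) (\<lambda>ps. avg Z (\<lambda>z. Cb (g z) (p # ps)))))"
      unfolding Cb.simps
      by (intro avg_mono Cons.IH low_mult_cnj b' False) (use Cons.prems in auto)
    also have "\<dots> = Re (avg (listset (map (\<lambda>I. I \<times> I) (I # Is))) (\<lambda>ps. avg Z (\<lambda>z. Cb (g z) ps)))"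
      by (simp add: avg_listset_Cons[OF fI2] Re_avg del: Cb.simps)
    finally show ?thesis .
  qed
qed simp

text \<open>\<open>dd h\<close> is the multiplicative derivative \<open>\<Delta>\<^sub>h\<close>, \<open>dl\<close> its iteration over a list, and \<open>gowers T k\<close> below is
  the \<open>2\<^sup>k\<close>-th power of the Gowers norm \<open>U\<^sup>k\<close> on \<open>\<int>/T\<int>\<close>; functions on \<open>\<int>/T\<int>\<close> are \<open>T\<close>-periodic functions
  of an integer, and \<open>listset (replicate k I)\<close> is the box \<open>I\<^sup>k\<close>.\<close>
definition dd :: "int \<Rightarrow> (int \<Rightarrow> complex) \<Rightarrow> int \<Rightarrow> complex" where
  "dd h f x = f (x + h) * cnj (f x)"

primrec dl :: "int list \<Rightarrow> (int \<Rightarrow> complex) \<Rightarrow> int \<Rightarrow> complex" where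
  "dl [] f = f"
| "dl (h # hs) f = dl hs (dd h f)"

lemma dl_shift: "dl hs (\<lambda>x. f (x + c)) x = dl hs f (x + c)"
proof (induction hs arbitrary: f)
  case (Cons h hs)
  have "dd h (\<lambda>x. f (x + c)) = (\<lambda>x. dd h f (x + c))" by (auto simp: dd_def fun_eq_iff ac_simps)
  then show ?case by (simp add: Cons.IH)
qed simp

lemma dl_mult_cnj: "dl hs (\<lambda>x. f x * cnj (g x)) x = dl hs f x * cnj (dl hs g x)"
proof (induction hs arbitrary: f g)
  case (Cons h hs)
  have "dd h (\<lambda>x. f x * cnj (g x)) = (\<lambda>x. dd h f x * cnj (dd h g x))" by (auto simp: dd_def fun_eq_iff)
  then show ?case by (simp add: Cons.IH)
qed simp

lemma dl_Cons: "dl (h # hs) f x = dl hs f (x + h) * cnj (dl hs f x)"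
proof -
  have "dl (h # hs) f x = dl hs (\<lambda>x. f (x + h) * cnj (f x)) x" by (simp add: dd_def[abs_def])
  then show ?thesis by (simp only: dl_mult_cnj dl_shift)
qed

lemma dd_commute: "dd a (dd b f) = dd b (dd a f)"
  by (simp add: dd_def fun_eq_iff mult_ac add.commute add.left_commute)

lemma norm_dd: "(\<And>x. norm (f x) \<le> 1) \<Longrightarrow> norm (dd h f x) \<le> 1"
  by (simp add: dd_def norm_mult mult_le_one)

lemma norm_dl: "(\<And>x. norm (f x) \<le> 1) \<Longrightarrow> norm (dl hs f x) \<le> 1"
  by (induction hs arbitrary: f) (auto simp: norm_dd)

lemma per_dd: "per T f \<Longrightarrow> per T (dd h f)"
  using per_shift[of T f h] by (simp add: per_def dd_def)

lemma per_dl: "per T f \<Longrightarrow> per T (dl hs f)"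
  by (induction hs arbitrary: f) (auto simp: per_dd)

lemma dd_per: "per T f \<Longrightarrow> dd (h + T) f = dd h f"
  using per_mult[of T f _ 1] by (simp add: dd_def fun_eq_iff add.assoc[symmetric])

text \<open>All factors of the iterated derivative except the one at the top vertex x + sum hs. Each
  omits at least one of the directions, so the product is low.\<close>

primrec bl :: "(int \<Rightarrow> complex) \<Rightarrow> int list \<Rightarrow> int \<Rightarrow> complex" where
  "bl f [] x = 1"
| "bl f (h # hs) x = bl f hs (x + h) * cnj (dl hs f x)"

lemma dl_bl: "dl hs f x = bl f hs x * f (x + sum_list hs)"
proof (induction hs arbitrary: x)
  case (Cons h hs)
  show ?case by (simp only: dl_Cons Cons.IH[of "x + h"]) (simp add: add.assoc mult_ac)
qed simp

lemma low_bl: "(\<And>x. norm (f x) \<le> 1) \<Longrightarrow> low k (\<lambda>hs. bl f hs x)"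
proof (induction k arbitrary: x)
  case (Suc k)
  show ?case unfolding low.simps
    by (intro exI[of _ "\<lambda>hs. cnj (dl hs f x)"] exI[of _ "\<lambda>h hs. bl f hs (x + h)"])
      (auto simp: Suc.IH[OF Suc.prems] norm_dl[OF Suc.prems] mult.commute)
qed simp

lemma per_bl: assumes "per T f" shows "bl f hs (x + T) = bl f hs x"
proof (induction hs arbitrary: x)
  case (Cons h hs)
  have "bl f hs (x + T + h) = bl f hs (x + h)" using Cons[of "x + h"] by (simp add: ac_simps)
  then show ?case using per_dl[OF assms, of hs] by (simp add: per_def)
qed simp

lemma Cb_dl: "Cb (\<lambda>is. f (x + sum_list is)) ps = dl (map (\<lambda>p. fst p - snd p) ps) f (x + sum_list (map snd ps))"
proof (induction ps arbitrary: f x)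
  case (Cons p ps)
  have A: "(\<lambda>is. f (x + sum_list (fst p # is)) * cnj (f (x + sum_list (snd p # is)))) =
     (\<lambda>is. dd (fst p - snd p) f ((x + snd p) + sum_list is))" by (auto simp: dd_def fun_eq_iff ac_simps)
  show ?case unfolding Cb.simps A Cons.IH by (simp add: add.assoc)
qed simp

definition gowers :: "int \<Rightarrow> nat \<Rightarrow> (int \<Rightarrow> complex) \<Rightarrow> real" where
  "gowers T k f = Re (avg (listset (replicate k {0..<T})) (\<lambda>hs. avg {0..<T} (dl hs f)))"

lemma finite_box [simp]: "finite (listset (replicate k {0..<T::int}))"
  by (rule finite_listset) auto

lemma gowers_Suc: "gowers T (Suc k) f = avg {0..<T} (\<lambda>h. gowers T k (dd h f))"
  by (simp add: gowers_def avg_listset_Cons[OF _ finite_box] Re_avg)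

lemma gowers_add: "gowers T (k + m) f = avg (listset (replicate k {0..<T})) (\<lambda>hs. gowers T m (dl hs f))"
proof (induction k arbitrary: f)
  case (Suc k)
  show ?case by (simp add: gowers_Suc Suc.IH avg_listset_Cons[OF _ finite_box])
qed (simp add: gowers_def)

lemma avg_autocorrelation:
  assumes "T > 0" "per T f"
  shows "avg {0..<T} (\<lambda>h. avg {0..<T} (\<lambda>t. f (t + h) * cnj (f t))) = of_real ((norm (avg {0..<T} f))\<^sup>2)"
proof -
  have "avg {0..<T} (\<lambda>h. avg {0..<T} (\<lambda>t. f (t + h) * cnj (f t))) =
     avg {0..<T} (\<lambda>t. avg {0..<T} (\<lambda>h. f (h + t)) * cnj (f t))"
    by (subst avg_swap) (simp add: avg_multc add.commute)
  then show ?thesis by (simp only: avg_per_shift[OF assms] avg_cmult cnj_avg[symmetric] complex_norm_square)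
qed

lemma gowers_Suc_norm:
  assumes "T > 0" "per T f"
  shows "gowers T (Suc k) f = avg (listset (replicate k {0..<T})) (\<lambda>hs. (norm (avg {0..<T} (dl hs f)))\<^sup>2)"
proof -
  have "avg (listset (replicate (Suc k) {0..<T})) (\<lambda>hs. avg {0..<T} (dl hs f)) =
    avg (listset (replicate k {0..<T})) (\<lambda>hs. avg {0..<T} (\<lambda>h. avg {0..<T} (\<lambda>t. dl hs f (t + h) * cnj (dl hs f t))))"
    unfolding replicate_Suc avg_listset_Cons[OF finite_atLeastLessThan_int finite_box] dl_Cons
    by (subst avg_swap) (rule refl)
  then show ?thesis
    by (simp only: gowers_def avg_autocorrelation[OF assms(1) per_dl[OF assms(2)]] avg_of_real Re_complex_of_real)
qed

lemma gowers_nonneg: "T > 0 \<Longrightarrow> per T f \<Longrightarrow> 0 \<le> gowers T (Suc k) f"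
  by (simp add: gowers_Suc_norm avg_nonneg)

text \<open>For each value of the second entry of a pair the difference runs uniformly over the
  cyclic group, and the remaining translation disappears in the average over t.\<close>

lemma avg_pairs_box:
  assumes T: "T > 0" and f: "per T f"
  shows "avg (listset (map (\<lambda>I. I \<times> I) (replicate k {0..<T})))
      (\<lambda>ps. avg {0..<T} (\<lambda>t. dl (map (\<lambda>p. fst p - snd p) ps) f (t + sum_list (map snd ps)))) =
    avg (listset (replicate k {0..<T})) (\<lambda>hs. avg {0..<T} (dl hs f))"
  using f
proof (induction k arbitrary: f)
  case 0
  then show ?case by simp
next
  case (Suc k)
  have fin: "finite (listset (map (\<lambda>I. I \<times> I) (replicate k {0..<T})))"
    by (rule finite_listset) (auto split: if_splits)
  have sh: "avg {0..<T} (\<lambda>t. dl hs f (t + s)) = avg {0..<T} (\<lambda>t. dl hs f (t + s'))" if "per T f" for hs s s' f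
    using that avg_per_shift[OF T per_dl] by metis
  let ?G = "\<lambda>h. avg (listset (replicate k {0..<T})) (\<lambda>hs. avg {0..<T} (dl hs (dd h f)))"
  have p: "per T ?G" unfolding per_def dd_per[OF Suc.prems] by simp
  have "avg (listset (map (\<lambda>I. I \<times> I) (replicate (Suc k) {0..<T})))
      (\<lambda>ps. avg {0..<T} (\<lambda>t. dl (map (\<lambda>p. fst p - snd p) ps) f (t + sum_list (map snd ps)))) =
    avg ({0..<T} \<times> {0..<T}) (\<lambda>p. avg (listset (map (\<lambda>I. I \<times> I) (replicate k {0..<T})))
      (\<lambda>ps. avg {0..<T} (\<lambda>t. dl (map (\<lambda>p. fst p - snd p) ps) (dd (fst p - snd p) f) (t + (snd p + sum_list (map snd ps))))))"
    unfolding replicate_Suc list.map by (subst avg_listset_Cons[OF _ fin]) simp_all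
  also have "\<dots> = avg ({0..<T} \<times> {0..<T}) (\<lambda>p. ?G (fst p - snd p))"
    by (rule avg_cong[OF refl], subst Suc.IH[OF per_dd[OF Suc.prems], symmetric])
      (intro avg_cong refl sh per_dd Suc.prems)
  also have "\<dots> = avg {0..<T} (\<lambda>b. avg {0..<T} (\<lambda>a. ?G (a + (- b))))"
    by (subst avg_prod) (auto intro: avg_swap)
  also have "\<dots> = avg {0..<T} (\<lambda>b. avg {0..<T} ?G)"
    by (intro avg_cong refl avg_per_shift[OF T p])
  also have "\<dots> = avg {0..<T} ?G" using T by (intro avg_const) auto
  finally show ?case
    by (simp add: avg_listset_Cons[OF _ finite_box])
qed

section \<open>Fourier analysis on \<open>Z/TZ\<close> and the inverse theorem for
  \<open>U^2\<close>\<close>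

definition ft :: "int \<Rightarrow> (int \<Rightarrow> complex) \<Rightarrow> int \<Rightarrow> complex" where
  "ft T f j = avg {0..<T} (\<lambda>t. f t * ee (- (of_int j / of_int T * of_int t)))"

lemma ee_orthogonal:
  assumes "T > 0"
  shows "(\<Sum>j\<in>{0..<T}. ee (of_int j / of_int T * of_int m)) = (if T dvd m then of_int T else 0)"
proof (cases "T dvd m")
  case True
  then obtain k where m: "m = T * k" by auto
  have "ee (of_int j / of_int T * of_int m) = 1" for j
  proof -
    have "of_int j / of_int T * of_int m = real_of_int (j * k)" using assms m by simp
    then show ?thesis by (metis ee_of_int)
  qed
  then show ?thesis using True assms by simp
next
  case False
  define g where "g j = ee (of_int j / of_int T * of_int m)" for j
  have p: "per T g"
  proof -
    have "of_int (j + T) / of_int T * real_of_int m = of_int j / of_int T * of_int m + of_int m" for j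
      using assms by (simp add: field_simps)
    then show ?thesis unfolding per_def g_def by (metis ee_add_int)
  qed
  have "avg {0..<T} g = avg {0..<T} (\<lambda>j. g (j + 1))" using avg_per_shift[OF assms p] by simp
  also have "\<dots> = avg {0..<T} (\<lambda>j. ee (of_int m / of_int T) * g j)"
    unfolding g_def ee_add[symmetric] by (intro avg_cong refl arg_cong[of _ _ ee]) (simp add: field_simps)
  also have "\<dots> = ee (of_int m / of_int T) * avg {0..<T} g" by (rule avg_cmult)
  finally have "(ee (of_int m / of_int T) - 1) * avg {0..<T} g = 0" by (simp add: algebra_simps)
  moreover have "ee (of_int m / of_int T) \<noteq> 1"
  proof
    assume e: "ee (of_int m / of_int T) = 1"
    define r where "r = m mod T"
    have r: "0 < r" "r < T" using assms False by (auto simp: r_def dvd_eq_mod_eq_0 order_le_neq_trans[OF pos_mod_sign])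
    have "real_of_int m / of_int T = of_int r / of_int T + of_int (m div T)"
      unfolding r_def using assms by (simp add: field_simps flip: of_int_mult of_int_add)
    then have "ee (of_int r / of_int T) = 1" using e by (metis ee_add_int)
    then have "sin (pi * (of_int r / of_int T)) = 0" using norm_ee_minus_1[of "of_int r / of_int T"] by simp
    moreover have "0 < sin (pi * (of_int r / of_int T))" using r by (intro sin_gt_zero) (auto simp: field_simps)
    ultimately show False by simp
  qed
  ultimately have "avg {0..<T} g = 0" by simp
  then show ?thesis using False assms by (simp add: avg_def g_def)
qed

lemma parseval:
  assumes T: "T > 0"
  shows "(\<Sum>j\<in>{0..<T}. (norm (ft T f j))\<^sup>2) = avg {0..<T} (\<lambda>t. (norm (f t))\<^sup>2)"
proof -
  have e: "ee (- (of_int j / of_int T * of_int t)) * cnj (ee (- (of_int j / of_int T * of_int t'))) =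
     ee (of_int j / of_int T * of_int (t' - t))" for j t t'
    by (simp add: cnj_ee ee_add[symmetric] right_diff_distrib diff_divide_distrib)
  have "of_real (\<Sum>j\<in>{0..<T}. (norm (ft T f j))\<^sup>2) =
     (\<Sum>j\<in>{0..<T}. avg {0..<T} (\<lambda>t. avg {0..<T} (\<lambda>t'. (f t * cnj (f t')) * ee (of_int j / of_int T * of_int (t' - t)))))"
    unfolding of_real_sum ft_def norm_sq_avg
    by (intro sum.cong refl avg_cong, subst e[symmetric]) (simp only: complex_cnj_mult mult_ac)
  also have "\<dots> = avg {0..<T} (\<lambda>t. avg {0..<T} (\<lambda>t'. (f t * cnj (f t')) * (\<Sum>j\<in>{0..<T}. ee (of_int j / of_int T * of_int (t' - t)))))"
    unfolding avg_sum[symmetric] sum_distrib_left ..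
  also have "\<dots> = avg {0..<T} (\<lambda>t. avg {0..<T} (\<lambda>t'. if t' = t then (f t * cnj (f t)) * of_int T else 0))"
  proof (intro avg_cong refl)
    fix t t' assume tt: "t \<in> {0..<T}" "t' \<in> {0..<T}"
    have "\<not> T dvd \<bar>t' - t\<bar>" if "t' \<noteq> t" by (rule zdvd_not_zless) (use tt that in auto)
    then have "T dvd t' - t \<longleftrightarrow> t' = t" by (cases "t' = t") auto
    then show "(f t * cnj (f t')) * (\<Sum>j\<in>{0..<T}. ee (of_int j / of_int T * of_int (t' - t))) =
      (if t' = t then (f t * cnj (f t)) * of_int T else 0)" unfolding ee_orthogonal[OF T] by simp
  qed
  also have "\<dots> = avg {0..<T} (\<lambda>t. of_real ((norm (f t))\<^sup>2))"
    using T by (intro avg_cong refl) (simp add: avg_def complex_norm_square del: of_real_power)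
  finally show ?thesis by (simp only: avg_of_real of_real_eq_iff)
qed

lemma ft_autocorrelation:
  assumes T: "T > 0" and f: "per T f"
  shows "ft T (\<lambda>h. avg {0..<T} (dd h f)) j = of_real ((norm (ft T f j))\<^sup>2)"
proof -
  define g where "g t = f t * ee (- (of_int j / of_int T * of_int t))" for t
  have p: "per T g"
  proof -
    have "ee (- (of_int j / of_int T * of_int (t + T))) = ee (- (of_int j / of_int T * of_int t))" for t
    proof -
      have "- (of_int j / of_int T * of_int (t + T)) = - (of_int j / of_int T * real_of_int t) + of_int (- j)"
        using T by (simp add: field_simps)
      then show ?thesis by (metis ee_add_int)
    qed
    then show ?thesis using f by (simp add: per_def g_def)
  qed
  have "ft T (\<lambda>h. avg {0..<T} (dd h f)) j = avg {0..<T} (\<lambda>h. avg {0..<T} (\<lambda>t. g (t + h) * cnj (g t)))"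
    unfolding ft_def avg_multc[symmetric]
  proof (rule avg_cong[OF refl], rule avg_cong[OF refl])
    fix h t
    have "ee (- (of_int j / of_int T * of_int h)) =
       ee (- (of_int j / of_int T * of_int (t + h))) * cnj (ee (- (of_int j / of_int T * of_int t)))"
      by (simp add: cnj_ee ee_add[symmetric] distrib_left add_divide_distrib)
    then show "dd h f t * ee (- (of_int j / of_int T * of_int h)) = g (t + h) * cnj (g t)"
      by (simp only: dd_def g_def complex_cnj_mult mult_ac)
  qed
  then show ?thesis unfolding avg_autocorrelation[OF T p] by (simp only: ft_def g_def[abs_def])
qed

text \<open>The autocorrelation of f has Fourier coefficients |ft f|^2, so by Parseval the
  \<open>U^2\<close> expression is the sum of |ft f|^4, at most the largest |ft f|^2 times the mean
  of |f|^2.\<close>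

lemma U2_inverse:
  assumes T: "T > 0" and f: "per T f" "\<And>x. norm (f x) \<le> 1"
  shows "\<exists>j::int. gowers T 2 f \<le> (norm (avg {0..<T} (\<lambda>t. f t * ee (of_int j / of_int T * of_int t))))\<^sup>2"
proof -
  have ne: "{0..<T} \<noteq> {}" using T by auto
  define m where "m = Max ((\<lambda>j. (norm (ft T f j))\<^sup>2) ` {0..<T})"
  have m: "(norm (ft T f j))\<^sup>2 \<le> m" if "j \<in> {0..<T}" for j unfolding m_def using that by (intro Max_ge) auto
  have "m \<in> (\<lambda>j. (norm (ft T f j))\<^sup>2) ` {0..<T}" unfolding m_def using ne by (intro Max_in) auto
  then obtain j where j: "m = (norm (ft T f j))\<^sup>2" by auto
  have m0: "0 \<le> m" by (simp add: j)
  have "gowers T 2 f = avg {0..<T} (\<lambda>h. (norm (avg {0..<T} (dd h f)))\<^sup>2)"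
    using gowers_Suc_norm[OF T f(1), of 1]
    by (simp add: numeral_2_eq_2 avg_listset_Cons[of _ "[]"])
  also have "\<dots> = (\<Sum>j\<in>{0..<T}. (norm (ft T f j))\<^sup>2 * (norm (ft T f j))\<^sup>2)"
    by (simp only: parseval[OF T, symmetric] ft_autocorrelation[OF T f(1)] norm_of_real abs_power2 power2_eq_square[of "_\<^sup>2"])
  also have "\<dots> \<le> (\<Sum>j\<in>{0..<T}. m * (norm (ft T f j))\<^sup>2)"
    by (intro sum_mono mult_right_mono m) auto
  also have "\<dots> = m * avg {0..<T} (\<lambda>t. (norm (f t))\<^sup>2)" by (simp add: sum_distrib_left[symmetric] parseval[OF T])
  also have "\<dots> \<le> m * 1"
    using f(2) by (intro mult_left_mono avg_le m0) (auto intro: power_le_one)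
  finally have "gowers T 2 f \<le> (norm (ft T f j))\<^sup>2" by (simp add: j)
  then show ?thesis unfolding ft_def by (intro exI[of _ "- j"]) simp
qed

lemma avg_classes:
  assumes "q > 0" "T > (0::int)"
  shows "avg {0..<q} (\<lambda>r. avg {0..<T} (\<lambda>t. G (r + q * t))) = avg {0..<q * T} G"
proof -
  have b: "bij_betw (\<lambda>x. (x mod q, x div q)) {0..<q * T} ({0..<q} \<times> {0..<T})"
  proof (rule bij_betw_byWitness[where f' = "\<lambda>(r, t). r + q * t"])
    show "(\<lambda>x. (x mod q, x div q)) ` {0..<q * T} \<subseteq> {0..<q} \<times> {0..<T}"
    proof (rule image_subsetI)
      fix x assume x: "x \<in> {0..<q * T}"
      have "q * (x div q) \<le> x" using assms by (simp add: minus_mod_eq_mult_div[symmetric])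
      then have "q * (x div q) < q * T" using x by simp
      then have "x div q < T" using assms by (simp add: mult_less_cancel_left_pos)
      then show "(x mod q, x div q) \<in> {0..<q} \<times> {0..<T}" using x assms by (simp add: pos_imp_zdiv_nonneg_iff)
    qed
    show "(\<lambda>(r, t). r + q * t) ` ({0..<q} \<times> {0..<T}) \<subseteq> {0..<q * T}"
    proof (rule image_subsetI)
      fix p assume "p \<in> {0..<q} \<times> {0..<T}"
      then obtain r t where p: "p = (r, t)" and a: "0 \<le> r" "r < q" "0 \<le> t" "t < T" by auto
      then have "q * t \<le> q * (T - 1)" using assms by (intro mult_left_mono) auto
      moreover have "0 \<le> q * t" using a assms by simp
      ultimately show "(case p of (r, t) \<Rightarrow> r + q * t) \<in> {0..<q * T}" using a by (simp add: p right_diff_distrib)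
    qed
  qed (use assms in auto)
  have "avg {0..<q} (\<lambda>r. avg {0..<T} (\<lambda>t. G (r + q * t))) = avg ({0..<q} \<times> {0..<T}) (\<lambda>p. G (fst p + q * snd p))"
    by (simp add: avg_prod)
  also have "\<dots> = avg {0..<q * T} G" by (subst avg_reindex[OF b]) simp
  finally show ?thesis .
qed

text \<open>As \<Phi> is nonnegative, the set I can be enlarged to all residues at the cost of its
  density.\<close>

lemma avg_le_density:
  fixes \<Phi> :: "int \<Rightarrow> real"
  assumes T: "T > 0" and I: "inj_on (\<lambda>i. i mod T) I" and \<Phi>: "per T \<Phi>" "\<And>x. 0 \<le> \<Phi> x"
  shows "avg I \<Phi> \<le> real_of_int T / card I * avg {0..<T} \<Phi>"
proof -
  have "sum \<Phi> I = (\<Sum>i\<in>I. \<Phi> (i mod T))" by (simp add: per_mod[OF \<Phi>(1)])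
  also have "\<dots> = sum \<Phi> ((\<lambda>i. i mod T) ` I)" by (simp add: sum.reindex[OF I])
  also have "\<dots> \<le> sum \<Phi> {0..<T}" by (rule sum_mono2) (use T \<Phi> in auto)
  finally show ?thesis using T by (simp add: avg_def divide_right_mono)
qed

subsection \<open>Low-order phases and dual functions\<close>

lemma avg_listset_zip:
  fixes h :: "('a \<times> 'a) list \<Rightarrow> 'b::real_normed_field"
  assumes "\<And>I. I \<in> set Is \<Longrightarrow> finite I"
  shows "avg (listset (map (\<lambda>I. I \<times> I) Is)) h = avg (listset Is) (\<lambda>as. avg (listset Is) (\<lambda>bs. h (zip as bs)))"
  using assms
proof (induction Is arbitrary: h)
  case (Cons I Is)
  have fJ: "finite J" if "J \<in> set (I # Is)" for J using Cons.prems[OF that] .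
  have f1: "finite I" using fJ by simp
  have f2: "finite (listset Is)" by (rule finite_listset) (simp add: fJ)
  have f3: "finite (listset (map (\<lambda>I. I \<times> I) Is))" by (rule finite_listset) (auto simp: fJ)
  note f = f1 f2 f3
  have IH: "avg (listset (map (\<lambda>I. I \<times> I) Is)) h = avg (listset Is) (\<lambda>as. avg (listset Is) (\<lambda>bs. h (zip as bs)))"
    for h :: "('a \<times> 'a) list \<Rightarrow> 'b"
    by (rule Cons.IH) (simp add: fJ)
  have "avg (listset (map (\<lambda>I. I \<times> I) (I # Is))) h =
    avg (I \<times> I) (\<lambda>p. avg (listset (map (\<lambda>I. I \<times> I) Is)) (\<lambda>ps. h (p # ps)))"
    unfolding list.map by (rule avg_listset_Cons[OF _ f3]) (simp add: f1)
  also have "\<dots> = avg I (\<lambda>a. avg I (\<lambda>b. avg (listset Is) (\<lambda>as. avg (listset Is) (\<lambda>bs. h ((a, b) # zip as bs)))))"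
    unfolding IH by (rule avg_prod[OF f(1) f(1)])
  also have "\<dots> = avg I (\<lambda>a. avg (listset Is) (\<lambda>as. avg I (\<lambda>b. avg (listset Is) (\<lambda>bs. h ((a, b) # zip as bs)))))"
    by (rule avg_cong[OF refl], rule avg_swap)
  also have "\<dots> = avg (listset (I # Is)) (\<lambda>as. avg (listset (I # Is)) (\<lambda>bs. h (zip as bs)))"
    unfolding avg_listset_Cons[OF f(1,2)] zip_Cons_Cons by (rule refl)
  finally show ?case .
qed simp

lemma avg_exists_ge:
  fixes f :: "'a \<Rightarrow> real"
  assumes "finite A" "A \<noteq> {}"
  shows "\<exists>a\<in>A. avg A f \<le> f a"
proof (rule ccontr)
  assume "\<not> ?thesis"
  then have "\<And>a. a \<in> A \<Longrightarrow> f a < avg A f" by (meson not_le)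
  then have "sum f A < (\<Sum>a\<in>A. avg A f)" using assms by (intro sum_strict_mono) auto
  then show False using assms by (simp add: avg_def)
qed

lemma card_box: "T > 0 \<Longrightarrow> card (listset (replicate k {0..<T::int})) = nat T ^ k"
proof (induction k)
  case (Suc k)
  have "listset (replicate (Suc k) {0..<T}) = (\<lambda>(i, is). i # is) ` ({0..<T} \<times> listset (replicate k {0..<T}))"
    by (auto simp: set_Cons_def listset.simps)
  then have "card (listset (replicate (Suc k) {0..<T})) = card ({0..<T} \<times> listset (replicate k {0..<T}))"
    by (simp only:) (intro card_image, auto simp: inj_on_def)
  then show ?case using Suc by (simp add: card_cartesian_product)
qed (simp add: listset.simps)

lemma box_ne: "T > 0 \<Longrightarrow> listset (replicate k {0..<T::int}) \<noteq> {}"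
proof
  assume "T > 0" "listset (replicate k {0..<T}) = {}"
  with card_box[of T k] show False by simp
qed

text \<open>The phase \<open>\<psi>\<close> is a low-order phase plus the major arc phase \<open>Cs \<psi>\<close>. On progressions of step \<open>b\<close>
  the latter is constant, and the former is removed by Cauchy-Schwarz.\<close>
lemma remove_phase:
  fixes T M b :: int and D D2 :: real and \<psi> :: "int list \<Rightarrow> real"
  assumes T: "M > 0" "M\<^sup>2 \<le> T" "T \<le> 16 * M\<^sup>2" and f: "per T f" "\<And>x. norm (f x) \<le> 1"
    and D: "D \<ge> 2" "D2 \<ge> 1" and M: "128 * D * D2 \<le> (real_of_int M)\<^sup>2"
    and b: "1 \<le> b" "b \<le> D2" and k: "k \<ge> 1" "length bs = k"
    and \<psi>: "\<And>as. \<exists>j::int. \<psi> as = of_int j / of_int T"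
    and A: "\<And>as. as \<in> A \<Longrightarrow> 1 / (2 * D) \<le> (norm (avg {0..<T} (\<lambda>t. dl as f t * ee (\<psi> as * of_int t))))\<^sup>2"
      "\<And>as. as \<in> A \<Longrightarrow> near_int (of_int b * Cs \<psi> (zip as bs)) (D2 / (real_of_int M)\<^sup>2)"
  shows "(avg (listset (replicate k {0..<T})) (\<lambda>as. of_bool (as \<in> A)) / (4 * D)) ^ (2 ^ Suc k) \<le> 2048 * D * D2 * gowers T (Suc k) f"
proof -
  let ?Is = "replicate k {0..<T}"
  have M0: "0 < (real_of_int M)\<^sup>2" using T by simp
  have T0: "T > 0" using T by (smt (verit) zero_less_power)
  have DD: "D * D2 > 0" using D by simp
  \<comment> \<open>For j up to J the phase j b Cs is within 1 / (64 D) of an integer, so dropping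
    it changes the average by at most 1 / (8 D).\<close>
  define J where "J = \<lfloor>(real_of_int M)\<^sup>2 / (64 * D * D2)\<rfloor>"
  have JM: "J \<le> (real_of_int M)\<^sup>2 / (64 * D * D2)" unfolding J_def by linarith
  have "2 \<le> (real_of_int M)\<^sup>2 / (64 * D * D2)" using M DD by (simp add: field_simps)
  then have J1: "(real_of_int M)\<^sup>2 / (128 * D * D2) \<le> J" "1 \<le> J"
  proof -
    assume a: "2 \<le> (real_of_int M)\<^sup>2 / (64 * D * D2)"
    have "(real_of_int M)\<^sup>2 / (128 * D * D2) = (real_of_int M)\<^sup>2 / (64 * D * D2) / 2" by simp
    moreover have "x / 2 \<le> real_of_int \<lfloor>x\<rfloor>" if "2 \<le> x" for x :: real using that by linarith
    ultimately show "(real_of_int M)\<^sup>2 / (128 * D * D2) \<le> J" using a unfolding J_def by presburger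
    show "1 \<le> J" unfolding J_def using a by linarith
  qed
  have Jne: "finite {1..J}" "{1..J} \<noteq> {}" using J1 by auto
  have Tne: "finite {0..<T}" "{0..<T} \<noteq> {}" using T0 by auto
  define L where "L as = \<psi> as - Cs \<psi> (zip as bs)" for as
  define X where "X t as = avg {1..J} (\<lambda>j. dl as f (t + b * j) * ee (L as * of_int (b * j)))" for t as
  define Y where "Y t as = avg {1..J} (\<lambda>j. dl as f (t + b * j) * ee (\<psi> as * of_int (t + b * j)))" for t as
  have nX: "norm (X t as) \<le> 1" and nY: "norm (Y t as) \<le> 1" for t as
    unfolding X_def Y_def by (rule norm_avg_le_bound; simp add: norm_mult norm_dl[OF f(2)])+
  have avgY: "avg {0..<T} (\<lambda>t. Y t as) = avg {0..<T} (\<lambda>t. dl as f t * ee (\<psi> as * of_int t))" for as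
  proof -
    obtain j :: int where j: "\<psi> as = of_int j / of_int T" using \<psi> by blast
    have "ee (\<psi> as * of_int (t + T)) = ee (\<psi> as * of_int t)" for t
    proof -
      have "\<psi> as * of_int (t + T) = \<psi> as * of_int t + of_int j" using T0 j by (simp add: field_simps)
      then show ?thesis by (metis ee_add_int)
    qed
    then have p: "per T (\<lambda>t. dl as f t * ee (\<psi> as * of_int t))" using per_dl[OF f(1), of as] by (simp add: per_def)
    have "avg {0..<T} (\<lambda>t. Y t as) = avg {1..J} (\<lambda>j. avg {0..<T} (\<lambda>t. (\<lambda>t. dl as f t * ee (\<psi> as * of_int t)) (t + b * j)))"
      unfolding Y_def by (rule avg_swap)
    also have "\<dots> = avg {1..J} (\<lambda>j. avg {0..<T} (\<lambda>t. dl as f t * ee (\<psi> as * of_int t)))"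
      by (intro avg_cong refl avg_per_shift[OF T0 p])
    finally show ?thesis by (simp add: avg_const[OF Jne])
  qed
  have XY: "norm (Y t as) \<le> norm (X t as) + 1 / (8 * D)" if "as \<in> A" for t as
  proof -
    have "Y t as = ee (\<psi> as * of_int t) * avg {1..J} (\<lambda>j. dl as f (t + b * j) * ee (L as * of_int (b * j)) * ee (of_int j * (of_int b * Cs \<psi> (zip as bs))))"
      unfolding Y_def avg_cmult[symmetric]
    proof (rule avg_cong[OF refl])
      fix j
      have "\<psi> as * of_int (t + b * j) = \<psi> as * of_int t + (L as * of_int (b * j) + of_int j * (of_int b * Cs \<psi> (zip as bs)))"
        by (simp add: L_def algebra_simps)
      then show "dl as f (t + b * j) * ee (\<psi> as * of_int (t + b * j)) =
         ee (\<psi> as * of_int t) * (dl as f (t + b * j) * ee (L as * of_int (b * j)) * ee (of_int j * (of_int b * Cs \<psi> (zip as bs))))"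
        by (simp add: ee_add mult_ac)
    qed
    then have "norm (Y t as) = norm (avg {1..J} (\<lambda>j. dl as f (t + b * j) * ee (L as * of_int (b * j)) * ee (of_int j * (of_int b * Cs \<psi> (zip as bs)))))"
      by (simp add: norm_mult)
    moreover have "norm (avg {1..J} (\<lambda>j. dl as f (t + b * j) * ee (L as * of_int (b * j)) * ee (of_int j * (of_int b * Cs \<psi> (zip as bs)))) - X t as) \<le> 1 / (8 * D)"
      unfolding X_def avg_diff[symmetric]
    proof (rule norm_avg_le_bound)
      fix j assume j: "j \<in> {1..J}"
      let ?u = "dl as f (t + b * j) * ee (L as * of_int (b * j))"
      have "norm (?u * ee (of_int j * (of_int b * Cs \<psi> (zip as bs))) - ?u) = norm ?u * norm (ee (of_int j * (of_int b * Cs \<psi> (zip as bs))) - 1)"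
        by (simp add: norm_mult[symmetric] algebra_simps)
      also have "\<dots> \<le> 1 * norm (ee (of_int j * (of_int b * Cs \<psi> (zip as bs))) - 1)"
        by (intro mult_right_mono) (auto simp: norm_mult norm_dl[OF f(2)])
      also have "\<dots> \<le> 1 * (8 * (\<bar>of_int j\<bar> * (D2 / (real_of_int M)\<^sup>2)))"
        by (intro mult_left_mono ee_near_int near_int_mult A(2) that) auto
      also have "\<dots> \<le> 1 * (8 * (((real_of_int M)\<^sup>2 / (64 * D * D2)) * (D2 / (real_of_int M)\<^sup>2)))"
        using j JM D by (intro mult_left_mono mult_right_mono) auto
      also have "\<dots> = 1 / (8 * D)" using M0 D by (simp add: field_simps)
      finally show "norm (?u * ee (of_int j * (of_int b * Cs \<psi> (zip as bs))) - ?u) \<le> 1 / (8 * D)" .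
    qed (use D in auto)
    ultimately show ?thesis by (smt (verit) norm_triangle_sub)
  qed
  have X2: "1 / (4 * D) \<le> avg {0..<T} (\<lambda>t. (norm (X t as))\<^sup>2)" if "as \<in> A" for as
  proof -
    have "1 / (2 * D) \<le> (norm (avg {0..<T} (\<lambda>t. Y t as)))\<^sup>2" using A(1)[OF that] by (simp add: avgY)
    also have "\<dots> \<le> avg {0..<T} (\<lambda>t. (norm (Y t as))\<^sup>2)" by (rule avg_sq)
    also have "\<dots> \<le> avg {0..<T} (\<lambda>t. (norm (X t as))\<^sup>2 + 1 / (4 * D))"
    proof (rule avg_mono)
      fix t
      have "(norm (Y t as))\<^sup>2 - (norm (X t as))\<^sup>2 = (norm (Y t as) - norm (X t as)) * (norm (Y t as) + norm (X t as))"
        by (simp add: power2_eq_square algebra_simps)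
      also have "\<dots> \<le> 1 / (8 * D) * (norm (Y t as) + norm (X t as))"
        using XY[OF that, of t] by (intro mult_right_mono) auto
      also have "\<dots> \<le> 1 / (8 * D) * 2" using nX[of t as] nY[of t as] D by (intro mult_left_mono) auto
      finally show "(norm (Y t as))\<^sup>2 \<le> (norm (X t as))\<^sup>2 + 1 / (4 * D)" by simp
    qed
    also have "\<dots> = avg {0..<T} (\<lambda>t. (norm (X t as))\<^sup>2) + 1 / (4 * D)" by (simp add: avg_add avg_const[OF Tne])
    finally show ?thesis by simp
  qed
  define I where "I = (\<lambda>j. b * j) ` {1..J}"
  have bj: "bij_betw (\<lambda>j. b * j) {1..J} I" unfolding I_def using b by (auto simp: bij_betw_def inj_on_def)
  have fI: "finite I" "I \<noteq> {}" "card I = nat J" using Jne bij_betw_same_card[OF bj] by (auto simp: I_def)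
  have XI: "X t as = avg I (\<lambda>i. dl as f (t + i) * ee (L as * of_int i))" for t as
    unfolding X_def avg_reindex[OF bj] ..
  \<comment> \<open>Multiplication by the conjugate of X turns the square |X|^2 into an average over
    the step variable i. As c does not involve i, it counts as a low factor and Cauchy-Schwarz
    removes it together with the phases L.\<close>
  define c where "c t as = of_bool (as \<in> A) * cnj (X t as)" for t as
  define bb where "bb t is = c t (tl is) * (bl f (tl is) (t + hd is) * ee (L (tl is) * of_int (hd is)))" for t "is"
  define g where "g t is = f (t + sum_list is)" for t "is"
  have low: "low (length (I # ?Is)) (bb t)" for t
  proof -
    have "low k (\<lambda>as. bl f as (t + i) * ee (L as * of_int i))" for i
      unfolding L_def by (intro low_mult low_bl f(2) low_Cs k(2))
    moreover have "norm (c t as) \<le> 1" for as using nX[of t as] by (simp add: c_def norm_mult)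
    ultimately show ?thesis by (auto simp: bb_def intro!: exI[of _ "c t"] exI[of _ "\<lambda>i as. bl f as (t + i) * ee (L as * of_int i)"])
  qed
  have fIs: "finite S" if "S \<in> set (I # ?Is)" for S using that fI by (auto split: if_splits)
  let ?W = "avg (listset ?Is) (\<lambda>as. of_bool (as \<in> A) * avg {0..<T} (\<lambda>t. (norm (X t as))\<^sup>2)) :: real"
  have "avg {0..<T} (\<lambda>t. avg (listset (I # ?Is)) (\<lambda>is. bb t is * g t is)) =
     avg {0..<T} (\<lambda>t. avg I (\<lambda>i. avg (listset ?Is) (\<lambda>as. c t as * (dl as f (t + i) * ee (L as * of_int i)))))"
    unfolding avg_listset_Cons[OF fI(1) finite_box] bb_def g_def dl_bl[of _ f] by (simp add: mult_ac add.assoc)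
  also have "\<dots> = avg {0..<T} (\<lambda>t. avg (listset ?Is) (\<lambda>as. c t as * X t as))"
    unfolding XI by (subst (2) avg_swap) (simp add: avg_cmult)
  also have "\<dots> = avg (listset ?Is) (\<lambda>as. avg {0..<T} (\<lambda>t. of_real (of_bool (as \<in> A) * (norm (X t as))\<^sup>2)))"
    unfolding c_def
    by (subst avg_swap) (intro avg_cong refl, simp add: complex_norm_square mult.commute del: of_real_power)
  also have "\<dots> = of_real ?W" by (simp only: avg_of_real avg_cmult)
  finally have WW: "avg {0..<T} (\<lambda>t. avg (listset (I # ?Is)) (\<lambda>is. bb t is * g t is)) = of_real ?W" .
  have "avg (listset ?Is) (\<lambda>as. of_bool (as \<in> A)) / (4 * D) = avg (listset ?Is) (\<lambda>as. of_bool (as \<in> A) * (1 / (4 * D)))"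
    unfolding avg_multc by simp
  also have "\<dots> \<le> ?W" by (rule avg_mono) (use X2 in auto)
  finally have "(avg (listset ?Is) (\<lambda>as. of_bool (as \<in> A)) / (4 * D)) ^ (2 ^ Suc k) \<le> ?W ^ (2 ^ Suc k)"
    using D by (intro power_mono) (auto intro!: avg_nonneg divide_nonneg_nonneg)
  also have "?W \<le> norm (avg {0..<T} (\<lambda>t. avg (listset (I # ?Is)) (\<lambda>is. bb t is * g t is)))" unfolding WW by simp
  then have "?W ^ (2 ^ Suc k) \<le> norm (avg {0..<T} (\<lambda>t. avg (listset (I # ?Is)) (\<lambda>is. bb t is * g t is))) ^ (2 ^ length (I # ?Is))"
    by (simp only: length_Cons length_replicate) (intro power_mono, auto intro!: avg_nonneg mult_nonneg_nonneg)
  also have "\<dots> \<le> Re (avg (listset (map (\<lambda>I. I \<times> I) (I # ?Is))) (\<lambda>ps. avg {0..<T} (\<lambda>t. Cb (g t) ps)))"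
    by (rule gowers_CS_pos[OF Tne(1) fIs low]) auto
  also have "avg (listset (map (\<lambda>I. I \<times> I) (I # ?Is))) (\<lambda>ps. avg {0..<T} (\<lambda>t. Cb (g t) ps)) =
     avg (I \<times> I) (\<lambda>p. avg (listset (map (\<lambda>I. I \<times> I) ?Is)) (\<lambda>ps. avg {0..<T} (\<lambda>t.
       dl (map (\<lambda>p. fst p - snd p) ps) (\<lambda>x. dd (fst p - snd p) f (x + snd p)) (t + sum_list (map snd ps)))))"
  proof -
    have "finite (listset (map (\<lambda>I. I \<times> I) ?Is))" by (rule finite_listset) (auto split: if_splits)
    then show ?thesis unfolding list.map(2) g_def Cb_dl
      by (subst avg_listset_Cons) (use fI in \<open>auto simp: dl_shift add.assoc add.commute add.left_commute intro!: avg_cong\<close>)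
  qed
  also have "\<dots> = avg (I \<times> I) (\<lambda>p. avg (listset ?Is) (\<lambda>hs. avg {0..<T} (dl hs (dd (fst p - snd p) f))))"
  proof (rule avg_cong[OF refl])
    fix p
    have p: "per T (\<lambda>x. dd (fst p - snd p) f (x + snd p))" by (intro per_shift per_dd f)
    show "avg (listset (map (\<lambda>I. I \<times> I) ?Is)) (\<lambda>ps. avg {0..<T} (\<lambda>t.
       dl (map (\<lambda>p. fst p - snd p) ps) (\<lambda>x. dd (fst p - snd p) f (x + snd p)) (t + sum_list (map snd ps)))) =
      avg (listset ?Is) (\<lambda>hs. avg {0..<T} (dl hs (dd (fst p - snd p) f)))"
      unfolding avg_pairs_box[OF T0 p] unfolding dl_shift[abs_def]
      by (intro avg_cong refl avg_per_shift[OF T0] per_dl per_dd f)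
  qed
  also have "Re \<dots> = avg (I \<times> I) (\<lambda>p. gowers T k (dd (fst p - snd p) f))" by (simp add: gowers_def Re_avg)
  also have "\<dots> = avg I (\<lambda>i'. avg I (\<lambda>i. gowers T k (dd (i - i') f)))"
    by (subst avg_prod[OF fI(1) fI(1)]) (auto intro: avg_swap)
  also have "\<dots> \<le> T / J * gowers T (Suc k) f"
  proof (rule avg_le)
    fix i' assume "i' \<in> I"
    define \<Phi> where "\<Phi> d = gowers T k (dd d f)" for d
    have \<Phi>p: "per T \<Phi>" by (simp add: per_def \<Phi>_def dd_per[OF f(1)])
    obtain k' where k': "k = Suc k'" using k by (cases k) auto
    have \<Phi>0: "0 \<le> \<Phi> d" for d unfolding \<Phi>_def k' by (intro gowers_nonneg T0 per_dd f)
    have bb2: "bij_betw (\<lambda>i. i - i') I ((\<lambda>i. i - i') ` I)" by (auto simp: bij_betw_def inj_on_def)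
    have inj: "inj_on (\<lambda>i. i mod T) ((\<lambda>i. i - i') ` I)"
    proof (rule inj_onI)
      fix x y assume x: "x \<in> (\<lambda>i. i - i') ` I" and y: "y \<in> (\<lambda>i. i - i') ` I" and e: "x mod T = y mod T"
      from x y obtain j1 j2 where j: "x = b * j1 - i'" "y = b * j2 - i'" "j1 \<in> {1..J}" "j2 \<in> {1..J}"
        unfolding I_def by blast
      have "real_of_int (b * J) = real_of_int b * J" by simp
      also have "\<dots> \<le> D2 * ((real_of_int M)\<^sup>2 / (64 * D * D2))"
        using b JM J1 D by (intro mult_mono) auto
      also have "\<dots> = (real_of_int M)\<^sup>2 / (64 * D)" using D by simp
      also have "\<dots> < (real_of_int M)\<^sup>2" using M0 D by (simp add: field_simps)
      finally have "b * J < M\<^sup>2" by (metis of_int_less_iff of_int_power)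
      then have bJ: "b * J < T" using T by linarith
      have "T dvd b * (j1 - j2)" using e by (simp add: j mod_eq_dvd_iff algebra_simps)
      then have "T dvd \<bar>b * (j1 - j2)\<bar>" by simp
      moreover have "\<bar>b * (j1 - j2)\<bar> < T"
      proof -
        have "\<bar>b * (j1 - j2)\<bar> = b * \<bar>j1 - j2\<bar>" using b by (simp add: abs_mult)
        also have "\<dots> \<le> b * J" using j b by (intro mult_left_mono) auto
        finally show ?thesis using bJ by simp
      qed
      moreover have "\<not> T dvd \<bar>b * (j1 - j2)\<bar>" if "b * (j1 - j2) \<noteq> 0" "\<bar>b * (j1 - j2)\<bar> < T"
        by (rule zdvd_not_zless) (use that in auto)
      ultimately have "b * (j1 - j2) = 0" by blast
      then show "x = y" using b by (simp add: j)
    qed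
    have "avg I (\<lambda>i. gowers T k (dd (i - i') f)) = avg ((\<lambda>i. i - i') ` I) \<Phi>"
      unfolding avg_reindex[OF bb2] \<Phi>_def ..
    also have "\<dots> \<le> T / card ((\<lambda>i. i - i') ` I) * avg {0..<T} \<Phi>"
      by (rule avg_le_density[OF T0 inj \<Phi>p \<Phi>0])
    also have "card ((\<lambda>i. i - i') ` I) = nat J" using bij_betw_same_card[OF bb2] fI(3) by simp
    also have "T / nat J * avg {0..<T} \<Phi> = T / J * gowers T (Suc k) f"
      using J1 by (simp add: gowers_Suc \<Phi>_def[abs_def])
    finally show "avg I (\<lambda>i. gowers T k (dd (i - i') f)) \<le> T / J * gowers T (Suc k) f" .
  qed (use gowers_nonneg[OF T0 f(1)] T0 J1 in auto)
  also have "\<dots> \<le> 2048 * D * D2 * gowers T (Suc k) f"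
  proof (rule mult_right_mono)
    have "T / J \<le> 16 * (real_of_int M)\<^sup>2 / ((real_of_int M)\<^sup>2 / (128 * D * D2))"
    proof (rule frac_le)
      have "real_of_int T \<le> real_of_int (16 * M\<^sup>2)" using T(3) by (simp only: of_int_le_iff)
      then show "real_of_int T \<le> 16 * (real_of_int M)\<^sup>2" by simp
    qed (use M0 DD J1 in auto)
    also have "\<dots> = 2048 * D * D2" using M0 DD by (simp add: field_simps)
    finally show "T / J \<le> 2048 * D * D2" .
  qed (rule gowers_nonneg[OF T0 f(1)])
  finally show ?thesis .
qed

text \<open>Its correlation with g is the counting form with third function g, after x has been
  replaced by x - q y^2.\<close>

definition dualf :: "int \<Rightarrow> int \<Rightarrow> (int \<Rightarrow> complex) \<Rightarrow> (int \<Rightarrow> complex) \<Rightarrow> int \<Rightarrow> complex" where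
  "dualf q M f0 f1 x = avg {1..M} (\<lambda>y. f0 (x - q * y\<^sup>2) * f1 (x - q * y\<^sup>2 + y))"

text \<open>\<open>F r\<close> is the restriction of the dual function to the residue class of \<open>r\<close> modulo \<open>q\<close>. Since \<open>T\<close> is
  comparable to \<open>M\<^sup>2\<close>, the points \<open>q y\<^sup>2\<close> with \<open>y \<le> M\<close> spread over a positive proportion of \<open>\<int>/qT\<int>\<close>.\<close>
locale config =
  fixes q T M :: int and f0 f1 :: "int \<Rightarrow> complex"
  assumes q: "q > 0" and M: "M > 0" and TM: "M\<^sup>2 \<le> T" "T \<le> 16 * M\<^sup>2"
    and per0: "per (q * T) f0" and per1: "per (q * T) f1"
    and bd0: "\<And>x. norm (f0 x) \<le> 1" and bd1: "\<And>x. norm (f1 x) \<le> 1"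
begin

definition F :: "int \<Rightarrow> int \<Rightarrow> complex" where "F r t = dualf q M f0 f1 (r + q * t)"

lemma T0: "T > 0" using M TM by (smt (verit) zero_less_power)

lemma M_ne: "finite {1..M}" "{1..M} \<noteq> {}" using M by auto

lemma norm_dualf: "norm (dualf q M f0 f1 x) \<le> 1"
  unfolding dualf_def by (rule norm_avg_le_bound) (simp_all add: norm_mult mult_le_one bd0 bd1)

lemma norm_F: "norm (F r t) \<le> 1" by (simp add: F_def norm_dualf)

lemma per_F: "per T (F r)"
proof -
  have "f0 (x + q * T - w) = f0 (x - w)" "f1 (x + q * T - w + y) = f1 (x - w + y)" for x w y
    using per_mult[OF per0, of "x - w" 1] per_mult[OF per1, of "x - w + y" 1] by (simp_all add: algebra_simps)
  then have "dualf q M f0 f1 (x + q * T) = dualf q M f0 f1 x" for x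
    unfolding dualf_def by simp
  then have "dualf q M f0 f1 (r + q * (t + T)) = dualf q M f0 f1 (r + q * t)" for t
    by (simp add: distrib_left add.assoc[symmetric])
  then show ?thesis unfolding per_def F_def by simp
qed

end

context config
begin

text \<open>Dual--difference interchange: inserting the definition of the dual function into its own
  correlation and applying Cauchy-Schwarz leaves a configuration average with a purely quadratic phase,
  to which Weyl's inequality applies.\<close>
lemma interchange:
  fixes D :: real and \<psi> :: "int \<Rightarrow> int list \<Rightarrow> real"
  assumes D: "D \<ge> 2" and \<psi>: "\<And>r as. \<exists>j::int. \<psi> r as = of_int j / of_int T"
    and c1: "\<And>r as. norm (c r as) \<le> 1"
    and big: "1 / D \<le> norm (avg {0..<q} (\<lambda>r. avg (listset (replicate k {0..<T})) (\<lambda>as. c r as * avg {0..<T} (\<lambda>t. dl as (F r) t * ee (\<psi> r as * of_int t)))))"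
    and D1: "D1 = 2 * D ^ (2 ^ k)" and M1: "D1 ^ 7000 \<le> M"
  shows "1 / D1 ^ 7001 \<le> avg {0..<q} (\<lambda>r. avg (listset (map (\<lambda>I. I \<times> I) (replicate k {0..<T})))
     (\<lambda>ps. of_bool (c r (map fst ps) \<noteq> 0 \<and> major (D1 ^ 7000) M (Cs (\<psi> r) ps))))"
proof -
  let ?Is = "replicate k {0..<T}"
  let ?Ps = "listset (map (\<lambda>I. I \<times> I) ?Is)"
  define Z where "Z = {0..<q} \<times> {0..<T} \<times> {1..M}"
  define s where "s as = sum_list as" for as :: "int list"
  have D1D: "D1 \<ge> 2"
  proof -
    have "1 \<le> D ^ (2 ^ k)" using D by (intro one_le_power) auto
    then show ?thesis by (simp add: D1)
  qed
  have eeper: "ee (\<psi> r as * of_int (t + T)) = ee (\<psi> r as * of_int t)" for r as t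
  proof -
    obtain j :: int where j: "\<psi> r as = of_int j / of_int T" using \<psi> by blast
    have "\<psi> r as * of_int (t + T) = \<psi> r as * of_int t + of_int j" using T0 j by (simp add: field_simps)
    then show ?thesis by (metis ee_add_int)
  qed
  \<comment> \<open>Only the top vertex of the derivative is unfolded by the definition of the dual
    function. Shifting t by y^2 then clears f0 and f1 of the square, which survives in the phase and
    in the low factor \<open>bl\<close>.\<close>
  define g where "g z as = (case z of (r, t, y) \<Rightarrow> c r as * ee (\<psi> r as * of_int (t + y\<^sup>2)) * f0 (r + q * (t + s as)) * f1 (r + q * (t + s as) + y))"
    for z :: "int \<times> int \<times> int" and as
  define b where "b z as = (case z of (r, t, y) \<Rightarrow> bl (F r) as (t + y\<^sup>2))" for z :: "int \<times> int \<times> int" and as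
  have inner: "c r as * avg {0..<T} (\<lambda>t. dl as (F r) t * ee (\<psi> r as * of_int t)) =
     avg {0..<T} (\<lambda>t. avg {1..M} (\<lambda>y. b (r, t, y) as * g (r, t, y) as))" for r as
  proof -
    have p: "per T (\<lambda>t. c r as * ee (\<psi> r as * of_int t) * bl (F r) as t * (f0 (r + q * (t + s as) - q * y\<^sup>2) * f1 (r + q * (t + s as) - q * y\<^sup>2 + y)))" for y
    proof -
      have "f0 (r + q * (t + T + s as) - q * y\<^sup>2) = f0 (r + q * (t + s as) - q * y\<^sup>2)"
           "f1 (r + q * (t + T + s as) - q * y\<^sup>2 + y) = f1 (r + q * (t + s as) - q * y\<^sup>2 + y)" for t
      proof -
        have "f0 ((r + q * (t + s as) - q * y\<^sup>2) + q * T) = f0 (r + q * (t + s as) - q * y\<^sup>2)" using per0 by (simp add: per_def)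
        then show "f0 (r + q * (t + T + s as) - q * y\<^sup>2) = f0 (r + q * (t + s as) - q * y\<^sup>2)" by (simp add: algebra_simps)
        have "f1 ((r + q * (t + s as) - q * y\<^sup>2 + y) + q * T) = f1 (r + q * (t + s as) - q * y\<^sup>2 + y)" using per1 unfolding per_def by blast
        then show "f1 (r + q * (t + T + s as) - q * y\<^sup>2 + y) = f1 (r + q * (t + s as) - q * y\<^sup>2 + y)" by (simp add: algebra_simps)
      qed
      then show ?thesis unfolding per_def using eeper per_bl[OF per_F] by simp
    qed
    have "c r as * avg {0..<T} (\<lambda>t. dl as (F r) t * ee (\<psi> r as * of_int t)) =
      avg {0..<T} (\<lambda>t. avg {1..M} (\<lambda>y. c r as * ee (\<psi> r as * of_int t) * bl (F r) as t * (f0 (r + q * (t + s as) - q * y\<^sup>2) * f1 (r + q * (t + s as) - q * y\<^sup>2 + y))))"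
      unfolding avg_cmult[of _ "c r as", symmetric]
    proof (rule avg_cong[OF refl])
      fix t
      show "c r as * (dl as (F r) t * ee (\<psi> r as * of_int t)) = avg {1..M} (\<lambda>y. c r as * ee (\<psi> r as * of_int t) * bl (F r) as t * (f0 (r + q * (t + s as) - q * y\<^sup>2) * f1 (r + q * (t + s as) - q * y\<^sup>2 + y)))"
        unfolding avg_cmult dl_bl[of as "F r"] s_def by (simp add: F_def dualf_def mult_ac)
    qed
    also have "\<dots> = avg {1..M} (\<lambda>y. avg {0..<T} (\<lambda>t. c r as * ee (\<psi> r as * of_int t) * bl (F r) as t * (f0 (r + q * (t + s as) - q * y\<^sup>2) * f1 (r + q * (t + s as) - q * y\<^sup>2 + y))))"
      by (rule avg_swap)
    also have "\<dots> = avg {1..M} (\<lambda>y. avg {0..<T} (\<lambda>t. b (r, t, y) as * g (r, t, y) as))"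
    proof (rule avg_cong[OF refl])
      fix y
      have "avg {0..<T} (\<lambda>t. c r as * ee (\<psi> r as * of_int t) * bl (F r) as t * (f0 (r + q * (t + s as) - q * y\<^sup>2) * f1 (r + q * (t + s as) - q * y\<^sup>2 + y))) =
        avg {0..<T} (\<lambda>t. (\<lambda>t. c r as * ee (\<psi> r as * of_int t) * bl (F r) as t * (f0 (r + q * (t + s as) - q * y\<^sup>2) * f1 (r + q * (t + s as) - q * y\<^sup>2 + y))) (t + y\<^sup>2))"
        by (rule avg_per_shift[OF T0 p, symmetric])
      also have "\<dots> = avg {0..<T} (\<lambda>t. b (r, t, y) as * g (r, t, y) as)"
        by (simp add: b_def g_def algebra_simps)
      finally show "avg {0..<T} (\<lambda>t. c r as * ee (\<psi> r as * of_int t) * bl (F r) as t * (f0 (r + q * (t + s as) - q * y\<^sup>2) * f1 (r + q * (t + s as) - q * y\<^sup>2 + y))) =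
        avg {0..<T} (\<lambda>t. b (r, t, y) as * g (r, t, y) as)" .
    qed
    also have "\<dots> = avg {0..<T} (\<lambda>t. avg {1..M} (\<lambda>y. b (r, t, y) as * g (r, t, y) as))" by (rule avg_swap)
    finally show ?thesis .
  qed
  have Zavg: "avg Z h = avg {0..<q} (\<lambda>r. avg {0..<T} (\<lambda>t. avg {1..M} (\<lambda>y. h (r, t, y))))" for h :: "int \<times> int \<times> int \<Rightarrow> complex"
    unfolding Z_def by (simp add: avg_prod)
  have "avg {0..<q} (\<lambda>r. avg (listset ?Is) (\<lambda>as. c r as * avg {0..<T} (\<lambda>t. dl as (F r) t * ee (\<psi> r as * of_int t)))) =
     avg (listset ?Is) (\<lambda>as. avg Z (\<lambda>z. b z as * g z as))"
    unfolding Zavg inner by (rule avg_swap)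
  also have "\<dots> = avg Z (\<lambda>z. avg (listset ?Is) (\<lambda>as. b z as * g z as))" by (rule avg_swap)
  finally have "1 / D \<le> norm (avg Z (\<lambda>z. avg (listset ?Is) (\<lambda>as. b z as * g z as)))" using big by simp
  then have "(1 / D) ^ (2 ^ k) \<le> norm (avg Z (\<lambda>z. avg (listset ?Is) (\<lambda>as. b z as * g z as))) ^ (2 ^ length ?Is)"
    using D by (simp only: length_replicate) (intro power_mono, auto)
  also have "\<dots> \<le> avg ?Ps (\<lambda>ps. norm (avg Z (\<lambda>z. Cb (g z) ps)))"
  proof (rule gowers_CS)
    show "low (length ?Is) (b z)" for z unfolding b_def by (cases z) (auto intro!: low_bl norm_F)
  qed (auto simp: Z_def split: if_splits)
  finally have P: "2 / D1 \<le> avg ?Ps (\<lambda>ps. norm (avg Z (\<lambda>z. Cb (g z) ps)))" using D by (simp add: D1 power_one_over field_simps)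
  define ind :: "int \<Rightarrow> (int \<times> int) list \<Rightarrow> real" where
    "ind r ps = of_bool (c r (map fst ps) \<noteq> 0 \<and> major (D1 ^ 7000) M (Cs (\<psi> r) ps))" for r ps
  \<comment> \<open>A cube contributes at most half of the lower bound 2 / D1, or else Weyl's
    inequality makes at least the proportion D1^-7000 of the classes major.\<close>
  have ps: "norm (avg Z (\<lambda>z. Cb (g z) ps)) \<le> 1 / D1 + D1 ^ 7000 * avg {0..<q} (\<lambda>r. ind r ps)" for ps
  proof (cases "1 / D1 \<le> norm (avg Z (\<lambda>z. Cb (g z) ps))")
    case False
    moreover have "0 \<le> D1 ^ 7000 * avg {0..<q} (\<lambda>r. ind r ps)" using D1D by (intro mult_nonneg_nonneg avg_nonneg) (auto simp: ind_def)
    ultimately show ?thesis by linarith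
  next
    case True
    \<comment> \<open>In the variable x = r + q t the part of the phase linear in t belongs to A,
      and f1 gives a function of x + y. What is left is the quadratic phase with coefficient
      \<open>Cs (\<psi> r) ps\<close>, which depends on the class only.\<close>
    define A where "A x = Cb (\<lambda>as. c (x mod q) as * ee (\<psi> (x mod q) as * of_int (x div q)) * f0 (x + q * s as)) ps" for x
    define B where "B w = Cb (\<lambda>as. f1 (w + q * s as)) ps" for w
    have "avg Z (\<lambda>z. Cb (g z) ps) = avg {0..<q} (\<lambda>r. avg {0..<T} (\<lambda>t. (\<lambda>x. avg {1..M} (\<lambda>y. A x * B (x + y) * ee (Cs (\<psi> (x mod q)) ps * (of_int y)\<^sup>2))) (r + q * t)))"
      unfolding Zavg
    proof (intro avg_cong[OF refl])
      fix r t y assume r: "r \<in> {0..<q}"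
      have e: "(r + q * t) mod q = r" "(r + q * t) div q = t" using r q by auto
      have "Cb (g (r, t, y)) ps = Cb (\<lambda>as. (c r as * ee (\<psi> r as * of_int t) * f0 (r + q * t + q * s as)) * f1 (r + q * t + y + q * s as) * ee (\<psi> r as * (of_int y)\<^sup>2)) ps"
        by (rule Cb_cong) (simp add: g_def ee_add algebra_simps)
      also have "\<dots> = A (r + q * t) * B (r + q * t + y) * ee (Cs (\<psi> ((r + q * t) mod q)) ps * (of_int y)\<^sup>2)"
        unfolding Cb_mult Cb_ee Cs_mult A_def B_def e by simp
      finally show "Cb (g (r, t, y)) ps = A (r + q * t) * B (r + q * t + y) * ee (Cs (\<psi> ((r + q * t) mod q)) ps * (of_int y)\<^sup>2)" .
    qed
    then have eq: "avg Z (\<lambda>z. Cb (g z) ps) = avg {0..<q * T} (\<lambda>x. avg {1..M} (\<lambda>y. A x * B (x + y) * ee (Cs (\<psi> (x mod q)) ps * (of_int y)\<^sup>2)))"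
      unfolding avg_classes[OF q T0, symmetric] by simp
    have "q / D1 ^ 7000 \<le> card {r\<in>{0..<q}. c r (map fst ps) \<noteq> 0 \<and> major (D1 ^ 7000) M ((\<lambda>x. Cs (\<psi> (x mod q)) ps) r)}"
    proof (rule weyl_classes[OF D1D M1 q T0 refl, where ?f0.0 = A and ?f1.0 = B])
      show "per (q * T) A"
      proof -
        have "(x + q * T) mod q = x mod q" "(x + q * T) div q = x div q + T" "f0 (x + q * T + w) = f0 (x + w)" for x w
          using q per0 by (auto simp: per_def) (metis add.assoc add.commute)
        then show ?thesis by (simp add: per_def A_def eeper del: of_int_add)
      qed
      show "per (q * T) B"
      proof -
        have "f1 (x + q * T + w) = f1 (x + w)" for x w using per1 unfolding per_def by (metis add.assoc add.commute)
        then show ?thesis by (simp add: per_def B_def)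
      qed
      show "norm (A x) \<le> 1" for x unfolding A_def
        by (rule norm_Cb) (simp add: norm_mult mult_le_one c1 bd0)
      show "norm (B x) \<le> 1" for x unfolding B_def by (rule norm_Cb) (rule bd1)
      show "per q (\<lambda>x. Cs (\<psi> (x mod q)) ps)" by (simp add: per_def)
      show "1 / D1 \<le> norm (avg {0..<q * T} (\<lambda>x. avg {1..M} (\<lambda>y. A x * B (x + y) * ee (Cs (\<psi> (x mod q)) ps * (of_int y)\<^sup>2))))"
        using True unfolding eq .
      show "c (x mod q) (map fst ps) \<noteq> 0" if "A x \<noteq> 0" for x
        using Cb_nonzero[OF that[unfolded A_def]] by auto
    qed
    also have "{r\<in>{0..<q}. c r (map fst ps) \<noteq> 0 \<and> major (D1 ^ 7000) M ((\<lambda>x. Cs (\<psi> (x mod q)) ps) r)} =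
       {r\<in>{0..<q}. c r (map fst ps) \<noteq> 0 \<and> major (D1 ^ 7000) M (Cs (\<psi> r) ps)}" by auto
    finally have "1 / D1 ^ 7000 \<le> avg {0..<q} (\<lambda>r. ind r ps)" unfolding ind_def using q
      by (subst avg_indicator) (auto simp: field_simps)
    then have "1 \<le> D1 ^ 7000 * avg {0..<q} (\<lambda>r. ind r ps)" using D1D by (simp add: field_simps)
    moreover have "norm (avg Z (\<lambda>z. Cb (g z) ps)) \<le> 1"
    proof (rule norm_avg_le_bound)
      fix z show "norm (Cb (g z) ps) \<le> 1"
        by (rule norm_Cb) (cases z, simp add: g_def norm_mult mult_le_one c1 bd0 bd1)
    qed simp
    ultimately show ?thesis using D1D by (smt (verit) divide_nonneg_nonneg)
  qed
  have "2 / D1 \<le> avg ?Ps (\<lambda>ps. 1 / D1 + D1 ^ 7000 * avg {0..<q} (\<lambda>r. ind r ps))"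
    by (rule order_trans[OF P avg_mono]) (rule ps)
  also have "\<dots> \<le> 1 / D1 + D1 ^ 7000 * avg ?Ps (\<lambda>ps. avg {0..<q} (\<lambda>r. ind r ps))"
    unfolding avg_add avg_cmult using D1D by (intro add_right_mono avg_le) auto
  finally have "1 / D1 \<le> D1 ^ 7000 * avg ?Ps (\<lambda>ps. avg {0..<q} (\<lambda>r. ind r ps))" by (simp add: field_simps)
  then have "1 / D1 ^ 7001 \<le> avg ?Ps (\<lambda>ps. avg {0..<q} (\<lambda>r. ind r ps))"
    using D1D by (simp add: field_simps power_add[of _ 7000 1, simplified])
  also have "\<dots> = avg {0..<q} (\<lambda>r. avg ?Ps (ind r))" by (rule avg_swap)
  finally show ?thesis unfolding ind_def .
qed

end

subsection \<open>Degree lowering\<close>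

context config
begin

text \<open>The norm is an average of \<open>U^2\<close> norms of k-fold derivatives, each of which
  correlates with a linear phase \<psi>. The frequencies are arbitrary at first;
  \<open>interchange\<close> shows that their alternating sums over cubes are major, so that \<psi>
  is of low order up to a major arc term, and \<open>remove_phase\<close> then returns a norm of one
  degree less.\<close>

lemma degree_lowering:
  fixes D D1 :: real
  assumes D: "D \<ge> 2" and k: "k \<ge> 1" and D1: "D1 = 2 * (2 * D) ^ (2 ^ k)" and M1: "D1 ^ 7010 \<le> M"
    and big: "1 / D \<le> avg {0..<q} (\<lambda>r. gowers T (k + 2) (F r))"
  shows "1 / D1 ^ (14010 * 2 ^ Suc k + 7010) \<le> avg {0..<q} (\<lambda>r. gowers T (Suc k) (F r))"
proof -
  let ?Is = "replicate k {0..<T}"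
  let ?Ps = "listset (map (\<lambda>I. I \<times> I) ?Is)"
  have D1D: "4 * D \<le> D1"
  proof -
    have "(2 * D) ^ 1 \<le> (2 * D) ^ (2 ^ k)" using D by (intro power_increasing) auto
    then show ?thesis unfolding D1 power_one_right by linarith
  qed
  have D12: "D1 \<ge> 2" "D1 \<ge> 8" using D1D D by auto
  define D2 where "D2 = D1 ^ 7000"
  have D2: "1 \<le> D2" unfolding D2_def using D12 by (intro one_le_power) auto
  have "\<forall>r as. \<exists>j::int. gowers T 2 (dl as (F r)) \<le> (norm (avg {0..<T} (\<lambda>t. dl as (F r) t * ee (of_int j / of_int T * of_int t))))\<^sup>2"
    by (intro allI U2_inverse T0 per_dl per_F norm_dl norm_F)
  then obtain jj :: "int \<Rightarrow> int list \<Rightarrow> int" where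
    jj: "\<And>r as. gowers T 2 (dl as (F r)) \<le> (norm (avg {0..<T} (\<lambda>t. dl as (F r) t * ee (of_int (jj r as) / of_int T * of_int t))))\<^sup>2"
    by metis
  define \<psi> where "\<psi> r as = of_int (jj r as) / real_of_int T" for r as
  define E where "E r as = avg {0..<T} (\<lambda>t. dl as (F r) t * ee (\<psi> r as * of_int t))" for r as
  define good where "good r as \<longleftrightarrow> 1 / (2 * D) \<le> (norm (E r as))\<^sup>2" for r as
  \<comment> \<open>The conjugate makes the weighted correlations equal to |E|^2, without
    cancellation. Moreover c is nonzero exactly where the correlation is large, a fact that
    \<open>interchange\<close> passes on to the cubes it finds.\<close>
  define c where "c r as = of_bool (good r as) * cnj (E r as)" for r as
  have nE: "norm (E r as) \<le> 1" for r as
    unfolding E_def by (rule norm_avg_le_bound) (auto simp: norm_mult norm_dl norm_F)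
  have \<psi>: "\<exists>j::int. \<psi> r as = of_int j / of_int T" for r as unfolding \<psi>_def by blast
  let ?w = "avg {0..<q} (\<lambda>r. avg (listset ?Is) (\<lambda>as. of_bool (good r as) * (norm (E r as))\<^sup>2)) :: real"
  have qne: "finite {0..<q}" "{0..<q} \<noteq> {}" using q by auto
  have "1 / D \<le> avg {0..<q} (\<lambda>r. avg (listset ?Is) (\<lambda>as. gowers T 2 (dl as (F r))))" using big by (simp only: gowers_add)
  also have "\<dots> \<le> avg {0..<q} (\<lambda>r. avg (listset ?Is) (\<lambda>as. of_bool (good r as) * (norm (E r as))\<^sup>2 + 1 / (2 * D)))"
  proof (intro avg_mono)
    fix r as
    have "gowers T 2 (dl as (F r)) \<le> (norm (E r as))\<^sup>2" using jj unfolding E_def \<psi>_def .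
    then show "gowers T 2 (dl as (F r)) \<le> of_bool (good r as) * (norm (E r as))\<^sup>2 + 1 / (2 * D)"
    proof (cases "good r as")
      case True
      moreover have "0 \<le> 1 / (2 * D)" using D by simp
      ultimately show ?thesis using \<open>gowers T 2 (dl as (F r)) \<le> (norm (E r as))\<^sup>2\<close> by (simp add: add_increasing2)
    next
      case False
      then have "(norm (E r as))\<^sup>2 \<le> 1 / (2 * D)" unfolding good_def by linarith
      then show ?thesis using \<open>gowers T 2 (dl as (F r)) \<le> (norm (E r as))\<^sup>2\<close> False by simp
    qed
  qed
  also have "\<dots> = ?w + 1 / (2 * D)"
    by (simp add: avg_add avg_const[OF finite_box box_ne[OF T0]] avg_const[OF qne])
  finally have w: "1 / (2 * D) \<le> ?w" by (simp add: field_simps)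
  have "1 / D1 ^ 7001 \<le> avg {0..<q} (\<lambda>r. avg ?Ps (\<lambda>ps. of_bool (c r (map fst ps) \<noteq> 0 \<and> major (D1 ^ 7000) M (Cs (\<psi> r) ps))))"
  proof (rule interchange[where D = "2 * D"])
    show "norm (c r as) \<le> 1" for r as using nE[of r as] by (simp add: c_def norm_mult)
    have "avg {0..<q} (\<lambda>r. avg (listset ?Is) (\<lambda>as. c r as * avg {0..<T} (\<lambda>t. dl as (F r) t * ee (\<psi> r as * of_int t)))) =
      avg {0..<q} (\<lambda>r. avg (listset ?Is) (\<lambda>as. of_real (of_bool (good r as) * (norm (E r as))\<^sup>2)))"
      unfolding E_def[symmetric] by (intro avg_cong refl) (simp add: c_def complex_norm_square mult.commute del: of_real_power)
    also have "\<dots> = of_real ?w" by (simp only: avg_of_real)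
    finally show "1 / (2 * D) \<le> norm (avg {0..<q} (\<lambda>r. avg (listset ?Is) (\<lambda>as. c r as * avg {0..<T} (\<lambda>t. dl as (F r) t * ee (\<psi> r as * of_int t)))))"
      using w by simp
    show "D1 ^ 7000 \<le> M" using M1 power_increasing[of 7000 7010 D1] D12 by linarith
  qed (use D D1 \<psi> in auto)
  moreover define W where "W r = avg ?Ps (\<lambda>ps. of_bool (c r (map fst ps) \<noteq> 0 \<and> major D2 M (Cs (\<psi> r) ps)) :: real)" for r
  ultimately have W: "1 / D1 ^ 7001 \<le> avg {0..<q} W" unfolding D2_def W_def by simp
  have W0: "0 \<le> W r" for r unfolding W_def by (rule avg_nonneg) simp
  have main: "(W r / (4 * D * D2)) ^ (2 ^ Suc k) \<le> 2048 * D * D2 * gowers T (Suc k) (F r)" for r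
  proof -
    \<comment> \<open>Freezing the second corner \<open>bs\<close> at a value of at least average
      quality makes the alternating sum a function of \<open>as\<close> alone, as the splitting of
      \<psi> requires.\<close>
    have "W r = avg (listset ?Is) (\<lambda>as. avg (listset ?Is) (\<lambda>bs. of_bool (c r (map fst (zip as bs)) \<noteq> 0 \<and> major D2 M (Cs (\<psi> r) (zip as bs)))))"
      unfolding W_def by (rule avg_listset_zip) (simp split: if_splits)
    also have "\<dots> = avg (listset ?Is) (\<lambda>bs. avg (listset ?Is) (\<lambda>as. of_bool (c r (map fst (zip as bs)) \<noteq> 0 \<and> major D2 M (Cs (\<psi> r) (zip as bs)))))"
      by (rule avg_swap)
    finally have "\<exists>bs\<in>listset ?Is. W r \<le> avg (listset ?Is) (\<lambda>as. of_bool (c r (map fst (zip as bs)) \<noteq> 0 \<and> major D2 M (Cs (\<psi> r) (zip as bs))))"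
      using avg_exists_ge[OF finite_box box_ne[OF T0]] by simp
    then obtain bs where bs: "bs \<in> listset ?Is"
      "W r \<le> avg (listset ?Is) (\<lambda>as. of_bool (c r (map fst (zip as bs)) \<noteq> 0 \<and> major D2 M (Cs (\<psi> r) (zip as bs))))"
      by (elim bexE)
    have lb: "length bs = k" using length_listset[OF bs(1)] by simp
    define A' where "A' = {as\<in>listset ?Is. c r as \<noteq> 0 \<and> major D2 M (Cs (\<psi> r) (zip as bs))}"
    have fA': "finite A'" unfolding A'_def by simp
    have "avg (listset ?Is) (\<lambda>as. of_bool (c r (map fst (zip as bs)) \<noteq> 0 \<and> major D2 M (Cs (\<psi> r) (zip as bs)))) =
      avg (listset ?Is) (\<lambda>as. of_bool (c r as \<noteq> 0 \<and> major D2 M (Cs (\<psi> r) (zip as bs))))"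
      by (intro avg_cong refl) (use lb in \<open>auto dest!: length_listset\<close>)
    also have "\<dots> = card A' / card (listset ?Is)" unfolding A'_def by (rule avg_indicator) simp
    finally have WA: "W r \<le> card A' / card (listset ?Is)" using bs(2) by simp
    show ?thesis
    proof (cases "A' = {}")
      case True
      then have "W r = 0" using WA W0[of r] by simp
      then show ?thesis using gowers_nonneg[OF T0 per_F, of k r] D D2 by (simp add: power_0_left)
    next
      case False
      have "\<forall>as\<in>A'. \<exists>b::int. 1 \<le> b \<and> b \<le> D2 \<and> near_int (of_int b * Cs (\<psi> r) (zip as bs)) (D2 / (real_of_int M)\<^sup>2)"
        by (auto simp: A'_def major_def)
      then obtain bb :: "int list \<Rightarrow> int" where bb: "\<And>as. as \<in> A' \<Longrightarrow> 1 \<le> bb as" "\<And>as. as \<in> A' \<Longrightarrow> bb as \<le> D2"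
        "\<And>as. as \<in> A' \<Longrightarrow> near_int (of_int (bb as) * Cs (\<psi> r) (zip as bs)) (D2 / (real_of_int M)\<^sup>2)" by metis
      have "\<exists>v\<in>{1..\<lfloor>D2\<rfloor>}. real (card A') \<le> D2 * real (card {as\<in>A'. bb as = v})"
      proof (rule pigeonhole_fibre[OF fA' _ _ _ False])
        show "bb ` A' \<subseteq> {1..\<lfloor>D2\<rfloor>}" using bb(1,2) by (auto simp: le_floor_iff)
        show "real (card {1..\<lfloor>D2\<rfloor>}) \<le> D2" using D2 by (simp add: of_nat_nat)
      qed auto
      then obtain b :: int where b: "1 \<le> b" "b \<le> D2" "real (card A') \<le> D2 * real (card {as\<in>A'. bb as = b})"
        by (auto simp: le_floor_iff)
      define A where "A = {as\<in>A'. bb as = b}"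
      have "(avg (listset ?Is) (\<lambda>as. of_bool (as \<in> A)) / (4 * D)) ^ (2 ^ Suc k) \<le> 2048 * D * D2 * gowers T (Suc k) (F r)"
      proof (rule remove_phase[OF M TM per_F norm_F D D2 _ b(1,2) k lb])
        have "128 * D * D2 \<le> D1 ^ 3 * D1 * D2" using D1D D12 D D2 power_mono[of 8 D1 3] by (intro mult_right_mono mult_mono) auto
        also have "\<dots> \<le> D1 ^ 7010" unfolding D2_def using D12 power_increasing[of 7004 7010 D1] by (simp add: power_add[symmetric] flip: power_Suc2)
        also have "\<dots> \<le> M" by (rule M1)
        also have "\<dots> \<le> (real_of_int M)\<^sup>2" using M by (simp add: power2_eq_square)
        finally show "128 * D * D2 \<le> (real_of_int M)\<^sup>2" .
        show "\<exists>j::int. \<psi> r as = of_int j / of_int T" for as by (rule \<psi>)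
        fix as assume as: "as \<in> A"
        then have "good r as" by (auto simp: A_def A'_def c_def)
        then show "1 / (2 * D) \<le> (norm (avg {0..<T} (\<lambda>t. dl as (F r) t * ee (\<psi> r as * of_int t))))\<^sup>2"
          unfolding good_def E_def .
        show "near_int (of_int b * Cs (\<psi> r) (zip as bs)) (D2 / (real_of_int M)\<^sup>2)" using bb(3)[of as] as by (auto simp: A_def)
      qed
      moreover have "W r / D2 \<le> avg (listset ?Is) (\<lambda>as. of_bool (as \<in> A))"
      proof -
        have "avg (listset ?Is) (\<lambda>as. of_bool (as \<in> A)) = card {as\<in>listset ?Is. as \<in> A} / card (listset ?Is)"
          by (rule avg_indicator) simp
        also have "{as\<in>listset ?Is. as \<in> A} = A" by (auto simp: A_def A'_def)
        finally have e: "avg (listset ?Is) (\<lambda>as. of_bool (as \<in> A)) = card A / card (listset ?Is)" .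
        have "W r \<le> D2 * card A / card (listset ?Is)"
          using WA b(3) unfolding A_def[symmetric] by (meson divide_right_mono of_nat_0_le_iff order_trans)
        then show ?thesis unfolding e using D2 by (simp add: field_simps)
      qed
      then have "(W r / (4 * D * D2)) ^ (2 ^ Suc k) \<le> (avg (listset ?Is) (\<lambda>as. of_bool (as \<in> A)) / (4 * D)) ^ (2 ^ Suc k)"
        using W0[of r] D D2 by (intro power_mono) (auto simp: field_simps)
      ultimately show ?thesis by linarith
    qed
  qed
  \<comment> \<open>The exponent 14010 covers the 7001 of \<open>interchange\<close>, the 7000 lost
    in fixing the common denominator and the factor 4 D; the later 7010 covers the constant of
    \<open>remove_phase\<close>.\<close>
  have "(1 / D1 ^ 14010) ^ (2 ^ Suc k) \<le> (avg {0..<q} W / (4 * D * D2)) ^ (2 ^ Suc k)"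
  proof (rule power_mono)
    have "1 / D1 ^ 14010 \<le> 1 / D1 ^ 7001 / (D1 * D1 ^ 7000)"
      using power_increasing[of 14002 14010 D1] D12
      by (simp add: power_add[symmetric] flip: power_Suc) (simp add: field_simps)
    also have "\<dots> \<le> avg {0..<q} W / (4 * D * D2)"
      using W D1D D D2 D12 unfolding D2_def by (intro frac_le mult_right_mono avg_nonneg W0) auto
    finally show "1 / D1 ^ 14010 \<le> avg {0..<q} W / (4 * D * D2)" .
  qed (use D12 in auto)
  also have "\<dots> = avg {0..<q} (\<lambda>r. W r / (4 * D * D2)) ^ (2 ^ Suc k)" by (simp add: avg_def sum_divide_distrib mult_ac)
  also have "\<dots> \<le> avg {0..<q} (\<lambda>r. (W r / (4 * D * D2)) ^ (2 ^ Suc k))"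
    using W0 D D2 by (intro avg_pow2) auto
  also have "\<dots> \<le> avg {0..<q} (\<lambda>r. 2048 * D * D2 * gowers T (Suc k) (F r))" by (intro avg_mono main)
  also have "\<dots> = 2048 * D * D2 * avg {0..<q} (\<lambda>r. gowers T (Suc k) (F r))" by (rule avg_cmult)
  also have "\<dots> \<le> D1 ^ 7010 * avg {0..<q} (\<lambda>r. gowers T (Suc k) (F r))"
  proof (rule mult_right_mono)
    have "2048 * D * D2 \<le> D1 ^ 4 * D1 * D2" using D1D D12 D D2 power_mono[of 8 D1 4] by (intro mult_right_mono mult_mono) auto
    also have "\<dots> \<le> D1 ^ 7010" unfolding D2_def using D12 power_increasing[of 7005 7010 D1] by (simp add: power_add[symmetric] flip: power_Suc2)
    finally show "2048 * D * D2 \<le> D1 ^ 7010" .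
  qed (intro avg_nonneg gowers_nonneg T0 per_F)
  finally have fin: "(1 / D1 ^ 14010) ^ (2 ^ Suc k) \<le> D1 ^ 7010 * avg {0..<q} (\<lambda>r. gowers T (Suc k) (F r))" .
  have "(1 / D1 ^ 14010) ^ (2 ^ Suc k) = 1 / D1 ^ (14010 * 2 ^ Suc k)" by (simp only: power_one_over power_mult)
  moreover have "0 < D1 ^ (14010 * 2 ^ Suc k)" "0 < D1 ^ 7010" using D12 by simp_all
  ultimately show ?thesis using fin unfolding power_add by (simp add: field_simps del: power_Suc)
qed

end

subsection \<open>Linear configurations and PET induction\<close>

text \<open>Each function carries its own slope, an arbitrary function of one entry of the list.
  Entries of type \<open>'a\<close> will be pairs, so that slopes can use two independent families
  of variables.\<close>

definition pv :: "((int \<Rightarrow> complex) \<times> ('a \<Rightarrow> int)) list \<Rightarrow> 'a list \<Rightarrow> int \<Rightarrow> complex" where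
  "pv gs as x = prod_list (map (\<lambda>g. fst g (x + sum_list (map (snd g) as))) gs)"

lemma avg_per_shift_eq: "P > 0 \<Longrightarrow> per P f \<Longrightarrow> (\<And>x. g x = f (x + h)) \<Longrightarrow> avg {0..<P} g = avg {0..<P} f"
  using avg_per_shift[of P f h] by presburger

lemma per_pv: "(\<And>g. g \<in> set gs \<Longrightarrow> per P (fst g)) \<Longrightarrow> per P (pv gs as)"
proof (induction gs)
  case (Cons g gs)
  have "fst g (x + P + s) = fst g (x + s)" for x s
    using per_mult[of P "fst g" "x + s" 1] Cons.prems[of g] by (simp add: ac_simps)
  then show ?case using Cons by (simp add: per_def pv_def)
qed (simp add: per_def pv_def)

text \<open>A linear configuration with pairwise different slopes is controlled by the box norm of one of its
  functions, whose directions are the differences of slopes: each step shifts \<open>x\<close> so that one of the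
  other functions becomes independent of the variable that is doubled.\<close>
lemma linear_configuration:
  fixes A :: "'a set" and g0 :: "int \<Rightarrow> complex" and sl0 :: "'a \<Rightarrow> int"
  assumes P: "P > 0" and A: "finite A" and g0: "per P g0"
    and gs: "\<And>g. g \<in> set gs \<Longrightarrow> per P (fst g)" "\<And>g x. g \<in> set gs \<Longrightarrow> norm (fst g x) \<le> 1" and n: "length gs = n" "n \<noteq> 0"
  shows "norm (avg (listset (replicate n A)) (\<lambda>as. avg {0..<P} (\<lambda>x. g0 (x + sum_list (map sl0 as)) * pv gs as x))) ^ (2 ^ n)
    \<le> Re (avg (listset (replicate n (A \<times> A))) (\<lambda>ps. avg {0..<P} (dl
        (map2 (\<lambda>g p. (sl0 (fst p) - snd g (fst p)) - (sl0 (snd p) - snd g (snd p))) gs ps) g0)))"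
  using g0 gs n
proof (induction n arbitrary: gs g0 sl0)
  case (Suc n gs1)
  obtain g1 gs where gs1: "gs1 = g1 # gs" and n: "length gs = n" using Suc.prems(4) by (cases gs1) auto
  note prems = Suc.prems[unfolded gs1]
  define l1 where "l1 = snd g1"
  define X where "X = {0..<P}"
  have fX: "finite X" by (simp add: X_def)
  have fL: "finite (listset (replicate m A))" "finite (listset (replicate m (A \<times> A)))" for m
    by (rule finite_listset; use A in \<open>auto split: if_splits\<close>)+
  define sl1 where "sl1 a = sl0 a - l1 a" for a
  define g0' where "g0' a a' = (\<lambda>x. g0 (x + sl1 a) * cnj (g0 (x + sl1 a')))" for a a'
  define gs' where "gs' a a' = map (\<lambda>g. (\<lambda>x. fst g (x + (snd g a - l1 a)) * cnj (fst g (x + (snd g a' - l1 a'))), \<lambda>b. snd g b - l1 b)) gs" for a a'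
  define G where "G a as x = g0 (x + sl1 a + sum_list (map sl1 as)) * prod_list (map (\<lambda>g. fst g (x + (snd g a - l1 a) + sum_list (map (\<lambda>b. snd g b - l1 b) as))) gs)" for a as x
  have sl: "sum_list (map (\<lambda>b. f b - h b) as) = sum_list (map f as) - sum_list (map h as)" for f h :: "'a \<Rightarrow> int" and as
    by (induction as) auto
  have GG: "G a as x * cnj (G a' as x) = g0' a a' (x + sum_list (map sl1 as)) * pv (gs' a a') as x" for a a' as x
  proof -
    have "prod_list (map (\<lambda>g. fst g (x + (snd g a - l1 a) + sum_list (map (\<lambda>b. snd g b - l1 b) as))) gs) *
      cnj (prod_list (map (\<lambda>g. fst g (x + (snd g a' - l1 a') + sum_list (map (\<lambda>b. snd g b - l1 b) as))) gs)) =
      pv (gs' a a') as x"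
      unfolding pv_def gs'_def by (induction gs) (simp_all add: ac_simps)
    then show ?thesis unfolding G_def g0'_def by (simp add: ac_simps)
  qed
  define E where "E = avg (listset (replicate (Suc n) A)) (\<lambda>as. avg X (\<lambda>x. g0 (x + sum_list (map sl0 as)) * pv (g1 # gs) as x))"
  have "E = avg A (\<lambda>a. avg (listset (replicate n A)) (\<lambda>as. avg X (\<lambda>x. g0 (x + sum_list (map sl0 (a # as))) * pv (g1 # gs) (a # as) x)))"
    unfolding E_def by (simp only: replicate_Suc avg_listset_Cons[OF A fL(1)])
  also have "\<dots> = avg A (\<lambda>a. avg (listset (replicate n A)) (\<lambda>as. avg X (\<lambda>x. fst g1 x * G a as x)))"
  proof (rule avg_cong[OF refl], rule avg_cong[OF refl])
    fix a as
    have p: "per P (\<lambda>x. g0 (x + sum_list (map sl0 (a # as))) * pv (g1 # gs) (a # as) x)"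
      using per_pv[of "g1 # gs" P "a # as"] prems(1,2) per_shift[OF prems(1), of "sum_list (map sl0 (a # as))"]
      by (auto simp: per_def)
    show "avg X (\<lambda>x. g0 (x + sum_list (map sl0 (a # as))) * pv (g1 # gs) (a # as) x) = avg X (\<lambda>x. fst g1 x * G a as x)"
      unfolding X_def
    proof (rule avg_per_shift_eq[OF P p, where h = "- sum_list (map l1 (a # as))", symmetric])
      fix x
      show "fst g1 x * G a as x = g0 (x + - sum_list (map l1 (a # as)) + sum_list (map sl0 (a # as))) * pv (g1 # gs) (a # as) (x + - sum_list (map l1 (a # as)))"
        unfolding G_def pv_def sl1_def[abs_def] sl by (simp add: l1_def algebra_simps)
    qed
  qed
  also have "\<dots> = avg (listset (replicate n A) \<times> X) (\<lambda>z. fst g1 (snd z) * avg A (\<lambda>a. G a (fst z) (snd z)))"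
  proof -
    have "avg (listset (replicate n A) \<times> X) (\<lambda>z. fst g1 (snd z) * avg A (\<lambda>a. G a (fst z) (snd z))) =
      avg (listset (replicate n A)) (\<lambda>as. avg X (\<lambda>x. avg A (\<lambda>a. fst g1 x * G a as x)))"
      by (simp add: avg_prod[OF fL(1) fX] avg_cmult)
    also have "\<dots> = avg (listset (replicate n A)) (\<lambda>as. avg A (\<lambda>a. avg X (\<lambda>x. fst g1 x * G a as x)))"
      by (intro avg_cong[OF refl] avg_swap)
    also have "\<dots> = avg A (\<lambda>a. avg (listset (replicate n A)) (\<lambda>as. avg X (\<lambda>x. fst g1 x * G a as x)))" by (rule avg_swap)
    finally show ?thesis by simp
  qed
  finally have "(norm E)\<^sup>2 \<le> Re (avg A (\<lambda>a. avg A (\<lambda>a'. avg (listset (replicate n A) \<times> X) (\<lambda>z. G a (fst z) (snd z) * cnj (G a' (fst z) (snd z))))))"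
    by (simp only:) (rule avg_CS, use prems in auto)
  also have "\<dots> = Re (avg (A \<times> A) (\<lambda>p. avg (listset (replicate n A)) (\<lambda>as. avg X (\<lambda>x. g0' (fst p) (snd p) (x + sum_list (map sl1 as)) * pv (gs' (fst p) (snd p)) as x))))"
    unfolding GG by (simp add: avg_prod[OF A A] avg_prod[OF fL(1) fX])
  finally have CS: "(norm E)\<^sup>2 \<le> Re (avg (A \<times> A) (\<lambda>p. avg (listset (replicate n A)) (\<lambda>as. avg X (\<lambda>x. g0' (fst p) (snd p) (x + sum_list (map sl1 as)) * pv (gs' (fst p) (snd p)) as x))))"
    (is "_ \<le> Re (avg _ ?E')") .
  \<comment> \<open>Translating x changes all slopes by the same amount, so differences of slopes
    survive the induction step unchanged.\<close>
  define \<mu> where "\<mu> = (\<lambda>(g::(int \<Rightarrow> complex) \<times> ('a \<Rightarrow> int)) (p::'a \<times> 'a). (sl0 (fst p) - snd g (fst p)) - (sl0 (snd p) - snd g (snd p)))"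
  have dlg0': "avg X (dl hs (g0' (fst p) (snd p))) = avg X (dl (\<mu> g1 p # hs) g0)" for p hs
  proof -
    have "g0' (fst p) (snd p) = (\<lambda>x. dd (\<mu> g1 p) g0 (x + sl1 (snd p)))"
      by (auto simp: g0'_def dd_def \<mu>_def sl1_def l1_def fun_eq_iff algebra_simps)
    then show ?thesis unfolding X_def dl.simps
      by (intro avg_per_shift_eq[OF P per_dl[OF per_dd[OF prems(1)]], where h = "sl1 (snd p)"]) (simp add: dl_shift)
  qed
  have "norm E ^ (2 ^ Suc n) \<le> Re (avg (A \<times> A) (\<lambda>p. avg (listset (replicate n (A \<times> A))) (\<lambda>ps. avg X (dl (\<mu> g1 p # map2 \<mu> gs ps) g0))))"
  proof (cases "gs = []")
    case True
    with n have "n = 0" by simp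
    have "?E' p = avg X (dl [\<mu> g1 p] g0)" for p
      using dlg0'[of "[]" p] True \<open>n = 0\<close> by (simp add: gs'_def pv_def)
    then show ?thesis using CS True \<open>n = 0\<close> by simp
  next
    case False
    have "norm E ^ (2 ^ Suc n) = ((norm E)\<^sup>2) ^ (2 ^ n)" by (simp add: power_mult)
    also have "\<dots> \<le> (avg (A \<times> A) (\<lambda>p. norm (?E' p))) ^ (2 ^ n)"
      by (rule power_mono[OF order_trans[OF CS order_trans[OF complex_Re_le_cmod norm_avg_le]]]) simp
    also have "\<dots> \<le> avg (A \<times> A) (\<lambda>p. norm (?E' p) ^ (2 ^ n))" by (rule avg_pow2) simp
    also have "\<dots> \<le> avg (A \<times> A) (\<lambda>p. Re (avg (listset (replicate n (A \<times> A))) (\<lambda>ps. avg X (dl (\<mu> g1 p # map2 \<mu> gs ps) g0))))"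
    proof (rule avg_mono)
      fix p
      have "norm (?E' p) ^ (2 ^ n) \<le> Re (avg (listset (replicate n (A \<times> A))) (\<lambda>ps. avg {0..<P} (dl
        (map2 (\<lambda>g p. (sl1 (fst p) - snd g (fst p)) - (sl1 (snd p) - snd g (snd p))) (gs' (fst p) (snd p)) ps) (g0' (fst p) (snd p)))))"
        unfolding X_def
      proof (rule Suc.IH)
        show "per P (g0' (fst p) (snd p))"
          using per_shift[OF prems(1)] unfolding per_def g0'_def by simp
        show "per P (fst g)" if "g \<in> set (gs' (fst p) (snd p))" for g
        proof -
          from that obtain h where h: "h \<in> set gs" "fst g = (\<lambda>x. fst h (x + (snd h (fst p) - l1 (fst p))) * cnj (fst h (x + (snd h (snd p) - l1 (snd p)))))"
            by (auto simp: gs'_def)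
          have "per P (fst h)" using h(1) prems(2) by simp
          from per_shift[OF this] show ?thesis unfolding h(2) per_def by simp
        qed
        show "norm (fst g x) \<le> 1" if "g \<in> set (gs' (fst p) (snd p))" for g x
        proof -
          from that obtain h where h: "h \<in> set gs" "fst g = (\<lambda>x. fst h (x + (snd h (fst p) - l1 (fst p))) * cnj (fst h (x + (snd h (snd p) - l1 (snd p)))))"
            by (auto simp: gs'_def)
          have "norm (fst h y) \<le> 1" for y using h(1) prems(3) by simp
          then show ?thesis unfolding h(2) by (simp add: norm_mult mult_le_one)
        qed
      qed (use False n in \<open>auto simp: gs'_def\<close>)
      also have "map2 (\<lambda>g p. (sl1 (fst p) - snd g (fst p)) - (sl1 (snd p) - snd g (snd p))) (gs' (fst p) (snd p)) = map2 \<mu> gs"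
        unfolding gs'_def by (simp add: fun_eq_iff zip_map1 \<mu>_def sl1_def case_prod_beta)
      finally show "norm (?E' p) ^ (2 ^ n) \<le> Re (avg (listset (replicate n (A \<times> A))) (\<lambda>ps. avg X (dl (\<mu> g1 p # map2 \<mu> gs ps) g0)))"
        by (simp only: X_def dlg0'[unfolded X_def])
    qed
    also have "\<dots> = Re (avg (A \<times> A) (\<lambda>p. avg (listset (replicate n (A \<times> A))) (\<lambda>ps. avg X (dl (\<mu> g1 p # map2 \<mu> gs ps) g0))))"
      by (simp add: Re_avg)
    finally show ?thesis .
  qed
  also have "\<dots> = Re (avg (listset (replicate (Suc n) (A \<times> A))) (\<lambda>ps. avg X (dl (map2 \<mu> (g1 # gs) ps) g0)))"
    unfolding replicate_Suc
    by (subst avg_listset_Cons) (use A fL in simp_all)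
  finally show ?case unfolding E_def X_def \<mu>_def gs1 by simp
qed simp

lemma listset_ne: "(\<And>I. I \<in> set Is \<Longrightarrow> I \<noteq> {}) \<Longrightarrow> listset Is \<noteq> {}"
proof (induction Is)
  case (Cons I Is)
  then obtain i "is" where "i \<in> I" "is \<in> listset Is" by fastforce
  then have "i # is \<in> listset (I # Is)" by (simp add: listset.simps set_Cons_def)
  then show ?case by blast
qed (simp add: listset.simps)

lemma sum_listset_interval:
  "w \<in> listset (replicate k {1..H::int}) \<Longrightarrow> 0 \<le> sum_list w \<and> sum_list w \<le> int k * H"
proof (induction k arbitrary: w)
  case (Suc k)
  then obtain i w' where "w = i # w'" "i \<in> {1..H}" "w' \<in> listset (replicate k {1..H})"
    by (auto simp: listset.simps set_Cons_def)
  then show ?case using Suc.IH[of w'] by (auto simp: algebra_simps)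
qed (simp add: listset.simps)

lemma Re_le_norm_trans: "a \<le> Re z \<Longrightarrow> z = w \<Longrightarrow> a \<le> norm w"
  using complex_Re_le_cmod[of w] by simp

definition dif :: "int \<times> int \<Rightarrow> int" where "dif p = fst p - snd p"

text \<open>The four directions left after linearisation: the first comes from pairing the two
  copies at slope u + v, the others are the differences between the slope of the surviving pair and
  those of the three pairs removed by \<open>linear_configuration\<close>. All are divisible by
  q.\<close>

definition pet_dirs :: "int \<Rightarrow> int \<Rightarrow> int \<Rightarrow> int \<Rightarrow> int \<Rightarrow> ((int \<times> int) \<times> (int \<times> int)) list \<Rightarrow> int list" where
  "pet_dirs q l u v v' ps = 2 * q * (l * (u + v)) # map2 (\<lambda>\<mu> p. \<mu> (fst p) - \<mu> (snd p))
     [\<lambda>k. 2 * q * (v * fst k - (v' - u) * snd k), \<lambda>k. 2 * q * (v * fst k - v' * snd k), \<lambda>k. 2 * q * (u * fst k)] ps"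

context config
begin

text \<open>Linearisation (PET induction). Writing \<open>y\<close> as a sum of many small variables makes every
  Cauchy-Schwarz step an exact identity. The first two remove \<open>f0\<close> and \<open>f1\<close>, leaving four copies of
  \<open>f\<close> at quadratic points; the next two remove one copy and the pair of slope \<open>u\<close>, which makes the
  remaining slopes depend on two independent sets of variables.\<close>
lemma linearisation:
  fixes D :: real and H :: int
  assumes D: "D \<ge> 2" and H: "H \<ge> 1" and HM: "24 * D * H \<le> M"
    and f: "per (q * T) f" "\<And>x. norm (f x) \<le> 1"
    and big: "1 / D \<le> norm (avg {0..<q * T} (\<lambda>x. avg {1..M} (\<lambda>y. f0 x * f1 (x + y) * f (x + q * y\<^sup>2))))"
  shows "(1 / (2 * D)) ^ 128 \<le> avg ({1..H} \<times> {1..H}) (\<lambda>v. avg ({1..H} \<times> {1..H}) (\<lambda>v'. avg ({1..H} \<times> {1..H}) (\<lambda>l. avg ({1..H} \<times> {1..H}) (\<lambda>u.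
     avg (listset (replicate 3 (({1..H} \<times> {1..H}) \<times> ({1..H} \<times> {1..H})))) (\<lambda>ps.
       Re (avg {0..<q * T} (dl (pet_dirs q (dif l) (dif u) (dif v) (dif v') ps) f)))))))"
proof -
  define P where "P = q * T"
  define X where "X = {0..<P}"
  define Hs where "Hs = {1..H}"
  define W where "W = listset (replicate 3 Hs)"
  have P0: "P > 0" using q T0 by (simp add: P_def)
  have fin: "finite X" "finite Hs" "finite W" by (auto simp: X_def Hs_def W_def intro!: finite_listset)
  have fP: "f (x + P + a) = f (x + a)" "f1 (x + P + a) = f1 (x + a)" "f0 (x + P) = f0 x" "f (x + P) = f x" "f1 (x + P) = f1 x" for x a
    using per_mult[OF f(1), of "x + a" 1] per_mult[OF per1, of "x + a" 1] f(1) per0 per1 by (auto simp: P_def per_def ac_simps)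
  define g where "g y = avg X (\<lambda>x. f0 x * f1 (x + y) * f (x + q * y\<^sup>2))" for y
  have g1: "norm (g y) \<le> 1" for y unfolding g_def
    by (rule norm_avg_le_bound) (simp_all add: norm_mult mult_le_one bd0 bd1 f(2))
  \<comment> \<open>One variable for each of the first three applications of Cauchy-Schwarz, and
    three that remain for the linear configuration. The total shift is at most 6 H, which costs 12 H
    / M.\<close>
  define S where "S = Hs \<times> Hs \<times> Hs \<times> W"
  define s where "s z = (case z of (h1, h2, h3, w) \<Rightarrow> h1 + h2 + h3 + sum_list w)" for z :: "int \<times> int \<times> int \<times> int list"
  have Sne: "finite S" "S \<noteq> {}"
  proof -
    have "W \<noteq> {}" unfolding W_def by (rule listset_ne) (use H in \<open>auto simp: Hs_def\<close>)
    then show "finite S" "S \<noteq> {}" using fin H unfolding S_def Hs_def by auto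
  qed
  have s6: "0 \<le> s z \<and> s z \<le> 6 * H" if "z \<in> S" for z
    using that sum_listset_interval[of _ 3 H] unfolding S_def s_def W_def Hs_def by fastforce
  have "avg X (\<lambda>x. avg {1..M} (\<lambda>y. f0 x * f1 (x + y) * f (x + q * y\<^sup>2))) = avg {1..M} g"
    unfolding g_def by (rule avg_swap)
  then have b1: "1 / D \<le> norm (avg {1..M} g)" using big by (simp add: X_def P_def)
  have "norm (avg S (\<lambda>z. avg {1..M} (\<lambda>y. g (y + s z))) - avg {1..M} g) \<le> 1 / (2 * D)"
  proof -
    have "avg S (\<lambda>z. avg {1..M} (\<lambda>y. g (y + s z))) - avg {1..M} g = avg S (\<lambda>z. avg {1..M} (\<lambda>y. g (y + s z)) - avg {1..M} g)"
      by (simp add: avg_diff avg_const[OF Sne])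
    also have "norm \<dots> \<le> 1 / (2 * D)"
    proof (rule norm_avg_le_bound)
      fix z assume z: "z \<in> S"
      have "norm (avg {1..M} (\<lambda>y. g (y + s z)) - avg {1..M} g) \<le> 2 * real_of_int (s z) / M"
        by (rule avg_interval_shift) (use g1 M s6[OF z] in auto)
      also have "\<dots> \<le> 12 * real_of_int H / M" using s6[OF z] M by (intro divide_right_mono) auto
      also have "\<dots> \<le> 1 / (2 * D)" using HM M D by (simp add: field_simps)
      finally show "norm (avg {1..M} (\<lambda>y. g (y + s z)) - avg {1..M} g) \<le> 1 / (2 * D)" .
    qed (use D in auto)
    finally show ?thesis .
  qed
  then have "norm (avg {1..M} g) \<le> norm (avg S (\<lambda>z. avg {1..M} (\<lambda>y. g (y + s z)))) + 1 / (2 * D)"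
    using norm_triangle_sub[of "avg {1..M} g" "avg S (\<lambda>z. avg {1..M} (\<lambda>y. g (y + s z)))"] by (simp add: norm_minus_commute)
  moreover have "1 / D = 1 / (2 * D) + 1 / (2 * D)" by simp
  ultimately have "1 / (2 * D) \<le> norm (avg S (\<lambda>z. avg {1..M} (\<lambda>y. g (y + s z))))" using b1 by linarith
  also have "avg S (\<lambda>z. avg {1..M} (\<lambda>y. g (y + s z))) = avg {1..M} (\<lambda>y. avg S (\<lambda>z. g (y + s z)))" by (rule avg_swap)
  also have "norm \<dots> \<le> avg {1..M} (\<lambda>y. norm (avg S (\<lambda>z. g (y + s z))))" by (rule norm_avg_le)
  finally obtain y0 where y0: "1 / (2 * D) \<le> norm (avg S (\<lambda>z. g (y0 + s z)))"
    using avg_exists_ge[OF M_ne, of "\<lambda>y. norm (avg S (\<lambda>z. g (y + s z)))"] by (meson order_trans)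
  define \<epsilon> where "\<epsilon> = 1 / (2 * D)"
  have e0: "\<epsilon> \<ge> 0" using D by (simp add: \<epsilon>_def)

  \<comment> \<open>Removal of f0, which does not see the shift of y; h1 is doubled.\<close>
  define G where "G z h1 = (case z of (h2, h3, w, x) \<Rightarrow> f1 (x + (y0 + h2 + h3 + sum_list w + h1)) * f (x + q * (y0 + h2 + h3 + sum_list w + h1)\<^sup>2))"
    for z :: "int \<times> int \<times> int list \<times> int" and h1
  have "avg S (\<lambda>z. g (y0 + s z)) = avg Hs (\<lambda>h1. avg (Hs \<times> Hs \<times> W \<times> X) (\<lambda>z. f0 (snd (snd (snd z))) * G z h1))"
    unfolding S_def g_def s_def G_def by (simp add: avg_prod fin algebra_simps)
  also have "\<dots> = avg (Hs \<times> Hs \<times> W \<times> X) (\<lambda>z. f0 (snd (snd (snd z))) * avg Hs (G z))"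
    unfolding avg_cmult[symmetric] by (rule avg_swap)
  finally have "\<epsilon>\<^sup>2 \<le> (norm (avg (Hs \<times> Hs \<times> W \<times> X) (\<lambda>z. f0 (snd (snd (snd z))) * avg Hs (G z))))\<^sup>2"
    using y0 e0 unfolding \<epsilon>_def by (intro power_mono) auto
  also have "\<dots> \<le> Re (avg Hs (\<lambda>h1. avg Hs (\<lambda>h1'. avg (Hs \<times> Hs \<times> W \<times> X) (\<lambda>z. G z h1 * cnj (G z h1')))))"
    by (rule avg_CS) (rule bd0)
  finally have e1: "\<epsilon>\<^sup>2 \<le> Re (avg Hs (\<lambda>h1. avg Hs (\<lambda>h1'. avg (Hs \<times> Hs \<times> W \<times> X) (\<lambda>z. G z h1 * cnj (G z h1')))))" .

  \<comment> \<open>After translation of x the factors with f1 depend on h1, h1' only and are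
    removed; h2 is doubled. From here on only f occurs.\<close>
  define V where "V z h2 = (case z of (p, h3, w, x) \<Rightarrow>
      f (x + (q * (y0 + h2 + h3 + sum_list w + fst p)\<^sup>2 - (y0 + h2 + h3 + sum_list w))) *
      cnj (f (x + (q * (y0 + h2 + h3 + sum_list w + snd p)\<^sup>2 - (y0 + h2 + h3 + sum_list w)))))"
    for z :: "(int \<times> int) \<times> int \<times> int list \<times> int" and h2
  define U where "U z = (case z of (p, h3, w, x) \<Rightarrow> f1 (x + fst p) * cnj (f1 (x + snd p)))"
    for z :: "(int \<times> int) \<times> int \<times> int list \<times> int"
  have U1: "norm (U z) \<le> 1" for z by (cases z) (simp add: U_def norm_mult mult_le_one bd1)
  have "avg Hs (\<lambda>h1. avg Hs (\<lambda>h1'. avg (Hs \<times> Hs \<times> W \<times> X) (\<lambda>z. G z h1 * cnj (G z h1')))) =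
    avg Hs (\<lambda>h1. avg Hs (\<lambda>h1'. avg Hs (\<lambda>h2. avg Hs (\<lambda>h3. avg W (\<lambda>w. avg X (\<lambda>x. G (h2, h3, w, x) h1 * cnj (G (h2, h3, w, x) h1')))))))"
    by (simp add: avg_prod fin)
  also have "\<dots> = avg Hs (\<lambda>h1. avg Hs (\<lambda>h1'. avg Hs (\<lambda>h2. avg Hs (\<lambda>h3. avg W (\<lambda>w. avg X (\<lambda>x. U ((h1, h1'), h3, w, x) * V ((h1, h1'), h3, w, x) h2))))))"
  proof (rule avg_cong[OF refl], rule avg_cong[OF refl], rule avg_cong[OF refl], rule avg_cong[OF refl], rule avg_cong[OF refl])
    fix h1 h1' h2 h3 w
    show "avg X (\<lambda>x. G (h2, h3, w, x) h1 * cnj (G (h2, h3, w, x) h1')) = avg X (\<lambda>x. U ((h1, h1'), h3, w, x) * V ((h1, h1'), h3, w, x) h2)"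
      unfolding X_def
    proof (rule avg_per_shift_eq[OF P0, symmetric, where h = "- (y0 + h2 + h3 + sum_list w)"])
      show "per P (\<lambda>x. G (h2, h3, w, x) h1 * cnj (G (h2, h3, w, x) h1'))" by (simp add: per_def G_def fP)
    qed (simp add: G_def U_def V_def algebra_simps)
  qed
  also have "\<dots> = avg Hs (\<lambda>h2. avg ((Hs \<times> Hs) \<times> Hs \<times> W \<times> X) (\<lambda>z. U z * V z h2))"
  proof -
    have "avg Hs (\<lambda>h1. avg Hs (\<lambda>h1'. avg Hs (\<lambda>h2. K h1 h1' h2))) = avg Hs (\<lambda>h2. avg Hs (\<lambda>h1. avg Hs (\<lambda>h1'. K h1 h1' h2)))" for K :: "int \<Rightarrow> int \<Rightarrow> int \<Rightarrow> complex"
    proof -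
      have "avg Hs (\<lambda>h1. avg Hs (\<lambda>h1'. avg Hs (\<lambda>h2. K h1 h1' h2))) = avg Hs (\<lambda>h1. avg Hs (\<lambda>h2. avg Hs (\<lambda>h1'. K h1 h1' h2)))"
        by (intro avg_cong[OF refl] avg_swap)
      also have "\<dots> = avg Hs (\<lambda>h2. avg Hs (\<lambda>h1. avg Hs (\<lambda>h1'. K h1 h1' h2)))" by (rule avg_swap)
      finally show ?thesis .
    qed
    then show ?thesis by (simp add: avg_prod fin)
  qed
  also have "\<dots> = avg ((Hs \<times> Hs) \<times> Hs \<times> W \<times> X) (\<lambda>z. U z * avg Hs (V z))"
    unfolding avg_cmult[symmetric] by (rule avg_swap)
  finally have "\<epsilon>\<^sup>2 \<le> norm (avg ((Hs \<times> Hs) \<times> Hs \<times> W \<times> X) (\<lambda>z. U z * avg Hs (V z)))"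
    by (rule Re_le_norm_trans[OF e1])
  then have "(\<epsilon>\<^sup>2)\<^sup>2 \<le> (norm (avg ((Hs \<times> Hs) \<times> Hs \<times> W \<times> X) (\<lambda>z. U z * avg Hs (V z))))\<^sup>2" by (rule power_mono) simp
  also have "\<dots> \<le> Re (avg Hs (\<lambda>h2. avg Hs (\<lambda>h2'. avg ((Hs \<times> Hs) \<times> Hs \<times> W \<times> X) (\<lambda>z. V z h2 * cnj (V z h2')))))"
    by (rule avg_CS) (rule U1)
  finally have e2: "(\<epsilon>\<^sup>2)\<^sup>2 \<le> Re (avg Hs (\<lambda>h2. avg Hs (\<lambda>h2'. avg ((Hs \<times> Hs) \<times> Hs \<times> W \<times> X) (\<lambda>z. V z h2 * cnj (V z h2')))))" .

  \<comment> \<open>With u and v the doubled h1 and h2, the four copies of f have slopes 0, u, v and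
    u + v in h3 once x is translated. The copy of slope 0 is removed and h3 is doubled to l.\<close>
  define Q where "Q z h3 = (case z of (v, u, w, x) \<Rightarrow>
      cnj (f (x + q * (2 * (y0 + snd u + snd v + sum_list w + h3) * dif u + (dif u)\<^sup>2))) *
      cnj (f (x + (q * (2 * (y0 + snd u + snd v + sum_list w + h3) * dif v + (dif v)\<^sup>2) - dif v))) *
      f (x + (q * (2 * (y0 + snd u + snd v + sum_list w + h3) * (dif u + dif v) + (dif u + dif v)\<^sup>2) - dif v)))"
    for z :: "(int \<times> int) \<times> (int \<times> int) \<times> int list \<times> int" and h3
  have "avg Hs (\<lambda>h2. avg Hs (\<lambda>h2'. avg ((Hs \<times> Hs) \<times> Hs \<times> W \<times> X) (\<lambda>z. V z h2 * cnj (V z h2')))) =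
    avg (Hs \<times> Hs) (\<lambda>v. avg (Hs \<times> Hs) (\<lambda>u. avg Hs (\<lambda>h3. avg W (\<lambda>w. avg X (\<lambda>x. V (u, h3, w, x) (fst v) * cnj (V (u, h3, w, x) (snd v)))))))"
    by (simp add: avg_prod fin)
  also have "\<dots> = avg (Hs \<times> Hs) (\<lambda>v. avg (Hs \<times> Hs) (\<lambda>u. avg Hs (\<lambda>h3. avg W (\<lambda>w. avg X (\<lambda>x. f x * Q (v, u, w, x) h3)))))"
  proof (rule avg_cong[OF refl], rule avg_cong[OF refl], rule avg_cong[OF refl], rule avg_cong[OF refl])
    fix u v h3 w
    show "avg X (\<lambda>x. V (u, h3, w, x) (fst v) * cnj (V (u, h3, w, x) (snd v))) = avg X (\<lambda>x. f x * Q (v, u, w, x) h3)"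
      unfolding X_def
    proof (rule avg_per_shift_eq[OF P0, symmetric, where h = "y0 + snd v + h3 + sum_list w - q * (y0 + snd v + h3 + sum_list w + snd u)\<^sup>2"])
      show "per P (\<lambda>x. V (u, h3, w, x) (fst v) * cnj (V (u, h3, w, x) (snd v)))" by (simp add: per_def V_def fP)
    qed (simp add: Q_def V_def dif_def algebra_simps power2_eq_square)
  qed
  also have "\<dots> = avg Hs (\<lambda>h3. avg ((Hs \<times> Hs) \<times> (Hs \<times> Hs) \<times> W \<times> X) (\<lambda>z. f (snd (snd (snd z))) * Q z h3))"
  proof -
    have "avg A (\<lambda>v. avg A (\<lambda>u. avg Hs (\<lambda>h3. K v u h3))) = avg Hs (\<lambda>h3. avg A (\<lambda>v. avg A (\<lambda>u. K v u h3)))"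
      for K :: "int \<times> int \<Rightarrow> int \<times> int \<Rightarrow> int \<Rightarrow> complex" and A
    proof -
      have "avg A (\<lambda>v. avg A (\<lambda>u. avg Hs (\<lambda>h3. K v u h3))) = avg A (\<lambda>v. avg Hs (\<lambda>h3. avg A (\<lambda>u. K v u h3)))"
        by (intro avg_cong[OF refl] avg_swap)
      also have "\<dots> = avg Hs (\<lambda>h3. avg A (\<lambda>v. avg A (\<lambda>u. K v u h3)))" by (rule avg_swap)
      finally show ?thesis .
    qed
    then show ?thesis
      by (simp add: avg_prod[of "Hs \<times> Hs"] avg_prod[of W] fin)
  qed
  also have "\<dots> = avg ((Hs \<times> Hs) \<times> (Hs \<times> Hs) \<times> W \<times> X) (\<lambda>z. f (snd (snd (snd z))) * avg Hs (Q z))"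
    unfolding avg_cmult[symmetric] by (rule avg_swap)
  finally have "(\<epsilon>\<^sup>2)\<^sup>2 \<le> norm (avg ((Hs \<times> Hs) \<times> (Hs \<times> Hs) \<times> W \<times> X) (\<lambda>z. f (snd (snd (snd z))) * avg Hs (Q z)))"
    by (rule Re_le_norm_trans[OF e2])
  then have "((\<epsilon>\<^sup>2)\<^sup>2)\<^sup>2 \<le> (norm (avg ((Hs \<times> Hs) \<times> (Hs \<times> Hs) \<times> W \<times> X) (\<lambda>z. f (snd (snd (snd z))) * avg Hs (Q z))))\<^sup>2" by (rule power_mono) simp
  also have "\<dots> \<le> Re (avg Hs (\<lambda>h3. avg Hs (\<lambda>h3'. avg ((Hs \<times> Hs) \<times> (Hs \<times> Hs) \<times> W \<times> X) (\<lambda>z. Q z h3 * cnj (Q z h3')))))"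
    by (rule avg_CS) (rule f(2))
  finally have e3: "((\<epsilon>\<^sup>2)\<^sup>2)\<^sup>2 \<le> Re (avg Hs (\<lambda>h3. avg Hs (\<lambda>h3'. avg ((Hs \<times> Hs) \<times> (Hs \<times> Hs) \<times> W \<times> X) (\<lambda>z. Q z h3 * cnj (Q z h3')))))" .

  \<comment> \<open>Another translation makes the pair of slope u independent of v and w. Doubling v
    and w together removes this pair and provides a second, independent v' for the slopes.\<close>
  define C where "C u v = 2 * q * (y0 + snd u + snd v) * (dif v - dif u) + q * ((dif v)\<^sup>2 - (dif u)\<^sup>2) - dif v" for u v :: "int \<times> int"
  define C' where "C' u v = 2 * q * (y0 + snd u + snd v) * dif v + q * ((dif v)\<^sup>2 + 2 * dif u * dif v) - dif v" for u v :: "int \<times> int"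
  define \<beta> where "\<beta> l u v = (\<lambda>x. cnj (f (x + (C u v + 2 * q * fst l * dif v))) * f (x + (C u v + 2 * q * snd l * dif v)))" for l u v :: "int \<times> int"
  define \<gamma> where "\<gamma> l u v = (\<lambda>x. f (x + (C' u v + 2 * q * fst l * (dif u + dif v))) * cnj (f (x + (C' u v + 2 * q * snd l * (dif u + dif v)))))" for l u v :: "int \<times> int"
  define R where "R z \<theta> = (case z of (l, u, x) \<Rightarrow> case \<theta> of (v, w) \<Rightarrow> \<beta> l u v (x + 2 * q * (dif v - dif u) * sum_list w) * \<gamma> l u v (x + 2 * q * dif v * sum_list w))"
    for z :: "(int \<times> int) \<times> (int \<times> int) \<times> int" and \<theta> :: "(int \<times> int) \<times> int list"
  define \<alpha> where "\<alpha> z = (case z of (l, u, x) \<Rightarrow> cnj (f (x + 2 * q * fst l * dif u)) * f (x + 2 * q * snd l * dif u))"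
    for z :: "(int \<times> int) \<times> (int \<times> int) \<times> int"
  have \<alpha>1: "norm (\<alpha> z) \<le> 1" for z by (cases z) (simp add: \<alpha>_def norm_mult mult_le_one f(2))
  have "avg Hs (\<lambda>h3. avg Hs (\<lambda>h3'. avg ((Hs \<times> Hs) \<times> (Hs \<times> Hs) \<times> W \<times> X) (\<lambda>z. Q z h3 * cnj (Q z h3')))) =
    avg (Hs \<times> Hs) (\<lambda>l. avg (Hs \<times> Hs) (\<lambda>v. avg (Hs \<times> Hs) (\<lambda>u. avg W (\<lambda>w. avg X (\<lambda>x. Q (v, u, w, x) (fst l) * cnj (Q (v, u, w, x) (snd l)))))))"
    by (simp add: avg_prod fin)
  also have "\<dots> = avg (Hs \<times> Hs) (\<lambda>l. avg (Hs \<times> Hs) (\<lambda>v. avg (Hs \<times> Hs) (\<lambda>u. avg W (\<lambda>w. avg X (\<lambda>x. \<alpha> (l, u, x) * R (l, u, x) (v, w))))))"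
  proof (rule avg_cong[OF refl], rule avg_cong[OF refl], rule avg_cong[OF refl], rule avg_cong[OF refl])
    fix l u v :: "int \<times> int" and w
    show "avg X (\<lambda>x. Q (v, u, w, x) (fst l) * cnj (Q (v, u, w, x) (snd l))) = avg X (\<lambda>x. \<alpha> (l, u, x) * R (l, u, x) (v, w))"
      unfolding X_def
    proof (rule avg_per_shift_eq[OF P0, symmetric, where h = "- q * (2 * (y0 + snd u + snd v + sum_list w) * dif u + (dif u)\<^sup>2)"])
      show "per P (\<lambda>x. Q (v, u, w, x) (fst l) * cnj (Q (v, u, w, x) (snd l)))" by (simp add: per_def Q_def fP)
    qed (simp add: Q_def \<alpha>_def R_def \<beta>_def \<gamma>_def C_def C'_def algebra_simps power2_eq_square)
  qed
  also have "\<dots> = avg ((Hs \<times> Hs) \<times> W) (\<lambda>\<theta>. avg ((Hs \<times> Hs) \<times> (Hs \<times> Hs) \<times> X) (\<lambda>z. \<alpha> z * R z \<theta>))"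
  proof -
    define A where "A = Hs \<times> Hs"
    have fA: "finite A" using fin by (simp add: A_def)
    have "avg A (\<lambda>l. avg A (\<lambda>v. avg A (\<lambda>u. avg W (K l v u)))) = avg A (\<lambda>v. avg W (\<lambda>w. avg A (\<lambda>l. avg A (\<lambda>u. K l v u w))))"
      for K :: "int \<times> int \<Rightarrow> int \<times> int \<Rightarrow> int \<times> int \<Rightarrow> int list \<Rightarrow> complex"
    proof -
      have "avg A (\<lambda>l. avg A (\<lambda>v. avg A (\<lambda>u. avg W (K l v u)))) = avg A (\<lambda>v. avg A (\<lambda>l. avg A (\<lambda>u. avg W (K l v u))))" by (rule avg_swap)
      also have "\<dots> = avg A (\<lambda>v. avg A (\<lambda>l. avg W (\<lambda>w. avg A (\<lambda>u. K l v u w))))" by (intro avg_cong[OF refl] avg_swap)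
      also have "\<dots> = avg A (\<lambda>v. avg W (\<lambda>w. avg A (\<lambda>l. avg A (\<lambda>u. K l v u w))))" by (intro avg_cong[OF refl] avg_swap)
      finally show ?thesis .
    qed
    then show ?thesis unfolding A_def[symmetric] by (simp add: avg_prod fA fin)
  qed
  also have "\<dots> = avg ((Hs \<times> Hs) \<times> (Hs \<times> Hs) \<times> X) (\<lambda>z. \<alpha> z * avg ((Hs \<times> Hs) \<times> W) (R z))"
    unfolding avg_cmult[symmetric] by (rule avg_swap)
  finally have "((\<epsilon>\<^sup>2)\<^sup>2)\<^sup>2 \<le> norm (avg ((Hs \<times> Hs) \<times> (Hs \<times> Hs) \<times> X) (\<lambda>z. \<alpha> z * avg ((Hs \<times> Hs) \<times> W) (R z)))"
    by (rule Re_le_norm_trans[OF e3])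
  then have "(((\<epsilon>\<^sup>2)\<^sup>2)\<^sup>2)\<^sup>2 \<le> (norm (avg ((Hs \<times> Hs) \<times> (Hs \<times> Hs) \<times> X) (\<lambda>z. \<alpha> z * avg ((Hs \<times> Hs) \<times> W) (R z))))\<^sup>2" by (rule power_mono) simp
  also have "\<dots> \<le> Re (avg ((Hs \<times> Hs) \<times> W) (\<lambda>\<theta>. avg ((Hs \<times> Hs) \<times> W) (\<lambda>\<theta>'. avg ((Hs \<times> Hs) \<times> (Hs \<times> Hs) \<times> X) (\<lambda>z. R z \<theta> * cnj (R z \<theta>')))))"
    by (rule avg_CS) (rule \<alpha>1)
  finally have e4: "(((\<epsilon>\<^sup>2)\<^sup>2)\<^sup>2)\<^sup>2 \<le> Re (avg ((Hs \<times> Hs) \<times> W) (\<lambda>\<theta>. avg ((Hs \<times> Hs) \<times> W) (\<lambda>\<theta>'. avg ((Hs \<times> Hs) \<times> (Hs \<times> Hs) \<times> X) (\<lambda>z. R z \<theta> * cnj (R z \<theta>')))))" .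

  define A where "A = Hs \<times> Hs"
  have fA: "finite A" using fin by (simp add: A_def)
  define E where "E v v' l u = avg W (\<lambda>w. avg W (\<lambda>w'. avg X (\<lambda>x. R (l, u, x) (v, w) * cnj (R (l, u, x) (v', w')))))" for v v' l u
  have "avg (A \<times> W) (\<lambda>\<theta>. avg (A \<times> W) (\<lambda>\<theta>'. avg (A \<times> A \<times> X) (\<lambda>z. R z \<theta> * cnj (R z \<theta>')))) =
    avg A (\<lambda>v. avg W (\<lambda>w. avg A (\<lambda>v'. avg W (\<lambda>w'. avg A (\<lambda>l. avg A (\<lambda>u. avg X (\<lambda>x. R (l, u, x) (v, w) * cnj (R (l, u, x) (v', w')))))))))"
    by (simp add: avg_prod fA fin)
  also have "\<dots> = avg A (\<lambda>v. avg A (\<lambda>v'. avg A (\<lambda>l. avg A (\<lambda>u. E v v' l u))))"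
  proof (rule avg_cong[OF refl])
    fix v
    let ?K = "\<lambda>w v' w' l u. avg X (\<lambda>x. R (l, u, x) (v, w) * cnj (R (l, u, x) (v', w')))"
    have "avg W (\<lambda>w. avg A (\<lambda>v'. avg W (\<lambda>w'. avg A (\<lambda>l. avg A (\<lambda>u. ?K w v' w' l u))))) =
      avg A (\<lambda>v'. avg W (\<lambda>w. avg W (\<lambda>w'. avg A (\<lambda>l. avg A (\<lambda>u. ?K w v' w' l u)))))" by (rule avg_swap)
    also have "\<dots> = avg A (\<lambda>v'. avg W (\<lambda>w. avg A (\<lambda>l. avg W (\<lambda>w'. avg A (\<lambda>u. ?K w v' w' l u)))))" by (intro avg_cong[OF refl] avg_swap)
    also have "\<dots> = avg A (\<lambda>v'. avg A (\<lambda>l. avg W (\<lambda>w. avg W (\<lambda>w'. avg A (\<lambda>u. ?K w v' w' l u)))))" by (intro avg_cong[OF refl] avg_swap)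
    also have "\<dots> = avg A (\<lambda>v'. avg A (\<lambda>l. avg W (\<lambda>w. avg A (\<lambda>u. avg W (\<lambda>w'. ?K w v' w' l u)))))" by (intro avg_cong[OF refl] avg_swap)
    also have "\<dots> = avg A (\<lambda>v'. avg A (\<lambda>l. avg A (\<lambda>u. avg W (\<lambda>w. avg W (\<lambda>w'. ?K w v' w' l u)))))" by (intro avg_cong[OF refl] avg_swap)
    finally show "avg W (\<lambda>w. avg A (\<lambda>v'. avg W (\<lambda>w'. avg A (\<lambda>l. avg A (\<lambda>u. ?K w v' w' l u))))) = avg A (\<lambda>v'. avg A (\<lambda>l. avg A (\<lambda>u. E v v' l u)))"
      unfolding E_def .
  qed
  finally have "(((\<epsilon>\<^sup>2)\<^sup>2)\<^sup>2)\<^sup>2 \<le> norm (avg A (\<lambda>v. avg A (\<lambda>v'. avg A (\<lambda>l. avg A (\<lambda>u. E v v' l u)))))"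
    by (rule Re_le_norm_trans[OF e4[folded A_def]])
  also have "\<dots> \<le> avg A (\<lambda>v. norm (avg A (\<lambda>v'. avg A (\<lambda>l. avg A (\<lambda>u. E v v' l u)))))" by (rule norm_avg_le)
  also have "\<dots> \<le> avg A (\<lambda>v. avg A (\<lambda>v'. avg A (\<lambda>l. avg A (\<lambda>u. norm (E v v' l u)))))"
    by (intro avg_mono order_trans[OF norm_avg_le] order.refl)
  finally have e5: "(((\<epsilon>\<^sup>2)\<^sup>2)\<^sup>2)\<^sup>2 \<le> avg A (\<lambda>v. avg A (\<lambda>v'. avg A (\<lambda>l. avg A (\<lambda>u. norm (E v v' l u)))))" .
  \<comment> \<open>Four applications of Cauchy-Schwarz give the exponent 16, and three functions
    are then removed by \<open>linear_configuration\<close>, giving the factor 2^3.\<close>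
  have "(1 / (2 * D)) ^ 128 = ((((\<epsilon>\<^sup>2)\<^sup>2)\<^sup>2)\<^sup>2) ^ (2 ^ 3)" by (simp add: \<epsilon>_def power_mult[symmetric])
  also have "\<dots> \<le> avg A (\<lambda>v. avg A (\<lambda>v'. avg A (\<lambda>l. avg A (\<lambda>u. norm (E v v' l u))))) ^ (2 ^ 3)"
    by (rule power_mono[OF e5]) simp
  also have "\<dots> \<le> avg A (\<lambda>v. avg A (\<lambda>v'. avg A (\<lambda>l. avg A (\<lambda>u. norm (E v v' l u)))) ^ (2 ^ 3))"
    by (intro avg_pow2 avg_nonneg) auto
  also have "\<dots> \<le> avg A (\<lambda>v. avg A (\<lambda>v'. avg A (\<lambda>l. avg A (\<lambda>u. norm (E v v' l u))) ^ (2 ^ 3)))"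
    by (intro avg_mono avg_pow2 avg_nonneg) auto
  also have "\<dots> \<le> avg A (\<lambda>v. avg A (\<lambda>v'. avg A (\<lambda>l. avg A (\<lambda>u. norm (E v v' l u)) ^ (2 ^ 3))))"
    by (intro avg_mono avg_pow2 avg_nonneg) auto
  also have "\<dots> \<le> avg A (\<lambda>v. avg A (\<lambda>v'. avg A (\<lambda>l. avg A (\<lambda>u. norm (E v v' l u) ^ (2 ^ 3)))))"
    by (intro avg_mono avg_pow2 avg_nonneg) auto
  also have "\<dots> \<le> avg A (\<lambda>v. avg A (\<lambda>v'. avg A (\<lambda>l. avg A (\<lambda>u. avg (listset (replicate 3 (A \<times> A))) (\<lambda>ps.
       Re (avg X (dl (pet_dirs q (dif l) (dif u) (dif v) (dif v') ps) f)))))))"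
  proof (intro avg_mono)
    fix v v' l u :: "int \<times> int"
    define sl0 where "sl0 p = 2 * q * dif v * fst p" for p :: "int \<times> int"
    define gs where "gs = [((\<lambda>x. cnj (\<beta> l u v' x)), \<lambda>p::int\<times>int. 2 * q * (dif v' - dif u) * snd p),
      ((\<lambda>x. cnj (\<gamma> l u v' x)), \<lambda>p::int\<times>int. 2 * q * dif v' * snd p), (\<beta> l u v, \<lambda>p::int\<times>int. 2 * q * (dif v - dif u) * fst p)]"
    have sl: "sum_list (map (\<lambda>p. c * fst p) ps) = c * sum_list (map fst ps)" "sum_list (map (\<lambda>p. c * snd p) ps) = c * sum_list (map snd ps)"
      for c :: int and ps :: "(int \<times> int) list" by (induction ps) (auto simp: distrib_left)
    have "E v v' l u = avg (listset (map (\<lambda>I. I \<times> I) (replicate 3 Hs))) (\<lambda>ps. avg X (\<lambda>x. R (l, u, x) (v, map fst ps) * cnj (R (l, u, x) (v', map snd ps))))"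
    proof -
      have "avg (listset (map (\<lambda>I. I \<times> I) (replicate 3 Hs))) (\<lambda>ps. avg X (\<lambda>x. R (l, u, x) (v, map fst ps) * cnj (R (l, u, x) (v', map snd ps)))) =
        avg W (\<lambda>w. avg W (\<lambda>w'. avg X (\<lambda>x. R (l, u, x) (v, map fst (zip w w')) * cnj (R (l, u, x) (v', map snd (zip w w'))))))"
        unfolding W_def by (rule avg_listset_zip) (use fin in \<open>simp split: if_splits\<close>)
      also have "\<dots> = E v v' l u" unfolding E_def
      proof (rule avg_cong[OF refl], rule avg_cong[OF refl])
        fix w w' assume "w \<in> W" "w' \<in> W"
        then have "length w = length w'" unfolding W_def by (auto dest!: length_listset)
        then show "avg X (\<lambda>x. R (l, u, x) (v, map fst (zip w w')) * cnj (R (l, u, x) (v', map snd (zip w w')))) =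
          avg X (\<lambda>x. R (l, u, x) (v, w) * cnj (R (l, u, x) (v', w')))" by simp
      qed
      finally show ?thesis ..
    qed
    also have "\<dots> = avg (listset (replicate 3 A)) (\<lambda>ps. avg {0..<P} (\<lambda>x. \<gamma> l u v (x + sum_list (map sl0 ps)) * pv gs ps x))"
      unfolding A_def map_replicate X_def
      by (intro avg_cong refl) (simp only: R_def prod.case pv_def gs_def list.map fst_conv snd_conv sl0_def[abs_def] sl
          prod_list.Cons prod_list.Nil complex_cnj_mult mult_1_right, simp only: mult_ac)
    finally have "norm (E v v' l u) ^ (2 ^ 3) = norm (avg (listset (replicate 3 A)) (\<lambda>ps. avg {0..<P} (\<lambda>x. \<gamma> l u v (x + sum_list (map sl0 ps)) * pv gs ps x))) ^ (2 ^ 3)" by simp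
    also have "\<dots> \<le> Re (avg (listset (replicate 3 (A \<times> A))) (\<lambda>ps. avg {0..<P} (dl
        (map2 (\<lambda>g p. (sl0 (fst p) - snd g (fst p)) - (sl0 (snd p) - snd g (snd p))) gs ps) (\<gamma> l u v))))"
    proof (rule linear_configuration[OF P0 fA])
      show "per P (\<gamma> l u v)" by (simp add: per_def \<gamma>_def fP)
      show "per P (fst g)" if "g \<in> set gs" for g using that by (auto simp: gs_def per_def \<beta>_def \<gamma>_def fP)
      show "norm (fst g x) \<le> 1" if "g \<in> set gs" for g x
        using that by (auto simp: gs_def \<beta>_def \<gamma>_def norm_mult mult_le_one f(2))
    qed (auto simp: gs_def)
    also have "\<dots> = avg (listset (replicate 3 (A \<times> A))) (\<lambda>ps. Re (avg X (dl (pet_dirs q (dif l) (dif u) (dif v) (dif v') ps) f)))"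
      unfolding Re_avg[of "listset _"]
    proof (rule avg_cong[OF refl], rule arg_cong[of _ _ Re])
      fix ps assume "ps \<in> listset (replicate 3 (A \<times> A))"
      then have "length ps = 3" using length_listset by fastforce
      then obtain p1 p2 p3 where ps: "ps = [p1, p2, p3]" by (auto simp: numeral_3_eq_3 length_Suc_conv)
      define hs where "hs = map2 (\<lambda>g p. (sl0 (fst p) - snd g (fst p)) - (sl0 (snd p) - snd g (snd p))) gs ps"
      have hs: "pet_dirs q (dif l) (dif u) (dif v) (dif v') ps = 2 * q * (dif l * (dif u + dif v)) # hs"
        unfolding pet_dirs_def hs_def ps gs_def sl0_def by (simp add: algebra_simps)
      have "\<gamma> l u v = (\<lambda>x. dd (2 * q * (dif l * (dif u + dif v))) f (x + (C' u v + 2 * q * snd l * (dif u + dif v))))"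
        by (simp add: \<gamma>_def dd_def dif_def[of l] algebra_simps)
      then show "avg {0..<P} (dl hs (\<gamma> l u v)) = avg X (dl (pet_dirs q (dif l) (dif u) (dif v) (dif v') ps) f)"
        unfolding X_def hs dl.simps
        by (intro avg_per_shift_eq[OF P0 per_dl[OF per_dd], where h = "C' u v + 2 * q * snd l * (dif u + dif v)"]) (use f in \<open>auto simp: dl_shift P_def\<close>)
    qed
    finally show "norm (E v v' l u) ^ (2 ^ 3) \<le> avg (listset (replicate 3 (A \<times> A))) (\<lambda>ps. Re (avg X (dl (pet_dirs q (dif l) (dif u) (dif v) (dif v') ps) f)))" .
  qed
  finally show ?thesis unfolding A_def Hs_def X_def P_def .
qed

end

subsection \<open>Concatenation of box norms\<close>

lemma avg_le_fibre:
  fixes \<Phi> :: "int \<Rightarrow> real"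
  assumes T: "T > 0" and A: "finite A" and \<Phi>: "per T \<Phi>" "\<And>x. 0 \<le> \<Phi> x"
    and B: "\<And>s. real (card {a\<in>A. g a mod T = s}) \<le> B"
  shows "avg A (\<lambda>a. \<Phi> (g a)) \<le> B * T / card A * avg {0..<T} \<Phi>"
proof -
  have "(\<Sum>a\<in>A. \<Phi> (g a)) = (\<Sum>a\<in>A. \<Phi> (g a mod T))" by (simp add: per_mod[OF \<Phi>(1)])
  also have "\<dots> = (\<Sum>s\<in>{0..<T}. \<Sum>a\<in>{a\<in>A. g a mod T = s}. \<Phi> (g a mod T))"
    by (rule sum.group[symmetric, OF A]) (use T in auto)
  also have "\<dots> = (\<Sum>s\<in>{0..<T}. real (card {a\<in>A. g a mod T = s}) * \<Phi> s)"
    by (intro sum.cong refl) simp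
  also have "\<dots> \<le> (\<Sum>s\<in>{0..<T}. B * \<Phi> s)" by (intro sum_mono mult_right_mono B \<Phi>)
  also have "\<dots> = B * T * avg {0..<T} \<Phi>" using T by (simp add: avg_def sum_distrib_left[symmetric])
  finally show ?thesis by (simp add: avg_def[of A] divide_right_mono)
qed

lemma card_congruent:
  fixes a H :: int
  assumes a: "a \<ge> 1" and S: "S \<subseteq> {1..H}" and c: "\<And>x y. x \<in> S \<Longrightarrow> y \<in> S \<Longrightarrow> a dvd x - y" and H: "H \<ge> 1"
  shows "real (card S) \<le> H / a + 1"
proof -
  have "inj_on (\<lambda>x. x div a) S"
  proof (rule inj_onI)
    fix x y assume xy: "x \<in> S" "y \<in> S" "x div a = y div a"
    then have "x mod a = y mod a" using c by (simp add: mod_eq_dvd_iff)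
    with xy(3) show "x = y" by (metis mult_div_mod_eq)
  qed
  moreover have "(\<lambda>x. x div a) ` S \<subseteq> {0..H div a}"
  proof (rule image_subsetI)
    fix x assume "x \<in> S"
    then have "1 \<le> x" "x \<le> H" using S by auto
    then show "x div a \<in> {0..H div a}" using a by (auto intro!: zdiv_mono1 simp: pos_imp_zdiv_nonneg_iff)
  qed
  ultimately have "card S \<le> card {0..H div a}" by (metis card_image card_mono finite_atLeastAtMost_int)
  also have "real \<dots> = real_of_int (H div a) + 1" using a H by (simp add: pos_imp_zdiv_nonneg_iff of_nat_nat)
  also have "\<dots> \<le> H / a + 1" using real_of_int_div4[of H a] by simp
  finally show ?thesis by simp
qed

text \<open>The pairs for which \<open>\<alpha> k - \<beta> k'\<close> with \<open>k, k' \<le> H\<close> is far from equidistributed.\<close>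
definition bad :: "int \<Rightarrow> int \<Rightarrow> int \<Rightarrow> int \<Rightarrow> bool" where
  "bad H m \<alpha> \<beta> \<longleftrightarrow> \<bar>\<alpha>\<bar> * m < H \<or> gcd \<alpha> \<beta> > m"

text \<open>No residue is hit more than m^2 + 1 times. Since 12 H^2 is below T, two hits give an
  equation \<alpha> x = \<beta> y between integers, whose solutions have y divisible by |\<alpha>| /
  gcd, at least H / m^2 for a pair that is not bad.\<close>

lemma avg_generic:
  fixes \<Phi> :: "int \<Rightarrow> real" and H m :: int
  assumes T: "T > 0" "12 * H\<^sup>2 < T" and H: "H \<ge> 1" "m \<ge> 1" and \<Phi>: "per T \<Phi>" "\<And>x. 0 \<le> \<Phi> x"
    and ab: "\<not> bad H m \<alpha> \<beta>" "\<bar>\<alpha>\<bar> \<le> 3 * H" "\<bar>\<beta>\<bar> \<le> 3 * H"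
  shows "avg ({1..H} \<times> {1..H}) (\<lambda>k. \<Phi> (2 * (\<alpha> * fst k - \<beta> * snd k) + c)) \<le> (real_of_int m ^ 2 + 1) * T / (real_of_int H)\<^sup>2 * avg {0..<T} \<Phi>"
proof -
  let ?A = "{1..H} \<times> {1..H}"
  let ?g = "\<lambda>k :: int \<times> int. 2 * (\<alpha> * fst k - \<beta> * snd k) + c"
  have a: "H \<le> \<bar>\<alpha>\<bar> * m" "gcd \<alpha> \<beta> \<le> m" using ab(1) by (auto simp: bad_def)
  have a0: "\<alpha> \<noteq> 0" using a H by auto
  define d where "d = gcd \<alpha> \<beta>"
  have d: "d \<ge> 1" "d \<le> m" using a0 a gcd_pos_int[of \<alpha> \<beta>] unfolding d_def by linarith+
  define e where "e = \<bar>\<alpha>\<bar> div d"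
  have ed: "\<bar>\<alpha>\<bar> = e * d" unfolding e_def d_def by (simp add: dvd_div_mult_self)
  have e1: "e \<ge> 1" using ed a0 d by (smt (verit) mult_nonneg_nonneg mult_nonpos_nonneg)
  have "avg ?A (\<lambda>k. \<Phi> (?g k)) \<le> (real_of_int m ^ 2 + 1) * T / card ?A * avg {0..<T} \<Phi>"
  proof (rule avg_le_fibre[OF T(1) _ \<Phi>])
    fix s
    define S where "S = {k\<in>?A. ?g k mod T = s}"
    have eq: "\<alpha> * (fst k - fst k') = \<beta> * (snd k - snd k')" if k: "k \<in> S" "k' \<in> S" for k k'
    proof -
      define z where "z = \<alpha> * (fst k - fst k') - \<beta> * (snd k - snd k')"
      have "?g k mod T = ?g k' mod T" using k by (simp add: S_def)
      then have "T dvd ?g k - ?g k'" by (simp add: mod_eq_dvd_iff)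
      also have "?g k - ?g k' = 2 * z" by (simp add: z_def algebra_simps)
      finally have dv: "T dvd \<bar>2 * z\<bar>" by simp
      have k1: "\<bar>fst k - fst k'\<bar> \<le> H" "\<bar>snd k - snd k'\<bar> \<le> H" using k by (auto simp: S_def)
      have "\<bar>z\<bar> \<le> \<bar>\<alpha> * (fst k - fst k')\<bar> + \<bar>\<beta> * (snd k - snd k')\<bar>" unfolding z_def by simp
      also have "\<dots> \<le> 3 * H * H + 3 * H * H" unfolding abs_mult using k1 ab H by (intro add_mono mult_mono) auto
      finally have "\<bar>2 * z\<bar> < T" using T by (simp add: power2_eq_square)
      moreover have "\<not> T dvd \<bar>2 * z\<bar>" if "2 * z \<noteq> 0" "\<bar>2 * z\<bar> < T" by (rule zdvd_not_zless) (use that in auto)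
      ultimately have "z = 0" using dv by fastforce
      then show ?thesis by (simp add: z_def)
    qed
    have fS: "finite S" unfolding S_def by simp
    have inj: "inj_on snd S"
    proof (rule inj_onI)
      fix k k' assume k: "k \<in> S" "k' \<in> S" "snd k = snd k'"
      then have "\<alpha> * (fst k - fst k') = 0" using eq[OF k(1,2)] by simp
      then show "k = k'" using a0 k(3) by (simp add: prod_eq_iff)
    qed
    have "real (card (snd ` S)) \<le> H / e + 1"
    proof (rule card_congruent[OF e1 _ _ H(1)])
      show "snd ` S \<subseteq> {1..H}" by (auto simp: S_def)
      fix x y assume "x \<in> snd ` S" "y \<in> snd ` S"
      then obtain k k' where k: "k \<in> S" "k' \<in> S" "x = snd k" "y = snd k'" by auto
      have co: "coprime (\<alpha> div d) (\<beta> div d)" unfolding d_def using a0 by (intro div_gcd_coprime) auto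
      have "\<alpha> = d * (\<alpha> div d)" "\<beta> = d * (\<beta> div d)" unfolding d_def by simp_all
      then have "d * (\<alpha> div d * (fst k - fst k')) = d * (\<beta> div d * (x - y))"
        using eq[OF k(1,2)] k by (metis mult.assoc)
      then have "\<alpha> div d * (fst k - fst k') = \<beta> div d * (x - y)" using d by simp
      then have "\<alpha> div d dvd \<beta> div d * (x - y)" by (metis dvd_triv_left)
      then have "\<alpha> div d dvd x - y" using co by (simp add: coprime_dvd_mult_right_iff)
      moreover have "e = \<bar>\<alpha> div d\<bar>" unfolding e_def d_def by (simp add: abs_div)
      ultimately show "e dvd x - y" by simp
    qed
    also have "H / e + 1 \<le> real_of_int m ^ 2 + 1"
    proof -
      have "H \<le> e * d * m" using a ed by simp
      also have "\<dots> \<le> e * m * m" using d e1 by (intro mult_right_mono mult_left_mono) auto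
      finally have "real_of_int H \<le> real_of_int (e * m * m)" by (simp only: of_int_le_iff)
      then show ?thesis using e1 by (simp add: field_simps power2_eq_square)
    qed
    finally show "real (card {k\<in>?A. ?g k mod T = s}) \<le> real_of_int m ^ 2 + 1"
      unfolding S_def[symmetric] using card_image[OF inj] by simp
  qed simp
  also have "real (card ?A) = (real_of_int H)\<^sup>2" using H by (simp add: card_cartesian_product power2_eq_square)
  finally show ?thesis .
qed

lemma sum_inverse_squares: "m \<le> n \<Longrightarrow> 1 \<le> m \<Longrightarrow> (\<Sum>d\<in>{m+1..n::int}. 1 / (real_of_int d)\<^sup>2) \<le> 1 / m - 1 / n"
proof (induction n rule: int_ge_induct)
  case (step n)
  have "{m+1..n+1} = insert (n+1) {m+1..n}" using step by auto
  moreover have "1 / (real_of_int (n+1))\<^sup>2 \<le> 1 / n - 1 / real_of_int (n+1)"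
  proof -
    have n: "real_of_int n \<ge> 1" using step by simp
    then have "1 / (real_of_int (n+1))\<^sup>2 \<le> 1 / (real_of_int n * real_of_int (n+1))"
      by (intro divide_left_mono) (auto simp: power2_eq_square)
    also have "\<dots> = 1 / n - 1 / real_of_int (n+1)" using n by (simp add: field_simps)
    finally show ?thesis .
  qed
  ultimately show ?case using step by simp
qed simp

lemma avg_dvd:
  fixes H c d :: int
  assumes "H \<ge> 1" "d \<ge> 1"
  shows "avg {1..H} (\<lambda>h. of_bool (d dvd c + h)) \<le> 1 / d + 1 / real_of_int H"
proof -
  have "real (card {h\<in>{1..H}. d dvd c + h}) \<le> H / d + 1"
  proof (rule card_congruent[OF assms(2) _ _ assms(1)])
    fix x y assume "x \<in> {h\<in>{1..H}. d dvd c + h}" "y \<in> {h\<in>{1..H}. d dvd c + h}"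
    then have "d dvd (c + x) - (c + y)" by (intro dvd_diff) auto
    then show "d dvd x - y" by simp
  qed auto
  then show ?thesis using assms by (simp add: avg_indicator field_simps)
qed

text \<open>A small |c + h| has probability of order 1 / m. A common divisor d has probability at
  most (1/d + 1/H)^2, and summing over d beyond m gives 1 / m again; divisors above 3 H cannot
  occur.\<close>

lemma avg_bad:
  fixes H m c c' :: int
  assumes H: "7 * m \<le> H" "m \<ge> 1" and c: "\<bar>c\<bar> \<le> 2 * H" "\<bar>c'\<bar> \<le> 2 * H"
  shows "avg {1..H} (\<lambda>h. avg {1..H} (\<lambda>k. of_bool (bad H m (c + h) (c' + k)))) \<le> 5 / real_of_int m"
proof -
  have H1: "H \<ge> 1" using H by simp
  have Hne: "finite {1..H}" "{1..H} \<noteq> {}" using H1 by auto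
  have "avg {1..H} (\<lambda>h. avg {1..H} (\<lambda>k. of_bool (bad H m (c + h) (c' + k)))) \<le>
     avg {1..H} (\<lambda>h. avg {1..H} (\<lambda>k. (of_bool (\<bar>c + h\<bar> * m < H) :: real) + (\<Sum>d\<in>{m+1..3*H}. of_bool (d dvd c + h) * of_bool (d dvd c' + k))))"
  proof (intro avg_mono)
    fix h k assume hk: "h \<in> {1..H}" "k \<in> {1..H}"
    show "of_bool (bad H m (c + h) (c' + k)) \<le> of_bool (\<bar>c + h\<bar> * m < H) + (\<Sum>d\<in>{m+1..3*H}. of_bool (d dvd c + h) * of_bool (d dvd c' + k) :: real)"
    proof (cases "bad H m (c + h) (c' + k) \<and> \<not> \<bar>c + h\<bar> * m < H")
      case False
      then show ?thesis by (auto intro!: sum_nonneg)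
    next
      case True
      then have g: "gcd (c + h) (c' + k) > m" and "c + h \<noteq> 0" using H1 by (auto simp: bad_def)
      have "gcd (c + h) (c' + k) \<le> \<bar>c + h\<bar>" using \<open>c + h \<noteq> 0\<close> by (intro zdvd_imp_le) auto
      also have "\<dots> \<le> 3 * H" using c hk by auto
      finally have "gcd (c + h) (c' + k) \<in> {m+1..3*H}" using g by simp
      then have "(\<lambda>d. of_bool (d dvd c + h) * of_bool (d dvd c' + k) :: real) (gcd (c + h) (c' + k)) \<le> (\<Sum>d\<in>{m+1..3*H}. of_bool (d dvd c + h) * of_bool (d dvd c' + k) :: real)"
        by (intro member_le_sum) auto
      then show ?thesis using True by simp
    qed
  qed
  also have "\<dots> = avg {1..H} (\<lambda>h. of_bool (\<bar>c + h\<bar> * m < H)) + (\<Sum>d\<in>{m+1..3*H}. avg {1..H} (\<lambda>h. of_bool (d dvd c + h)) * avg {1..H} (\<lambda>k. of_bool (d dvd c' + k)))"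
    by (simp only: avg_add avg_sum avg_const[OF Hne] avg_cmult avg_multc)
  also have "\<dots> \<le> (2 / real_of_int m + 1 / real_of_int H) + (\<Sum>d\<in>{m+1..3*H}. 2 * (1 / (real_of_int d)\<^sup>2) + 2 * (1 / (real_of_int H)\<^sup>2))"
  proof (intro add_mono sum_mono)
    have "{h\<in>{1..H}. \<bar>c + h\<bar> * m < H} \<subseteq> {- c - (H - 1) div m..- c + (H - 1) div m}"
    proof
      fix h assume "h \<in> {h\<in>{1..H}. \<bar>c + h\<bar> * m < H}"
      then have "\<bar>c + h\<bar> * m \<le> H - 1" by simp
      then have "\<bar>c + h\<bar> \<le> (H - 1) div m" using H(2) zdiv_mono1[of "\<bar>c + h\<bar> * m" "H - 1" m] by simp
      then show "h \<in> {- c - (H - 1) div m..- c + (H - 1) div m}" by auto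
    qed
    then have "card {h\<in>{1..H}. \<bar>c + h\<bar> * m < H} \<le> card {- c - (H - 1) div m..- c + (H - 1) div m}" by (intro card_mono) auto
    also have "real \<dots> \<le> 2 * (H / m) + 1"
    proof -
      have "0 \<le> (H - 1) div m" using H1 H(2) by (simp add: pos_imp_zdiv_nonneg_iff)
      then have "real (card {- c - (H - 1) div m..- c + (H - 1) div m}) = 2 * real_of_int ((H - 1) div m) + 1" by (simp add: of_nat_nat)
      also have "real_of_int ((H - 1) div m) \<le> real_of_int (H - 1) / m" by (rule real_of_int_div4)
      also have "\<dots> \<le> H / m" using H by (intro divide_right_mono) auto
      finally show ?thesis by simp
    qed
    finally have "real (card {h\<in>{1..H}. \<bar>c + h\<bar> * m < H}) \<le> 2 * (H / m) + 1" by simp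
    then show "avg {1..H} (\<lambda>h. of_bool (\<bar>c + h\<bar> * m < H)) \<le> 2 / real_of_int m + 1 / real_of_int H"
      using H1 H(2) by (simp add: avg_indicator field_simps)
  next
    fix d assume d: "d \<in> {m+1..3*H}"
    then have d1: "d \<ge> 1" using H by simp
    have "avg {1..H} (\<lambda>h. of_bool (d dvd c + h)) * avg {1..H} (\<lambda>k. of_bool (d dvd c' + k)) \<le> (1 / d + 1 / real_of_int H) * (1 / d + 1 / real_of_int H)"
      using d1 H1 by (intro mult_mono avg_dvd avg_nonneg) (auto intro!: add_nonneg_nonneg)
    also have "\<dots> \<le> 2 * (1 / (real_of_int d)\<^sup>2) + 2 * (1 / (real_of_int H)\<^sup>2)"
    proof -
      have "(x + y) * (x + y) \<le> 2 * x\<^sup>2 + 2 * y\<^sup>2" for x y :: real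
        using sum_squares_bound[of x y] by (simp add: power2_eq_square algebra_simps)
      from this[of "1 / d" "1 / real_of_int H"] show ?thesis by (simp add: power_divide)
    qed
    finally show "avg {1..H} (\<lambda>h. of_bool (d dvd c + h)) * avg {1..H} (\<lambda>k. of_bool (d dvd c' + k)) \<le> 2 * (1 / (real_of_int d)\<^sup>2) + 2 * (1 / (real_of_int H)\<^sup>2)" .
  qed
  also have "(\<Sum>d\<in>{m+1..3*H}. 2 * (1 / (real_of_int d)\<^sup>2) + 2 * (1 / (real_of_int H)\<^sup>2)) =
     2 * (\<Sum>d\<in>{m+1..3*H}. 1 / (real_of_int d)\<^sup>2) + card {m+1..3*H} * (2 * (1 / (real_of_int H)\<^sup>2))"
    by (simp add: sum.distrib sum_distrib_left)
  also have "\<dots> \<le> 2 * (1 / m) + (3 * H) * (2 * (1 / (real_of_int H)\<^sup>2))"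
  proof (intro add_mono mult_left_mono mult_right_mono)
    have "(\<Sum>d\<in>{m+1..3*H}. 1 / (real_of_int d)\<^sup>2) \<le> 1 / m - 1 / real_of_int (3 * H)" by (rule sum_inverse_squares) (use H in auto)
    also have "\<dots> \<le> 1 / m" using H1 by simp
    finally show "(\<Sum>d\<in>{m+1..3*H}. 1 / (real_of_int d)\<^sup>2) \<le> 1 / m" .
    show "real (card {m+1..3*H}) \<le> real_of_int (3 * H)" using H by simp
  qed auto
  also have "2 / real_of_int m + 1 / real_of_int H + (2 * (1 / m) + (3 * H) * (2 * (1 / (real_of_int H)\<^sup>2))) = 4 / m + 7 / real_of_int H"
    using H1 by (simp add: field_simps power2_eq_square)
  also have "\<dots> \<le> 4 / m + 1 / m" using H by (simp add: field_simps)
  finally show ?thesis by simp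
qed

lemma dl_dd: "dl hs (dd d f) = dd d (dl hs f)"
proof (induction hs arbitrary: f)
  case (Cons h hs)
  show ?case unfolding dl.simps dd_commute[of h d] Cons.IH ..
qed simp

text \<open>Van der Corput in a single direction turns an average over products into one over differences of
  products, whose distribution is essentially uniform.\<close>
lemma concatenate:
  assumes T: "T > 0" and K: "per T K" and K1: "\<And>x. norm (K x) \<le> 1" and I: "finite I"
  shows "(avg I (\<lambda>i. (norm (avg {0..<T} (dd (\<theta> i) K)))\<^sup>2))\<^sup>2
    \<le> avg I (\<lambda>i. avg I (\<lambda>i'. (norm (avg {0..<T} (dd (\<theta> i - \<theta> i') K)))\<^sup>2))"
proof -
  let ?X = "{0..<T}"
  have sq: "of_real ((norm (avg ?X (dd d K)))\<^sup>2) = avg ?X (\<lambda>h. avg ?X (dd d (dd h K)))" for d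
  proof -
    have "dd d (dd h K) = (\<lambda>t. dd d K (t + h) * cnj (dd d K t))" for h
      by (simp only: dd_commute[of d h]) (simp add: dd_def[of h "dd d K"] fun_eq_iff)
    then show ?thesis unfolding avg_autocorrelation[OF T per_dd[OF K], symmetric] by simp
  qed
  have "of_real (avg I (\<lambda>i. (norm (avg ?X (dd (\<theta> i) K)))\<^sup>2)) = avg I (\<lambda>i. avg ?X (\<lambda>h. avg ?X (dd (\<theta> i) (dd h K))))"
    unfolding avg_of_real[symmetric] sq ..
  also have "\<dots> = avg (?X \<times> ?X) (\<lambda>z. avg I (\<lambda>i. dd (\<theta> i) (dd (fst z) K) (snd z)))"
    unfolding avg_swap[of I] by (simp add: avg_prod)
  also have "\<dots> = avg (?X \<times> ?X) (\<lambda>z. cnj (dd (fst z) K (snd z)) * avg I (\<lambda>i. dd (fst z) K (snd z + \<theta> i)))"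
    unfolding avg_cmult[symmetric] by (simp add: dd_def[of "\<theta> _"] mult.commute)
  finally have e: "of_real (avg I (\<lambda>i. (norm (avg ?X (dd (\<theta> i) K)))\<^sup>2)) = avg (?X \<times> ?X) (\<lambda>z. cnj (dd (fst z) K (snd z)) * avg I (\<lambda>i. dd (fst z) K (snd z + \<theta> i)))" .
  have "(avg I (\<lambda>i. (norm (avg ?X (dd (\<theta> i) K)))\<^sup>2))\<^sup>2 = (norm (of_real (avg I (\<lambda>i. (norm (avg ?X (dd (\<theta> i) K)))\<^sup>2)) :: complex))\<^sup>2"
    by (simp add: norm_of_real)
  also have "\<dots> \<le> Re (avg I (\<lambda>i. avg I (\<lambda>i'. avg (?X \<times> ?X) (\<lambda>z. dd (fst z) K (snd z + \<theta> i) * cnj (dd (fst z) K (snd z + \<theta> i'))))))"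
    unfolding e by (rule avg_CS) (simp add: norm_dd K1)
  also have "avg I (\<lambda>i. avg I (\<lambda>i'. avg (?X \<times> ?X) (\<lambda>z. dd (fst z) K (snd z + \<theta> i) * cnj (dd (fst z) K (snd z + \<theta> i'))))) =
    avg I (\<lambda>i. avg I (\<lambda>i'. of_real ((norm (avg ?X (dd (\<theta> i - \<theta> i') K)))\<^sup>2)))"
  proof (rule avg_cong[OF refl], rule avg_cong[OF refl])
    fix i i'
    have "avg (?X \<times> ?X) (\<lambda>z. dd (fst z) K (snd z + \<theta> i) * cnj (dd (fst z) K (snd z + \<theta> i'))) =
      avg ?X (\<lambda>h. avg ?X (\<lambda>x. dd (\<theta> i - \<theta> i') (dd h K) (x + \<theta> i')))"
      by (simp add: avg_prod dd_def[of "\<theta> i - \<theta> i'"] add.commute add.left_commute)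
    also have "\<dots> = avg ?X (\<lambda>h. avg ?X (dd (\<theta> i - \<theta> i') (dd h K)))"
      by (intro avg_cong[OF refl] avg_per_shift T per_dd K)
    finally show "avg (?X \<times> ?X) (\<lambda>z. dd (fst z) K (snd z + \<theta> i) * cnj (dd (fst z) K (snd z + \<theta> i'))) = of_real ((norm (avg ?X (dd (\<theta> i - \<theta> i') K)))\<^sup>2)"
      unfolding sq .
  qed
  also have "Re \<dots> = avg I (\<lambda>i. avg I (\<lambda>i'. (norm (avg {0..<T} (dd (\<theta> i - \<theta> i') K)))\<^sup>2))"
    by (simp add: Re_avg del: of_real_power)
  finally show ?thesis .
qed

text \<open>A single product b (e + a) need not be equidistributed, but the difference of two such
  products is linear in b and b' with coefficients e + a and e + a', and these are bad only with
  probability of order 1 / m.\<close>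

lemma concatenate_products:
  fixes H m e :: int
  assumes T: "T > 0" "12 * H\<^sup>2 < T" and H: "7 * m \<le> H" "m \<ge> 1" and K: "per T K" "\<And>x. norm (K x) \<le> 1" and e: "\<bar>e\<bar> \<le> H"
  shows "(avg ({1..H} \<times> {1..H}) (\<lambda>a. avg ({1..H} \<times> {1..H}) (\<lambda>b. (norm (avg {0..<T} (dd (2 * (dif b * (e + dif a))) K)))\<^sup>2)))\<^sup>2
    \<le> 5 / real_of_int m + (real_of_int m ^ 2 + 1) * T / (real_of_int H)\<^sup>2 * avg {0..<T} (\<lambda>g. (norm (avg {0..<T} (dd g K)))\<^sup>2)"
proof -
  define A where "A = {1..H} \<times> {1..H}"
  have H1: "H \<ge> 1" using H by simp
  have Hne: "finite {1..H}" "{1..H} \<noteq> {}" using H1 by auto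
  have Ane: "finite A" "A \<noteq> {}" using Hne by (auto simp: A_def)
  define \<Phi> where "\<Phi> d = (norm (avg {0..<T} (dd d K)))\<^sup>2" for d
  have \<Phi>p: "per T \<Phi>" by (simp add: per_def \<Phi>_def dd_per[OF K(1)])
  have \<Phi>0: "0 \<le> \<Phi> d" for d by (simp add: \<Phi>_def)
  have \<Phi>1: "\<Phi> d \<le> 1" for d unfolding \<Phi>_def
    by (rule power_le_one) (auto intro!: norm_avg_le_bound norm_dd K(2))
  define c where "c = (real_of_int m ^ 2 + 1) * T / (real_of_int H)\<^sup>2 * avg {0..<T} \<Phi>"
  have c0: "0 \<le> c" unfolding c_def using T by (intro mult_nonneg_nonneg avg_nonneg \<Phi>0 divide_nonneg_nonneg) auto
  have "(avg A (\<lambda>a. avg A (\<lambda>b. \<Phi> (2 * (dif b * (e + dif a))))))\<^sup>2 = (avg (A \<times> A) (\<lambda>i. (norm (avg {0..<T} (dd (2 * (dif (snd i) * (e + dif (fst i)))) K)))\<^sup>2))\<^sup>2"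
    by (simp add: \<Phi>_def avg_prod[OF Ane(1) Ane(1)])
  also have "\<dots> \<le> avg (A \<times> A) (\<lambda>i. avg (A \<times> A) (\<lambda>i'. (norm (avg {0..<T} (dd (2 * (dif (snd i) * (e + dif (fst i))) - 2 * (dif (snd i') * (e + dif (fst i')))) K)))\<^sup>2))"
    by (rule concatenate[OF T(1) K]) (use Ane in auto)
  also have "\<dots> = avg A (\<lambda>a. avg A (\<lambda>b. avg A (\<lambda>a'. avg A (\<lambda>b'. \<Phi> (2 * (dif b * (e + dif a)) - 2 * (dif b' * (e + dif a')))))))"
    unfolding \<Phi>_def by (simp add: avg_prod[OF Ane(1) Ane(1)])
  also have "\<dots> = avg A (\<lambda>a. avg A (\<lambda>a'. avg A (\<lambda>b. avg A (\<lambda>b'. \<Phi> (2 * (dif b * (e + dif a)) - 2 * (dif b' * (e + dif a')))))))"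
    by (intro avg_cong[OF refl] avg_swap)
  also have "\<dots> \<le> avg A (\<lambda>a. avg A (\<lambda>a'. of_bool (bad H m (e + dif a) (e + dif a')) + c))"
  proof (intro avg_mono)
    fix a a' assume a: "a \<in> A" "a' \<in> A"
    have da: "\<bar>dif a\<bar> \<le> H" "\<bar>dif a'\<bar> \<le> H" using a by (auto simp: A_def dif_def)
    show "avg A (\<lambda>b. avg A (\<lambda>b'. \<Phi> (2 * (dif b * (e + dif a)) - 2 * (dif b' * (e + dif a'))))) \<le> of_bool (bad H m (e + dif a) (e + dif a')) + c"
    proof (cases "bad H m (e + dif a) (e + dif a')")
      case True
      have "avg A (\<lambda>b. avg A (\<lambda>b'. \<Phi> (2 * (dif b * (e + dif a)) - 2 * (dif b' * (e + dif a'))))) \<le> 1"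
        by (intro avg_le \<Phi>1) auto
      then show ?thesis using True c0 by simp
    next
      case False
      have "avg A (\<lambda>b. avg A (\<lambda>b'. \<Phi> (2 * (dif b * (e + dif a)) - 2 * (dif b' * (e + dif a'))))) =
        avg {1..H} (\<lambda>k. avg {1..H} (\<lambda>l. avg {1..H} (\<lambda>k'. avg {1..H} (\<lambda>l'. \<Phi> (2 * ((k - l) * (e + dif a)) - 2 * ((k' - l') * (e + dif a')))))))"
        unfolding A_def by (simp add: avg_prod[OF Hne(1) Hne(1)] dif_def)
      also have "\<dots> = avg {1..H} (\<lambda>l. avg {1..H} (\<lambda>k. avg {1..H} (\<lambda>k'. avg {1..H} (\<lambda>l'. \<Phi> (2 * ((k - l) * (e + dif a)) - 2 * ((k' - l') * (e + dif a')))))))"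
        by (rule avg_swap)
      also have "\<dots> = avg {1..H} (\<lambda>l. avg {1..H} (\<lambda>k. avg {1..H} (\<lambda>l'. avg {1..H} (\<lambda>k'. \<Phi> (2 * ((k - l) * (e + dif a)) - 2 * ((k' - l') * (e + dif a')))))))"
        by (intro avg_cong[OF refl] avg_swap)
      also have "\<dots> = avg {1..H} (\<lambda>l. avg {1..H} (\<lambda>l'. avg {1..H} (\<lambda>k. avg {1..H} (\<lambda>k'. \<Phi> (2 * ((k - l) * (e + dif a)) - 2 * ((k' - l') * (e + dif a')))))))"
        by (intro avg_cong[OF refl] avg_swap)
      also have "\<dots> \<le> c"
      proof (rule avg_le[OF avg_le])
        fix l l'
        have "avg {1..H} (\<lambda>k. avg {1..H} (\<lambda>k'. \<Phi> (2 * ((k - l) * (e + dif a)) - 2 * ((k' - l') * (e + dif a'))))) =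
          avg ({1..H} \<times> {1..H}) (\<lambda>k. \<Phi> (2 * ((e + dif a) * fst k - (e + dif a') * snd k) + (2 * l' * (e + dif a') - 2 * l * (e + dif a))))"
          by (simp add: avg_prod algebra_simps)
        also have "\<dots> \<le> c" unfolding c_def
          by (rule avg_generic[OF T H1 H(2) \<Phi>p \<Phi>0 False]) (use e da in auto)
        finally show "avg {1..H} (\<lambda>k. avg {1..H} (\<lambda>k'. \<Phi> (2 * ((k - l) * (e + dif a)) - 2 * ((k' - l') * (e + dif a'))))) \<le> c" .
      qed (rule c0)+
      finally show ?thesis using False by simp
    qed
  qed
  also have "\<dots> = avg A (\<lambda>a. avg A (\<lambda>a'. of_bool (bad H m (e + dif a) (e + dif a')))) + c"
    by (simp add: avg_add avg_const[OF Ane])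
  also have "avg A (\<lambda>a. avg A (\<lambda>a'. of_bool (bad H m (e + dif a) (e + dif a')))) =
     avg {1..H} (\<lambda>k. avg {1..H} (\<lambda>l. avg {1..H} (\<lambda>k'. avg {1..H} (\<lambda>l'. of_bool (bad H m ((e - l) + k) ((e - l') + k'))))))"
    unfolding A_def by (simp add: avg_prod[OF Hne(1) Hne(1)] dif_def add_diff_eq diff_add_eq)
  also have "\<dots> = avg {1..H} (\<lambda>l. avg {1..H} (\<lambda>k. avg {1..H} (\<lambda>k'. avg {1..H} (\<lambda>l'. of_bool (bad H m ((e - l) + k) ((e - l') + k'))))))"
    by (rule avg_swap)
  also have "\<dots> = avg {1..H} (\<lambda>l. avg {1..H} (\<lambda>k. avg {1..H} (\<lambda>l'. avg {1..H} (\<lambda>k'. of_bool (bad H m ((e - l) + k) ((e - l') + k'))))))"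
    by (intro avg_cong[OF refl] avg_swap)
  also have "\<dots> = avg {1..H} (\<lambda>l. avg {1..H} (\<lambda>l'. avg {1..H} (\<lambda>k. avg {1..H} (\<lambda>k'. of_bool (bad H m ((e - l) + k) ((e - l') + k'))))))"
    by (intro avg_cong[OF refl] avg_swap)
  also have "\<dots> \<le> 5 / real_of_int m"
    by (intro avg_le avg_bad H) (use e H in auto)
  finally show ?thesis unfolding c_def \<Phi>_def A_def by simp
qed

lemma avg_bad_dif:
  fixes H m e e' :: int
  assumes H: "7 * m \<le> H" "m \<ge> 1" and e: "\<bar>e\<bar> \<le> H" "\<bar>e'\<bar> \<le> H"
  shows "avg ({1..H} \<times> {1..H}) (\<lambda>a. avg ({1..H} \<times> {1..H}) (\<lambda>a'. of_bool (bad H m (e + dif a) (e' + dif a')))) \<le> 5 / real_of_int m"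
proof -
  have Hne: "finite {1..H}" "{1..H} \<noteq> {}" using H by auto
  have "avg ({1..H} \<times> {1..H}) (\<lambda>a. avg ({1..H} \<times> {1..H}) (\<lambda>a'. of_bool (bad H m (e + dif a) (e' + dif a')))) =
     avg {1..H} (\<lambda>k. avg {1..H} (\<lambda>l. avg {1..H} (\<lambda>k'. avg {1..H} (\<lambda>l'. of_bool (bad H m ((e - l) + k) ((e' - l') + k')) :: real))))"
    by (simp add: avg_prod[OF Hne(1) Hne(1)] dif_def add_diff_eq diff_add_eq)
  also have "\<dots> = avg {1..H} (\<lambda>l. avg {1..H} (\<lambda>k. avg {1..H} (\<lambda>k'. avg {1..H} (\<lambda>l'. of_bool (bad H m ((e - l) + k) ((e' - l') + k'))))))"
    by (rule avg_swap)
  also have "\<dots> = avg {1..H} (\<lambda>l. avg {1..H} (\<lambda>k. avg {1..H} (\<lambda>l'. avg {1..H} (\<lambda>k'. of_bool (bad H m ((e - l) + k) ((e' - l') + k'))))))"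
    by (intro avg_cong[OF refl] avg_swap)
  also have "\<dots> = avg {1..H} (\<lambda>l. avg {1..H} (\<lambda>l'. avg {1..H} (\<lambda>k. avg {1..H} (\<lambda>k'. of_bool (bad H m ((e - l) + k) ((e' - l') + k'))))))"
    by (intro avg_cong[OF refl] avg_swap)
  also have "\<dots> \<le> 5 / real_of_int m"
  proof (rule avg_le[OF avg_le])
    fix l l' assume "l \<in> {1..H}" "l' \<in> {1..H}"
    then show "avg {1..H} (\<lambda>k. avg {1..H} (\<lambda>k'. of_bool (bad H m ((e - l) + k) ((e' - l') + k')))) \<le> 5 / real_of_int m"
      using e by (intro avg_bad H) auto
  qed (use H in auto)
  finally show ?thesis .
qed

lemma avg_generic_dif:
  fixes \<Phi> :: "int \<Rightarrow> real" and H m :: int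
  assumes T: "T > 0" "12 * H\<^sup>2 < T" and H: "H \<ge> 1" "m \<ge> 1" and \<Phi>: "per T \<Phi>" "\<And>x. 0 \<le> \<Phi> x"
    and ab: "\<not> bad H m \<alpha> \<beta>" "\<bar>\<alpha>\<bar> \<le> 3 * H" "\<bar>\<beta>\<bar> \<le> 3 * H"
  shows "avg (({1..H} \<times> {1..H}) \<times> ({1..H} \<times> {1..H})) (\<lambda>p. \<Phi> (2 * (\<alpha> * fst (fst p) - \<beta> * snd (fst p)) - 2 * (\<alpha> * fst (snd p) - \<beta> * snd (snd p))))
    \<le> (real_of_int m ^ 2 + 1) * T / (real_of_int H)\<^sup>2 * avg {0..<T} \<Phi>"
proof -
  let ?A = "{1..H} \<times> {1..H}"
  have c0: "0 \<le> (real_of_int m ^ 2 + 1) * T / (real_of_int H)\<^sup>2 * avg {0..<T} \<Phi>"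
    using T by (intro mult_nonneg_nonneg avg_nonneg \<Phi> divide_nonneg_nonneg) auto
  have "avg (?A \<times> ?A) (\<lambda>p. \<Phi> (2 * (\<alpha> * fst (fst p) - \<beta> * snd (fst p)) - 2 * (\<alpha> * fst (snd p) - \<beta> * snd (snd p)))) =
    avg ?A (\<lambda>k. avg ?A (\<lambda>k'. \<Phi> (2 * (\<alpha> * fst k - \<beta> * snd k) + (- (2 * (\<alpha> * fst k' - \<beta> * snd k'))))))"
    by (simp add: avg_prod algebra_simps)
  also have "\<dots> = avg ?A (\<lambda>k'. avg ?A (\<lambda>k. \<Phi> (2 * (\<alpha> * fst k - \<beta> * snd k) + (- (2 * (\<alpha> * fst k' - \<beta> * snd k'))))))"
    by (rule avg_swap)
  also have "\<dots> \<le> (real_of_int m ^ 2 + 1) * T / (real_of_int H)\<^sup>2 * avg {0..<T} \<Phi>"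
    by (rule avg_le[OF avg_generic[OF T H \<Phi> ab] c0])
  finally show ?thesis .
qed

text \<open>Directions divisible by q do not leave the residue class; therefore the derivatives of
  the dual function split into derivatives of the functions \<open>F r\<close>.\<close>

lemma dl_scaled: "dl (map ((*) q) hs) g (r + q * t) = dl hs (\<lambda>t. g (r + q * t)) t"
proof (induction hs arbitrary: g)
  case (Cons h hs)
  have "(\<lambda>t. dd (q * h) g (r + q * t)) = dd h (\<lambda>t. g (r + q * t))" by (simp add: dd_def fun_eq_iff algebra_simps)
  then show ?case by (simp add: Cons.IH)
qed simp

lemma dl_cnj: "dl hs (\<lambda>x. cnj (f x)) x = cnj (dl hs f x)"
proof (induction hs arbitrary: f)
  case (Cons h hs)
  have "dd h (\<lambda>x. cnj (f x)) = (\<lambda>x. cnj (dd h f x))" by (simp add: dd_def fun_eq_iff)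
  then show ?case by (simp add: Cons.IH)
qed simp

text \<open>The choice of m balances two losses: exceptional pairs cost 10 / m and must stay below
  half of 1 / B, while passing to all directions costs about m^2 T / H^2.\<close>

lemma absorb_constants:
  fixes B :: real and m H T :: int
  assumes B: "B \<ge> 2" and m: "m = \<lceil>20 * B\<rceil>" and TH: "real_of_int T / (real_of_int H)\<^sup>2 \<le> B" "T > 0"
  shows "(real_of_int m ^ 2 + 1) * T / (real_of_int H)\<^sup>2 \<le> B ^ 14" "10 / real_of_int m \<le> 1 / (2 * B)" "m \<ge> 1" "7 * m \<le> 280 * B"
proof -
  have m1: "20 * B \<le> m" "m \<le> 40 * B" using B unfolding m by linarith+
  then show m0: "m \<ge> 1" using B by linarith
  have "real_of_int m ^ 2 + 1 \<le> (40 * B) ^ 2 + 1" using m1 m0 by (intro add_right_mono power_mono) auto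
  also have "\<dots> \<le> 1601 * B ^ 2" using B one_le_power[of B 2] by (simp add: power_mult_distrib)
  finally have "(real_of_int m ^ 2 + 1) * (T / (real_of_int H)\<^sup>2) \<le> 1601 * B ^ 2 * B"
    using TH B by (intro mult_mono) auto
  also have "\<dots> = 1601 * B ^ 3" by (simp add: power2_eq_square power3_eq_cube)
  also have "\<dots> \<le> B ^ 14" by (rule pow_absorb[OF B, of _ 11]) auto
  finally show "(real_of_int m ^ 2 + 1) * T / (real_of_int H)\<^sup>2 \<le> B ^ 14" by simp
  show "10 / real_of_int m \<le> 1 / (2 * B)" using m1 B by (simp add: field_simps)
  show "7 * m \<le> 280 * B" using m1 by simp
qed

lemma lower_bound_transfer:
  fixes B v :: real
  assumes B: "B \<ge> 2" and "1 / B \<le> s + B ^ k * v" "s \<le> 1 / (2 * B)"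
  shows "1 / B ^ (k + 2) \<le> v"
proof -
  have "1 / B = 1 / (2 * B) + 1 / (2 * B)" by simp
  then have "1 / (2 * B) \<le> B ^ k * v" using assms by linarith
  then have "1 \<le> (2 * B) * (B ^ k * v)" using B by (simp add: field_simps)
  also have "\<dots> = 2 * (B ^ k * B * v)" by simp
  finally have 1: "1 \<le> 2 * (B ^ k * B * v)" .
  have v: "0 < v"
  proof (rule ccontr)
    assume "\<not> 0 < v"
    then have "B ^ k * B * v \<le> 0" using B by (intro mult_nonneg_nonpos) auto
    with 1 show False by linarith
  qed
  have "2 * (B ^ k * B * v) \<le> B * (B ^ k * B * v)" using B v by (intro mult_right_mono) auto
  also have "\<dots> = B ^ (k + 2) * v" by (simp add: power_add power2_eq_square)
  finally have "1 \<le> B ^ (k + 2) * v" using 1 by linarith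
  then show ?thesis using B by (simp only: pos_divide_le_eq zero_less_power) (simp add: pos_divide_le_eq mult.commute)
qed

section \<open>The \<open>U^5\<close> norm of the dual function\<close>

context config
begin

definition N4 :: "int \<Rightarrow> int \<Rightarrow> int \<Rightarrow> int \<Rightarrow> int \<Rightarrow> real" where
  "N4 r a b c d = (norm (avg {0..<T} (dl [a, b, c, d] (F r))))\<^sup>2"

lemma N4_nonneg: "0 \<le> N4 r a b c d" by (simp add: N4_def)

lemma N4_1: "N4 r a b c d = (norm (avg {0..<T} (dd a (dl [b, c, d] (F r)))))\<^sup>2"
  unfolding N4_def dl_dd[symmetric] by simp

lemma N4_4: "N4 r a b c d = (norm (avg {0..<T} (dd d (dl [a, b, c] (F r)))))\<^sup>2"
  unfolding N4_def by simp

lemma per_N4: "per T (\<lambda>a. N4 r a b c d)" "per T (\<lambda>b. N4 r a b c d)" "per T (\<lambda>c. N4 r a b c d)" "per T (\<lambda>d. N4 r a b c d)"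
  unfolding per_def N4_def by (simp_all add: dd_per per_F per_dd)

text \<open>Cauchy-Schwarz replaces f2 by the conjugate of the dual function at the cost of squaring
  D. Thus the norm bounded from below afterwards is that of the dual function and not of f2.\<close>

lemma dual_energy:
  assumes D: "D > 0" and f2: "per (q * T) f2" "\<And>x. norm (f2 x) \<le> 1"
    and big: "1 / D \<le> norm (avg {0..<q * T} (\<lambda>x. avg {1..M} (\<lambda>y. f0 x * f1 (x + y) * f2 (x + q * y\<^sup>2))))"
  shows "1 / D\<^sup>2 \<le> avg {0..<q * T} (\<lambda>x. (norm (dualf q M f0 f1 x))\<^sup>2)"
    and "avg {0..<q * T} (\<lambda>x. avg {1..M} (\<lambda>y. f0 x * f1 (x + y) * cnj (dualf q M f0 f1 (x + q * y\<^sup>2)))) =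
       of_real (avg {0..<q * T} (\<lambda>x. (norm (dualf q M f0 f1 x))\<^sup>2))"
proof -
  have P0: "q * T > 0" using q T0 by simp
  have dual: "avg {0..<q * T} (\<lambda>x. avg {1..M} (\<lambda>y. f0 x * f1 (x + y) * g (x + q * y\<^sup>2))) = avg {0..<q * T} (\<lambda>x. dualf q M f0 f1 x * g x)"
    if g: "per (q * T) g" for g
  proof -
    have "avg {0..<q * T} (\<lambda>x. avg {1..M} (\<lambda>y. f0 x * f1 (x + y) * g (x + q * y\<^sup>2))) =
      avg {1..M} (\<lambda>y. avg {0..<q * T} (\<lambda>x. f0 x * f1 (x + y) * g (x + q * y\<^sup>2)))" by (rule avg_swap)
    also have "\<dots> = avg {1..M} (\<lambda>y. avg {0..<q * T} (\<lambda>x. (f0 (x - q * y\<^sup>2) * f1 (x - q * y\<^sup>2 + y)) * g x))"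
    proof (rule avg_cong[OF refl], rule avg_per_shift_eq[OF P0, symmetric])
      fix y x
      show "per (q * T) (\<lambda>x. f0 x * f1 (x + y) * g (x + q * y\<^sup>2))"
        using per0 per_shift[OF per1, of y] per_shift[OF g, of "q * y\<^sup>2"] by (simp add: per_def)
      show "(f0 (x - q * y\<^sup>2) * f1 (x - q * y\<^sup>2 + y)) * g x = f0 (x + - (q * y\<^sup>2)) * f1 (x + - (q * y\<^sup>2) + y) * g (x + - (q * y\<^sup>2) + q * y\<^sup>2)" by simp
    qed
    also have "\<dots> = avg {0..<q * T} (\<lambda>x. dualf q M f0 f1 x * g x)"
      unfolding dualf_def avg_multc[symmetric] by (rule avg_swap)
    finally show ?thesis .
  qed
  have "per (q * T) (dualf q M f0 f1)"
  proof -
    have "f0 (x + q * T - w) = f0 (x - w)" "f1 (x + q * T - w + y) = f1 (x - w + y)" for x w y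
      using per_mult[OF per0, of "x - w" 1] per_mult[OF per1, of "x - w + y" 1] by (simp_all add: algebra_simps)
    then show ?thesis unfolding dualf_def per_def by simp
  qed
  then have "per (q * T) (\<lambda>x. cnj (dualf q M f0 f1 x))" by (simp add: per_def)
  from dual[OF this] show "avg {0..<q * T} (\<lambda>x. avg {1..M} (\<lambda>y. f0 x * f1 (x + y) * cnj (dualf q M f0 f1 (x + q * y\<^sup>2)))) =
       of_real (avg {0..<q * T} (\<lambda>x. (norm (dualf q M f0 f1 x))\<^sup>2))"
    by (simp only: avg_of_real[symmetric] complex_norm_square)
  have "(1 / D)\<^sup>2 \<le> (norm (avg {0..<q * T} (\<lambda>x. dualf q M f0 f1 x * f2 x)))\<^sup>2"
    using big D unfolding dual[OF f2(1)] by (intro power_mono) auto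
  also have "\<dots> \<le> avg {0..<q * T} (\<lambda>x. (norm (dualf q M f0 f1 x * f2 x))\<^sup>2)" by (rule avg_sq)
  also have "\<dots> \<le> avg {0..<q * T} (\<lambda>x. (norm (dualf q M f0 f1 x))\<^sup>2)"
    using f2(2) by (intro avg_mono power_mono) (auto simp: norm_mult intro: mult_left_le)
  finally show "1 / D\<^sup>2 \<le> avg {0..<q * T} (\<lambda>x. (norm (dualf q M f0 f1 x))\<^sup>2)" by (simp add: power_divide)
qed

text \<open>Linearisation gives four directions, and a mean square over four free directions is a
  \<open>U^5\<close> norm. Two of the directions are linear in free variables and equidistribute at
  once; the other two are products and need concatenation, one after the other.\<close>

lemma U5_dual:
  fixes D B :: real
  assumes D: "D \<ge> 2" and B: "B = (2 * D\<^sup>2) ^ 256" and MB: "B ^ 3000 \<le> M"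
    and f2: "per (q * T) f2" "\<And>x. norm (f2 x) \<le> 1"
    and big: "1 / D \<le> norm (avg {0..<q * T} (\<lambda>x. avg {1..M} (\<lambda>y. f0 x * f1 (x + y) * f2 (x + q * y\<^sup>2))))"
  shows "1 / B ^ 30720 \<le> avg {0..<q} (\<lambda>r. gowers T 5 (F r))"
proof -
  define E where "E = D\<^sup>2"
  have E4: "E \<ge> 4" using D power_mono[of 2 D 2] by (simp add: E_def)
  have BE: "B = (2 * E) ^ 256" by (simp add: B E_def)
  have B2: "B \<ge> 2" and EB: "2 * E \<le> B"
  proof -
    have "(2 * E) ^ 1 \<le> (2 * E) ^ 256" using E4 by (intro power_increasing) auto
    then show "2 * E \<le> B" by (simp add: BE)
    then show "B \<ge> 2" using E4 by simp
  qed
  \<comment> \<open>The largest size that linearisation permits. As T is at most 16 M^2, the ratio T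
    / H^2 is then a power of D, while 12 H^2 < T prevents wrap-around.\<close>
  define H where "H = \<lfloor>M / (24 * E)\<rfloor>"
  have HM: "H \<le> M / (24 * E)" unfolding H_def by linarith
  have MB1: "48 * E * B ^ 2000 \<le> M"
  proof -
    have "48 * E * B ^ 2000 = 24 * (2 * E) * B ^ 2000" by simp
    also have "\<dots> \<le> 24 * B * B ^ 2000" using EB B2 by (intro mult_right_mono mult_left_mono) auto
    also have "\<dots> = 24 * B ^ 2001" by (simp flip: power_Suc)
    also have "\<dots> \<le> B ^ 3000" by (rule pow_absorb[OF B2, of 24 5]) auto
    finally show ?thesis using MB by simp
  qed
  have B1: "1 \<le> B ^ 2000" using B2 by (intro one_le_power) auto
  have M48: "48 * E \<le> M"
  proof -
    have "48 * E * 1 \<le> 48 * E * B ^ 2000" using E4 B1 by (intro mult_left_mono) auto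
    then show ?thesis using MB1 by simp
  qed
  have HM2: "M / (48 * E) \<le> H"
  proof -
    have "2 \<le> M / (24 * E)" using M48 E4 by (simp add: field_simps)
    moreover have "x / 2 \<le> real_of_int \<lfloor>x\<rfloor>" if "2 \<le> x" for x :: real using that by linarith
    moreover have "M / (48 * E) = M / (24 * E) / 2" by simp
    ultimately show ?thesis unfolding H_def by presburger
  qed
  have HB: "B ^ 2000 \<le> H"
  proof -
    have "B ^ 2000 = 48 * E * B ^ 2000 / (48 * E)" using E4 by simp
    also have "\<dots> \<le> M / (48 * E)" using E4 by (intro divide_right_mono MB1) auto
    finally show ?thesis using HM2 by linarith
  qed
  have H1: "H \<ge> 1" using HB B1 by linarith
  have M0: "0 < real_of_int M" using M by simp
  have TH: "real_of_int T / (real_of_int H)\<^sup>2 \<le> B"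
  proof -
    have "real_of_int T / (real_of_int H)\<^sup>2 \<le> 16 * (real_of_int M)\<^sup>2 / (M / (48 * E))\<^sup>2"
    proof (intro frac_le power_mono)
      have "real_of_int T \<le> real_of_int (16 * M\<^sup>2)" using TM(2) by (simp only: of_int_le_iff)
      then show "real_of_int T \<le> 16 * (real_of_int M)\<^sup>2" by simp
    qed (use M0 E4 HM2 in auto)
    also have "\<dots> = 9216 * (2 * E) ^ 2" using M0 E4 by (simp add: field_simps power2_eq_square)
    also have "\<dots> \<le> (2 * E) ^ 256" by (rule pow_absorb[of _ _ 14]) (use E4 in auto)
    finally show ?thesis by (simp add: BE)
  qed
  have T12: "12 * H\<^sup>2 < T"
  proof -
    have "M / (24 * E) \<le> M / 96" by (rule divide_left_mono) (use E4 M0 in auto)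
    then have "real_of_int H \<le> M / 96" using HM by linarith
    then have "(real_of_int H)\<^sup>2 \<le> (M / 96)\<^sup>2" using H1 by (intro power_mono) auto
    then have "9216 * (real_of_int H)\<^sup>2 \<le> (real_of_int M)\<^sup>2" by (simp add: power_divide)
    moreover have "0 < (real_of_int M)\<^sup>2" using M0 by simp
    ultimately have "12 * (real_of_int H)\<^sup>2 < (real_of_int M)\<^sup>2" by linarith
    then have "real_of_int (12 * H\<^sup>2) < real_of_int (M\<^sup>2)" by simp
    then have "12 * H\<^sup>2 < M\<^sup>2" by (simp only: of_int_less_iff)
    then show ?thesis using TM by linarith
  qed
  define A where "A = {1..H} \<times> {1..H}"
  define Tt where "Tt = {0..<T}"
  define R where "R = {0..<q}"
  define h3 where "h3 p = fst (fst p) - fst (snd p)" for p :: "(int \<times> int) \<times> (int \<times> int)"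
  have fin: "finite A" "A \<noteq> {}" "finite Tt" "finite R" "finite (A \<times> A)" using H1 by (auto simp: A_def Tt_def R_def)
  have da: "\<bar>dif a\<bar> \<le> H" if "a \<in> A" for a using that by (auto simp: A_def dif_def)

  define dirs where "dirs l u v v' ps = [2 * (dif l * (dif u + dif v)),
     2 * (dif v * fst (fst (ps ! 0)) - (dif v' - dif u) * snd (fst (ps ! 0))) - 2 * (dif v * fst (snd (ps ! 0)) - (dif v' - dif u) * snd (snd (ps ! 0))),
     2 * (dif v * fst (fst (ps ! 1)) - dif v' * snd (fst (ps ! 1))) - 2 * (dif v * fst (snd (ps ! 1)) - dif v' * snd (snd (ps ! 1))),
     2 * (dif u * h3 (ps ! 2))]" for l u v v' :: "int \<times> int" and ps :: "((int \<times> int) \<times> (int \<times> int)) list"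
  let ?L = "listset (replicate 3 (A \<times> A))"
  have fL: "finite ?L" by (rule finite_listset) (use fin in \<open>simp split: if_splits\<close>)
  let ?f = "\<lambda>x. cnj (dualf q M f0 f1 x)"
  have "(1 / (2 * E)) ^ 128 \<le> avg A (\<lambda>v. avg A (\<lambda>v'. avg A (\<lambda>l. avg A (\<lambda>u. avg ?L (\<lambda>ps.
       Re (avg {0..<q * T} (dl (pet_dirs q (dif l) (dif u) (dif v) (dif v') ps) ?f)))))))"
    unfolding A_def
  proof (rule linearisation)
    show "2 \<le> E" using E4 by simp
    show "24 * E * H \<le> M" using HM E4 by (simp add: field_simps)
    have "f0 (x + q * T - w) = f0 (x - w)" "f1 (x + q * T - w + y) = f1 (x - w + y)" for x w y
      using per_mult[OF per0, of "x - w" 1] per_mult[OF per1, of "x - w + y" 1] by (simp_all add: algebra_simps)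
    then show "per (q * T) ?f" unfolding dualf_def per_def by simp
    show "norm (?f x) \<le> 1" for x using norm_dualf by simp
    have D0: "D > 0" using D by simp
    show "1 / E \<le> norm (avg {0..<q * T} (\<lambda>x. avg {1..M} (\<lambda>y. f0 x * f1 (x + y) * ?f (x + q * y\<^sup>2))))"
      using dual_energy[OF D0 f2 big] unfolding E_def by simp
  qed (rule H1)
  also have "\<dots> \<le> avg A (\<lambda>v. avg A (\<lambda>v'. avg A (\<lambda>l. avg A (\<lambda>u. avg ?L (\<lambda>ps. avg R (\<lambda>r. norm (avg Tt (dl (dirs l u v v' ps) (F r)))))))))"
  proof (rule avg_mono, rule avg_mono, rule avg_mono, rule avg_mono, rule avg_mono)
    fix v v' l u ps assume "ps \<in> ?L"
    then have "length ps = 3" using length_listset by fastforce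
    then obtain p1 p2 p3 where ps: "ps = [p1, p2, p3]" by (auto simp: numeral_3_eq_3 length_Suc_conv)
    have pd: "pet_dirs q (dif l) (dif u) (dif v) (dif v') ps = map ((*) q) (dirs l u v v' ps)"
      unfolding pet_dirs_def dirs_def h3_def ps by (simp add: algebra_simps)
    have "Re (avg {0..<q * T} (dl (pet_dirs q (dif l) (dif u) (dif v) (dif v') ps) ?f)) \<le> norm (avg {0..<q * T} (dl (pet_dirs q (dif l) (dif u) (dif v) (dif v') ps) ?f))"
      by (rule complex_Re_le_cmod)
    also have "\<dots> = norm (avg {0..<q * T} (dl (map ((*) q) (dirs l u v v' ps)) (dualf q M f0 f1)))"
      unfolding pd dl_cnj[abs_def] cnj_avg[symmetric] by simp
    also have "\<dots> = norm (avg R (\<lambda>r. avg Tt (\<lambda>t. dl (dirs l u v v' ps) (F r) t)))"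
      unfolding avg_classes[OF q T0, symmetric] dl_scaled F_def[abs_def] R_def Tt_def ..
    also have "\<dots> \<le> avg R (\<lambda>r. norm (avg Tt (dl (dirs l u v v' ps) (F r))))" by (rule norm_avg_le)
    finally show "Re (avg {0..<q * T} (dl (pet_dirs q (dif l) (dif u) (dif v) (dif v') ps) ?f)) \<le> avg R (\<lambda>r. norm (avg Tt (dl (dirs l u v v' ps) (F r))))" .
  qed
  also have "\<dots> = avg (A \<times> A \<times> A \<times> A \<times> ?L \<times> R) (\<lambda>(v, v', l, u, ps, r). norm (avg Tt (dl (dirs l u v v' ps) (F r))))"
    by (simp add: avg_prod fin fL)
  finally have "((1 / (2 * E)) ^ 128)\<^sup>2 \<le> (avg (A \<times> A \<times> A \<times> A \<times> ?L \<times> R) (\<lambda>(v, v', l, u, ps, r). norm (avg Tt (dl (dirs l u v v' ps) (F r)))))\<^sup>2"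
    using E4 by (intro power_mono) auto
  also have "\<dots> \<le> avg (A \<times> A \<times> A \<times> A \<times> ?L \<times> R) (\<lambda>z. (case z of (v, v', l, u, ps, r) \<Rightarrow> norm (avg Tt (dl (dirs l u v v' ps) (F r))))\<^sup>2)"
    by (rule avg_sq_real)
  also have "\<dots> = avg A (\<lambda>v. avg A (\<lambda>v'. avg A (\<lambda>l. avg A (\<lambda>u. avg ?L (\<lambda>ps. avg R (\<lambda>r. (norm (avg Tt (dl (dirs l u v v' ps) (F r))))\<^sup>2))))))"
    by (simp add: avg_prod fin fL)
  also have "\<dots> = avg A (\<lambda>v. avg A (\<lambda>v'. avg A (\<lambda>l. avg A (\<lambda>u. avg R (\<lambda>r. avg ?L (\<lambda>ps. (norm (avg Tt (dl (dirs l u v v' ps) (F r))))\<^sup>2))))))"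
    by (rule avg_cong[OF refl], rule avg_cong[OF refl], rule avg_cong[OF refl], rule avg_cong[OF refl], rule avg_swap)
  finally have s0: "1 / B \<le> avg A (\<lambda>v. avg A (\<lambda>v'. avg A (\<lambda>l. avg A (\<lambda>u. avg R (\<lambda>r. avg ?L (\<lambda>ps. (norm (avg Tt (dl (dirs l u v v' ps) (F r))))\<^sup>2))))))"
    by (simp add: BE power_one_over power_mult[symmetric])

  define m where "m = \<lceil>20 * B\<rceil>"
  define C where "C = (real_of_int m ^ 2 + 1) * T / (real_of_int H)\<^sup>2"
  note mC = absorb_constants[OF B2 m_def TH T0, folded C_def]
  have C0: "0 \<le> C" unfolding C_def using T0 by auto
  have HBk: "7 * \<lceil>20 * B ^ k\<rceil> \<le> H" if "k \<le> 1920" "k \<ge> 1" for k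
  proof -
    have Bk: "B ^ k \<ge> 2" using B2 power_increasing[of 1 k B] that by simp
    have "real_of_int \<lceil>x\<rceil> \<le> x + 1" for x :: real by linarith
    from mult_left_mono[OF this[of "20 * B ^ k"], of 7] have "7 * real_of_int \<lceil>20 * B ^ k\<rceil> \<le> 7 * (20 * B ^ k + 1)" by simp
    also have "\<dots> \<le> 280 * B ^ k" using Bk by simp
    also have "\<dots> \<le> B ^ 2000" by (rule pow_absorb[OF B2, of 280 9]) (use that in auto)
    finally show ?thesis using HB by linarith
  qed
  have Hm: "7 * m \<le> H" using HBk[of 1] by (simp add: m_def)
  define Y where "Y l u v r = avg (A \<times> A) (\<lambda>p. avg Tt (\<lambda>b. avg Tt (\<lambda>c. N4 r (2 * (dif l * (dif u + dif v))) b c (2 * (dif u * h3 p)))))" for l u v :: "int \<times> int" and r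
  have Y0: "0 \<le> Y l u v r" for l u v r unfolding Y_def by (intro avg_nonneg N4_nonneg)
  \<comment> \<open>For fixed u, v, v' the second and third directions are differences of integer
    combinations with coefficients (v, v' - u) and (v, v').\<close>
  have step1: "avg ?L (\<lambda>ps. (norm (avg Tt (dl (dirs l u v v' ps) (F r))))\<^sup>2) \<le>
      of_bool (bad H m (0 + dif v) (- dif u + dif v')) + of_bool (bad H m (0 + dif v) (0 + dif v')) + C\<^sup>2 * Y l u v r"
    if mem: "v \<in> A" "v' \<in> A" "u \<in> A" for l u v v' r
  proof (cases "bad H m (dif v) (dif v' - dif u) \<or> bad H m (dif v) (dif v')")
    case True
    have "avg ?L (\<lambda>ps. (norm (avg Tt (dl (dirs l u v v' ps) (F r))))\<^sup>2) \<le> 1"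
      by (intro avg_le power_le_one norm_ge_zero norm_avg_le_bound norm_dl norm_F) auto
    moreover have "0 \<le> C\<^sup>2 * Y l u v r" using Y0 by simp
    ultimately show ?thesis using True by (auto simp: algebra_simps)
  next
    case False
    define a where "a = 2 * (dif l * (dif u + dif v))"
    define b where "b p = 2 * (dif v * fst (fst p) - (dif v' - dif u) * snd (fst p)) - 2 * (dif v * fst (snd p) - (dif v' - dif u) * snd (snd p))" for p :: "(int \<times> int) \<times> (int \<times> int)"
    define c where "c p = 2 * (dif v * fst (fst p) - dif v' * snd (fst p)) - 2 * (dif v * fst (snd p) - dif v' * snd (snd p))" for p :: "(int \<times> int) \<times> (int \<times> int)"
    define d where "d p = 2 * (dif u * h3 p)" for p
    have fLk: "finite (listset (replicate k (A \<times> A)))" for k by (rule finite_listset) (use fin in \<open>simp split: if_splits\<close>)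
    have "avg ?L (\<lambda>ps. (norm (avg Tt (dl (dirs l u v v' ps) (F r))))\<^sup>2) = avg ?L (\<lambda>ps. N4 r a (b (ps ! 0)) (c (ps ! 1)) (d (ps ! 2)))"
      by (simp only: N4_def dirs_def Tt_def a_def b_def c_def d_def)
    also have "\<dots> = avg (A \<times> A) (\<lambda>p1. avg (A \<times> A) (\<lambda>p2. avg (A \<times> A) (\<lambda>p3. N4 r a (b p1) (c p2) (d p3))))"
      using fLk[of 2] fLk[of 1]
      by (simp add: numeral_3_eq_3 numeral_2_eq_2 avg_listset_Cons[OF fin(5)] avg_listset_Cons[OF fin(5) finite_listset_Nil])
    also have "\<dots> \<le> C * avg Tt (\<lambda>x. avg (A \<times> A) (\<lambda>p2. avg (A \<times> A) (\<lambda>p3. N4 r a x (c p2) (d p3))))"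
      unfolding C_def b_def A_def Tt_def
    proof (rule avg_generic_dif[OF T0 T12 H1 mC(3)])
      show "per T (\<lambda>x. avg (({1..H} \<times> {1..H}) \<times> {1..H} \<times> {1..H}) (\<lambda>p2. avg (({1..H} \<times> {1..H}) \<times> {1..H} \<times> {1..H}) (\<lambda>p3. N4 r a x (c p2) (d p3))))"
        using per_N4(2) by (simp add: per_def)
      show "0 \<le> avg (({1..H} \<times> {1..H}) \<times> {1..H} \<times> {1..H}) (\<lambda>p2. avg (({1..H} \<times> {1..H}) \<times> {1..H} \<times> {1..H}) (\<lambda>p3. N4 r a x (c p2) (d p3)))" for x
        by (intro avg_nonneg N4_nonneg)
      show "\<bar>dif v\<bar> \<le> 3 * H" "\<bar>dif v' - dif u\<bar> \<le> 3 * H" using da[OF mem(1)] da[OF mem(2)] da[OF mem(3)] H1 by linarith+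
    qed (use False in auto)
    also have "\<dots> \<le> C * avg Tt (\<lambda>x. C * avg Tt (\<lambda>y. avg (A \<times> A) (\<lambda>p3. N4 r a x y (d p3))))"
    proof (rule mult_left_mono[OF avg_mono C0])
      fix x
      show "avg (A \<times> A) (\<lambda>p2. avg (A \<times> A) (\<lambda>p3. N4 r a x (c p2) (d p3))) \<le> C * avg Tt (\<lambda>y. avg (A \<times> A) (\<lambda>p3. N4 r a x y (d p3)))"
        unfolding C_def c_def A_def Tt_def
      proof (rule avg_generic_dif[OF T0 T12 H1 mC(3)])
        show "per T (\<lambda>y. avg (({1..H} \<times> {1..H}) \<times> {1..H} \<times> {1..H}) (\<lambda>p3. N4 r a x y (d p3)))"
          using per_N4(3) by (simp add: per_def)
        show "0 \<le> avg (({1..H} \<times> {1..H}) \<times> {1..H} \<times> {1..H}) (\<lambda>p3. N4 r a x y (d p3))" for y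
          by (intro avg_nonneg N4_nonneg)
        show "\<bar>dif v\<bar> \<le> 3 * H" "\<bar>dif v'\<bar> \<le> 3 * H" using da[OF mem(1)] da[OF mem(2)] H1 by linarith+
      qed (use False in auto)
    qed
    also have "\<dots> = C\<^sup>2 * avg Tt (\<lambda>x. avg Tt (\<lambda>y. avg (A \<times> A) (\<lambda>p3. N4 r a x y (d p3))))"
      by (simp add: avg_cmult power2_eq_square)
    also have "avg Tt (\<lambda>x. avg Tt (\<lambda>y. avg (A \<times> A) (\<lambda>p3. N4 r a x y (d p3)))) = avg Tt (\<lambda>x. avg (A \<times> A) (\<lambda>p3. avg Tt (\<lambda>y. N4 r a x y (d p3))))"
      by (intro avg_cong[OF refl] avg_swap)
    also have "\<dots> = Y l u v r" unfolding Y_def a_def d_def by (rule avg_swap)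
    finally show ?thesis by simp
  qed
  have "1 / B \<le> avg A (\<lambda>v. avg A (\<lambda>v'. avg A (\<lambda>l. avg A (\<lambda>u. avg R (\<lambda>r.
     of_bool (bad H m (0 + dif v) (- dif u + dif v')) + of_bool (bad H m (0 + dif v) (0 + dif v')) + C\<^sup>2 * Y l u v r)))))"
    by (rule order_trans[OF s0], rule avg_mono, rule avg_mono, rule avg_mono, rule avg_mono, rule avg_mono, rule step1)
  also have "\<dots> = avg A (\<lambda>v. avg A (\<lambda>v'. avg A (\<lambda>u. of_bool (bad H m (0 + dif v) (- dif u + dif v'))))) +
      avg A (\<lambda>v. avg A (\<lambda>v'. of_bool (bad H m (0 + dif v) (0 + dif v')))) + C\<^sup>2 * avg A (\<lambda>v. avg A (\<lambda>l. avg A (\<lambda>u. avg R (Y l u v))))"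
  proof -
    have Rne: "finite R" "R \<noteq> {}" using q by (auto simp: R_def)
    show ?thesis by (simp only: avg_add avg_cmult avg_const[OF fin(1,2)] avg_const[OF Rne])
  qed
  also have "avg A (\<lambda>v. avg A (\<lambda>v'. avg A (\<lambda>u. of_bool (bad H m (0 + dif v) (- dif u + dif v'))))) =
      avg A (\<lambda>u. avg A (\<lambda>v. avg A (\<lambda>v'. of_bool (bad H m (0 + dif v) (- dif u + dif v')) :: real)))"
    by (subst avg_swap[of A A "\<lambda>u v. avg A (\<lambda>v'. of_bool (bad H m (0 + dif v) (- dif u + dif v')) :: real)"]) (intro avg_cong[OF refl] avg_swap)
  also have "\<dots> \<le> 5 / real_of_int m"
  proof (rule avg_le)
    fix u assume "u \<in> A"
    then show "avg A (\<lambda>v. avg A (\<lambda>v'. of_bool (bad H m (0 + dif v) (- dif u + dif v')))) \<le> 5 / real_of_int m"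
      unfolding A_def using da[of u] H1 by (intro avg_bad_dif Hm mC) (auto simp: A_def)
  qed (use mC in auto)
  also have "avg A (\<lambda>v. avg A (\<lambda>v'. of_bool (bad H m (0 + dif v) (0 + dif v')))) \<le> 5 / real_of_int m"
    unfolding A_def using H1 by (intro avg_bad_dif Hm mC) auto
  finally have "1 / B \<le> 10 / real_of_int m + C\<^sup>2 * avg A (\<lambda>v. avg A (\<lambda>l. avg A (\<lambda>u. avg R (Y l u v))))" by simp
  also have "C\<^sup>2 * avg A (\<lambda>v. avg A (\<lambda>l. avg A (\<lambda>u. avg R (Y l u v)))) \<le> (B ^ 14)\<^sup>2 * avg A (\<lambda>v. avg A (\<lambda>l. avg A (\<lambda>u. avg R (Y l u v))))"
    by (intro mult_right_mono power_mono mC(1) C0 avg_nonneg Y0)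
  finally have "1 / B \<le> 10 / real_of_int m + B ^ 28 * avg A (\<lambda>v. avg A (\<lambda>l. avg A (\<lambda>u. avg R (Y l u v))))" by (simp flip: power_mult)
  from lower_bound_transfer[OF B2 this mC(2)]
  have v1: "1 / B ^ 30 \<le> avg A (\<lambda>v. avg A (\<lambda>l. avg A (\<lambda>u. avg R (Y l u v))))" by simp

  \<comment> \<open>Everything except l and v is frozen, and the other three derivatives are put
    into K. The first direction is then a product of l with v translated by u.\<close>
  define \<Omega> where "\<Omega> = A \<times> R \<times> (A \<times> A) \<times> Tt \<times> Tt"
  define K where "K z = (case z of (u, r, p, b, c) \<Rightarrow> dl [b, c, 2 * (dif u * h3 p)] (F r))" for z :: "(int \<times> int) \<times> int \<times> ((int \<times> int) \<times> (int \<times> int)) \<times> int \<times> int"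
  have KN: "N4 r a b c (2 * (dif u * h3 p)) = (norm (avg Tt (dd a (K (u, r, p, b, c)))))\<^sup>2" for r a b c u p
    unfolding N4_1 Tt_def K_def by simp
  have Kper: "per T (K z)" "norm (K z x) \<le> 1" for z x
    unfolding K_def by (cases z; auto intro!: per_dl per_F norm_dl norm_F simp del: dl.simps)+
  have "avg A (\<lambda>v. avg A (\<lambda>l. avg A (\<lambda>u. avg R (Y l u v)))) =
    avg A (\<lambda>v. avg A (\<lambda>l. avg \<Omega> (\<lambda>z. (norm (avg Tt (dd (2 * (dif l * (dif (fst z) + dif v))) (K z))))\<^sup>2)))"
    unfolding Y_def KN \<Omega>_def by (simp add: avg_prod fin)
  also have "\<dots> = avg A (\<lambda>v. avg \<Omega> (\<lambda>z. avg A (\<lambda>l. (norm (avg Tt (dd (2 * (dif l * (dif (fst z) + dif v))) (K z))))\<^sup>2)))"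
    by (intro avg_cong[OF refl] avg_swap)
  also have "\<dots> = avg \<Omega> (\<lambda>z. avg A (\<lambda>v. avg A (\<lambda>l. (norm (avg Tt (dd (2 * (dif l * (dif (fst z) + dif v))) (K z))))\<^sup>2)))"
    by (rule avg_swap)
  finally have "(1 / B ^ 30)\<^sup>2 \<le> (avg \<Omega> (\<lambda>z. avg A (\<lambda>v. avg A (\<lambda>l. (norm (avg Tt (dd (2 * (dif l * (dif (fst z) + dif v))) (K z))))\<^sup>2))))\<^sup>2"
    using v1 B2 by (intro power_mono) auto
  also have "\<dots> \<le> avg \<Omega> (\<lambda>z. (avg A (\<lambda>v. avg A (\<lambda>l. (norm (avg Tt (dd (2 * (dif l * (dif (fst z) + dif v))) (K z))))\<^sup>2)))\<^sup>2)"
    by (rule avg_sq_real)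
  also have "(1 / B ^ 30)\<^sup>2 = 1 / B ^ 60" by (simp add: power_one_over flip: power_mult)
  finally have s2: "1 / B ^ 60 \<le> avg \<Omega> (\<lambda>z. (avg A (\<lambda>v. avg A (\<lambda>l. (norm (avg Tt (dd (2 * (dif l * (dif (fst z) + dif v))) (K z))))\<^sup>2)))\<^sup>2)" .
  have Bk: "B ^ k \<ge> 2" "real_of_int T / (real_of_int H)\<^sup>2 \<le> B ^ k" if "k \<ge> 1" for k
  proof -
    have "B ^ 1 \<le> B ^ k" using B2 that by (intro power_increasing) auto
    then show "B ^ k \<ge> 2" "real_of_int T / (real_of_int H)\<^sup>2 \<le> B ^ k" using B2 TH by auto
  qed
  define m2 where "m2 = \<lceil>20 * B ^ 60\<rceil>"
  define C2 where "C2 = (real_of_int m2 ^ 2 + 1) * T / (real_of_int H)\<^sup>2"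
  have k60: "(60::nat) \<ge> 1" by simp
  note mC2 = absorb_constants[OF Bk(1)[OF k60] m2_def Bk(2)[OF k60] T0, folded C2_def]
  have Hm2: "7 * m2 \<le> H" using HBk[of 60] by (simp add: m2_def)
  define V2 where "V2 = avg \<Omega> (\<lambda>z. avg Tt (\<lambda>g. (norm (avg Tt (dd g (K z))))\<^sup>2))"
  have V20: "0 \<le> V2" unfolding V2_def by (intro avg_nonneg) simp
  have \<Omega>ne: "finite \<Omega>" "\<Omega> \<noteq> {}" using fin q T0 by (auto simp: \<Omega>_def R_def Tt_def)
  have "1 / B ^ 60 \<le> avg \<Omega> (\<lambda>z. 5 / real_of_int m2 + C2 * avg Tt (\<lambda>g. (norm (avg Tt (dd g (K z))))\<^sup>2))"
  proof (rule order_trans[OF s2], rule avg_mono)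
    fix z assume "z \<in> \<Omega>"
    then have "fst z \<in> A" by (auto simp: \<Omega>_def)
    from da[OF this] show "(avg A (\<lambda>v. avg A (\<lambda>l. (norm (avg Tt (dd (2 * (dif l * (dif (fst z) + dif v))) (K z))))\<^sup>2)))\<^sup>2 \<le> 5 / real_of_int m2 + C2 * avg Tt (\<lambda>g. (norm (avg Tt (dd g (K z))))\<^sup>2)"
      unfolding A_def Tt_def C2_def by (intro concatenate_products T0 T12 Hm2 mC2 Kper)
  qed
  also have "\<dots> = 5 / real_of_int m2 + C2 * V2" unfolding V2_def by (simp add: avg_add avg_cmult avg_const[OF \<Omega>ne])
  also have "\<dots> \<le> 10 / real_of_int m2 + (B ^ 60) ^ 14 * V2"
    using mC2 V20 by (intro add_mono mult_right_mono divide_right_mono) auto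
  finally have v2: "1 / B ^ 960 \<le> V2"
    using lower_bound_transfer[OF Bk(1)[OF k60] _ mC2(2), of 14 V2] by (simp flip: power_mult)

  \<comment> \<open>The same for the last direction, now with no translation. The first direction
    has become free and is absorbed into K'.\<close>
  define \<Omega>' where "\<Omega>' = R \<times> Tt \<times> Tt \<times> Tt"
  define K' where "K' z = (case z of (r, g, b, c) \<Rightarrow> dl [g, b, c] (F r))" for z :: "int \<times> int \<times> int \<times> int"
  have KN': "(norm (avg Tt (dd g (K (u, r, p, b, c)))))\<^sup>2 = (norm (avg Tt (dd (2 * (dif u * h3 p)) (K' (r, g, b, c)))))\<^sup>2" for r g b c u p
    unfolding KN[symmetric] by (simp only: K'_def prod.case N4_4 Tt_def)
  have Kper': "per T (K' z)" "norm (K' z x) \<le> 1" for z x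
    unfolding K'_def by (cases z; auto intro!: per_dl per_F norm_dl norm_F simp del: dl.simps)+
  have "V2 = avg A (\<lambda>u. avg R (\<lambda>r. avg (A \<times> A) (\<lambda>p. avg Tt (\<lambda>b. avg Tt (\<lambda>c. avg Tt (\<lambda>g. (norm (avg Tt (dd (2 * (dif u * h3 p)) (K' (r, g, b, c)))))\<^sup>2))))))"
    unfolding V2_def \<Omega>_def KN'[symmetric] by (simp add: avg_prod fin)
  also have "\<dots> = avg A (\<lambda>u. avg (A \<times> A) (\<lambda>p. avg R (\<lambda>r. avg Tt (\<lambda>g. avg Tt (\<lambda>b. avg Tt (\<lambda>c. (norm (avg Tt (dd (2 * (dif u * h3 p)) (K' (r, g, b, c)))))\<^sup>2))))))"
  proof (rule avg_cong[OF refl])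
    fix u
    let ?G = "\<lambda>r p b c g. (norm (avg Tt (dd (2 * (dif u * h3 p)) (K' (r, g, b, c)))))\<^sup>2"
    have "avg R (\<lambda>r. avg (A \<times> A) (\<lambda>p. avg Tt (\<lambda>b. avg Tt (\<lambda>c. avg Tt (\<lambda>g. ?G r p b c g))))) = avg (A \<times> A) (\<lambda>p. avg R (\<lambda>r. avg Tt (\<lambda>b. avg Tt (\<lambda>c. avg Tt (\<lambda>g. ?G r p b c g)))))"
      by (rule avg_swap)
    also have "\<dots> = avg (A \<times> A) (\<lambda>p. avg R (\<lambda>r. avg Tt (\<lambda>b. avg Tt (\<lambda>g. avg Tt (\<lambda>c. ?G r p b c g)))))"
      by (intro avg_cong[OF refl] avg_swap)
    also have "\<dots> = avg (A \<times> A) (\<lambda>p. avg R (\<lambda>r. avg Tt (\<lambda>g. avg Tt (\<lambda>b. avg Tt (\<lambda>c. ?G r p b c g)))))"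
      by (intro avg_cong[OF refl] avg_swap)
    finally show "avg R (\<lambda>r. avg (A \<times> A) (\<lambda>p. avg Tt (\<lambda>b. avg Tt (\<lambda>c. avg Tt (\<lambda>g. ?G r p b c g))))) = avg (A \<times> A) (\<lambda>p. avg R (\<lambda>r. avg Tt (\<lambda>g. avg Tt (\<lambda>b. avg Tt (\<lambda>c. ?G r p b c g)))))" .
  qed
  also have "\<dots> = avg A (\<lambda>u. avg (A \<times> A) (\<lambda>p. avg \<Omega>' (\<lambda>z. (norm (avg Tt (dd (2 * (dif u * h3 p)) (K' z))))\<^sup>2)))"
    unfolding \<Omega>'_def by (simp add: avg_prod fin)
  also have "\<dots> = avg A (\<lambda>u. avg \<Omega>' (\<lambda>z. avg (A \<times> A) (\<lambda>p. (norm (avg Tt (dd (2 * (dif u * h3 p)) (K' z))))\<^sup>2)))"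
    by (intro avg_cong[OF refl] avg_swap)
  also have "\<dots> = avg \<Omega>' (\<lambda>z. avg A (\<lambda>u. avg (A \<times> A) (\<lambda>p. (norm (avg Tt (dd (2 * (dif u * h3 p)) (K' z))))\<^sup>2)))"
    by (rule avg_swap)
  also have "\<dots> = avg \<Omega>' (\<lambda>z. avg A (\<lambda>u. avg A (\<lambda>b. (norm (avg Tt (dd (2 * (dif b * (0 + dif u))) (K' z))))\<^sup>2)))"
  proof (rule avg_cong[OF refl], rule avg_cong[OF refl])
    fix z and u :: "int \<times> int"
    have Hne: "finite {1..H}" "{1..H} \<noteq> {}" using H1 by auto
    have "avg (A \<times> A) (\<lambda>p. G (h3 p)) = avg A (\<lambda>b. G (dif b))" for G :: "int \<Rightarrow> real"
    proof -
      have "avg (A \<times> A) (\<lambda>p. G (h3 p)) = avg {1..H} (\<lambda>i. avg {1..H} (\<lambda>j. avg {1..H} (\<lambda>i'. avg {1..H} (\<lambda>j'. G (i - i')))))"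
        unfolding A_def h3_def by (simp add: avg_prod)
      also have "\<dots> = avg A (\<lambda>b. G (dif b))"
        unfolding A_def dif_def by (simp add: avg_prod avg_const[OF Hne])
      finally show ?thesis .
    qed
    from this[of "\<lambda>x. (norm (avg Tt (dd (2 * (dif u * x)) (K' z))))\<^sup>2"]
    show "avg (A \<times> A) (\<lambda>p. (norm (avg Tt (dd (2 * (dif u * h3 p)) (K' z))))\<^sup>2) = avg A (\<lambda>b. (norm (avg Tt (dd (2 * (dif b * (0 + dif u))) (K' z))))\<^sup>2)"
      by (simp add: mult.commute)
  qed
  finally have "(1 / B ^ 960)\<^sup>2 \<le> (avg \<Omega>' (\<lambda>z. avg A (\<lambda>u. avg A (\<lambda>b. (norm (avg Tt (dd (2 * (dif b * (0 + dif u))) (K' z))))\<^sup>2))))\<^sup>2"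
    using v2 B2 by (intro power_mono) auto
  also have "\<dots> \<le> avg \<Omega>' (\<lambda>z. (avg A (\<lambda>u. avg A (\<lambda>b. (norm (avg Tt (dd (2 * (dif b * (0 + dif u))) (K' z))))\<^sup>2)))\<^sup>2)"
    by (rule avg_sq_real)
  also have "(1 / B ^ 960)\<^sup>2 = 1 / B ^ 1920" by (simp add: power_one_over flip: power_mult)
  finally have s3: "1 / B ^ 1920 \<le> avg \<Omega>' (\<lambda>z. (avg A (\<lambda>u. avg A (\<lambda>b. (norm (avg Tt (dd (2 * (dif b * (0 + dif u))) (K' z))))\<^sup>2)))\<^sup>2)" .
  define m3 where "m3 = \<lceil>20 * B ^ 1920\<rceil>"
  define C3 where "C3 = (real_of_int m3 ^ 2 + 1) * T / (real_of_int H)\<^sup>2"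
  have k1920: "(1920::nat) \<ge> 1" by simp
  note mC3 = absorb_constants[OF Bk(1)[OF k1920] m3_def Bk(2)[OF k1920] T0, folded C3_def]
  have Hm3: "7 * m3 \<le> H" using HBk[of 1920] by (simp add: m3_def)
  define V3 where "V3 = avg \<Omega>' (\<lambda>z. avg Tt (\<lambda>g. (norm (avg Tt (dd g (K' z))))\<^sup>2))"
  have V30: "0 \<le> V3" unfolding V3_def by (intro avg_nonneg) simp
  have \<Omega>ne': "finite \<Omega>'" "\<Omega>' \<noteq> {}" using fin q T0 by (auto simp: \<Omega>'_def R_def Tt_def)
  have "1 / B ^ 1920 \<le> avg \<Omega>' (\<lambda>z. 5 / real_of_int m3 + C3 * avg Tt (\<lambda>g. (norm (avg Tt (dd g (K' z))))\<^sup>2))"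
  proof (rule order_trans[OF s3], rule avg_mono)
    fix z
    have "\<bar>0::int\<bar> \<le> H" using H1 by simp
    then show "(avg A (\<lambda>u. avg A (\<lambda>b. (norm (avg Tt (dd (2 * (dif b * (0 + dif u))) (K' z))))\<^sup>2)))\<^sup>2 \<le> 5 / real_of_int m3 + C3 * avg Tt (\<lambda>g. (norm (avg Tt (dd g (K' z))))\<^sup>2)"
      unfolding A_def Tt_def C3_def by (intro concatenate_products T0 T12 Hm3 mC3 Kper')
  qed
  also have "\<dots> = 5 / real_of_int m3 + C3 * V3" unfolding V3_def by (simp add: avg_add avg_cmult avg_const[OF \<Omega>ne'])
  also have "\<dots> \<le> 10 / real_of_int m3 + (B ^ 1920) ^ 14 * V3"
    using mC3 V30 by (intro add_mono mult_right_mono divide_right_mono) auto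
  finally have v3: "1 / B ^ 30720 \<le> V3"
    using lower_bound_transfer[OF Bk(1)[OF k1920] _ mC3(2), of 14 V3] by (simp flip: power_mult)
  have "V3 = avg R (\<lambda>r. avg Tt (\<lambda>g. avg Tt (\<lambda>b. avg Tt (\<lambda>c. avg Tt (\<lambda>a. (norm (avg Tt (dl [a, g, b, c] (F r))))\<^sup>2)))))"
  proof -
    have "dd a (K' (r, g, b, c)) = dl [a, g, b, c] (F r)" for a r g b c by (simp only: K'_def prod.case dl_dd dl.simps)
    then show ?thesis unfolding V3_def \<Omega>'_def by (simp add: avg_prod fin del: dl.simps)
  qed
  also have "\<dots> = avg R (\<lambda>r. avg Tt (\<lambda>a. avg Tt (\<lambda>g. avg Tt (\<lambda>b. avg Tt (\<lambda>c. (norm (avg Tt (dl [a, g, b, c] (F r))))\<^sup>2)))))"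
  proof (rule avg_cong[OF refl])
    fix r
    let ?G = "\<lambda>g b c a. (norm (avg Tt (dl [a, g, b, c] (F r))))\<^sup>2"
    have "avg Tt (\<lambda>g. avg Tt (\<lambda>b. avg Tt (\<lambda>c. avg Tt (\<lambda>a. ?G g b c a)))) = avg Tt (\<lambda>g. avg Tt (\<lambda>b. avg Tt (\<lambda>a. avg Tt (\<lambda>c. ?G g b c a))))"
      by (rule avg_cong[OF refl], rule avg_cong[OF refl], rule avg_swap)
    also have "\<dots> = avg Tt (\<lambda>g. avg Tt (\<lambda>a. avg Tt (\<lambda>b. avg Tt (\<lambda>c. ?G g b c a))))" by (rule avg_cong[OF refl], rule avg_swap)
    also have "\<dots> = avg Tt (\<lambda>a. avg Tt (\<lambda>g. avg Tt (\<lambda>b. avg Tt (\<lambda>c. ?G g b c a))))" by (rule avg_swap)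
    finally show "avg Tt (\<lambda>g. avg Tt (\<lambda>b. avg Tt (\<lambda>c. avg Tt (\<lambda>a. ?G g b c a)))) = avg Tt (\<lambda>a. avg Tt (\<lambda>g. avg Tt (\<lambda>b. avg Tt (\<lambda>c. ?G g b c a))))" .
  qed
  also have "\<dots> = avg R (\<lambda>r. avg (listset (replicate 4 Tt)) (\<lambda>hs. (norm (avg Tt (dl hs (F r))))\<^sup>2))"
  proof -
    have "finite (listset (replicate k Tt))" for k by (rule finite_listset) (simp add: Tt_def split: if_splits)
    from this[of 3] this[of 2] this[of 1] show ?thesis
      by (simp add: numeral_3_eq_3 numeral_2_eq_2 avg_listset_Cons[OF fin(3)] avg_listset_Cons[OF fin(3) finite_listset_Nil] eval_nat_numeral(2) del: dl.simps)
  qed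
  also have "\<dots> = avg R (\<lambda>r. gowers T (Suc 4) (F r))" unfolding Tt_def gowers_Suc_norm[OF T0 per_F] ..
  finally show ?thesis using v3 by (simp add: R_def)
qed

end

subsection \<open>The inverse theorem\<close>

text \<open>Replacing y by y + b l changes the phase by a multiple of b \<psi>, hence hardly at all,
  so the phase factors out of the average over l and is discarded by the norm.\<close>

lemma shift_phase:
  fixes f1 :: "int \<Rightarrow> complex" and \<psi> \<delta> :: real and M b L :: int
  assumes f1: "\<And>x. norm (f1 x) \<le> 1" and M: "M > 0" and b: "b \<ge> 1" and L: "L \<ge> 1" and nb: "near_int (b * \<psi>) \<delta>" and d: "\<delta> \<ge> 0"
  shows "norm (avg {1..M} (\<lambda>y. f1 (x + y) * ee (\<psi> * (real_of_int y)\<^sup>2))) \<le>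
    avg {1..M} (\<lambda>y. norm (avg {0..<L} (\<lambda>l. f1 (x + y + b * l)))) + 2 * real_of_int b * L / M + 8 * \<delta> * (2 * real_of_int M * L + b * (real_of_int L)\<^sup>2)"
proof -
  define g where "g y = f1 (x + y) * ee (\<psi> * (real_of_int y)\<^sup>2)" for y
  define h where "h l y = f1 (x + y + b * l) * ee (\<psi> * (real_of_int y)\<^sup>2)" for l y
  have Lne: "finite {0..<L}" "{0..<L} \<noteq> {}" using L by auto
  have "norm (avg {1..M} g - avg {1..M} (\<lambda>y. avg {0..<L} (\<lambda>l. h l y))) \<le> 2 * real_of_int (b * L) / M + 8 * \<delta> * (2 * real_of_int M * L + b * (real_of_int L)\<^sup>2)"
  proof (rule avg_shifts[OF _ M Lne])
    show "norm (g y) \<le> 1" for y by (simp add: g_def norm_mult f1)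
    show "0 \<le> b * l \<and> b * l \<le> b * L" if "l \<in> {0..<L}" for l using that b by auto
    fix l y assume l: "l \<in> {0..<L}" and y: "y \<in> {1..M}"
    define k where "k = 2 * y * l + b * l\<^sup>2"
    have k0: "0 \<le> k" using y b l by (auto simp: k_def)
    have k: "real_of_int k \<le> 2 * real_of_int M * L + b * (real_of_int L)\<^sup>2"
      unfolding k_def using y b l by (auto intro!: add_mono mult_mono power_mono)
    have "near_int (of_int k * (b * \<psi>)) (\<bar>of_int k\<bar> * \<delta>)" by (rule near_int_mult[OF nb])
    then have "norm (ee (of_int k * (b * \<psi>)) - 1) \<le> 8 * (\<bar>of_int k\<bar> * \<delta>)" by (rule ee_near_int)
    also have "\<dots> \<le> 8 * ((2 * real_of_int M * L + b * (real_of_int L)\<^sup>2) * \<delta>)" using k k0 d by (intro mult_left_mono mult_right_mono) auto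
    finally have n: "norm (ee (of_int k * (b * \<psi>)) - 1) \<le> 8 * \<delta> * (2 * real_of_int M * L + b * (real_of_int L)\<^sup>2)" by (simp add: mult_ac)
    have "\<psi> * (real_of_int (y + b * l))\<^sup>2 = \<psi> * (real_of_int y)\<^sup>2 + of_int k * (b * \<psi>)"
      by (simp add: k_def power2_eq_square algebra_simps)
    then have "g (y + b * l) - h l y = f1 (x + y + b * l) * ee (\<psi> * (real_of_int y)\<^sup>2) * (ee (of_int k * (b * \<psi>)) - 1)"
      unfolding g_def h_def by (simp only: ee_add) (simp add: algebra_simps)
    then have "norm (g (y + b * l) - h l y) = norm (f1 (x + y + b * l)) * norm (ee (of_int k * (b * \<psi>)) - 1)" by (simp add: norm_mult)
    also have "\<dots> \<le> 1 * norm (ee (of_int k * (b * \<psi>)) - 1)" by (intro mult_right_mono f1) auto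
    finally show "norm (g (y + b * l) - h l y) \<le> 8 * \<delta> * (2 * real_of_int M * L + b * (real_of_int L)\<^sup>2)" using n by simp
  qed (use d M b L in \<open>auto intro!: mult_nonneg_nonneg add_nonneg_nonneg\<close>)
  moreover have "norm (avg {1..M} (\<lambda>y. avg {0..<L} (\<lambda>l. h l y))) \<le> avg {1..M} (\<lambda>y. norm (avg {0..<L} (\<lambda>l. f1 (x + y + b * l))))"
  proof (rule order_trans[OF norm_avg_le], rule avg_mono)
    fix y
    show "norm (avg {0..<L} (\<lambda>l. h l y)) \<le> norm (avg {0..<L} (\<lambda>l. f1 (x + y + b * l)))"
      unfolding h_def avg_multc by (simp add: norm_mult)
  qed
  moreover have "norm (avg {1..M} g) \<le> norm (avg {1..M} (\<lambda>y. avg {0..<L} (\<lambda>l. h l y))) + norm (avg {1..M} g - avg {1..M} (\<lambda>y. avg {0..<L} (\<lambda>l. h l y)))"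
    by (rule norm_triangle_sub)
  ultimately show ?thesis unfolding g_def by simp
qed

context config
begin

text \<open>Unfolding the dual function and translating t by y^2 moves the square into the phase, as
  in \<open>interchange\<close> but with no derivatives. The weights c select and align the
  classes.\<close>

lemma fourier_class:
  fixes c a :: "int \<Rightarrow> complex" and j :: "int \<Rightarrow> int" and \<psi> :: "int \<Rightarrow> real"
  defines "\<psi> \<equiv> \<lambda>x. j (x mod q) / T"
  defines "a \<equiv> \<lambda>x. c (x mod q) * ee (\<psi> x * (x div q)) * f0 x"
  shows "per (q * T) a"
    and "avg {0..<q} (\<lambda>r. c r * avg {0..<T} (\<lambda>t. F r t * ee (of_int (j r) / of_int T * of_int t))) =
      avg {0..<q * T} (\<lambda>x. avg {1..M} (\<lambda>y. a x * f1 (x + y) * ee (\<psi> x * (of_int y)\<^sup>2)))"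
proof -
  have int: "ee (of_int (j r) / of_int T * of_int (t + T)) = ee (of_int (j r) / of_int T * of_int t)" for r t
  proof -
    have "of_int (j r) / of_int T * real_of_int (t + T) = of_int (j r) / of_int T * of_int t + of_int (j r)" using T0 by (simp add: field_simps)
    then show ?thesis by simp
  qed
  show "per (q * T) a" unfolding per_def
  proof
    fix x
    have 1: "(x + q * T) mod q = x mod q" by simp
    have 2: "(x + q * T) div q = x div q + T" using q by simp
    show "a (x + q * T) = a x" unfolding a_def \<psi>_def 1 2 int using per0 by (simp add: per_def)
  qed
  have cl: "avg {0..<T} (\<lambda>t. F r t * ee (of_int (j r) / of_int T * of_int t)) =
     avg {0..<T} (\<lambda>t. avg {1..M} (\<lambda>y. f0 (r + q * t) * f1 (r + q * t + y) * ee (of_int (j r) / of_int T * of_int (t + y\<^sup>2))))" for r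
  proof -
    have "avg {0..<T} (\<lambda>t. F r t * ee (of_int (j r) / of_int T * of_int t)) =
      avg {0..<T} (\<lambda>t. avg {1..M} (\<lambda>y. f0 (r + q * t - q * y\<^sup>2) * f1 (r + q * t - q * y\<^sup>2 + y) * ee (of_int (j r) / of_int T * of_int t)))"
      unfolding F_def dualf_def avg_multc ..
    also have "\<dots> = avg {1..M} (\<lambda>y. avg {0..<T} (\<lambda>t. f0 (r + q * t - q * y\<^sup>2) * f1 (r + q * t - q * y\<^sup>2 + y) * ee (of_int (j r) / of_int T * of_int t)))"
      by (rule avg_swap)
    also have "\<dots> = avg {1..M} (\<lambda>y. avg {0..<T} (\<lambda>t. f0 (r + q * t) * f1 (r + q * t + y) * ee (of_int (j r) / of_int T * of_int (t + y\<^sup>2))))"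
    proof (rule avg_cong[OF refl], rule avg_per_shift_eq[OF T0, symmetric])
      fix y t
      have "f0 (r + q * (t + T) - w) = f0 (r + q * t - w)" "f1 (r + q * (t + T) - w + y) = f1 (r + q * t - w + y)" for t w
        using per_mult[OF per0, of "r + q * t - w" 1] per_mult[OF per1, of "r + q * t - w + y" 1] by (simp_all add: algebra_simps)
      then show "per T (\<lambda>t. f0 (r + q * t - q * y\<^sup>2) * f1 (r + q * t - q * y\<^sup>2 + y) * ee (of_int (j r) / of_int T * of_int t))"
        unfolding per_def int by simp
      have s: "r + q * (t + y\<^sup>2) - q * y\<^sup>2 = r + q * t" by (simp add: algebra_simps)
      show "f0 (r + q * t) * f1 (r + q * t + y) * ee (of_int (j r) / of_int T * of_int (t + y\<^sup>2)) =
        f0 (r + q * (t + y\<^sup>2) - q * y\<^sup>2) * f1 (r + q * (t + y\<^sup>2) - q * y\<^sup>2 + y) * ee (of_int (j r) / of_int T * of_int (t + y\<^sup>2))" unfolding s ..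
    qed
    also have "\<dots> = avg {0..<T} (\<lambda>t. avg {1..M} (\<lambda>y. f0 (r + q * t) * f1 (r + q * t + y) * ee (of_int (j r) / of_int T * of_int (t + y\<^sup>2))))" by (rule avg_swap)
    finally show ?thesis .
  qed
  have "avg {0..<q} (\<lambda>r. c r * avg {0..<T} (\<lambda>t. F r t * ee (of_int (j r) / of_int T * of_int t))) =
    avg {0..<q} (\<lambda>r. avg {0..<T} (\<lambda>t. avg {1..M} (\<lambda>y. a (r + q * t) * f1 (r + q * t + y) * ee (\<psi> (r + q * t) * (of_int y)\<^sup>2))))"
  proof (rule avg_cong[OF refl])
    fix r assume r: "r \<in> {0..<q}"
    then have m: "(r + q * t) mod q = r" "(r + q * t) div q = t" for t by auto
    have e: "ee (of_int (j r) / of_int T * of_int (t + y\<^sup>2)) = ee (of_int (j r) / of_int T * of_int t) * ee (of_int (j r) / of_int T * (of_int y)\<^sup>2)" for t y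
      unfolding ee_add[symmetric] by (simp add: algebra_simps)
    show "c r * avg {0..<T} (\<lambda>t. F r t * ee (of_int (j r) / of_int T * of_int t)) =
      avg {0..<T} (\<lambda>t. avg {1..M} (\<lambda>y. a (r + q * t) * f1 (r + q * t + y) * ee (\<psi> (r + q * t) * (of_int y)\<^sup>2)))"
      unfolding cl avg_cmult[symmetric] a_def \<psi>_def m e by (simp add: mult_ac)
  qed
  also have "\<dots> = avg {0..<q * T} (\<lambda>x. avg {1..M} (\<lambda>y. a x * f1 (x + y) * ee (\<psi> x * (of_int y)\<^sup>2)))"
    by (rule avg_classes[OF q T0])
  finally show "avg {0..<q} (\<lambda>r. c r * avg {0..<T} (\<lambda>t. F r t * ee (of_int (j r) / of_int T * of_int t))) =
      avg {0..<q * T} (\<lambda>x. avg {1..M} (\<lambda>y. a x * f1 (x + y) * ee (\<psi> x * (of_int y)\<^sup>2)))" .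
qed

text \<open>One frequency is chosen for each class; classes with coefficient below 1 / D account for
  half of the assumed 2 / D. Weyl's inequality makes many of the remaining frequencies major, and
  the pigeonhole principle gives them a common b, along which f1 must have large averages.\<close>

lemma U2_inverse_dual:
  fixes D :: real
  assumes D: "D \<ge> 4" and MD: "D ^ 7000 \<le> M" and big: "2 / D \<le> avg {0..<q} (\<lambda>r. gowers T 2 (F r))"
  shows "\<exists>b::int. 1 \<le> b \<and> b \<le> D ^ 7000 \<and> (\<forall>L::int. 1 \<le> L \<longrightarrow> L * D ^ 30000 \<le> M \<longrightarrow>
    1 / D ^ 14002 \<le> avg {0..<q * T} (\<lambda>x. norm (avg {0..<L} (\<lambda>l. f1 (x + b * l)))))"
proof -
  have D2: "D \<ge> 2" and D0: "D > 0" using D by auto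
  have "\<forall>r. \<exists>j::int. gowers T 2 (F r) \<le> (norm (avg {0..<T} (\<lambda>t. F r t * ee (of_int j / of_int T * of_int t))))\<^sup>2"
    using U2_inverse[OF T0 per_F norm_F] by blast
  then obtain j :: "int \<Rightarrow> int" where j: "\<And>r. gowers T 2 (F r) \<le> (norm (avg {0..<T} (\<lambda>t. F r t * ee (of_int (j r) / of_int T * of_int t))))\<^sup>2" by metis
  define w where "w r = avg {0..<T} (\<lambda>t. F r t * ee (of_int (j r) / of_int T * of_int t))" for r
  have w1: "norm (w r) \<le> 1" for r unfolding w_def by (rule norm_avg_le_bound) (simp_all add: norm_mult norm_F)
  define G where "G r \<longleftrightarrow> 1 / D \<le> (norm (w r))\<^sup>2" for r
  define \<psi> where "\<psi> x = j (x mod q) / T" for x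
  \<comment> \<open>The set S is a parameter because the weight is used twice: with all good classes
    to find major frequencies, and with those of a common denominator to conclude.\<close>
  define a where "a S x = of_bool (x mod q \<in> S) * cnj (w (x mod q)) * ee (\<psi> x * (x div q)) * f0 x" for S x
  have qne: "finite {0..<q}" "{0..<q} \<noteq> {}" using q by auto
  have perpsi: "per q \<psi>" by (simp add: per_def \<psi>_def)
  have pera: "per (q * T) (a S)" for S
    using fourier_class(1)[of "\<lambda>r. of_bool (r \<in> S) * cnj (w r)" j] unfolding a_def \<psi>_def .
  have a1: "norm (a S x) \<le> 1" for S x unfolding a_def by (simp add: norm_mult mult_le_one w1 bd0)
  have exp: "avg {0..<q * T} (\<lambda>x. avg {1..M} (\<lambda>y. a S x * f1 (x + y) * ee (\<psi> x * (of_int y)\<^sup>2))) =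
     of_real (avg {0..<q} (\<lambda>r. of_bool (r \<in> S) * (norm (w r))\<^sup>2))" for S
  proof -
    have "of_real (avg {0..<q} (\<lambda>r. of_bool (r \<in> S) * (norm (w r))\<^sup>2)) = avg {0..<q} (\<lambda>r. of_bool (r \<in> S) * cnj (w r) * w r)"
      unfolding avg_of_real[symmetric]
    proof (rule avg_cong[OF refl])
      fix r
      show "of_real (of_bool (r \<in> S) * (norm (w r))\<^sup>2) = of_bool (r \<in> S) * cnj (w r) * w r"
        by (cases "r \<in> S") (simp_all add: complex_norm_square mult.commute del: of_real_power)
    qed
    then show ?thesis
      using fourier_class(2)[of "\<lambda>r. of_bool (r \<in> S) * cnj (w r)" j] unfolding a_def \<psi>_def w_def[symmetric] by simp
  qed
  have nonneg: "0 \<le> avg {0..<q} (\<lambda>r. of_bool (r \<in> S) * (norm (w r))\<^sup>2)" for S by (rule avg_nonneg) simp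
  have "2 / D \<le> avg {0..<q} (\<lambda>r. (norm (w r))\<^sup>2)" unfolding w_def by (rule order_trans[OF big avg_mono[OF j]])
  also have "\<dots> \<le> avg {0..<q} (\<lambda>r. 1 / D + of_bool (r \<in> Collect G) * (norm (w r))\<^sup>2)"
    by (rule avg_mono) (use D0 in \<open>auto simp: G_def\<close>)
  also have "\<dots> = 1 / D + avg {0..<q} (\<lambda>r. of_bool (r \<in> Collect G) * (norm (w r))\<^sup>2)" by (simp only: avg_add avg_const[OF qne])
  finally have e1: "1 / D \<le> avg {0..<q} (\<lambda>r. of_bool (r \<in> Collect G) * (norm (w r))\<^sup>2)" by simp
  define S where "S = {r\<in>{0..<q}. G r \<and> major (D ^ 7000) M (\<psi> r)}"
  have "q / D ^ 7000 \<le> card S" unfolding S_def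
  proof (rule weyl_classes[OF D2 MD q T0 refl, of "a (Collect G)" f1])
    show "1 / D \<le> norm (avg {0..<q * T} (\<lambda>x. avg {1..M} (\<lambda>y. a (Collect G) x * f1 (x + y) * ee (\<psi> x * (of_int y)\<^sup>2))))"
      unfolding exp using e1 nonneg[of "Collect G"] by simp
    show "G (x mod q)" if "a (Collect G) x \<noteq> 0" for x using that by (auto simp: a_def split: if_splits)
  qed (use pera a1 per1 bd1 perpsi in auto)
  moreover have Dp: "0 < D ^ k" "1 \<le> D ^ k" for k using D by (auto intro: one_le_power)
  ultimately have cS1: "q / D ^ 7000 \<le> card S" by simp
  have "0 < q / D ^ 7000" using q Dp(1)[of 7000] by simp
  then have "card S > 0" using cS1 by linarith
  then have cS: "q / D ^ 7000 \<le> card S" "S \<noteq> {}" "finite S" using cS1 by (auto simp: card_gt_0_iff)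
  define bb where "bb r = (SOME b::int. 1 \<le> b \<and> real_of_int b \<le> D ^ 7000 \<and> near_int (of_int b * \<psi> r) (D ^ 7000 / (real_of_int M)\<^sup>2))" for r
  have bb: "1 \<le> bb r" "bb r \<le> D ^ 7000" "near_int (of_int (bb r) * \<psi> r) (D ^ 7000 / (real_of_int M)\<^sup>2)" if "r \<in> S" for r
  proof -
    have "\<exists>b::int. 1 \<le> b \<and> real_of_int b \<le> D ^ 7000 \<and> near_int (of_int b * \<psi> r) (D ^ 7000 / (real_of_int M)\<^sup>2)"
      using that unfolding S_def major_def by blast
    from someI_ex[OF this] show "1 \<le> bb r" "bb r \<le> D ^ 7000" "near_int (of_int (bb r) * \<psi> r) (D ^ 7000 / (real_of_int M)\<^sup>2)"
      unfolding bb_def by blast+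
  qed
  define Z where "Z = \<lfloor>D ^ 7000\<rfloor>"
  have Zc: "real (card {1..Z}) \<le> D ^ 7000" using Dp(1)[of 7000] unfolding Z_def by simp
  have "bb ` S \<subseteq> {1..Z}" using bb by (auto simp: Z_def le_floor_iff)
  from pigeonhole_fibre[OF cS(3) _ this Zc cS(2)] obtain b where
    b: "b \<in> {1..Z}" "real (card S) \<le> D ^ 7000 * real (card {r\<in>S. bb r = b})" by auto
  define S' where "S' = {r\<in>S. bb r = b}"
  have bD: "1 \<le> b" "b \<le> D ^ 7000" using b(1) unfolding Z_def by (auto simp: le_floor_iff)
  have S'q: "S' \<subseteq> {0..<q}" by (auto simp: S'_def S_def)
  have q0: "real_of_int q > 0" using q by simp
  have "q / D ^ 7000 / D ^ 7000 \<le> D ^ 7000 * real (card S') / D ^ 7000"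
    using cS(1) b(2) Dp by (intro divide_right_mono) (auto simp: S'_def)
  then have "1 / (D ^ 7000 * D ^ 7000) \<le> card S' / q" using q0 Dp(1)[of 7000] by (simp add: field_simps)
  then have cS': "1 / D ^ 14000 \<le> card S' / q" by (simp only: power_add[symmetric]) simp
  have "1 / D ^ 14001 = 1 / D * (1 / D ^ 14000)" by (simp flip: power_Suc)
  also have "\<dots> \<le> 1 / D * (card S' / q)" using D0 by (intro mult_left_mono cS') auto
  also have "card S' / q = avg {0..<q} (\<lambda>r. of_bool (r \<in> S'))"
  proof -
    have "{r \<in> {0..<q}. r \<in> S'} = S'" using S'q by auto
    then show ?thesis using q by (simp add: avg_indicator)
  qed
  also have "1 / D * avg {0..<q} (\<lambda>r. of_bool (r \<in> S')) = avg {0..<q} (\<lambda>r. 1 / D * of_bool (r \<in> S'))" by (simp only: avg_cmult)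
  also have "\<dots> \<le> avg {0..<q} (\<lambda>r. of_bool (r \<in> S') * (norm (w r))\<^sup>2)"
    by (rule avg_mono) (auto simp: S'_def S_def G_def)
  also have "\<dots> = norm (avg {0..<q * T} (\<lambda>x. avg {1..M} (\<lambda>y. a S' x * f1 (x + y) * ee (\<psi> x * (of_int y)\<^sup>2))))"
    unfolding exp using nonneg[of S'] by simp
  finally have main: "1 / D ^ 14001 \<le> norm (avg {0..<q * T} (\<lambda>x. avg {1..M} (\<lambda>y. a S' x * f1 (x + y) * ee (\<psi> x * (of_int y)\<^sup>2))))" .
  have M0: "0 < real_of_int M" using M by simp
  have "1 / D ^ 14002 \<le> avg {0..<q * T} (\<lambda>x. norm (avg {0..<L} (\<lambda>l. f1 (x + b * l))))"
    if L: "1 \<le> L" "L * D ^ 30000 \<le> M" for L :: int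
  proof -
    define N where "N x = norm (avg {0..<L} (\<lambda>l. f1 (x + b * l)))" for x
    have perN: "per (q * T) N" 
    proof -
      have "f1 (x + q * T + b * l) = f1 (x + b * l)" for x l
        using per_mult[OF per1, of "x + b * l" 1] by (simp add: ac_simps)
      then show ?thesis unfolding N_def per_def by simp
    qed
    define \<delta> where "\<delta> = D ^ 7000 / (real_of_int M)\<^sup>2"
    have d0: "\<delta> \<ge> 0" using Dp by (simp add: \<delta>_def)
    define e where "e = 2 * real_of_int b * L / M + 8 * \<delta> * (2 * real_of_int M * L + b * (real_of_int L)\<^sup>2)"
    have e0: "e \<ge> 0" using M bD L d0 unfolding e_def by (intro add_nonneg_nonneg) auto
    have e: "e \<le> 1 / (2 * D ^ 14001)"
    proof -
      define u where "u = L / real_of_int M"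
      have u0: "0 \<le> u" using L M by (simp add: u_def)
      have u: "u \<le> 1 / D ^ 30000" using L(2) M0 Dp(1)[of 30000] by (simp add: u_def field_simps)
      have u1: "u \<le> 1" using u Dp(2)[of 30000] by (meson divide_le_eq_1 order_trans Dp(1))
      have "e = 2 * b * u + 8 * D ^ 7000 * (2 * u + b * u * u)"
        unfolding e_def \<delta>_def u_def using M0 by (simp add: field_simps power2_eq_square)
      also have "\<dots> \<le> 2 * D ^ 7000 * u + 8 * D ^ 7000 * (2 * u + D ^ 7000 * u * 1)"
        using bD u0 u1 Dp by (intro add_mono mult_left_mono mult_right_mono mult_mono) auto
      also have "\<dots> = (18 * D ^ 7000 + 8 * D ^ 14000) * u" by (simp add: algebra_simps flip: power_add)
      also have "\<dots> \<le> (26 * D ^ 14000) * u"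
      proof (rule mult_right_mono[OF _ u0])
        have "D ^ 7000 \<le> D ^ 14000" using D by (intro power_increasing) auto
        then show "18 * D ^ 7000 + 8 * D ^ 14000 \<le> 26 * D ^ 14000" by linarith
      qed
      also have "\<dots> \<le> (26 * D ^ 14000) * (1 / D ^ 30000)" using u Dp by (intro mult_left_mono) auto
      also have "\<dots> \<le> 1 / (2 * D ^ 14001)"
      proof -
        have "52 * D ^ 28001 \<le> D ^ 30000" by (rule pow_absorb[OF D2, of 52 6]) auto
        then have "(26 * D ^ 14000) * (2 * D ^ 14001) \<le> D ^ 30000" by (simp flip: power_add)
        then show ?thesis using Dp(1)[of 14001] Dp(1)[of 30000] by (simp add: divide_simps mult_ac)
      qed
      finally show ?thesis .
    qed
    have "norm (avg {0..<q * T} (\<lambda>x. avg {1..M} (\<lambda>y. a S' x * f1 (x + y) * ee (\<psi> x * (of_int y)\<^sup>2)))) \<le>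
      avg {0..<q * T} (\<lambda>x. norm (avg {1..M} (\<lambda>y. a S' x * f1 (x + y) * ee (\<psi> x * (of_int y)\<^sup>2))))" by (rule norm_avg_le)
    also have "\<dots> \<le> avg {0..<q * T} (\<lambda>x. avg {1..M} (\<lambda>y. N (x + y)) + e)"
    proof (rule avg_mono)
      fix x
      have N0: "0 \<le> avg {1..M} (\<lambda>y. N (x + y))" by (rule avg_nonneg) (simp add: N_def)
      show "norm (avg {1..M} (\<lambda>y. a S' x * f1 (x + y) * ee (\<psi> x * (of_int y)\<^sup>2))) \<le> avg {1..M} (\<lambda>y. N (x + y)) + e"
      proof (cases "x mod q \<in> S'")
        case True
        then have n: "near_int (b * \<psi> x) \<delta>" using bb(3)[of "x mod q"] unfolding S'_def \<delta>_def by (auto simp: \<psi>_def)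
        have "norm (avg {1..M} (\<lambda>y. a S' x * f1 (x + y) * ee (\<psi> x * (of_int y)\<^sup>2))) = norm (a S' x) * norm (avg {1..M} (\<lambda>y. f1 (x + y) * ee (\<psi> x * (of_int y)\<^sup>2)))"
          unfolding norm_mult[symmetric] avg_cmult[symmetric] by (simp add: mult.assoc)
        also have "\<dots> \<le> 1 * norm (avg {1..M} (\<lambda>y. f1 (x + y) * ee (\<psi> x * (of_int y)\<^sup>2)))" by (intro mult_right_mono a1) auto
        also have "\<dots> \<le> avg {1..M} (\<lambda>y. N (x + y)) + e"
          using shift_phase[of f1 M b L "\<psi> x" \<delta> x, OF bd1 M bD(1) L(1) n d0] unfolding N_def e_def by simp
        finally show ?thesis .
      next
        case False
        then show ?thesis using N0 e0 by (simp add: a_def avg_def)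
      qed
    qed
    also have "\<dots> = avg {1..M} (\<lambda>y. avg {0..<q * T} (\<lambda>x. N (x + y))) + e"
    proof -
      have ne: "finite {0..<q * T}" "{0..<q * T} \<noteq> {}" using q T0 by auto
      show ?thesis unfolding avg_add avg_const[OF ne] by (subst avg_swap) (rule refl)
    qed
    also have "\<dots> = avg {0..<q * T} N + e"
    proof -
      have "q * T > 0" using q T0 by simp
      then show ?thesis by (simp add: avg_per_shift[OF _ perN] avg_const[OF M_ne])
    qed
    finally have "1 / D ^ 14001 - 1 / (2 * D ^ 14001) \<le> avg {0..<q * T} N" using main e by linarith
    moreover have "1 / D ^ 14001 - 1 / (2 * D ^ 14001) = 1 / (2 * D ^ 14001)" using Dp(1)[of 14001] by (simp add: field_simps)
    moreover have "1 / D ^ 14002 \<le> 1 / (2 * D ^ 14001)"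
      using pow_absorb[OF D2, of 2 1 14001 14002] Dp(1)[of 14001] Dp(1)[of 14002] by (intro divide_left_mono) auto
    ultimately show ?thesis unfolding N_def by linarith
  qed
  then show ?thesis using bD by blast
qed

text \<open>For k at most 3 one has D1 <= 2 (2 D)^8 <= D^17, and 3929890 = 17 * (14010 * 16 +
  7010).\<close>

lemma degree_lowering_power:
  fixes D :: real
  assumes D: "D \<ge> 2" and k: "1 \<le> k" "k \<le> 3" and MD: "D ^ 3929890 \<le> M"
    and big: "1 / D \<le> avg {0..<q} (\<lambda>r. gowers T (k + 2) (F r))"
  shows "1 / D ^ 3929890 \<le> avg {0..<q} (\<lambda>r. gowers T (Suc k) (F r))"
proof -
  define D1 where "D1 = 2 * (2 * D) ^ (2 ^ k)"
  have "(2::nat) ^ k \<le> 2 ^ 3" using k by (intro power_increasing) auto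
  then have k8: "(2::nat) ^ k \<le> 8" by simp
  have "D1 \<le> D * (D * D) ^ 8" unfolding D1_def
  proof (intro mult_mono)
    have "(2 * D) ^ (2 ^ k) \<le> (2 * D) ^ 8" using D k8 by (intro power_increasing) auto
    also have "\<dots> \<le> (D * D) ^ 8" using D by (intro power_mono mult_right_mono) auto
    finally show "(2 * D) ^ (2 ^ k) \<le> (D * D) ^ 8" .
  qed (use D in auto)
  also have "\<dots> = D ^ 17" by (simp flip: power_mult_distrib power_add power_Suc power2_eq_square power_mult)
  finally have D1: "D1 \<le> D ^ 17" .
  have D10: "1 \<le> D1" "0 \<le> D1"
  proof -
    have "1 \<le> (2 * D) ^ (2 ^ k)" using D by (intro one_le_power) auto
    then show "1 \<le> D1" "0 \<le> D1" unfolding D1_def by auto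
  qed
  have p: "D1 ^ n \<le> D ^ m" if "17 * n \<le> m" for n m
  proof -
    have "D1 ^ n \<le> (D ^ 17) ^ n" using D1 D10 by (intro power_mono) auto
    also have "\<dots> = D ^ (17 * n)" by (simp add: power_mult)
    also have "\<dots> \<le> D ^ m" using D that by (intro power_increasing) auto
    finally show ?thesis .
  qed
  have "D1 ^ 7010 \<le> M" using p[of 7010 3929890] MD by simp
  from degree_lowering[OF D k(1) D1_def this big]
  have "1 / D1 ^ (14010 * 2 ^ Suc k + 7010) \<le> avg {0..<q} (\<lambda>r. gowers T (Suc k) (F r))" .
  moreover have "1 / D ^ 3929890 \<le> 1 / D1 ^ (14010 * 2 ^ Suc k + 7010)"
    using k8 D D10 p[of "14010 * 2 ^ Suc k + 7010" 3929890] by (intro divide_left_mono) auto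
  ultimately show ?thesis by linarith
qed

text \<open>Three degree lowerings lead from 5 to 2, each raising the loss to the power a. The start
  is B^30720 with B at most D^768, and 23592960 = 768 * 30720.\<close>

lemma U2_dual:
  fixes D :: real
  assumes a: "a = 3929890" and K: "K = 23592960 * a * a * a"
    and D: "D \<ge> 2" and MD: "D ^ K \<le> M"
    and f2: "per (q * T) f2" "\<And>x. norm (f2 x) \<le> 1"
    and big: "1 / D \<le> norm (avg {0..<q * T} (\<lambda>x. avg {1..M} (\<lambda>y. f0 x * f1 (x + y) * f2 (x + q * y\<^sup>2))))"
  shows "1 / D ^ K \<le> avg {0..<q} (\<lambda>r. gowers T 2 (F r))"
proof -
  have Dp: "2 \<le> D ^ n" if "n \<ge> 1" for n
  proof -
    have "D ^ 1 \<le> D ^ n" using D that by (intro power_increasing) auto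
    then show ?thesis using D by simp
  qed
  have a0: "a \<ge> 1" by (simp add: a)
  have le: "D ^ n \<le> M" if "n \<le> K" for n
  proof -
    have "D ^ n \<le> D ^ K" using D that by (intro power_increasing) auto
    then show ?thesis using MD by linarith
  qed
  define B where "B = (2 * D\<^sup>2) ^ 256"
  have B: "B ^ n \<le> D ^ (768 * n)" "0 < B ^ n" for n
  proof -
    have "2 * D\<^sup>2 \<le> D * D\<^sup>2" using D by (intro mult_right_mono) auto
    then have "2 * D\<^sup>2 \<le> D ^ 3" by (simp add: power3_eq_cube power2_eq_square mult.assoc)
    then have "(2 * D\<^sup>2) ^ (256 * n) \<le> (D ^ 3) ^ (256 * n)" by (intro power_mono) auto
    moreover have "B ^ n = (2 * D\<^sup>2) ^ (256 * n)" by (simp only: B_def power_mult)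
    moreover have "(D ^ 3) ^ (256 * n) = D ^ (768 * n)" unfolding power_mult[symmetric] by simp
    ultimately show "B ^ n \<le> D ^ (768 * n)" by simp
    show "0 < B ^ n" using D by (simp add: B_def)
  qed
  define c :: nat where "c = 23592960"
  have K': "K = c * a * a * a" by (simp add: K c_def)
  have c0: "c \<ge> 1" by (simp add: c_def)
  have cK: "c * a \<le> K" "c * a * a \<le> K" "c * a * a * a \<le> K" "c \<le> K" using a0 unfolding K' by simp_all
  have "B ^ 3000 \<le> D ^ (768 * 3000)" by (rule B)
  also have "\<dots> \<le> D ^ c" using D by (intro power_increasing) (auto simp: c_def)
  also have "\<dots> \<le> M" by (rule le[OF cK(4)])
  finally have "1 / B ^ 30720 \<le> avg {0..<q} (\<lambda>r. gowers T 5 (F r))" by (rule U5_dual[OF D B_def _ f2 big])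
  moreover have "1 / D ^ c \<le> 1 / B ^ 30720"
    using B(1)[of 30720] B(2)[of 30720] D by (intro divide_left_mono) (auto simp: c_def)
  ultimately have "1 / D ^ c \<le> avg {0..<q} (\<lambda>r. gowers T (Suc 4) (F r))" by simp
  moreover have step: "1 / D ^ (n * a) \<le> avg {0..<q} (\<lambda>r. gowers T k (F r))"
    if "1 / D ^ n \<le> avg {0..<q} (\<lambda>r. gowers T (Suc k) (F r))" "n * a \<le> K" "n \<ge> 1" "2 \<le> k" "k \<le> 4" for n k
  proof -
    have k: "k - 1 + 2 = Suc k" "Suc (k - 1) = k" using that by auto
    have "(D ^ n) ^ 3929890 = D ^ (n * a)" by (simp only: a power_mult)
    then show ?thesis using degree_lowering_power[of "D ^ n" "k - 1", OF Dp] le[of "n * a"] that unfolding k by simp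
  qed
  ultimately have "1 / D ^ (c * a) \<le> avg {0..<q} (\<lambda>r. gowers T 4 (F r))" using cK c0 by (rule_tac step) auto
  then have "1 / D ^ (c * a * a) \<le> avg {0..<q} (\<lambda>r. gowers T 3 (F r))" using cK c0 a0 by (rule_tac step) auto
  then show ?thesis unfolding K' using cK(3) c0 a0 by (rule_tac step) (auto simp: K')
qed

end

lemma inverse_theorem:
  "\<exists>K. \<forall>q T M f0 f1 f2 (D::real). config q T M f0 f1 \<longrightarrow> D \<ge> 2 \<longrightarrow> D ^ K \<le> M \<longrightarrow> per (q * T) f2 \<longrightarrow> (\<forall>x. norm (f2 x) \<le> 1) \<longrightarrow>
    1 / D \<le> norm (avg {0..<q * T} (\<lambda>x. avg {1..M} (\<lambda>y. f0 x * f1 (x + y) * f2 (x + q * y\<^sup>2)))) \<longrightarrow>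
    (\<exists>b::int. 1 \<le> b \<and> b \<le> D ^ K \<and> (\<forall>L::int. 1 \<le> L \<longrightarrow> L * D ^ K \<le> M \<longrightarrow>
      1 / D ^ K \<le> avg {0..<q * T} (\<lambda>x. norm (avg {0..<L} (\<lambda>l. f1 (x + b * l))))))"
proof -
  define a :: nat where "a = 3929890"
  define K0 :: nat where "K0 = 23592960 * a * a * a"
  have K0: "K0 \<ge> 1" by (simp add: K0_def a_def)
  have "\<exists>b::int. 1 \<le> b \<and> b \<le> D ^ (60000 * K0) \<and> (\<forall>L::int. 1 \<le> L \<longrightarrow> L * D ^ (60000 * K0) \<le> M \<longrightarrow>
      1 / D ^ (60000 * K0) \<le> avg {0..<q * T} (\<lambda>x. norm (avg {0..<L} (\<lambda>l. f1 (x + b * l)))))"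
    if cf: "config q T M f0 f1" and D: "D \<ge> 2" and MD: "D ^ (60000 * K0) \<le> M" and f2: "per (q * T) f2" "\<forall>x. norm (f2 x) \<le> 1"
      and big: "1 / D \<le> norm (avg {0..<q * T} (\<lambda>x. avg {1..M} (\<lambda>y. f0 x * f1 (x + y) * f2 (x + q * y\<^sup>2))))"
    for q T M f0 f1 f2 and D :: real
  proof -
    interpret config q T M f0 f1 by (rule cf)
    \<comment> \<open>The factor 2 provides the numerator in 2 / E and makes E at least 4. As E is
      at most D^(2 K0), the powers of E up to 30000 are at most D^(60000 K0).\<close>
    define E where "E = 2 * D ^ K0"
    have DK: "2 \<le> D ^ K0"
    proof -
      have "D ^ 1 \<le> D ^ K0" using D K0 by (intro power_increasing) auto
      then show ?thesis using D by simp
    qed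
    then have E4: "E \<ge> 4" by (simp add: E_def)
    have "E \<le> (D ^ K0) * (D ^ K0)" unfolding E_def using DK by (intro mult_right_mono) auto
    then have E: "E \<le> D ^ (2 * K0)" by (simp add: mult_2 flip: power_add)
    have En: "E ^ n \<le> D ^ (60000 * K0)" if "n \<le> 30000" for n
    proof -
      have "E ^ n \<le> (D ^ (2 * K0)) ^ n" using E E4 by (intro power_mono) auto
      also have "\<dots> = D ^ (2 * K0 * n)" by (simp add: power_mult)
      also have "\<dots> \<le> D ^ (60000 * K0)" using that D by (intro power_increasing) auto
      finally show ?thesis .
    qed
    have "D ^ K0 \<le> D ^ (60000 * K0)" using D by (intro power_increasing) auto
    then have "1 / D ^ K0 \<le> avg {0..<q} (\<lambda>r. gowers T 2 (F r))"
      using U2_dual[OF a_def K0_def D _ f2(1) _ big] f2(2) MD by simp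
    then have "2 / E \<le> avg {0..<q} (\<lambda>r. gowers T 2 (F r))" by (simp add: E_def)
    from U2_inverse_dual[OF E4 _ this] En[of 7000] MD obtain b where b: "1 \<le> b" "b \<le> E ^ 7000"
      "\<And>L::int. 1 \<le> L \<Longrightarrow> L * E ^ 30000 \<le> M \<Longrightarrow> 1 / E ^ 14002 \<le> avg {0..<q * T} (\<lambda>x. norm (avg {0..<L} (\<lambda>l. f1 (x + b * l))))" by auto
    show ?thesis
    proof (intro exI[of _ b] conjI allI impI b)
      show "b \<le> D ^ (60000 * K0)" using b(2) En[of 7000] by linarith
      fix L :: int assume L: "1 \<le> L" "L * D ^ (60000 * K0) \<le> M"
      have "L * E ^ 30000 \<le> L * D ^ (60000 * K0)" using L En[of 30000] by (intro mult_left_mono) auto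
      then have "1 / E ^ 14002 \<le> avg {0..<q * T} (\<lambda>x. norm (avg {0..<L} (\<lambda>l. f1 (x + b * l))))" using b(3)[OF L(1)] L(2) by linarith
      moreover have "1 / D ^ (60000 * K0) \<le> 1 / E ^ 14002" using En[of 14002] E4 D by (intro divide_left_mono) auto
      ultimately show "1 / D ^ (60000 * K0) \<le> avg {0..<q * T} (\<lambda>x. norm (avg {0..<L} (\<lambda>l. f1 (x + b * l))))" by linarith
    qed
  qed
  then show ?thesis by blast
qed

subsection \<open>Smoothing and the structured count\<close>

definition smooth :: "int \<Rightarrow> int \<Rightarrow> (int \<Rightarrow> 'a::real_normed_field) \<Rightarrow> int \<Rightarrow> 'a" where
  "smooth b L f x = avg {0..<L} (\<lambda>l. f (x + b * l))"

lemma norm_smooth: "(\<And>x. norm (f x) \<le> 1) \<Longrightarrow> norm (smooth b L f x) \<le> 1"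
  unfolding smooth_def by (rule norm_avg_le_bound) auto

lemma smooth_of_real: "smooth b L (\<lambda>x. of_real (f x)) x = of_real (smooth b L f x)"
  unfolding smooth_def by (rule avg_of_real)

lemma smooth_diff: "smooth b L (\<lambda>x. f x - g x) x = smooth b L f x - smooth b L g x"
  unfolding smooth_def by (rule avg_diff)

lemma per_smooth: "per P f \<Longrightarrow> per P (smooth b L f)"
proof -
  assume p: "per P f"
  have "f (x + P + b * l) = f (x + b * l)" for x l using per_mult[OF p, of "x + b * l" 1] by (simp add: ac_simps)
  then show ?thesis unfolding per_def smooth_def by simp
qed

lemma smooth_shift:
  fixes f :: "int \<Rightarrow> 'a::real_normed_field"
  assumes f: "\<And>x. norm (f x) \<le> 1" and L: "L > 0"
  shows "norm (smooth b L f (x + b * k) - smooth b L f x) \<le> 2 * \<bar>real_of_int k\<bar> / L"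
proof -
  have pos: "norm (smooth b L f (x + b * k) - smooth b L f x) \<le> 2 * real_of_int k / L" if k: "k \<ge> 0" for x k
  proof -
    have bij: "bij_betw (\<lambda>l. l - 1) {1..L} {0..<L}" by (rule bij_betw_byWitness[where f' = "\<lambda>l. l + 1"]) auto
    have "norm (avg {1..L} (\<lambda>l. f (x + b * (l + k - 1))) - avg {1..L} (\<lambda>l. f (x + b * (l - 1)))) \<le> 2 * real_of_int k / L"
      using avg_interval_shift[of "\<lambda>l. f (x + b * (l - 1))" L k] f L k by simp
    then show ?thesis unfolding smooth_def avg_reindex[OF bij] by (simp add: algebra_simps)
  qed
  show ?thesis
  proof (cases "k \<ge> 0")
    case True
    then show ?thesis using pos[of k x] by simp
  next
    case False
    then have "norm (smooth b L f (x + b * k + b * (- k)) - smooth b L f (x + b * k)) \<le> 2 * real_of_int (- k) / L" using pos[of "- k" "x + b * k"] by simp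
    then show ?thesis using False by (simp add: norm_minus_commute)
  qed
qed

text \<open>Smoothing with a multiple of the step b' over a much shorter total range is invisible to
  the smoothing with step b'. The translation by b c is included so that the same estimate serves
  when a whole form is translated.\<close>

lemma smooth_smooth:
  fixes f :: "int \<Rightarrow> 'a::real_normed_field"
  assumes f: "\<And>x. norm (f x) \<le> 1" and L: "L > 0" "L' > 0" and b: "b = b' * k" "k \<ge> 0" and c: "0 \<le> c" "c \<le> L"
  shows "norm (smooth b' L' f (x + b * c) - smooth b' L' (smooth b L f) x) \<le> 2 * real_of_int k * L / L'"
proof -
  have Lne: "finite {0..<L}" "{0..<L} \<noteq> {}" using L by auto
  have "smooth b' L' (smooth b L f) x = avg {0..<L} (\<lambda>l. smooth b' L' f (x + b * l))"
    unfolding smooth_def by (subst avg_swap) (simp add: ac_simps)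
  then have "smooth b' L' f (x + b * c) - smooth b' L' (smooth b L f) x = avg {0..<L} (\<lambda>l. smooth b' L' f (x + b * c) - smooth b' L' f (x + b * l))"
    by (simp only: avg_diff avg_const[OF Lne])
  also have "norm \<dots> \<le> 2 * real_of_int k * L / L'"
  proof (rule norm_avg_le_bound)
    fix l assume l: "l \<in> {0..<L}"
    have e: "x + b * l + b' * (k * (c - l)) = x + b * c" by (simp add: b algebra_simps)
    have "norm (smooth b' L' f (x + b * c) - smooth b' L' f (x + b * l)) \<le> 2 * \<bar>real_of_int (k * (c - l))\<bar> / L'"
      using smooth_shift[of f L' b' "x + b * l" "k * (c - l)"] f L(2) unfolding e by simp
    also have "\<dots> \<le> 2 * (real_of_int k * L) / L'"
    proof (intro divide_right_mono mult_left_mono)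
      have "\<bar>c - l\<bar> \<le> L" using l c by auto
      then have "\<bar>k * (c - l)\<bar> \<le> k * L" using b by (auto simp: abs_mult intro: mult_left_mono)
      then have "real_of_int \<bar>k * (c - l)\<bar> \<le> real_of_int (k * L)" by (simp only: of_int_le_iff)
      then show "\<bar>real_of_int (k * (c - l))\<bar> \<le> real_of_int k * L" by simp
    qed (use L in auto)
    finally show "norm (smooth b' L' f (x + b * c) - smooth b' L' f (x + b * l)) \<le> 2 * real_of_int k * L / L'" by simp
  qed (use L b in auto)
  finally show ?thesis .
qed

definition form :: "int \<Rightarrow> int \<Rightarrow> int \<Rightarrow> (int \<Rightarrow> 'a::real_normed_field) \<Rightarrow> (int \<Rightarrow> 'a) \<Rightarrow> (int \<Rightarrow> 'a) \<Rightarrow> 'a" where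
  "form q M P f0 f1 f2 = avg {0..<P} (\<lambda>x. avg {1..M} (\<lambda>y. f0 x * f1 (x + y) * f2 (x + q * y\<^sup>2)))"

lemma form_of_real: "form q M P (\<lambda>x. of_real (f0 x)) (\<lambda>x. of_real (f1 x)) (\<lambda>x. of_real (f2 x)) = of_real (form q M P f0 f1 f2)"
  unfolding form_def by (simp only: of_real_mult[symmetric] avg_of_real)

text \<open>A name for some exponent that works in \<open>inverse_theorem\<close>, so that later
  parameters can be chosen in terms of it.\<close>

definition inverse_exponent :: nat where
  "inverse_exponent = (SOME K. \<forall>q T M f0 f1 f2 (D::real). config q T M f0 f1 \<longrightarrow> D \<ge> 2 \<longrightarrow> D ^ K \<le> M \<longrightarrow> per (q * T) f2 \<longrightarrow> (\<forall>x. norm (f2 x) \<le> 1) \<longrightarrow>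
    1 / D \<le> norm (avg {0..<q * T} (\<lambda>x. avg {1..M} (\<lambda>y. f0 x * f1 (x + y) * f2 (x + q * y\<^sup>2)))) \<longrightarrow>
    (\<exists>b::int. 1 \<le> b \<and> b \<le> D ^ K \<and> (\<forall>L::int. 1 \<le> L \<longrightarrow> L * D ^ K \<le> M \<longrightarrow>
      1 / D ^ K \<le> avg {0..<q * T} (\<lambda>x. norm (avg {0..<L} (\<lambda>l. f1 (x + b * l)))))))"

lemma inverse:
  fixes D :: real
  assumes "config q T M f0 f1" "D \<ge> 2" "D ^ inverse_exponent \<le> M" "per (q * T) f2" "\<And>x. norm (f2 x) \<le> 1" "1 / D \<le> norm (form q M (q * T) f0 f1 f2)"
  obtains b :: int where "1 \<le> b" "b \<le> D ^ inverse_exponent"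
    "\<And>L::int. 1 \<le> L \<Longrightarrow> L * D ^ inverse_exponent \<le> M \<Longrightarrow> 1 / D ^ inverse_exponent \<le> avg {0..<q * T} (\<lambda>x. norm (smooth b L f1 x))"
proof -
  have "\<exists>b::int. 1 \<le> b \<and> b \<le> D ^ inverse_exponent \<and> (\<forall>L::int. 1 \<le> L \<longrightarrow> L * D ^ inverse_exponent \<le> M \<longrightarrow>
      1 / D ^ inverse_exponent \<le> avg {0..<q * T} (\<lambda>x. norm (avg {0..<L} (\<lambda>l. f1 (x + b * l)))))"
    using someI_ex[OF inverse_theorem, folded inverse_exponent_def] assms unfolding form_def by blast
  then show ?thesis using that unfolding smooth_def by blast
qed

text \<open>Otherwise the inverse theorem would find large averages of f - smooth f along some step
  b. But B is a multiple of every admissible b, so averaging over the longer range L' with step b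
  identifies f with its smoothing and the averages are tiny.\<close>

lemma smooth_linear_factor:
  fixes D :: real and f f0 f2 :: "int \<Rightarrow> complex" and q M T B L L' :: int
  assumes q: "q > 0" and TM: "M\<^sup>2 \<le> T" "T \<le> 16 * M\<^sup>2" and M: "M > 0" "D ^ inverse_exponent \<le> M" and D: "D \<ge> 2"
    and per: "per (q * T) f0" "per (q * T) f" "per (q * T) f2"
    and bd: "\<And>x. norm (f0 x) \<le> 1" "\<And>x. norm (f x) \<le> 1" "\<And>x. norm (f2 x) \<le> 1" "\<And>x. norm (f x - smooth B L f x) \<le> 1"
    and B: "B > 0" "\<And>b::int. 1 \<le> b \<Longrightarrow> real_of_int b \<le> D ^ inverse_exponent \<Longrightarrow> b dvd B"
    and L: "L > 0" "L' > 0" "L' * D ^ inverse_exponent \<le> M" "2 * real_of_int B * L * D ^ inverse_exponent < L'"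
  shows "norm (form q M (q * T) f0 (\<lambda>x. f x - smooth B L f x) f2) \<le> 1 / D"
proof (rule ccontr)
  assume "\<not> ?thesis"
  then have big: "1 / D \<le> norm (form q M (q * T) f0 (\<lambda>x. f x - smooth B L f x) f2)" by simp
  have "config q T M f0 (\<lambda>x. f x - smooth B L f x)"
  proof
    show "per (q * T) (\<lambda>x. f x - smooth B L f x)" using per(2) per_smooth[OF per(2), of B L] by (simp add: per_def)
  qed (use q M TM per bd in auto)
  from inverse[OF this D M(2) per(3) bd(3) big] obtain b where b: "1 \<le> b" "b \<le> D ^ inverse_exponent"
    "\<And>R::int. 1 \<le> R \<Longrightarrow> R * D ^ inverse_exponent \<le> M \<Longrightarrow> 1 / D ^ inverse_exponent \<le> avg {0..<q * T} (\<lambda>x. norm (smooth b R (\<lambda>x. f x - smooth B L f x) x))" by blast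
  obtain k where k: "B = b * k" using B(2)[OF b(1,2)] by (auto elim: dvdE)
  have "0 < b * k" using B(1) k by simp
  then have k0: "k \<ge> 0" using b(1) by (simp add: zero_less_mult_iff)
  have "1 / D ^ inverse_exponent \<le> avg {0..<q * T} (\<lambda>x. norm (smooth b L' (\<lambda>x. f x - smooth B L f x) x))" using b(3)[of L'] L by simp
  also have "\<dots> \<le> 2 * real_of_int B * L / L'"
  proof (rule avg_le)
    fix x
    have "norm (smooth b L' (\<lambda>x. f x - smooth B L f x) x) = norm (smooth b L' f (x + B * 0) - smooth b L' (smooth B L f) x)" by (simp add: smooth_diff)
    also have "\<dots> \<le> 2 * real_of_int k * L / L'" by (rule smooth_smooth) (use bd L k k0 in auto)
    also have "\<dots> \<le> 2 * real_of_int B * L / L'"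
    proof -
      have "1 * k \<le> b * k" using b k0 by (intro mult_right_mono) auto
      then have "real_of_int k \<le> real_of_int B" unfolding k by (simp only: of_int_le_iff)
      then show ?thesis using L by (intro divide_right_mono mult_right_mono mult_left_mono) auto
    qed
    finally show "norm (smooth b L' (\<lambda>x. f x - smooth B L f x) x) \<le> 2 * real_of_int B * L / L'" .
  qed (use B L in auto)
  finally have "1 / D ^ inverse_exponent \<le> 2 * real_of_int B * L / L'" .
  moreover have "0 < D ^ inverse_exponent" using D by simp
  ultimately have "L' \<le> 2 * real_of_int B * L * D ^ inverse_exponent" using L by (simp add: field_simps)
  then show False using L(4) by simp
qed

lemma ft_avg_shift:
  assumes P: "P > 0" and f: "per P f"
  shows "ft P (\<lambda>x. avg I (\<lambda>i. f (x + s i))) \<xi> = ft P f \<xi> * avg I (\<lambda>i. ee (of_int \<xi> / of_int P * of_int (s i)))"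
proof -
  have "ft P (\<lambda>x. avg I (\<lambda>i. f (x + s i))) \<xi> = avg I (\<lambda>i. avg {0..<P} (\<lambda>x. f (x + s i) * ee (- (of_int \<xi> / of_int P * of_int x))))"
    unfolding ft_def avg_multc[symmetric] by (rule avg_swap)
  also have "\<dots> = avg I (\<lambda>i. ft P f \<xi> * ee (of_int \<xi> / of_int P * of_int (s i)))"
  proof (rule avg_cong[OF refl])
    fix i
    have "avg {0..<P} (\<lambda>x. f (x + s i) * ee (- (of_int \<xi> / of_int P * of_int x))) =
      avg {0..<P} (\<lambda>x. f x * ee (- (of_int \<xi> / of_int P * of_int x)) * ee (of_int \<xi> / of_int P * of_int (s i)))"
    proof (rule avg_per_shift_eq[OF P])
      have "- (of_int \<xi> / of_int P * real_of_int (x + P)) = - (of_int \<xi> / of_int P * of_int x) + of_int (- \<xi>)" for x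
        using P by (simp add: field_simps)
      then have "ee (- (of_int \<xi> / of_int P * real_of_int (x + P))) = ee (- (of_int \<xi> / of_int P * of_int x))" for x by (simp only: ee_add_int)
      then show "per P (\<lambda>x. f x * ee (- (of_int \<xi> / of_int P * of_int x)) * ee (of_int \<xi> / of_int P * of_int (s i)))"
        using f unfolding per_def by simp
      fix x
      have "- (of_int \<xi> / of_int P * real_of_int (x + s i)) + of_int \<xi> / of_int P * of_int (s i) = - (of_int \<xi> / of_int P * of_int x)" by (simp add: algebra_simps)
      then show "f (x + s i) * ee (- (of_int \<xi> / of_int P * of_int x)) =
        f (x + s i) * ee (- (of_int \<xi> / of_int P * of_int (x + s i))) * ee (of_int \<xi> / of_int P * of_int (s i))"
        by (simp only: mult.assoc ee_add[symmetric])
    qed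
    also have "\<dots> = ft P f \<xi> * ee (of_int \<xi> / of_int P * of_int (s i))" unfolding ft_def by (rule avg_multc)
    finally show "avg {0..<P} (\<lambda>x. f (x + s i) * ee (- (of_int \<xi> / of_int P * of_int x))) = ft P f \<xi> * ee (of_int \<xi> / of_int P * of_int (s i))" .
  qed
  finally show ?thesis by (simp only: avg_cmult)
qed

text \<open>On the Fourier side either the quadratic exponential sum in the shift is small, or the
  frequency is major, and then smoothing acts on it almost as the identity.\<close>
lemma smoothed_quadratic_shift:
  fixes D :: real and f :: "int \<Rightarrow> complex" and P q B B' Q L J y :: int
  assumes P: "P > 0" and f: "per P f" "\<And>x. norm (f x) \<le> 1" and D: "D \<ge> 2" and J: "D ^ 90 \<le> J"
    and Q: "Q = q * B\<^sup>2 * B'" and B': "B' > 0" "\<And>b::int. 1 \<le> b \<Longrightarrow> real_of_int b \<le> D ^ 16 \<Longrightarrow> b dvd B'"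
    and L: "L > 0" "8 * real_of_int L * B' * D ^ 60 / (real_of_int J)\<^sup>2 \<le> 1 / D"
  shows "avg {0..<P} (\<lambda>x. norm (avg {1..J} (\<lambda>j. f (x + q * (y + B * j)\<^sup>2) - smooth Q L f (x + q * (y + B * j)\<^sup>2)))) \<le> 2 / D"
proof -
  define h where "h x = f x - smooth Q L f x" for x
  define H where "H x = avg {1..J} (\<lambda>j. h (x + q * (y + B * j)\<^sup>2))" for x
  define e where "e \<xi> = avg {1..J} (\<lambda>j. ee (of_int \<xi> / of_int P * of_int (q * (y + B * j)\<^sup>2)))" for \<xi> :: int
  define m where "m \<xi> = avg {0..<L} (\<lambda>c. ee (of_int \<xi> / of_int P * of_int (Q * c)))" for \<xi> :: int
  have D1: "1 \<le> D ^ 90" using D by (intro one_le_power) auto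
  have J0: "J > 0" using J D1 by linarith
  have e1: "norm (e \<xi>) \<le> 1" and m1: "norm (m \<xi>) \<le> 1" for \<xi> unfolding e_def m_def by (rule norm_avg_le_bound; simp)+
  have ph: "per P h" unfolding h_def using f(1) per_smooth[OF f(1), of Q L] by (simp add: per_def)
  have "ft P h \<xi> = ft P f \<xi> - ft P (smooth Q L f) \<xi>" for \<xi> unfolding ft_def h_def by (simp only: left_diff_distrib avg_diff)
  then have fth: "ft P h \<xi> = ft P f \<xi> * (1 - m \<xi>)" for \<xi>
    using ft_avg_shift[OF P f(1), of "{0..<L}" "\<lambda>c. Q * c" \<xi>] by (simp add: smooth_def[abs_def] m_def right_diff_distrib)
  have ftH: "ft P H \<xi> = ft P f \<xi> * (1 - m \<xi>) * e \<xi>" for \<xi>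
    unfolding H_def e_def fth[symmetric] by (rule ft_avg_shift[OF P ph])
  have small: "norm ((1 - m \<xi>) * e \<xi>) \<le> 2 / D" for \<xi>
  proof (cases "1 / D \<le> norm (e \<xi>)")
    case False
    have "norm (1 - m \<xi>) \<le> norm (1::complex) + norm (m \<xi>)" by (rule norm_triangle_ineq4)
    also have "\<dots> \<le> 2" using m1[of \<xi>] by simp
    finally have "norm (1 - m \<xi>) * norm (e \<xi>) \<le> 2 * (1 / D)" using False by (intro mult_mono) auto
    then show ?thesis by (simp add: norm_mult)
  next
    case True
    \<comment> \<open>The coefficient of j^2. The form Q = q B^2 B' makes \<xi> Q / P equal to B'
      \<alpha>, a multiple of b \<alpha> for each possible b, so on major frequencies the multiplier
      of the smoothing is close to 1.\<close>
    define \<alpha> where "\<alpha> = of_int \<xi> / real_of_int P * of_int (q * B\<^sup>2)"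
    define \<beta> where "\<beta> = of_int \<xi> / real_of_int P * of_int (2 * q * B * y)"
    have "ee (of_int \<xi> / of_int P * of_int (q * (y + B * j)\<^sup>2)) = ee (of_int \<xi> / of_int P * of_int (q * y\<^sup>2)) * ee (\<alpha> * (of_int j)\<^sup>2 + \<beta> * of_int j)" for j
      unfolding ee_add[symmetric] \<alpha>_def \<beta>_def by (simp add: power2_eq_square algebra_simps)
    then have "e \<xi> = ee (of_int \<xi> / of_int P * of_int (q * y\<^sup>2)) * avg {1..J} (\<lambda>j. ee (\<alpha> * (of_int j)\<^sup>2 + \<beta> * of_int j))"
      unfolding e_def by (simp only: avg_cmult)
    then have "norm (e \<xi>) = norm (\<Sum>j\<in>{1..J}. ee (\<alpha> * (of_int j)\<^sup>2 + \<beta> * of_int j)) / J"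
      using J0 by (simp add: norm_mult avg_def norm_divide)
    then have "J / D \<le> norm (\<Sum>j\<in>{1..J}. ee (\<alpha> * (of_int j)\<^sup>2 + \<beta> * of_int j))" 
    proof -
      have "J * (1 / D) \<le> J * norm (e \<xi>)" using True J0 by (intro mult_left_mono) auto
      then show ?thesis using \<open>norm (e \<xi>) = _\<close> J0 by simp
    qed
    from quadratic_weyl[OF D J _ _ this] obtain b :: int where b: "1 \<le> b" "b \<le> D ^ 16" "near_int (of_int b * \<alpha>) (D ^ 60 / (real_of_int J)\<^sup>2)" by auto
    from B'(2)[OF b(1,2)] obtain k where k: "B' = b * k" by (auto elim: dvdE)
    have "0 < b * k" using B'(1) k by simp
    then have k0: "k \<ge> 0" using b(1) by (simp add: zero_less_mult_iff)
    have kB: "k \<le> B'" using mult_right_mono[of 1 b k] b k0 k by simp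
    have n1: "norm (ee (of_int \<xi> / of_int P * of_int (Q * c)) - 1) \<le> 1 / D" if c: "c \<in> {0..<L}" for c
    proof -
      have "of_int \<xi> / of_int P * of_int (Q * c) = of_int (k * c) * (of_int b * \<alpha>)" by (simp add: \<alpha>_def Q k)
      then have "norm (ee (of_int \<xi> / of_int P * of_int (Q * c)) - 1) \<le> 8 * (\<bar>of_int (k * c)\<bar> * (D ^ 60 / (real_of_int J)\<^sup>2))"
        using ee_near_int[OF near_int_mult[OF b(3), of "k * c"]] by simp
      also have "\<dots> \<le> 8 * ((L * real_of_int B') * (D ^ 60 / (real_of_int J)\<^sup>2))"
      proof (intro mult_left_mono mult_right_mono)
        have "\<bar>k * c\<bar> \<le> B' * L" using c k0 kB by (simp add: abs_mult mult_mono)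
        then have "real_of_int \<bar>k * c\<bar> \<le> real_of_int (B' * L)" by (simp only: of_int_le_iff)
        then show "\<bar>real_of_int (k * c)\<bar> \<le> L * real_of_int B'" by (simp add: mult.commute)
      qed (use D in auto)
      also have "\<dots> \<le> 1 / D" using L(2) by simp
      finally show ?thesis .
    qed
    have Lne: "finite {0..<L}" "{0..<L} \<noteq> {}" using L by auto
    have "1 - m \<xi> = avg {0..<L} (\<lambda>c. 1 - ee (of_int \<xi> / of_int P * of_int (Q * c)))" by (simp only: m_def avg_diff avg_const[OF Lne])
    then have "norm (1 - m \<xi>) \<le> 1 / D" using n1 D by (auto simp: norm_minus_commute intro!: norm_avg_le_bound)
    then have "norm (1 - m \<xi>) * norm (e \<xi>) \<le> 1 / D * 1" using e1 D by (intro mult_mono) auto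
    also have "\<dots> \<le> 2 / D" using D by (simp add: divide_right_mono)
    finally show ?thesis by (simp add: norm_mult)
  qed
  have "(avg {0..<P} (\<lambda>x. norm (H x)))\<^sup>2 \<le> avg {0..<P} (\<lambda>x. (norm (H x))\<^sup>2)" by (rule avg_sq_real)
  also have "\<dots> = (\<Sum>\<xi>\<in>{0..<P}. (norm (ft P H \<xi>))\<^sup>2)" by (rule parseval[OF P, symmetric])
  also have "\<dots> \<le> (\<Sum>\<xi>\<in>{0..<P}. (norm (ft P f \<xi>))\<^sup>2 * (2 / D)\<^sup>2)"
  proof (rule sum_mono)
    fix \<xi>
    have "(norm (ft P H \<xi>))\<^sup>2 = (norm (ft P f \<xi>))\<^sup>2 * (norm ((1 - m \<xi>) * e \<xi>))\<^sup>2" by (simp add: ftH norm_mult power_mult_distrib)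
    also have "\<dots> \<le> (norm (ft P f \<xi>))\<^sup>2 * (2 / D)\<^sup>2" by (intro mult_left_mono power_mono small) auto
    finally show "(norm (ft P H \<xi>))\<^sup>2 \<le> (norm (ft P f \<xi>))\<^sup>2 * (2 / D)\<^sup>2" .
  qed
  also have "\<dots> = avg {0..<P} (\<lambda>x. (norm (f x))\<^sup>2) * (2 / D)\<^sup>2" by (simp only: sum_distrib_right[symmetric] parseval[OF P])
  also have "\<dots> \<le> 1 * (2 / D)\<^sup>2" by (intro mult_right_mono avg_le power_le_one f) auto
  finally have "(avg {0..<P} (\<lambda>x. norm (H x)))\<^sup>2 \<le> (2 / D)\<^sup>2" by simp
  then have "avg {0..<P} (\<lambda>x. norm (H x)) \<le> 2 / D" by (rule power2_le_imp_le) (use D in simp)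
  then show ?thesis unfolding H_def h_def .
qed

text \<open>Moving y by B j scarcely affects g, so the average over j falls on the last factor
  alone, where the Fourier estimate is independent of the other two functions. This is why the
  linear factor has to be smoothed first.\<close>

lemma smooth_quadratic_factor:
  fixes D :: real and f f0 g :: "int \<Rightarrow> complex" and P q M B B' Q L J :: int
  assumes P: "P > 0" and M: "M > 0" and f: "per P f" "\<And>x. norm (f x) \<le> 1" and D: "D \<ge> 2" and J: "D ^ 90 \<le> J"
    and Q: "Q = q * B\<^sup>2 * B'" and B': "B' > 0" "\<And>b::int. 1 \<le> b \<Longrightarrow> real_of_int b \<le> D ^ 16 \<Longrightarrow> b dvd B'" and B: "B > 0"
    and L: "L > 0" "8 * real_of_int L * B' * D ^ 60 / (real_of_int J)\<^sup>2 \<le> 1 / D"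
    and bd: "\<And>x. norm (f0 x) \<le> 1" "\<And>x. norm (g x) \<le> 1" "\<And>x. norm (f x - smooth Q L f x) \<le> 1"
    and g: "\<And>x j. j \<in> {1..J} \<Longrightarrow> norm (g (x + B * j) - g x) \<le> \<epsilon>" "\<epsilon> \<ge> 0"
  shows "norm (form q M P f0 g (\<lambda>x. f x - smooth Q L f x)) \<le> 2 * real_of_int B * J / M + \<epsilon> + 2 / D"
proof -
  define h where "h x = f x - smooth Q L f x" for x
  define H where "H y x = avg {1..J} (\<lambda>j. h (x + q * (y + B * j)\<^sup>2))" for y x
  have D1: "1 \<le> D ^ 90" using D by (intro one_le_power) auto
  have J0: "J > 0" using J D1 by linarith
  have Jne: "finite {1..J}" "{1..J} \<noteq> {}" using J0 by auto
  have h1: "norm (h x) \<le> 1" for x unfolding h_def by (rule bd)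
  have pt: "norm (avg {1..M} (\<lambda>y. f0 x * g (x + y) * h (x + q * y\<^sup>2))) \<le> 2 * real_of_int B * J / M + \<epsilon> + avg {1..M} (\<lambda>y. norm (H y x))" for x
  proof -
    define \<phi> where "\<phi> y = f0 x * g (x + y) * h (x + q * y\<^sup>2)" for y
    define \<psi> where "\<psi> j y = f0 x * g (x + y) * h (x + q * (y + B * j)\<^sup>2)" for j y
    have "norm (avg {1..M} \<phi> - avg {1..M} (\<lambda>y. avg {1..J} (\<lambda>j. \<psi> j y))) \<le> 2 * real_of_int (B * J) / M + \<epsilon>"
    proof (rule avg_shifts[OF _ M Jne])
      show "norm (\<phi> y) \<le> 1" for y unfolding \<phi>_def by (simp add: norm_mult mult_le_one bd h1)
      show "0 \<le> B * j \<and> B * j \<le> B * J" if "j \<in> {1..J}" for j using that B by auto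
      fix j y assume j: "j \<in> {1..J}"
      have "\<phi> (y + B * j) - \<psi> j y = f0 x * (g (x + y + B * j) - g (x + y)) * h (x + q * (y + B * j)\<^sup>2)"
        unfolding \<phi>_def \<psi>_def by (simp add: algebra_simps)
      then have "norm (\<phi> (y + B * j) - \<psi> j y) = norm (f0 x) * norm (g (x + y + B * j) - g (x + y)) * norm (h (x + q * (y + B * j)\<^sup>2))" by (simp add: norm_mult)
      also have "\<dots> \<le> 1 * \<epsilon> * 1" using g bd h1 j by (intro mult_mono) auto
      finally show "norm (\<phi> (y + B * j) - \<psi> j y) \<le> \<epsilon>" by simp
    qed (rule g(2))
    moreover have "norm (avg {1..M} \<phi>) \<le> norm (avg {1..M} \<phi> - avg {1..M} (\<lambda>y. avg {1..J} (\<lambda>j. \<psi> j y))) + norm (avg {1..M} (\<lambda>y. avg {1..J} (\<lambda>j. \<psi> j y)))"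
      using norm_triangle_sub[of "avg {1..M} \<phi>"] by (simp add: add.commute)
    moreover have "norm (avg {1..M} (\<lambda>y. avg {1..J} (\<lambda>j. \<psi> j y))) \<le> avg {1..M} (\<lambda>y. norm (avg {1..J} (\<lambda>j. \<psi> j y)))" by (rule norm_avg_le)
    moreover have "avg {1..M} (\<lambda>y. norm (avg {1..J} (\<lambda>j. \<psi> j y))) \<le> avg {1..M} (\<lambda>y. norm (H y x))"
    proof (rule avg_mono)
      fix y
      have "norm (avg {1..J} (\<lambda>j. \<psi> j y)) = norm (f0 x) * norm (g (x + y)) * norm (H y x)"
        unfolding \<psi>_def H_def avg_cmult norm_mult ..
      also have "\<dots> \<le> 1 * 1 * norm (H y x)" by (intro mult_mono bd) auto
      finally show "norm (avg {1..J} (\<lambda>j. \<psi> j y)) \<le> norm (H y x)" by simp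
    qed
    ultimately show ?thesis unfolding \<phi>_def by simp
  qed
  have Pne: "finite {0..<P}" "{0..<P} \<noteq> {}" using P by auto
  have "norm (form q M P f0 g h) \<le> avg {0..<P} (\<lambda>x. norm (avg {1..M} (\<lambda>y. f0 x * g (x + y) * h (x + q * y\<^sup>2))))"
    unfolding form_def by (rule norm_avg_le)
  also have "\<dots> \<le> avg {0..<P} (\<lambda>x. (2 * real_of_int B * J / M + \<epsilon>) + avg {1..M} (\<lambda>y. norm (H y x)))"
    by (rule avg_mono[OF pt])
  also have "\<dots> = (2 * real_of_int B * J / M + \<epsilon>) + avg {1..M} (\<lambda>y. avg {0..<P} (\<lambda>x. norm (H y x)))"
    unfolding avg_add avg_const[OF Pne] by (subst avg_swap) (rule refl)
  also have "avg {1..M} (\<lambda>y. avg {0..<P} (\<lambda>x. norm (H y x))) \<le> 2 / D"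
    unfolding H_def h_def by (rule avg_le[OF smoothed_quadratic_shift]) (use assms in auto)
  finally show ?thesis unfolding h_def[abs_def] by simp
qed

text \<open>The form is invariant under translation of x by Q c. Averaging over c smooths the first
  factor, while the other two, already smooth at larger scales, hardly move; no inverse theorem is
  involved. Afterwards all three factors can be averages of one function.\<close>

lemma form_smooth:
  fixes f g0 g1 g2 v w :: "int \<Rightarrow> real"
  assumes P: "P > 0" and L: "L > 0" and per: "per P f" "per P g1" "per P g2"
    and bd: "\<And>x. \<bar>f x\<bar> \<le> 1" "\<And>x. \<bar>g1 x\<bar> \<le> 1" "\<And>x. \<bar>g2 x\<bar> \<le> 1" "\<And>x. \<bar>v x\<bar> \<le> 1"
    and v: "\<And>x c. c \<in> {0..<L} \<Longrightarrow> \<bar>g1 (x + Q * c) - v x\<bar> \<le> \<epsilon>1" and w: "\<And>x c. c \<in> {0..<L} \<Longrightarrow> \<bar>g2 (x + Q * c) - w x\<bar> \<le> \<epsilon>2"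
    and e: "\<epsilon>1 \<ge> 0" "\<epsilon>2 \<ge> 0"
  shows "\<bar>form q M P f g1 g2 - form q M P (smooth Q L f) v w\<bar> \<le> \<epsilon>1 + \<epsilon>2"
proof -
  have Lne: "finite {0..<L}" "{0..<L} \<noteq> {}" using L by auto
  have sh: "form q M P f g1 g2 = avg {0..<P} (\<lambda>x. avg {1..M} (\<lambda>y. f (x + Q * c) * g1 (x + y + Q * c) * g2 (x + q * y\<^sup>2 + Q * c)))" for c
    unfolding form_def
  proof (rule avg_per_shift_eq[OF P, symmetric])
    have "g1 (x + P + y) = g1 (x + y)" "g2 (x + P + y) = g2 (x + y)" for x y
      using per_mult[OF per(2), of "x + y" 1] per_mult[OF per(3), of "x + y" 1] by (simp_all add: ac_simps)
    then show "per P (\<lambda>x. avg {1..M} (\<lambda>y. f x * g1 (x + y) * g2 (x + q * y\<^sup>2)))" using per(1) unfolding per_def by simp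
    show "avg {1..M} (\<lambda>y. f (x + Q * c) * g1 (x + y + Q * c) * g2 (x + q * y\<^sup>2 + Q * c)) = avg {1..M} (\<lambda>y. f (x + Q * c) * g1 (x + Q * c + y) * g2 (x + Q * c + q * y\<^sup>2))" for x
      by (simp add: ac_simps)
  qed
  have L1: "form q M P f g1 g2 = avg {0..<L} (\<lambda>c. avg {0..<P} (\<lambda>x. avg {1..M} (\<lambda>y. f (x + Q * c) * g1 (x + y + Q * c) * g2 (x + q * y\<^sup>2 + Q * c))))"
    unfolding sh[symmetric] by (rule avg_const[OF Lne, symmetric])
  have "form q M P (smooth Q L f) v w = avg {0..<P} (\<lambda>x. avg {1..M} (\<lambda>y. avg {0..<L} (\<lambda>c. f (x + Q * c) * v (x + y) * w (x + q * y\<^sup>2))))"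
    unfolding form_def smooth_def avg_multc ..
  also have "\<dots> = avg {0..<P} (\<lambda>x. avg {0..<L} (\<lambda>c. avg {1..M} (\<lambda>y. f (x + Q * c) * v (x + y) * w (x + q * y\<^sup>2))))"
    by (rule avg_cong[OF refl], rule avg_swap)
  also have "\<dots> = avg {0..<L} (\<lambda>c. avg {0..<P} (\<lambda>x. avg {1..M} (\<lambda>y. f (x + Q * c) * v (x + y) * w (x + q * y\<^sup>2))))" by (rule avg_swap)
  finally have "form q M P f g1 g2 - form q M P (smooth Q L f) v w = avg {0..<L} (\<lambda>c. avg {0..<P} (\<lambda>x. avg {1..M} (\<lambda>y.
      f (x + Q * c) * g1 (x + y + Q * c) * g2 (x + q * y\<^sup>2 + Q * c) - f (x + Q * c) * v (x + y) * w (x + q * y\<^sup>2))))"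
    unfolding L1 avg_diff by simp
  also have "norm \<dots> \<le> \<epsilon>1 + \<epsilon>2"
  proof (rule norm_avg_le_bound, rule norm_avg_le_bound, rule norm_avg_le_bound)
    fix c x y assume c: "c \<in> {0..<L}"
    let ?F = "f (x + Q * c)" and ?G = "g1 (x + y + Q * c)" and ?K = "g2 (x + q * y\<^sup>2 + Q * c)"
    have "?F * ?G * ?K - ?F * v (x + y) * w (x + q * y\<^sup>2) = ?F * ((?G - v (x + y)) * ?K + v (x + y) * (?K - w (x + q * y\<^sup>2)))" by (simp add: algebra_simps)
    then have "\<bar>?F * ?G * ?K - ?F * v (x + y) * w (x + q * y\<^sup>2)\<bar> = \<bar>?F\<bar> * \<bar>(?G - v (x + y)) * ?K + v (x + y) * (?K - w (x + q * y\<^sup>2))\<bar>" by (simp only: abs_mult)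
    also have "\<dots> \<le> 1 * (\<bar>?G - v (x + y)\<bar> * \<bar>?K\<bar> + \<bar>v (x + y)\<bar> * \<bar>?K - w (x + q * y\<^sup>2)\<bar>)"
      using bd(1) by (intro mult_mono order_trans[OF abs_triangle_ineq]) (auto simp: abs_mult)
    also have "\<dots> \<le> 1 * (\<epsilon>1 * 1 + 1 * \<epsilon>2)" using v[OF c] w[OF c] bd e by (intro mult_left_mono add_mono mult_mono) auto
    finally show "norm (?F * ?G * ?K - ?F * v (x + y) * w (x + q * y\<^sup>2)) \<le> \<epsilon>1 + \<epsilon>2" by simp
  qed (use e in auto)
  finally show ?thesis by simp
qed

section \<open>Positivity of the count in the absence of a density increment\<close>

text \<open>The coefficient q makes the property stable under rescaling: along a progression of step
  Q, the shifts Q z and q (Q z)^2 = Q (q Q z^2) lead to the same property with coefficient q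
  Q.\<close>

definition avoids :: "int \<Rightarrow> int set \<Rightarrow> bool" where
  "avoids q A \<longleftrightarrow> (\<forall>n z. z \<ge> 1 \<longrightarrow> \<not> (n \<in> A \<and> n + z \<in> A \<and> n + q * z\<^sup>2 \<in> A))"

text \<open>The period leaves room for the shifts: x + s is at most P, and in the extreme case x + s
  = P the residue is 0, which is not in A.\<close>

lemma form_avoids:
  fixes A :: "int set"
  assumes avoids: "avoids q A" and A: "A \<subseteq> {1..N}" and P: "N + q * M\<^sup>2 \<le> P" and q: "q > 0" and M: "M > 0"
  defines "f \<equiv> \<lambda>x. of_bool (x mod P \<in> A) :: real"
  shows "form q M P f f f = 0"
proof -
  have "f x * f (x + y) * f (x + q * y\<^sup>2) = 0" if x: "x \<in> {0..<P}" and y: "y \<in> {1..M}" for x y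
  proof (rule ccontr)
    assume "f x * f (x + y) * f (x + q * y\<^sup>2) \<noteq> 0"
    then have m: "x \<in> A" "(x + y) mod P \<in> A" "(x + q * y\<^sup>2) mod P \<in> A" using x by (auto simp: f_def)
    have "y \<le> y * y" using y by (simp add: mult_le_cancel_left1)
    also have "y * y \<le> q * y\<^sup>2" using q mult_right_mono[of 1 q "y\<^sup>2"] by (simp add: power2_eq_square)
    finally have y1: "y \<le> q * y\<^sup>2" .
    have y2: "q * y\<^sup>2 \<le> q * M\<^sup>2" using q y by (intro mult_left_mono power_mono) auto
    have "x \<le> N" "x \<ge> 1" using m(1) A by auto
    have id: "x + s \<in> A" if s: "0 \<le> s" "s \<le> q * M\<^sup>2" "(x + s) mod P \<in> A" for s
    proof (cases "x + s < P")
      case True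
      then show ?thesis using s \<open>x \<ge> 1\<close> by simp
    next
      case False
      then have "x + s = P" using \<open>x \<le> N\<close> s P by linarith
      then have "0 \<in> A" using s by simp
      then show ?thesis using A by auto
    qed
    from id[of y] id[of "q * y\<^sup>2"] m(2,3) y y1 y2 have "x + y \<in> A" "x + q * y\<^sup>2 \<in> A" by auto
    then show False using avoids m(1) y unfolding avoids_def by auto
  qed
  then have "form q M P f f f = avg {0..<P} (\<lambda>x. avg {1..M} (\<lambda>y. 0))" unfolding form_def by (intro avg_cong[OF refl]) auto
  then show ?thesis by (simp add: avg_def)
qed

text \<open>The difference of the two sides is (a - u)(a - v) w + a (2a - u - v)(a - w). For factors
  close to their upper bound this reduces a product of three functions to their means.\<close>

lemma product_ge_sum:
  fixes a u v w :: real
  assumes "0 \<le> u" "u \<le> a" "0 \<le> v" "v \<le> a" "0 \<le> w" "w \<le> a"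
  shows "a\<^sup>2 * (u + v + w - 2 * a) \<le> u * v * w"
proof -
  have "0 \<le> (a - u) * (a - v) * w" "0 \<le> a * ((2 * a - u - v) * (a - w))" using assms by (intro mult_nonneg_nonneg; simp)+
  then show ?thesis by (simp add: power2_eq_square algebra_simps)
qed

text \<open>The gap between consecutive periodic copies of A is at least the length Q L of the
  progression, so a progression meets one copy only and the bound over the integers applies.\<close>

lemma no_increment_bound:
  fixes A :: "int set" and a0 :: real
  assumes A: "A \<subseteq> {1..N}" and Q: "Q > 0" and L: "L > 0" and P: "N + Q * L \<le> P" and N: "N \<ge> 0"
    and no: "\<And>x. real (card {c\<in>{0..<L}. x + Q * c \<in> A}) \<le> a0 * L"
  shows "smooth Q L (\<lambda>x. of_bool (x mod P \<in> A)) x \<le> a0"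
proof -
  have P0: "P > 0" using P N Q L by (smt (verit) mult_pos_pos)
  define x0 where "x0 = x mod P"
  have x0: "0 \<le> x0" "x0 < P" using P0 by (auto simp: x0_def)
  define x1 where "x1 = (if x0 \<le> N then x0 else x0 - P)"
  have "(x + Q * c) mod P \<in> A \<longleftrightarrow> x1 + Q * c \<in> A" if c: "c \<in> {0..<L}" for c
  proof -
    have m: "(x + Q * c) mod P = (x0 + Q * c) mod P" by (simp add: x0_def mod_add_left_eq)
    have Qc: "0 \<le> Q * c" "Q * c < Q * L" using c Q by auto
    show ?thesis
    proof (cases "x0 \<le> N")
      case True
      then have "(x0 + Q * c) mod P = x0 + Q * c" using x0 Qc P by (intro mod_pos_pos_trivial) auto
      then show ?thesis using True m by (simp add: x1_def)
    next
      case False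
      show ?thesis
      proof (cases "x0 + Q * c < P")
        case True
        then have "(x0 + Q * c) mod P = x0 + Q * c" using x0 Qc by (intro mod_pos_pos_trivial) auto
        then show ?thesis using m A False True Qc by (auto simp: x1_def)
      next
        case g: False
        have "(x0 + Q * c) mod P = (x0 + Q * c - P) mod P" by simp
        also have "\<dots> = x0 + Q * c - P" using g x0 Qc P N by (intro mod_pos_pos_trivial) auto
        finally have e: "(x0 + Q * c) mod P = x0 + Q * c - P" .
        have x1: "x1 + Q * c = x0 + Q * c - P" using False by (simp add: x1_def)
        show ?thesis unfolding m e x1 ..
      qed
    qed
  qed
  then have "smooth Q L (\<lambda>x. of_bool (x mod P \<in> A)) x = avg {0..<L} (\<lambda>c. of_bool (x1 + Q * c \<in> A) :: real)"
    unfolding smooth_def by (intro avg_cong[OF refl]) (simp only:)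
  also have "\<dots> = card {c\<in>{0..<L}. x1 + Q * c \<in> A} / L" using L by (simp add: avg_indicator)
  also have "\<dots> \<le> a0" using no[of x1] L by (simp add: field_simps)
  finally show ?thesis .
qed

text \<open>The total mass is card A, and outside the interval the smoothed function is at most a0,
  so an upper bound everywhere turns into a lower bound on any given interval.\<close>

lemma interval_mass:
  fixes A :: "int set" and a0 :: real
  assumes A: "A \<subseteq> {1..N}" and Q: "Q > 0" and L: "L > 0" and P: "N < P"
    and le: "\<And>x. smooth Q L (\<lambda>x. of_bool (x mod P \<in> A)) x \<le> a0" and s: "0 \<le> s" "s + n \<le> N" "n \<ge> 0"
  shows "real (card A) - a0 * real_of_int (N + Q * L - n) \<le> (\<Sum>x\<in>{1..n}. smooth Q L (\<lambda>x. of_bool (x mod P \<in> A)) (x + s))"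
proof -
  define f :: "int \<Rightarrow> real" where "f x = of_bool (x mod P \<in> A)" for x
  define u where "u = smooth Q L f"
  define W where "W = {1 - Q * L..N}"
  have QL: "Q * L > 0" using Q L by simp
  have Lne: "finite {0..<L}" "{0..<L} \<noteq> {}" using L by auto
  have f0: "0 \<le> f x" for x by (simp add: f_def)
  have "real (card A) = avg {0..<L} (\<lambda>c. real (card A))" by (simp only: avg_const[OF Lne])
  also have "\<dots> \<le> avg {0..<L} (\<lambda>c. \<Sum>x\<in>W. f (x + Q * c))"
  proof (rule avg_mono)
    fix c assume c: "c \<in> {0..<L}"
    have Qc: "0 \<le> Q * c" "Q * c < Q * L" using c Q by auto
    have "real (card A) = (\<Sum>x\<in>A. f x)" using A P by (auto simp: f_def intro!: sum.cong[of A A "\<lambda>_. 1::real", simplified])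
    also have "\<dots> = (\<Sum>x\<in>(\<lambda>x. x - Q * c) ` A. f (x + Q * c))" by (subst sum.reindex) (auto simp: inj_on_def)
    also have "\<dots> \<le> (\<Sum>x\<in>W. f (x + Q * c))"
    proof (rule sum_mono2)
      show "(\<lambda>x. x - Q * c) ` A \<subseteq> W"
      proof (rule image_subsetI)
        fix x assume "x \<in> A"
        then have "1 \<le> x" "x \<le> N" using A by auto
        then show "x - Q * c \<in> W" using Qc unfolding W_def atLeastAtMost_iff by linarith
      qed
    qed (use f0 in \<open>auto simp: W_def\<close>)
    finally show "real (card A) \<le> (\<Sum>x\<in>W. f (x + Q * c))" .
  qed
  also have "\<dots> = (\<Sum>x\<in>W. u x)" unfolding u_def smooth_def by (rule avg_sum)
  also have "\<dots> = (\<Sum>x\<in>{s+1..s+n}. u x) + (\<Sum>x\<in>W - {s+1..s+n}. u x)"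
    using QL s by (subst sum.subset_diff[of "{s+1..s+n}" W]) (auto simp: W_def)
  also have "(\<Sum>x\<in>W - {s+1..s+n}. u x) \<le> (\<Sum>x\<in>W - {s+1..s+n}. a0)"
    unfolding u_def f_def[abs_def] by (rule sum_mono[OF le])
  also have "\<dots> = a0 * real_of_int (N + Q * L - n)"
  proof -
    have "card (W - {s+1..s+n}) = card W - card {s+1..s+n}" by (rule card_Diff_subset) (use QL s in \<open>auto simp: W_def\<close>)
    then have "int (card (W - {s+1..s+n})) = N + Q * L - n" using QL s by (simp add: W_def)
    then have "real (card (W - {s+1..s+n})) = real_of_int (N + Q * L - n)" by (metis of_int_of_nat_eq)
    then show ?thesis by (simp add: mult.commute)
  qed
  also have "(\<Sum>x\<in>{s+1..s+n}. u x) = (\<Sum>x\<in>{1..n}. u (x + s))"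
    by (rule sum.reindex_bij_witness[of _ "\<lambda>x. x + s" "\<lambda>x. x - s"]) auto
  finally show ?thesis unfolding u_def f_def[abs_def] by simp
qed

text \<open>The averages u, v, w never exceed a0 = 1.01 a, while their means over suitable intervals
  are nearly a0. Thus u(x) v(x+y) w(x + q y^2) is about a0^3 on average without any information on
  correlations.\<close>

lemma structured_count:
  fixes A :: "int set" and a :: real
  assumes A: "A \<subseteq> {1..N}" "a * N \<le> card A" and a: "a > 0" and N: "N \<ge> 100"
    and Q: "Q > 0" and L: "L > 0" "100 * (Q * L) \<le> N" and P: "N < P" "P \<le> 5 * (q * M\<^sup>2)" and qM: "q * M\<^sup>2 \<le> N" "q > 0" "M \<ge> 2"
    and le: "\<And>x. smooth Q L (\<lambda>x. of_bool (x mod P \<in> A)) x \<le> 101 / 100 * a"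
    and B: "B > 0" "L1 > 0" "8 * (B * L1) \<le> N" and L2: "L2 > 0" "8 * (Q * L2) \<le> N"
  defines "u \<equiv> smooth Q L (\<lambda>x. of_bool (x mod P \<in> A)) :: int \<Rightarrow> real"
  shows "a ^ 3 / 45 \<le> form q M P u (smooth B L1 u) (smooth Q L2 u)"
proof -
  define a0 where "a0 = 101 / 100 * a"
  define v where "v = smooth B L1 u"
  define w where "w = smooth Q L2 u"
  \<comment> \<open>For y up to M / 2 both shifts are at most N / 4 and smoothing moves by at most N
    / 8, so intervals of length N / 2 stay inside {1..N}.\<close>
  define n where "n = N div 2"
  define M' where "M' = M div 2"
  have a00: "a0 > 0" using a by (simp add: a0_def)
  have u: "0 \<le> u x" "u x \<le> a0" for x
    using le unfolding u_def a0_def by (auto simp: smooth_def intro!: avg_nonneg)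
  have v: "0 \<le> v x" "v x \<le> a0" and w: "0 \<le> w x" "w x \<le> a0" for x
    unfolding v_def w_def smooth_def using u a00 by (auto intro!: avg_nonneg avg_le)
  define lb where "lb = real (card A) - a0 * real_of_int (N + Q * L - n)"
  have n: "n \<ge> 0" "49 * N \<le> 100 * n" "2 * n \<le> N" using N by (auto simp: n_def)
  have um: "lb \<le> (\<Sum>x\<in>{1..n}. u (x + s))" if "0 \<le> s" "s + n \<le> N" for s
    unfolding lb_def u_def by (rule interval_mass[OF A(1) Q L(1) P(1) le[folded a0_def] that n(1)])
  have smm: "lb \<le> (\<Sum>x\<in>{1..n}. smooth b R u (x + s))" if "b > 0" "R > 0" "8 * (b * R) \<le> N" "0 \<le> s" "8 * s \<le> 2 * N" for s b R
  proof -
    have Rne: "finite {0..<R}" "{0..<R} \<noteq> {}" using that by auto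
    have "lb = avg {0..<R} (\<lambda>l. lb)" by (simp only: avg_const[OF Rne])
    also have "\<dots> \<le> avg {0..<R} (\<lambda>l. \<Sum>x\<in>{1..n}. u (x + (s + b * l)))"
    proof (rule avg_mono, rule um)
      fix l assume l: "l \<in> {0..<R}"
      have bl: "0 \<le> b * l" "b * l < b * R" using l that by auto
      then show "0 \<le> s + b * l" "s + b * l + n \<le> N" using that n by linarith+
    qed
    also have "\<dots> = (\<Sum>x\<in>{1..n}. smooth b R u (x + s))" unfolding avg_sum smooth_def by (simp add: add.assoc)
    finally show ?thesis .
  qed
  \<comment> \<open>In units of a0 N the left margin is 3 * 0.99 - 3 - 0.03 + 0.49 = 0.43: the
    surplus 1/100 in a0 and the overhang Q L <= N / 100 are small compared with n.\<close>
  have lb: "a0 * N / 3 \<le> 3 * lb - 2 * a0 * n"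
  proof -
    have cA: "a0 * N * (99 / 100) \<le> card A"
    proof -
      have "a0 * N * (99 / 100) = a * N * (9999 / 10000)" by (simp add: a0_def)
      also have "\<dots> \<le> a * N * 1" using a N by (intro mult_left_mono) auto
      finally show ?thesis using A(2) by simp
    qed
    have QL: "real_of_int (Q * L) \<le> N / 100" using L(2) by linarith
    have nn: "49 / 100 * real_of_int N \<le> n" using n(2) by linarith
    have "3 * lb - 2 * a0 * n = 3 * card A - 3 * (a0 * N) - 3 * (a0 * (Q * L)) + a0 * n" by (simp add: lb_def algebra_simps)
    moreover have "a0 * real_of_int (Q * L) \<le> a0 * (N / 100)" using QL a00 by (intro mult_left_mono) auto
    moreover have "a0 * (49 / 100 * real_of_int N) \<le> a0 * n" using nn a00 by (intro mult_left_mono) auto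
    moreover have "0 \<le> a0 * N" using a00 N by simp
    ultimately show ?thesis using cA by (simp add: algebra_simps)
  qed
  have MN: "4 * M \<le> 2 * N"
  proof -
    have "2 * M \<le> M * M" using qM by (intro mult_right_mono) auto
    also have "\<dots> \<le> q * M\<^sup>2" using mult_right_mono[of 1 q "M\<^sup>2"] qM by (simp add: power2_eq_square)
    finally show ?thesis using qM by linarith
  qed
  have inner: "a0 ^ 3 * N / 3 \<le> (\<Sum>x\<in>{1..n}. u x * v (x + y) * w (x + q * y\<^sup>2))" if y: "y \<in> {1..M'}" for y
  proof -
    have y2: "2 * y \<le> M" using y by (auto simp: M'_def)
    have "q * (2 * y)\<^sup>2 \<le> q * M\<^sup>2" using y y2 qM by (intro mult_left_mono power_mono) auto
    moreover have "q * (2 * y)\<^sup>2 = 4 * (q * y\<^sup>2)" by (simp add: power_mult_distrib)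
    ultimately have qy: "8 * (q * y\<^sup>2) \<le> 2 * N" using qM by linarith
    have "a0 ^ 3 * N / 3 = a0\<^sup>2 * (a0 * N / 3)" by (simp add: power3_eq_cube power2_eq_square)
    also have "\<dots> \<le> a0\<^sup>2 * (3 * lb - 2 * a0 * n)" by (intro mult_left_mono lb) auto
    also have "\<dots> \<le> a0\<^sup>2 * ((\<Sum>x\<in>{1..n}. u x) + (\<Sum>x\<in>{1..n}. v (x + y)) + (\<Sum>x\<in>{1..n}. w (x + q * y\<^sup>2)) - 2 * a0 * n)"
    proof (rule mult_left_mono)
      have "lb \<le> (\<Sum>x\<in>{1..n}. u x)" using um[of 0] n N by simp
      moreover have "lb \<le> (\<Sum>x\<in>{1..n}. v (x + y))" unfolding v_def by (rule smm) (use B y y2 MN in auto)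
      moreover have "lb \<le> (\<Sum>x\<in>{1..n}. w (x + q * y\<^sup>2))" unfolding w_def by (rule smm) (use Q L2 qy qM in auto)
      ultimately show "3 * lb - 2 * a0 * n \<le> (\<Sum>x\<in>{1..n}. u x) + (\<Sum>x\<in>{1..n}. v (x + y)) + (\<Sum>x\<in>{1..n}. w (x + q * y\<^sup>2)) - 2 * a0 * n" by linarith
    qed auto
    also have "\<dots> = (\<Sum>x\<in>{1..n}. a0\<^sup>2 * (u x + v (x + y) + w (x + q * y\<^sup>2) - 2 * a0))"
      using n(1) by (simp add: sum_distrib_left[symmetric] sum.distrib sum_subtractf)
    also have "\<dots> \<le> (\<Sum>x\<in>{1..n}. u x * v (x + y) * w (x + q * y\<^sup>2))" by (intro sum_mono product_ge_sum u v w)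
    finally show ?thesis .
  qed
  define g where "g y = avg {0..<P} (\<lambda>x. u x * v (x + y) * w (x + q * y\<^sup>2))" for y
  have g0: "0 \<le> g y" for y unfolding g_def by (intro avg_nonneg mult_nonneg_nonneg u v w)
  \<comment> \<open>The sum a0^3 N / 3 is spread over a period P of at most 5 N.\<close>
  define \<kappa> where "\<kappa> = a0 ^ 3 / 15"
  have \<kappa>: "\<kappa> \<le> g y" if y: "y \<in> {1..M'}" for y
  proof -
    have P0: "0 < real_of_int P" using P N by simp
    have "P \<le> 5 * N" using P qM by linarith
    then have "real_of_int P \<le> 5 * real_of_int N" by linarith
    then have "\<kappa> * P \<le> \<kappa> * (5 * real_of_int N)" using a00 by (intro mult_left_mono) (auto simp: \<kappa>_def)
    also have "\<dots> = a0 ^ 3 * N / 3" by (simp add: \<kappa>_def)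
    also have "\<dots> \<le> (\<Sum>x\<in>{1..n}. u x * v (x + y) * w (x + q * y\<^sup>2))" by (rule inner[OF y])
    also have "\<dots> \<le> (\<Sum>x\<in>{0..<P}. u x * v (x + y) * w (x + q * y\<^sup>2))"
      by (rule sum_mono2) (use n P N u v w in auto)
    finally show ?thesis using P0 by (simp add: g_def avg_def field_simps)
  qed
  have M0: "0 < real_of_int M" using qM by simp
  have "a ^ 3 / 45 \<le> a0 ^ 3 / 45" using a by (simp add: a0_def power_mono)
  also have "\<dots> = \<kappa> * (1 / 3)" by (simp add: \<kappa>_def)
  also have "\<dots> \<le> \<kappa> * (M' / M)"
  proof (rule mult_left_mono)
    have "M \<le> 3 * M'" using qM by (simp add: M'_def)
    then show "1 / 3 \<le> real_of_int M' / real_of_int M" using M0 by (simp add: field_simps)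
  qed (use a00 in \<open>simp add: \<kappa>_def\<close>)
  also have "\<dots> = avg {1..M} (\<lambda>y. \<kappa> * of_bool (y \<le> M'))"
  proof -
    have "{y \<in> {1..M}. y \<le> M'} = {1..M'}" using qM by (auto simp: M'_def)
    then show ?thesis using qM by (simp add: avg_cmult avg_indicator M'_def)
  qed
  also have "\<dots> \<le> avg {1..M} g"
  proof (rule avg_mono)
    fix y assume "y \<in> {1..M}"
    then show "\<kappa> * of_bool (y \<le> M') \<le> g y" using \<kappa>[of y] g0[of y] by auto
  qed
  also have "\<dots> = form q M P u v w" unfolding form_def g_def by (rule avg_swap)
  finally show ?thesis unfolding v_def w_def .
qed

subsection \<open>The density increment\<close>

lemma form_decompose:
  "form q M P f0 f1 f2 = form q M P f0 (\<lambda>x. f1 x - g1 x) f2 + form q M P f0 g1 (\<lambda>x. f2 x - g2 x) + form q M P f0 g1 g2"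
  unfolding form_def avg_add[symmetric] by (simp add: algebra_simps)

lemma div_floor_bounds:
  fixes M t :: int
  assumes "t > 0" "t \<le> M"
  shows "M div t > 0" "t * (M div t) \<le> M" "M \<le> 2 * t * (M div t)"
proof -
  show p: "M div t > 0" using assms by (simp add: pos_imp_zdiv_pos_iff)
  show "t * (M div t) \<le> M" using assms by (simp add: mult.commute minus_mod_eq_mult_div[symmetric])
  have "M = t * (M div t) + M mod t" by simp
  moreover have "M mod t < t" using assms by simp
  moreover have "t * 1 \<le> t * (M div t)" using p assms by (intro mult_left_mono) auto
  ultimately show "M \<le> 2 * t * (M div t)" by linarith
qed

text \<open>Assume no increment on progressions of step Q and length L3. Smoothing the three factors
  costs 1 / D each and leads from the count 0 of a set avoiding the configuration to the structured
  count, at least a^3 / 45. As 3 / D is at most 3 a^3 / 256, this is impossible.\<close>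

lemma density_increment:
  fixes A :: "int set" and N q Y :: int and a D :: real
  assumes q: "q > 0" and A: "A \<subseteq> {1..N}" "a * N \<le> card A" "avoids q A" and a: "a > 0"
    and D: "D \<ge> 2" "256 / a ^ 3 \<le> D"
    and Y: "(8 * D) ^ inverse_exponent \<le> Y" "(8 * D) ^ 90 \<le> Y" "\<And>b::int. 1 \<le> b \<Longrightarrow> real_of_int b \<le> (8 * D) ^ inverse_exponent \<Longrightarrow> b dvd Y"
      "\<And>b::int. 1 \<le> b \<Longrightarrow> real_of_int b \<le> (8 * D) ^ 16 \<Longrightarrow> b dvd Y"
    and N: "q ^ 3 * Y ^ 300 \<le> N"
  shows "\<exists>N' A'. 0 < N' \<and> A' \<subseteq> {1..N'} \<and> avoids (q\<^sup>2 * Y ^ 3) A' \<and> 101 / 100 * a * real_of_int N' \<le> card A' \<and> N \<le> q ^ 3 * Y ^ 26 * N'\<^sup>2"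
proof -
  have D1: "(8 * D) ^ k \<le> Y" if "k \<le> 90" for k
  proof -
    have "(8 * D) ^ k \<le> (8 * D) ^ 90" using D that by (intro power_increasing) auto
    then show ?thesis using Y(2) by linarith
  qed
  have Y16: "16 * (8 * D) \<le> Y"
  proof -
    have "16 * (8 * D) \<le> (8 * D) * (8 * D)" using D by (intro mult_right_mono) auto
    also have "\<dots> \<le> Y" using D1[of 2] by (simp add: power2_eq_square)
    finally show ?thesis .
  qed
  then have Y256: "real_of_int Y \<ge> 256" using D by linarith
  have Yi: "Y \<ge> 256" using Y256 by linarith
  have Y0: "real_of_int Y > 0" using Y256 by simp
  have Yp: "Y ^ j \<ge> 1" for j using Yi by (intro one_le_power) auto
  have Ymono: "Y ^ i \<le> Y ^ j" if "i \<le> j" for i j using Yi that by (intro power_increasing) auto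
  have N0: "N > 0"
  proof -
    have "0 < q ^ 3 * Y ^ 300" using q Yi by simp
    then show ?thesis using N by linarith
  qed
  define M where "M = \<lfloor>sqrt (N / q)\<rfloor>"
  have M0: "0 \<le> M" using N0 q by (simp add: M_def)
  have qM: "q * M\<^sup>2 \<le> N"
  proof -
    have "real_of_int M \<le> sqrt (N / q)" unfolding M_def by (rule of_int_floor_le)
    then have "(real_of_int M)\<^sup>2 \<le> (sqrt (N / q))\<^sup>2" using M0 by (intro power_mono) auto
    then have "(real_of_int M)\<^sup>2 \<le> N / q" using N0 q by simp
    then have "real_of_int (q * M\<^sup>2) \<le> real_of_int N" using q by (simp add: field_simps)
    then show ?thesis by (simp only: of_int_le_iff)
  qed
  have qM1: "N < q * (M + 1)\<^sup>2"
  proof -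
    have "sqrt (N / q) < real_of_int M + 1" unfolding M_def by linarith
    then have "(sqrt (N / q))\<^sup>2 < (real_of_int M + 1)\<^sup>2" using N0 q by (intro power_strict_mono) auto
    then have "N / q < (real_of_int M + 1)\<^sup>2" using N0 q by simp
    then have "real_of_int N < real_of_int (q * (M + 1)\<^sup>2)" using q by (simp add: field_simps)
    then show ?thesis by (simp only: of_int_less_iff)
  qed
  have big: "q * Y ^ 100 \<le> M"
  proof (rule ccontr)
    assume "\<not> ?thesis"
    then have "M + 1 \<le> q * Y ^ 100" by simp
    then have "(M + 1)\<^sup>2 \<le> (q * Y ^ 100)\<^sup>2" using M0 by (intro power_mono) auto
    then have "q * (M + 1)\<^sup>2 \<le> q * (q * Y ^ 100)\<^sup>2" using q by (intro mult_left_mono) auto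
    also have "\<dots> = q ^ 3 * Y ^ 200" by (simp add: power_mult_distrib power2_eq_square power3_eq_cube flip: power_add)
    also have "\<dots> \<le> q ^ 3 * Y ^ 300" using q Ymono[of 200 300] by (intro mult_left_mono) auto
    finally show False using N qM1 by linarith
  qed
  have Mt: "Y ^ k \<le> M" "q * Y ^ k \<le> M" if "k \<le> 100" for k
  proof -
    have "q * Y ^ k \<le> q * Y ^ 100" using q Ymono that by (intro mult_left_mono) auto
    then show 1: "q * Y ^ k \<le> M" using big by linarith
    have "1 * Y ^ k \<le> q * Y ^ k" using q Yp[of k] by (intro mult_right_mono) auto
    then show "Y ^ k \<le> M" using 1 by linarith
  qed
  have M256: "256 \<le> M" using Mt(1)[of 1] Yi by simp
  have M0: "M > 0" using M256 by simp
  have N4: "N < 4 * (q * M\<^sup>2)"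
  proof -
    have "(M + 1)\<^sup>2 \<le> (2 * M)\<^sup>2" using M256 by (intro power_mono) auto
    then have "q * (M + 1)\<^sup>2 \<le> q * (2 * M)\<^sup>2" using q by (intro mult_left_mono) auto
    moreover have "q * (2 * M)\<^sup>2 = 4 * (q * M\<^sup>2)" by (simp add: power_mult_distrib)
    ultimately show ?thesis using qM1 by linarith
  qed
  have MM: "M \<le> q * M\<^sup>2" "256 * (q * M) \<le> q * M\<^sup>2"
  proof -
    have "256 * M \<le> M * M" using M256 by (intro mult_right_mono) auto
    then have "q * (256 * M) \<le> q * M\<^sup>2" using q by (intro mult_left_mono) (auto simp: power2_eq_square)
    then show 1: "256 * (q * M) \<le> q * M\<^sup>2" by simp
    have "1 * M \<le> q * M" using q M0 by (intro mult_right_mono) auto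
    then show "M \<le> q * M\<^sup>2" using 1 M0 by linarith
  qed
  define Q where "Q = q * Y\<^sup>2 * Y"
  \<comment> \<open>Since N < 4 q M^2, this leaves room for a shift by q M^2 without
    wrap-around.\<close>
  define P where "P = q * (5 * M\<^sup>2)"
  \<comment> \<open>Each length is negligible against those it is compared with, by some power of Y:
    L1 (smoothing of the linear factor) against L' (averages in the inverse theorem), J (shift of y)
    against L1, L2 (smoothing of the quadratic factor) against J, and L3 against L1 and L2. The q in
    L3 compensates that Q is q Y^2 times the step Y.\<close>
  define L' L1 J L2 L3 where "L' = M div Y" and "L1 = M div Y ^ 4" and "J = M div Y ^ 6" and "L2 = M div Y ^ 10" and "L3 = M div (q * Y ^ 12)"
  have QY: "Q = q * Y ^ 3" by (simp add: Q_def power2_eq_square power3_eq_cube)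
  have Yk: "Y ^ k > 0" "q * Y ^ k > 0" for k using q Yi by auto
  have "L' > 0" "Y * L' \<le> M" "M \<le> 2 * Y * L'"
    using div_floor_bounds[of Y M] Yi Mt(1)[of 1] by (auto simp: L'_def)
  note L' = this
  note L1 = div_floor_bounds[OF Yk(1)[of 4] Mt(1)[of 4, simplified], folded L1_def]
  note J = div_floor_bounds[OF Yk(1)[of 6] Mt(1)[of 6, simplified], folded J_def]
  note L2 = div_floor_bounds[OF Yk(1)[of 10] Mt(1)[of 10, simplified], folded L2_def]
  note L3 = div_floor_bounds[OF Yk(2)[of 12] Mt(2)[of 12, simplified], folded L3_def]
  have q1: "q \<ge> 1" using q by simp
  have scale: "c * U \<le> V" if "Y ^ i * U \<le> M" "M \<le> 2 * Y ^ j * V" "2 * c * Y ^ j \<le> Y ^ i" "U > 0" for i j and c U V :: int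
  proof -
    have "(2 * Y ^ j) * (c * U) = (2 * c * Y ^ j) * U" by simp
    also have "\<dots> \<le> Y ^ i * U" using that by (intro mult_right_mono) auto
    also have "\<dots> \<le> 2 * Y ^ j * V" using that by linarith
    finally show ?thesis using Yk(1)[of j] by simp
  qed
  have absorb: "c * Y ^ m \<le> Y ^ n" if "c \<le> Y ^ k" "k + m \<le> n" for c k m n
  proof -
    have "c * Y ^ m \<le> Y ^ k * Y ^ m" using that Yp[of m] by (intro mult_right_mono) auto
    also have "\<dots> = Y ^ (k + m)" by (simp add: power_add)
    also have "\<dots> \<le> Y ^ n" by (rule Ymono[OF that(2)])
    finally show ?thesis .
  qed
  have Ysq: "Y\<^sup>2 \<ge> 65536" using power_mono[of 256 Y 2] Yi by simp

  define f :: "int \<Rightarrow> real" where "f x = of_bool (x mod P \<in> A)" for x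
  define u where "u = smooth Q L3 f"
  define g1 where "g1 = smooth Y L1 f"
  define g2 where "g2 = smooth Q L2 f"
  have P0: "P > 0" using q M0 by (simp add: P_def)
  have P5: "P = 5 * (q * M\<^sup>2)" by (simp add: P_def)
  have f01: "0 \<le> f x" "f x \<le> 1" for x by (auto simp: f_def)
  have fb: "\<bar>f x\<bar> \<le> 1" for x by (simp add: f_def)
  have sm01: "0 \<le> smooth b R f x" "smooth b R f x \<le> 1" for b R x
    unfolding smooth_def using f01 by (auto intro!: avg_nonneg avg_le)
  have smb: "\<bar>smooth b R f x\<bar> \<le> 1" "\<bar>f x - smooth b R f x\<bar> \<le> 1" for b R x using sm01[of b R x] f01[of x] by linarith+
  have perf: "per P f" by (simp add: f_def per_def)
  have cD: "8 * D \<ge> 2" "D > 0" using D by auto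
  have iD: "D ^ inverse_exponent \<le> (8 * D) ^ inverse_exponent" using D by (intro power_mono) auto

  have invD: "1 / D \<le> a ^ 3 / 256" using D a by (simp add: field_simps)
  show ?thesis
  proof (cases "\<forall>x. real (card {c\<in>{0..<L3}. x + Q * c \<in> A}) \<le> 101 / 100 * a * L3")
    case False
    then obtain x where "\<not> real (card {c\<in>{0..<L3}. x + Q * c \<in> A}) \<le> 101 / 100 * a * L3" by blast
    then have x: "101 / 100 * a * L3 \<le> real (card {c\<in>{0..<L3}. x + Q * c \<in> A})" by simp
    \<comment> \<open>The dense progression is rescaled to {1..L3}; the index starts at 0, hence the
      c + 1.\<close>
    define A' where "A' = (\<lambda>c. c + 1) ` {c\<in>{0..<L3}. x + Q * c \<in> A}"
    have "card A' = card {c\<in>{0..<L3}. x + Q * c \<in> A}" unfolding A'_def by (rule card_image) (simp add: inj_on_def)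
    moreover have A'n: "n \<in> A' \<Longrightarrow> x + Q * (n - 1) \<in> A" for n by (auto simp: A'_def)
    moreover have "avoids (q\<^sup>2 * Y ^ 3) A'"
      unfolding avoids_def
    proof (intro allI impI notI)
      fix n z :: int assume z: "1 \<le> z" and "n \<in> A' \<and> n + z \<in> A' \<and> n + q\<^sup>2 * Y ^ 3 * z\<^sup>2 \<in> A'"
      then have m: "x + Q * (n - 1) \<in> A" "x + Q * (n + z - 1) \<in> A" "x + Q * (n + q\<^sup>2 * Y ^ 3 * z\<^sup>2 - 1) \<in> A" using A'n by blast+
      have e: "x + Q * (n + z - 1) = x + Q * (n - 1) + Q * z" "x + Q * (n + q\<^sup>2 * Y ^ 3 * z\<^sup>2 - 1) = x + Q * (n - 1) + q * (Q * z)\<^sup>2"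
        by (simp_all add: QY power2_eq_square algebra_simps)
      have "Q * z \<ge> 1"
      proof -
        have "0 < Q * z" using z Yk(2)[of 3] by (simp add: QY)
        then show ?thesis by simp
      qed
      then show False using m A(3)[unfolded avoids_def, rule_format, of "Q * z" "x + Q * (n - 1)"] unfolding e by blast
    qed
    moreover have "A' \<subseteq> {1..L3}" by (auto simp: A'_def)
    moreover have "N \<le> q ^ 3 * Y ^ 26 * L3\<^sup>2"
    proof -
      \<comment> \<open>Rounding down at most halves M / (q Y^12), and N < 4 q M^2; thus the new
        length is about the square root of N up to powers of q and Y.\<close>
      have "M\<^sup>2 \<le> (2 * (q * Y ^ 12) * L3)\<^sup>2" using L3 M0 by (intro power_mono) auto
      then have "4 * (q * M\<^sup>2) \<le> 4 * (q * (2 * (q * Y ^ 12) * L3)\<^sup>2)" using q by (intro mult_left_mono) auto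
      also have "\<dots> = 16 * Y ^ 24 * (q ^ 3 * L3\<^sup>2)"
        by (simp add: power_mult_distrib power2_eq_square power3_eq_cube mult_ac flip: power_add)
      also have "\<dots> \<le> Y ^ 26 * (q ^ 3 * L3\<^sup>2)"
        using q by (intro mult_right_mono absorb[of _ 1]) (use Yi in auto)
      finally show ?thesis using N4 by (simp add: mult_ac)
    qed
    ultimately show ?thesis using x L3(1) by (intro exI[of _ L3] exI[of _ A']) auto
  next
    case True
    have QL3: "1000 * (Q * L3) \<le> M"
    proof -
      have "1000 * (Q * L3) = q * L3 * (1000 * Y ^ 3)" by (simp add: QY)
      also have "\<dots> \<le> q * L3 * Y ^ 12"
        using q L3 by (intro mult_left_mono absorb[of _ 2]) (use Ysq in auto)
      finally show ?thesis using L3(2) by (simp add: mult_ac)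
    qed
    have Q0: "Q > 0" using Yk(2)[of 3] by (simp add: QY)
    have QL30: "Q * L3 > 0" using Q0 L3 by simp
    have le: "u x \<le> 101 / 100 * a" for x
      unfolding u_def f_def[abs_def]
      by (rule no_increment_bound[OF A(1) Q0 L3(1)]) (use True N4 P5 QL3 MM M0 N0 QL30 in auto)
    have count: "a ^ 3 / 45 \<le> form q M P u (smooth Y L1 u) (smooth Q L2 u)"
      unfolding u_def f_def[abs_def]
    proof (rule structured_count[OF A(1,2) a _ Q0 L3(1)])
      show "N \<ge> 100" "100 * (Q * L3) \<le> N" using MM qM QL3 M256 QL30 by linarith+
      show "N < P" "P \<le> 5 * (q * M\<^sup>2)" using N4 P5 M0 q N0 by linarith+
      show "q * M\<^sup>2 \<le> N" "q > 0" "M \<ge> 2" using qM q M256 by auto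
      show "smooth Q L3 (\<lambda>x. of_bool (x mod P \<in> A)) x \<le> 101 / 100 * a" for x
        using le[of x] unfolding u_def f_def[abs_def] .
      show "Y > 0" "L1 > 0" "L2 > 0" using Yi L1 L2 by auto
      have "8 * (Y * L1) \<le> Y ^ 4 * L1"
      proof -
        have "8 * Y ^ 1 \<le> Y ^ 4" by (rule absorb[of _ 1]) (use Yi in auto)
        then have "(8 * Y ^ 1) * L1 \<le> Y ^ 4 * L1" using L1 by (intro mult_right_mono) auto
        then show ?thesis by simp
      qed
      then show "8 * (Y * L1) \<le> N" using L1 MM qM by linarith
      have "8 * (Q * L2) \<le> q * (Y ^ 10 * L2)"
      proof -
        have "8 * Y ^ 3 \<le> Y ^ 10" by (rule absorb[of _ 1]) (use Yi in auto)
        then have "q * ((8 * Y ^ 3) * L2) \<le> q * (Y ^ 10 * L2)" using L2 q by (intro mult_left_mono mult_right_mono) auto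
        then show ?thesis by (simp add: QY mult_ac)
      qed
      also have "\<dots> \<le> q * M" using L2 q by (intro mult_left_mono) auto
      finally show "8 * (Q * L2) \<le> N" using MM qM q M0 by (smt (verit) mult_pos_pos)
    qed
    have fr: "real_of_int (2 * X) / Z \<le> 1 / (4 * D)" if "Y * X \<le> Z" "X > 0" for X Z :: int
    proof -
      have "0 < Y * X" using that Yi by simp
      then have Z: "0 < real_of_int Z" using that by linarith
      have "real_of_int Y * X \<le> real_of_int Z" using that by (metis of_int_le_iff of_int_mult)
      moreover have "(8 * D) * X \<le> Y * real_of_int X" using Y16 D that by (intro mult_right_mono) auto
      ultimately show ?thesis using Z cD by (simp add: field_simps)
    qed
    \<comment> \<open>Each ratio of lengths is at most 2 / Y, and Y is at least 128 D.\<close>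
    have e1: "real_of_int (2 * J) / L1 \<le> 1 / (4 * D)"
    proof (rule fr[OF scale[OF J(2) L1(3)]])
      show "2 * Y * Y ^ 4 \<le> Y ^ 6" using absorb[of 2 1 5 6] Yi by (simp add: mult.assoc flip: power_Suc)
    qed (rule J(1))+
    have e2: "real_of_int (2 * L3) / L2 \<le> 1 / (4 * D)"
    proof (rule fr[OF scale[OF _ L2(3)]])
      have "1 * (Y ^ 12 * L3) \<le> q * (Y ^ 12 * L3)" using q1 L3 Yk(1)[of 12] by (intro mult_right_mono) auto
      then show "Y ^ 12 * L3 \<le> M" using L3(2) by (simp add: mult.assoc)
      show "2 * Y * Y ^ 10 \<le> Y ^ 12" using absorb[of 2 1 11 12] Yi by (simp add: mult.assoc flip: power_Suc)
    qed (rule L3(1))+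
    have e3: "real_of_int (2 * (q * Y\<^sup>2 * L3)) / L1 \<le> 1 / (4 * D)"
    proof (rule fr[OF scale[OF _ L1(3)]])
      have e: "Y ^ 10 * (q * Y\<^sup>2 * L3) = (q * Y ^ 12) * L3" by (simp add: mult_ac flip: power_add)
      show "Y ^ 10 * (q * Y\<^sup>2 * L3) \<le> M" unfolding e by (rule L3(2))
      show "2 * Y * Y ^ 4 \<le> Y ^ 10" using absorb[of 2 1 5 10] Yi by (simp add: mult.assoc flip: power_Suc)
      show "0 < q * Y\<^sup>2 * L3" using q Yi L3 by simp
      then show "0 < q * Y\<^sup>2 * L3" .
    qed
    have e4: "real_of_int (2 * (Y * J)) / M \<le> 1 / (4 * D)"
    proof (rule fr)
      have "Y * (Y * J) = Y ^ 2 * J" by (simp add: power2_eq_square)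
      also have "\<dots> \<le> Y ^ 6 * J" using Ymono[of 2 6] J by (intro mult_right_mono) auto
      finally show "Y * (Y * J) \<le> M" using J(2) by linarith
      show "Y * J > 0" using Yi J by simp
    qed
    let ?c = "of_real :: real \<Rightarrow> complex"
    have percf: "per P (\<lambda>x. ?c (f x))" using perf by (simp add: per_def)
    have s1: "\<bar>form q M P f (\<lambda>x. f x - g1 x) f\<bar> \<le> 1 / D"
    proof -
      have "norm (form q M P (\<lambda>x. ?c (f x)) (\<lambda>x. ?c (f x) - smooth Y L1 (\<lambda>x. ?c (f x)) x) (\<lambda>x. ?c (f x))) \<le> 1 / D"
        unfolding P_def
      proof (rule smooth_linear_factor[where L' = L'])
        show "per (q * (5 * M\<^sup>2)) (\<lambda>x. ?c (f x))" "per (q * (5 * M\<^sup>2)) (\<lambda>x. ?c (f x))" "per (q * (5 * M\<^sup>2)) (\<lambda>x. ?c (f x))"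
          using percf unfolding P_def by auto
        show "norm (?c (f x)) \<le> 1" "norm (?c (f x)) \<le> 1" "norm (?c (f x)) \<le> 1" for x using fb by auto
        show "norm (?c (f x) - smooth Y L1 (\<lambda>x. ?c (f x)) x) \<le> 1" for x
          unfolding smooth_of_real of_real_diff[symmetric] norm_of_real by (rule smb)
        have "real_of_int Y \<le> M" using Mt(1)[of 1] by simp
        then show "D ^ inverse_exponent \<le> M" using iD Y(1) by linarith
        show "b dvd Y" if "1 \<le> b" "real_of_int b \<le> D ^ inverse_exponent" for b using Y(3)[of b] that iD by linarith
        have iY: "D ^ inverse_exponent \<le> Y" using iD Y(1) by linarith
        have "L' * D ^ inverse_exponent \<le> L' * real_of_int Y" using iY L' by (intro mult_left_mono) auto
        also have "\<dots> = real_of_int (Y * L')" by simp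
        also have "\<dots> \<le> M" using L'(2) by (simp only: of_int_le_iff)
        finally show "L' * D ^ inverse_exponent \<le> M" .
        have "(3 * Y ^ 2) * L1 \<le> L'"
        proof (rule scale[OF L1(2)])
          show "M \<le> 2 * Y ^ 1 * L'" using L' by simp
          have "2 * (3 * Y\<^sup>2) * Y ^ 1 = 6 * Y ^ 3" by (simp add: power2_eq_square power3_eq_cube)
          also have "\<dots> \<le> Y ^ 4" by (rule absorb[of _ 1]) (use Yi in auto)
          finally show "2 * (3 * Y\<^sup>2) * Y ^ 1 \<le> Y ^ 4" .
        qed (rule L1(1))
        moreover have "0 < Y ^ 2 * L1" using L1 Yk(1)[of 2] by simp
        ultimately have "2 * Y * L1 * Y < L'" by (simp add: power2_eq_square mult_ac)
        then have lt: "real_of_int (2 * Y * L1 * Y) < L'" by (simp only: of_int_less_iff)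
        have "2 * real_of_int Y * L1 * D ^ inverse_exponent \<le> 2 * real_of_int Y * L1 * Y" using iY L1 Y0 by (intro mult_left_mono) auto
        then show "2 * real_of_int Y * L1 * D ^ inverse_exponent < L'" using lt by simp
      qed (use q M0 D Yi L1 L' in auto)
      then show ?thesis unfolding smooth_of_real of_real_diff[symmetric] form_of_real norm_of_real g1_def .
    qed
    have s2: "\<bar>form q M P f g1 (\<lambda>x. f x - g2 x)\<bar> \<le> 1 / D"
    proof -
      have "norm (form q M P (\<lambda>x. ?c (f x)) (\<lambda>x. ?c (g1 x)) (\<lambda>x. ?c (f x) - smooth Q L2 (\<lambda>x. ?c (f x)) x))
        \<le> 2 * real_of_int Y * J / M + 2 * real_of_int J / L1 + 2 / (8 * D)"
      proof (rule smooth_quadratic_factor[OF P0 M0 percf _ cD(1)])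
        have "Y * 1 \<le> J"
        proof -
          have "(2 * Y ^ 6) * Y = 2 * Y ^ 7" by (simp flip: power_Suc2)
          also have "\<dots> \<le> Y ^ 8" by (rule absorb[of _ 1]) (use Yi in auto)
          also have "\<dots> \<le> (2 * Y ^ 6) * J" using Mt(1)[of 8] J(3) by linarith
          finally show ?thesis using Yk(1)[of 6] by simp
        qed
        then have "real_of_int Y \<le> J" by simp
        then show "(8 * D) ^ 90 \<le> J" using Y(2) by linarith
        show "Q = q * Y\<^sup>2 * Y" by (simp add: Q_def)
        show "b dvd Y" if "1 \<le> b" "real_of_int b \<le> (8 * D) ^ 16" for b using Y(4) that by blast
        show "8 * real_of_int L2 * Y * (8 * D) ^ 60 / (real_of_int J)\<^sup>2 \<le> 1 / (8 * D)"
        proof -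
          have "8 * Y\<^sup>2 * L2 \<le> J"
          proof (rule scale[OF L2(2) J(3)])
            have "2 * (8 * Y\<^sup>2) * Y ^ 6 = 16 * Y ^ 8" by (simp flip: power_add)
            also have "\<dots> \<le> Y ^ 10" by (rule absorb[of _ 1]) (use Yi in auto)
            finally show "2 * (8 * Y\<^sup>2) * Y ^ 6 \<le> Y ^ 10" .
          qed (rule L2(1))
          also have "J \<le> J\<^sup>2" using J by (simp add: power2_eq_square mult_le_cancel_left1)
          finally have "real_of_int (8 * Y\<^sup>2 * L2) \<le> real_of_int (J\<^sup>2)" by (simp only: of_int_le_iff)
          then have j: "8 * L2 * real_of_int Y * Y \<le> (real_of_int J)\<^sup>2" by (simp add: power2_eq_square mult_ac)
          have "8 * L2 * real_of_int Y * ((8 * D) ^ 60 * (8 * D)) \<le> 8 * L2 * real_of_int Y * Y"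
          proof (rule mult_left_mono)
            show "(8 * D) ^ 60 * (8 * D) \<le> Y" using D1[of 61] by (simp only: power_Suc2[symmetric] Suc_numeral) simp
          qed (use L2 Y0 in auto)
          then have "(8 * real_of_int L2 * Y * (8 * D) ^ 60) * (8 * D) \<le> (real_of_int J)\<^sup>2" using j by (simp add: mult_ac)
          then show ?thesis using J cD by (subst divide_le_eq) (auto simp: pos_le_divide_eq)
        qed
        show "norm (?c (f x)) \<le> 1" "norm (?c (f x)) \<le> 1" "norm (?c (g1 x)) \<le> 1" for x using fb smb by (auto simp: g1_def)
        show "norm (?c (f x) - smooth Q L2 (\<lambda>x. ?c (f x)) x) \<le> 1" for x
          unfolding smooth_of_real of_real_diff[symmetric] norm_of_real by (rule smb)
        fix x j assume j: "j \<in> {1..J}"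
        have "norm (smooth Y L1 f (x + Y * j) - smooth Y L1 f x) \<le> 2 * \<bar>real_of_int j\<bar> / L1"
          by (rule smooth_shift) (use fb L1 in auto)
        also have "\<dots> \<le> 2 * real_of_int J / L1" using j L1 by (intro divide_right_mono) auto
        finally show "norm (?c (g1 (x + Y * j)) - ?c (g1 x)) \<le> 2 * real_of_int J / L1"
          unfolding of_real_diff[symmetric] norm_of_real g1_def by simp
      qed (use Yi L2 J L1 in auto)
      also have "\<dots> \<le> 1 / (4 * D) + 1 / (4 * D) + 2 / (8 * D)" using e1 e4 by simp
      also have "\<dots> \<le> 1 / D" using cD by (simp add: field_simps)
      finally show ?thesis unfolding smooth_of_real of_real_diff[symmetric] form_of_real norm_of_real g2_def .
    qed
    have s3: "\<bar>form q M P f g1 g2 - form q M P u (smooth Y L1 u) (smooth Q L2 u)\<bar> \<le> 1 / D"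
    proof -
      have "\<bar>form q M P f g1 g2 - form q M P u (smooth Y L1 u) (smooth Q L2 u)\<bar> \<le> 1 / (4 * D) + 1 / (4 * D)"
        unfolding u_def
      proof (rule form_smooth[OF P0 L3(1) perf])
        show "per P g1" "per P g2" unfolding g1_def g2_def using per_smooth[OF perf] by auto
        show "\<bar>f x\<bar> \<le> 1" "\<bar>g1 x\<bar> \<le> 1" "\<bar>g2 x\<bar> \<le> 1" for x using fb smb by (auto simp: g1_def g2_def)
        show "\<bar>smooth Y L1 (smooth Q L3 f) x\<bar> \<le> 1" for x using norm_smooth[of "smooth Q L3 f" Y L1 x] smb by simp
        fix x c assume c: "c \<in> {0..<L3}"
        have "norm (smooth Y L1 f (x + Q * c) - smooth Y L1 (smooth Q L3 f) x) \<le> 2 * real_of_int (q * Y\<^sup>2) * L3 / L1"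
          by (rule smooth_smooth) (use fb L3 L1 c q Yi in \<open>auto simp: Q_def\<close>)
        then show "\<bar>g1 (x + Q * c) - smooth Y L1 (smooth Q L3 f) x\<bar> \<le> 1 / (4 * D)" using e3 by (simp add: g1_def)
        have "norm (smooth Q L2 f (x + Q * c) - smooth Q L2 (smooth Q L3 f) x) \<le> 2 * real_of_int 1 * L3 / L2"
          by (rule smooth_smooth) (use fb L3 L2 c in auto)
        then show "\<bar>g2 (x + Q * c) - smooth Q L2 (smooth Q L3 f) x\<bar> \<le> 1 / (4 * D)" using e2 by (simp add: g2_def)
      qed (use cD in auto)
      also have "\<dots> \<le> 1 / D" using cD by (simp add: field_simps)
      finally show ?thesis .
    qed
    \<comment> \<open>The unsmoothed form vanishes, so the structured count is bounded by the three
      replacement errors.\<close>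
    have "form q M P f f f = 0" unfolding f_def[abs_def]
      by (rule form_avoids[OF A(3,1) _ q M0]) (use N4 P5 in auto)
    then have "form q M P f (\<lambda>x. f x - g1 x) f + form q M P f g1 (\<lambda>x. f x - g2 x) + form q M P f g1 g2 = 0"
      using form_decompose[of q M P f f f g1 g2] by simp
    then have "form q M P u (smooth Y L1 u) (smooth Q L2 u) \<le> 3 * (1 / D)" using s1 s2 s3 by linarith
    then have "a ^ 3 / 45 \<le> 3 * (a ^ 3 / 256)" using count invD by linarith
    moreover have "0 < a ^ 3" using a by simp
    ultimately show ?thesis by linarith
  qed
qed

text \<open>With c = 300 * 9^n, the new coefficient satisfies q' Y = q^2 Y^4 <= (q Y)^4, so N' < (q
  Y)^(4 c). Squaring and the factor q^3 Y^26 give at most (q Y)^(8 c + 26), below exponent 9 c. The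
  induction ends because a density above 1 is impossible for positive N.\<close>

lemma increment_iteration:
  fixes Y :: int and D :: real
  assumes D: "D \<ge> 2" 
    and Y: "(8 * D) ^ inverse_exponent \<le> Y" "(8 * D) ^ 90 \<le> Y" "\<And>b::int. 1 \<le> b \<Longrightarrow> real_of_int b \<le> (8 * D) ^ inverse_exponent \<Longrightarrow> b dvd Y"
      "\<And>b::int. 1 \<le> b \<Longrightarrow> real_of_int b \<le> (8 * D) ^ 16 \<Longrightarrow> b dvd Y"
  shows "\<lbrakk>q > 0; A \<subseteq> {1..N}; a * real_of_int N \<le> card A; avoids q A; a > 0; 256 / a ^ 3 \<le> D; 1 < (101 / 100) ^ n * a\<rbrakk> \<Longrightarrow> N < (q * Y) ^ (300 * 9 ^ n)"
proof (induction n arbitrary: q A N a)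
  case 0
  have "N \<le> 0"
  proof (rule ccontr)
    assume N: "\<not> N \<le> 0"
    have "card A \<le> card {1..N}" by (rule card_mono) (use 0 in auto)
    then have "real (card A) \<le> N" using N by simp
    moreover have "real_of_int N * 1 < N * a" using N 0(7) by (intro mult_strict_left_mono) auto
    ultimately show False using 0(3) by (simp add: mult.commute)
  qed
  moreover have "Y > 0"
  proof -
    have "0 < (8 * D) ^ 90" using D by simp
    then show ?thesis using Y(2) by linarith
  qed
  ultimately show ?case using 0(1) by (smt (verit) mult_pos_pos zero_less_power)
next
  case (Suc n)
  show ?case
  proof (rule ccontr)
    assume "\<not> N < (q * Y) ^ (300 * 9 ^ Suc n)"
    then have N: "(q * Y) ^ (9 * (300 * 9 ^ n)) \<le> N" by (simp add: mult_ac)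
    have "1 \<le> (8 * D) ^ 90" using D by (intro one_le_power) auto
    then have Y1: "Y \<ge> 1" using Y(2) by linarith
    have qY: "q * Y \<ge> 1" "q \<ge> 1" "q \<le> q * Y" "Y \<le> q * Y" using Y1 Suc.prems(1) by (simp_all add: mult_le_cancel_left1 mult_le_cancel_right1) (smt (verit) mult_pos_pos)
    define c where "c = 300 * (9::nat) ^ n"
    have c: "c \<ge> 300" by (simp add: c_def)
    have mono: "(q * Y) ^ i \<le> (q * Y) ^ j" if "i \<le> j" for i j by (rule power_increasing[OF that qY(1)])
    have qYij: "q ^ i * Y ^ j \<le> (q * Y) ^ k" if "i \<le> k" "j \<le> k" for i j k
    proof -
      have "q ^ i * Y ^ j \<le> q ^ k * Y ^ k" using that qY Y1 by (intro mult_mono power_increasing) auto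
      then show ?thesis by (simp add: power_mult_distrib)
    qed
    have "q ^ 3 * Y ^ 300 \<le> (q * Y) ^ 300" by (rule qYij) auto
    also have "\<dots> \<le> (q * Y) ^ (9 * c)" using c by (intro mono) auto
    also have "\<dots> \<le> N" using N by (simp add: c_def)
    finally have N300: "q ^ 3 * Y ^ 300 \<le> N" .
    obtain N' A' where N': "0 < N'" "A' \<subseteq> {1..N'}" "avoids (q\<^sup>2 * Y ^ 3) A'" "101 / 100 * a * real_of_int N' \<le> card A'" "N \<le> q ^ 3 * Y ^ 26 * N'\<^sup>2"
      using density_increment[OF Suc.prems(1-5) D Suc.prems(6) Y N300] by blast
    have a': "a ^ 3 \<le> (101 / 100 * a) ^ 3" using Suc.prems(5) by (intro power_mono) auto
    have "256 / (101 / 100 * a) ^ 3 \<le> 256 / a ^ 3" using a' Suc.prems(5) by (intro divide_left_mono) auto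
    then have "N' < (q\<^sup>2 * Y ^ 3 * Y) ^ (300 * 9 ^ n)"
      using N' Suc.prems Y1 by (intro Suc.IH[of "q\<^sup>2 * Y ^ 3" A' N' "101 / 100 * a"]) auto
    also have "q\<^sup>2 * Y ^ 3 * Y = q ^ 2 * Y ^ 4" by (simp add: eval_nat_numeral)
    also have "(q ^ 2 * Y ^ 4) ^ (300 * 9 ^ n) = q ^ (2 * c) * Y ^ (4 * c)" by (simp only: c_def[symmetric] power_mult_distrib power_mult)
    also have "\<dots> \<le> (q * Y) ^ (4 * c)" by (rule qYij) auto
    finally have "N' < (q * Y) ^ (4 * c)" .
    then have "N'\<^sup>2 < ((q * Y) ^ (4 * c))\<^sup>2" using N'(1) by (intro power_strict_mono) auto
    also have "\<dots> = (q * Y) ^ (8 * c)" by (simp flip: power_mult)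
    finally have "q ^ 3 * Y ^ 26 * N'\<^sup>2 < q ^ 3 * Y ^ 26 * (q * Y) ^ (8 * c)" using qY Y1 by (intro mult_strict_left_mono) auto
    also have "\<dots> \<le> (q * Y) ^ 26 * (q * Y) ^ (8 * c)" using qY by (intro mult_right_mono qYij) auto
    also have "\<dots> = (q * Y) ^ (26 + 8 * c)" by (simp add: power_add)
    also have "\<dots> \<le> (q * Y) ^ (9 * c)" using c by (intro mono) auto
    finally show False using N N'(5) by (simp add: c_def)
  qed
qed

section \<open>From the iteration to a bound in terms of log N\<close>

lemma ln_fact_le: "ln (fact n :: real) \<le> (real n)\<^sup>2"
proof (cases "n = 0")
  case False
  then have "ln (fact n :: real) \<le> ln (real n ^ n)" using fact_le_power[of n, where 'a = real] by (subst ln_le_cancel_iff) auto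
  also have "\<dots> = n * ln (real n)" using False by (simp add: ln_realpow)
  also have "\<dots> \<le> n * real n" using False ln_le_minus_one[of "real n"] by (intro mult_left_mono) auto
  finally show ?thesis by (simp add: power2_eq_square)
qed simp

text \<open>The number of increments is logarithmic in the inverse density, so all losses are
  polynomial in it.\<close>
lemma ln_le_power_inverse_density:
  "\<exists>\<kappa>::nat. \<kappa> > 0 \<and> (\<forall>(N::int) A. N \<ge> 2 \<longrightarrow> A \<subseteq> {1..N} \<longrightarrow> avoids 1 A \<longrightarrow> A \<noteq> {} \<longrightarrow> ln N \<le> (2 * N / card A) ^ \<kappa>)"
proof (intro exI conjI allI impI)
  define p where "p = 14 * (inverse_exponent + 240) + 1"
  show "0 < 412 + 2 * p" by simp
  fix N :: int and A assume N: "N \<ge> 2" and A: "A \<subseteq> {1..N}" "avoids 1 A" "A \<noteq> {}"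
  have fA: "finite A" using A(1) finite_subset by blast
  have cA: "real (card A) > 0" using A(3) fA by (simp add: card_gt_0_iff)
  define a where "a = card A / N"
  have a0: "a > 0" using cA N by (simp add: a_def)
  have "card A \<le> card {1..N}" using A by (intro card_mono) auto
  then have a1: "a \<le> 1" using N by (simp add: a_def)
  define E where "E = 2 / a"
  have E: "E \<ge> 2" using a0 a1 by (simp add: E_def field_simps)
  have Ek: "E ^ i \<le> E ^ j" if "i \<le> j" for i j using E that by (intro power_increasing) auto
  \<comment> \<open>The increment needs D to be at least 256 / a^3 = 2^5 E^3, which is at most
    E^8.\<close>
  define D where "D = E ^ 11"
  have "E ^ 1 \<le> D" unfolding D_def by (rule Ek) simp
  then have D: "D \<ge> 2" using E by simp
  have "256 / a ^ 3 = 2 ^ 5 * E ^ 3" by (simp add: E_def power_divide)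
  also have "\<dots> \<le> D" unfolding D_def by (rule pow_absorb[OF E order_refl]) simp
  finally have Da: "256 / a ^ 3 \<le> D" .
  \<comment> \<open>The factorial of n0 is divisible by every b in question and exceeds the required
    powers of 8 D, with exponents \<open>inverse_exponent\<close>, 90 and 16. Its logarithm is at
    most n0^2, a power of E.\<close>
  define n0 where "n0 = nat \<lceil>(8 * D) ^ (inverse_exponent + 240)\<rceil>"
  have n0: "(8 * D) ^ (inverse_exponent + 240) \<le> n0" unfolding n0_def by (rule real_nat_ceiling_ge)
  define Y where "Y = int (fact n0)"
  have DY: "(8 * D) ^ k \<le> n0" if "k \<le> inverse_exponent + 240" for k
  proof -
    have "(8 * D) ^ k \<le> (8 * D) ^ (inverse_exponent + 240)" using D that by (intro power_increasing) auto
    then show ?thesis using n0 by linarith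
  qed
  have nY: "real n0 \<le> real_of_int Y" unfolding Y_def using fact_ge_self[of n0] by (simp only: of_int_of_nat_eq of_nat_le_iff)
  have dvd: "b dvd Y" if "1 \<le> b" "real_of_int b \<le> (8 * D) ^ k" "k \<le> inverse_exponent + 240" for b k
  proof -
    have "real_of_int b \<le> n0" using DY[OF that(3)] that(2) by linarith
    then have "nat b \<le> n0" "1 \<le> nat b" "int (nat b) = b" using that(1) by linarith+
    then show ?thesis unfolding Y_def using dvd_fact[of "nat b" n0] by (metis int_dvd_int_iff)
  qed
  have "\<exists>n. 1 / a < (101 / 100) ^ n" by (rule real_arch_pow) simp
  then obtain n where n: "1 / a < (101 / 100) ^ n" "\<And>m. m < n \<Longrightarrow> \<not> 1 / a < (101 / 100) ^ m"
    using exists_least_iff[of "\<lambda>n. 1 / a < (101 / 100) ^ n"] by auto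
  \<comment> \<open>By Bernoulli 1.01^100 >= 2, so 9 <= 2^4 <= 1.01^400; and by minimality of n,
    1.01^(n - 1) is at most 1 / a. Hence the exponent 9^n of the iteration is polynomial in 1 /
    a.\<close>
  have n9: "9 ^ n \<le> 9 * E ^ 400"
  proof (cases n)
    case 0
    have "1 \<le> E ^ 400" using E by (intro one_le_power) auto
    then show ?thesis using 0 by simp
  next
    case (Suc m)
    have "(2::real) \<le> (101 / 100) ^ 100" using Bernoulli_inequality[of "1 / 100 :: real" 100] by simp
    then have "(2::real) ^ 4 \<le> ((101 / 100) ^ 100) ^ 4" by (intro power_mono) auto
    then have "(9::real) ^ m \<le> (((101 / 100) ^ 100) ^ 4) ^ m" by (intro power_mono) auto
    also have "\<dots> = ((101 / 100) ^ m) ^ 400" by (simp only: power_mult[symmetric]) (simp add: mult.commute)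
    also have "\<dots> \<le> E ^ 400"
    proof (rule power_mono)
      have "(101 / 100) ^ m \<le> 1 / a" using n(2)[of m] Suc by simp
      also have "\<dots> \<le> E" using a0 by (simp add: E_def divide_right_mono)
      finally show "(101 / 100) ^ m \<le> E" .
    qed simp
    finally show ?thesis using Suc by simp
  qed
  have "N < (1 * Y) ^ (300 * 9 ^ n)"
  proof (rule increment_iteration[OF D])
    show "(8 * D) ^ inverse_exponent \<le> Y" "(8 * D) ^ 90 \<le> Y" using DY[of inverse_exponent] DY[of 90] nY by linarith+
    show "b dvd Y" if "1 \<le> b" "real_of_int b \<le> (8 * D) ^ inverse_exponent" for b by (rule dvd[OF that]) simp
    show "b dvd Y" if "1 \<le> b" "real_of_int b \<le> (8 * D) ^ 16" for b by (rule dvd[OF that]) simp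
    show "a * N \<le> card A" using N by (simp add: a_def)
    show "1 < (101 / 100) ^ n * a" using n(1) a0 by (simp add: field_simps)
  qed (use A a0 Da in auto)
  then have "real_of_int N \<le> real_of_int (Y ^ (300 * 9 ^ n))" by (simp only: of_int_le_iff) simp
  moreover have Y0: "0 < real_of_int Y" by (simp add: Y_def)
  ultimately have "ln N \<le> ln (real_of_int Y ^ (300 * 9 ^ n))" using N by (subst ln_le_cancel_iff) auto
  also have "\<dots> = 300 * 9 ^ n * ln (real_of_int Y)" using Y0 by (simp add: ln_realpow)
  also have "\<dots> \<le> 300 * (9 * E ^ 400) * E ^ (2 * p)"
  proof (intro mult_mono mult_left_mono n9)
    have "8 * D \<le> 2 ^ 3 * E ^ 11" by (simp add: D_def)
    also have "\<dots> \<le> E ^ 14" by (rule pow_absorb[OF E order_refl]) simp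
    finally have "(8 * D) ^ (inverse_exponent + 240) \<le> (E ^ 14) ^ (inverse_exponent + 240)" using D by (intro power_mono) auto
    also have "\<dots> = E ^ (14 * (inverse_exponent + 240))" by (rule power_mult[symmetric])
    finally have *: "(8 * D) ^ (inverse_exponent + 240) \<le> E ^ (14 * (inverse_exponent + 240))" .
    have "1 \<le> E ^ (14 * (inverse_exponent + 240))" using E by (intro one_le_power) auto
    moreover have "0 \<le> (8 * D) ^ (inverse_exponent + 240)" using D by simp
    then have "real n0 \<le> (8 * D) ^ (inverse_exponent + 240) + 1" unfolding n0_def by linarith
    ultimately have "real n0 \<le> 2 * E ^ (14 * (inverse_exponent + 240))" using * by linarith
    also have "\<dots> \<le> E ^ p" by (rule pow_absorb[OF E, of _ 1]) (auto simp: p_def)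
    finally have "(real n0)\<^sup>2 \<le> (E ^ p)\<^sup>2" by (intro power_mono) auto
    moreover have "ln (real_of_int Y) \<le> (real n0)\<^sup>2" using ln_fact_le[of n0] by (simp add: Y_def)
    ultimately show "ln (real_of_int Y) \<le> E ^ (2 * p)" by (simp add: mult.commute flip: power_mult)
    show "0 \<le> ln (real_of_int Y)" unfolding Y_def by (simp add: fact_ge_1)
  qed (use E in auto)
  also have "\<dots> = 2700 * E ^ (400 + 2 * p)" by (simp add: power_add)
  also have "\<dots> \<le> E ^ (412 + 2 * p)" by (rule pow_absorb[OF E, of _ 12]) auto
  also have "E = 2 * N / card A" by (simp add: E_def a_def)
  finally show "ln N \<le> (2 * N / card A) ^ (412 + 2 * p)" .
qed

theorem theorem1p1:
  "\<exists>c C :: real. c > 0 \<and> C > 0 \<and>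
     (\<forall>(N :: int) (A :: int set).
        N \<ge> 2 \<longrightarrow> A \<subseteq> {1..N} \<longrightarrow> lacks_configurations A \<longrightarrow>
        real (card A) \<le> C * (real_of_int N / (ln (real_of_int N)) powr c))"
proof -
  obtain \<kappa> :: nat where \<kappa>: "\<kappa> > 0" "\<And>(N::int) A. N \<ge> 2 \<Longrightarrow> A \<subseteq> {1..N} \<Longrightarrow> avoids 1 A \<Longrightarrow> A \<noteq> {} \<Longrightarrow> ln N \<le> (2 * N / card A) ^ \<kappa>"
    using ln_le_power_inverse_density by blast
  \<comment> \<open>Taking \<kappa>-th roots gives c = 1 / \<kappa> and C = 2. The empty set is
    treated apart because the quotient by its cardinality is 0 by convention.\<close>
  have "real (card A) \<le> 2 * (real_of_int N / (ln (real_of_int N)) powr (1 / \<kappa>))"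
    if N: "N \<ge> 2" and A: "A \<subseteq> {1..N}" "lacks_configurations A" for N :: int and A
  proof (cases "A = {}")
    case True
    then show ?thesis using N by simp
  next
    case False
    have "avoids 1 A" using A(2) unfolding avoids_def lacks_configurations_def by force
    from \<kappa>(2)[OF N A(1) this False] have le: "ln N \<le> (2 * N / card A) ^ \<kappa>" .
    have ln0: "0 < ln (real_of_int N)" using N by simp
    have cA: "real (card A) > 0" using False A(1) finite_subset[of A "{1..N}"] by (simp add: card_gt_0_iff)
    have b0: "0 < 2 * N / card A" using N cA by simp
    have "ln N powr (1 / \<kappa>) \<le> ((2 * N / card A) ^ \<kappa>) powr (1 / \<kappa>)" using le ln0 by (intro powr_mono2) auto
    also have "\<dots> = 2 * N / card A" 
    proof -
      have e: "real \<kappa> * (1 / real \<kappa>) = 1" using \<kappa>(1) by simp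
      show ?thesis unfolding powr_realpow[OF b0, symmetric] powr_powr e by (rule powr_one) (use b0 in simp)
    qed
    finally have "ln N powr (1 / \<kappa>) * card A \<le> 2 * N" using cA by (simp add: field_simps)
    moreover have "0 < ln N powr (1 / \<kappa>)" using ln0 by simp
    ultimately show ?thesis by (simp add: field_simps)
  qed
  moreover have "1 / real \<kappa> > 0" using \<kappa>(1) by simp
  ultimately show ?thesis by (intro exI[of _ "1 / real \<kappa>"] exI[of _ 2]) auto
qed

end
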